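(* Let $\mathfrak R$ be a nc rational function of $x_1,\dots,x_d$ over a field $\mathbb K$ which is regular at $\underline 0=(0,\dots,0)\in\mathbb K^d$ (i.e. $\underline 0\in dom_1(\mathfrak R)$). Then $\mathfrak R$ admits a unique (up to unique similarity) minimal (observable and controllable) nc Fornasini--Marchesini realization $$\mathfrak R(x_1,\dots,x_d)=D+C\Big(I_L-\sum_{k=1}^dA_kx_k\Big)^{-1}\sum_{k=1}^dB_kx_k ,$$ where $A_1,\dots,A_d\in\mathbb K^{L\times L}$, $B_1,\dots,B_d\in\mathbb K^{L\times1}$, $C\in\mathbb K^{1\times L}$, $D=\mathfrak R(\underline 0)$ and $L\in\mathbb N$; for every $m\in\mathbb N$, $$dom_m(\mathfrak R)=\big\{(X_1,\dots,X_d)\in(\mathbb K^{m\times m})^d:\det(I_{Lm}-X_1\otimes A_1-\dots-X_d\otimes A_d)\ne0\big\}$$ and for every $(X_1,\dots,X_d)\in dom_m(\mathfrak R)$ $$\mathfrak R(X_1,\dots,X_d)=I_m\otimes D+(I_m\otimes C)\Big(I_{Lm}-\sum_{k=1}^dX_k\otimes A_k\Big)^{-1}\sum_{k=1}^dX_k\otimes B_k .$$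
   Context: $\mathbb K$ is a field, $\mathbb N=\{1,2,\dots\}$; $\otimes$ is the Kronecker product. A nc rational expression $R$ in $x_1,\dots,x_d$ over $\mathbb K$ is a formal expression obtained from nc polynomials in $\mathbb K\langle x_1,\dots,x_d\rangle$ by successive additions, multiplications and inversions. $dom_n(R)\subseteq(\mathbb K^{n\times n})^d$ is the set of $d$-tuples of $n\times n$ matrices at which all inverses occurring in $R$ exist (evaluating recursively), $R(\underline X)\in\mathbb K^{n\times n}$ is the value, $dom(R)=\coprod_{n\ge1}dom_n(R)$; $R$ is non-degenerate if $dom(R)\ne\emptyset$. A nc rational function $\mathfrak R$ is an equivalence class of non-degenerate nc rational expressions, where $R_1\sim R_2$ iff $R_1(\underline X)=R_2(\underline X)$ for all $\underline X\in dom(R_1)\cap dom(R_2)$; $dom_n(\mathfrak R)=\bigcup_{R\in\mathfrak R}dom_n(R)$ and $\mathfrak R(\underline X)=R(\underline X)$ for any $R\in\mathfrak R$ with $\underline X\in dom_n(R)$. A realization (data $L\in\mathbb N$, $A_k,B_k,C,D$ as in the claim) of $\mathfrak R$ is such that for every $m$ and $\underline X\in dom_m(\mathfrak R)$ the matrix $I_{Lm}-\sum_kX_k\otimes A_k$ is invertible and the last displayed formula holds. It is minimal if $L$ is as small as possible. It is observable if $\bigcap_{\ell\ge0}\bigcap_{1\le i_1,\dots,i_\ell\le d}\ker(CA_{i_1}\cdots A_{i_\ell})=\{0\}$, and controllable if $\operatorname{span}\{A_{i_1}\cdots A_{i_\ell}B_j:\ell\ge0,\,1\le i_1,\dots,i_\ell,j\le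 d\}=\mathbb K^L$. Uniqueness up to unique similarity means: for any two minimal (observable and controllable) realizations $(L,A,B,C,D)$, $(L',A',B',C',D')$ of $\mathfrak R$ one has $L=L'$, $D=D'$ and there is a unique invertible $T\in\mathbb K^{L\times L}$ with $C'=CT^{-1}$, $B_k'=TB_k$, $A_k'=TA_kT^{-1}$ for all $k$.
   Formalization: L = 0 is also allowed (the text takes L in {1,2,...}): a constant function has no observable and controllable realization with L ≥ 1, its minimal realization has L = 0; for nonconstant functions L ≥ 1 follows. *)

theory Defs
  imports
    "HOL-Library.Poly_Mapping"
    "Jordan_Normal_Form.Matrix_Kernel"
    "Jordan_Normal_Form.Gauss_Jordan_Elimination"
    "Jordan_Normal_Form.VS_Connect"
begin

section \<open>Matrices\<close>

definition mat_inv :: "'a::field mat \<Rightarrow> 'a mat" where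
  "mat_inv M = the (mat_inverse M)"

definition kronecker :: "'a::times mat \<Rightarrow> 'a mat \<Rightarrow> 'a mat"  (infixl \<open>\<otimes>\<^sub>K\<close> 70) where
  "P \<otimes>\<^sub>K Q = mat (dim_row P * dim_row Q) (dim_col P * dim_col Q)
     (\<lambda>(i, j). P $$ (i div dim_row Q, j div dim_col Q) * Q $$ (i mod dim_row Q, j mod dim_col Q))"

text \<open>Matrices of varying size form no additive monoid class, so sums of
  \<open>nr \<times> nc\<close> matrices are taken in the corresponding module.\<close>

definition mat_sum :: "nat \<Rightarrow> nat \<Rightarrow> ('i \<Rightarrow> 'a::field mat) \<Rightarrow> 'i set \<Rightarrow> 'a mat" where
  "mat_sum nr nc f I = finsum (module_mat TYPE('a) nr nc) f I"

text \<open>\<open>word_mat n X [i\<^sub>1, \<dots>, i\<^sub>l] = X\<^bsub>i\<^sub>1\<^esub> \<cdots> X\<^bsub>i\<^sub>l\<^esub>\<close>, and \<open>I\<^sub>n\<close> for the empty word.\<close>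

definition word_mat :: "nat \<Rightarrow> ('d \<Rightarrow> 'a::field mat) \<Rightarrow> 'd list \<Rightarrow> 'a mat" where
  "word_mat n X w = foldr (\<lambda>i M. X i * M) w (1\<^sub>m n)"

section \<open>Noncommutative rational expressions\<close>

text \<open>The variables \<open>x\<^sub>1, \<dots>, x\<^sub>d\<close> are indexed by a finite type \<open>'d\<close> with
  \<open>CARD('d) = d\<close>. A nc polynomial is a finitely supported function from words to
  coefficients.\<close>

type_synonym ('a, 'd) nc_poly = "'d list \<Rightarrow>\<^sub>0 'a"

context notes [[typedef_overloaded]]
begin

datatype (dead 'a :: zero, dead 'd) nc_rexp =
    Poly "('a, 'd) nc_poly"
  | Add "('a, 'd) nc_rexp" "('a, 'd) nc_rexp"
  | Mul "('a, 'd) nc_rexp" "('a, 'd) nc_rexp"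
  | Inv "('a, 'd) nc_rexp"

end

definition matrix_tuples :: "nat \<Rightarrow> ('d \<Rightarrow> 'a::field mat) set" where
  "matrix_tuples n = {X. \<forall>k. X k \<in> carrier_mat n n}"

definition poly_eval :: "nat \<Rightarrow> ('d \<Rightarrow> 'a::field mat) \<Rightarrow> ('a, 'd) nc_poly \<Rightarrow> 'a mat" where
  "poly_eval n X p = mat_sum n n (\<lambda>w. Poly_Mapping.lookup p w \<cdot>\<^sub>m word_mat n X w) (Poly_Mapping.keys p)"

text \<open>The value is \<open>None\<close> iff some inverse occurring in the expression does not exist
  (\<open>mat_inverse\<close> yields \<open>None\<close> on singular matrices).\<close>

primrec rexp_eval :: "nat \<Rightarrow> ('d \<Rightarrow> 'a::field mat) \<Rightarrow> ('a, 'd) nc_rexp \<Rightarrow> 'a mat option" where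
  "rexp_eval n X (Poly p) = Some (poly_eval n X p)"
| "rexp_eval n X (Add R S) =
     Option.bind (rexp_eval n X R) (\<lambda>P. Option.bind (rexp_eval n X S) (\<lambda>Q. Some (P + Q)))"
| "rexp_eval n X (Mul R S) =
     Option.bind (rexp_eval n X R) (\<lambda>P. Option.bind (rexp_eval n X S) (\<lambda>Q. Some (P * Q)))"
| "rexp_eval n X (Inv R) = Option.bind (rexp_eval n X R) mat_inverse"

definition rexp_dom :: "nat \<Rightarrow> ('a::field, 'd) nc_rexp \<Rightarrow> ('d \<Rightarrow> 'a mat) set" where
  "rexp_dom n R = {X \<in> matrix_tuples n. rexp_eval n X R \<noteq> None}"

definition rexp_val :: "nat \<Rightarrow> ('a::field, 'd) nc_rexp \<Rightarrow> ('d \<Rightarrow> 'a mat) \<Rightarrow> 'a mat" where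
  "rexp_val n R X = the (rexp_eval n X R)"

definition nondegenerate :: "('a::field, 'd) nc_rexp \<Rightarrow> bool" where
  "nondegenerate R \<longleftrightarrow> (\<exists>n\<ge>1. rexp_dom n R \<noteq> {})"

section \<open>Noncommutative rational functions\<close>

definition rexp_equiv :: "(('a::field, 'd) nc_rexp \<times> ('a, 'd) nc_rexp) set" where
  "rexp_equiv = {(R, S). nondegenerate R \<and> nondegenerate S \<and>
     (\<forall>n\<ge>1. \<forall>X \<in> rexp_dom n R \<inter> rexp_dom n S. rexp_val n R X = rexp_val n S X)}"

definition nc_rational_functions :: "('a::field, 'd) nc_rexp set set" where
  "nc_rational_functions = Collect nondegenerate // rexp_equiv"

definition rfun_dom :: "nat \<Rightarrow> ('a::field, 'd) nc_rexp set \<Rightarrow> ('d \<Rightarrow> 'a mat) set" where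
  "rfun_dom n F = (\<Union>R\<in>F. rexp_dom n R)"

definition rfun_val :: "nat \<Rightarrow> ('a::field, 'd) nc_rexp set \<Rightarrow> ('d \<Rightarrow> 'a mat) \<Rightarrow> 'a mat" where
  "rfun_val n F X = (THE V. \<exists>R\<in>F. X \<in> rexp_dom n R \<and> V = rexp_val n R X)"

section \<open>Fornasini--Marchesini realizations\<close>

definition fm_pencil :: "nat \<Rightarrow> ('d::finite \<Rightarrow> 'a::field mat) \<Rightarrow> nat \<Rightarrow> ('d \<Rightarrow> 'a mat) \<Rightarrow> 'a mat" where
  "fm_pencil L A m X = 1\<^sub>m (L * m) - mat_sum (L * m) (L * m) (\<lambda>k. X k \<otimes>\<^sub>K A k) UNIV"

definition fm_val :: "nat \<Rightarrow> ('d::finite \<Rightarrow> 'a::field mat) \<Rightarrow> ('d \<Rightarrow> 'a mat) \<Rightarrow> 'a mat \<Rightarrow> 'a mat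
    \<Rightarrow> nat \<Rightarrow> ('d \<Rightarrow> 'a mat) \<Rightarrow> 'a mat" where
  "fm_val L A B C D m X =
     1\<^sub>m m \<otimes>\<^sub>K D
     + (1\<^sub>m m \<otimes>\<^sub>K C) * mat_inv (fm_pencil L A m X)
       * mat_sum (L * m) m (\<lambda>k. X k \<otimes>\<^sub>K B k) UNIV"

text \<open>The state space dimension \<open>L = 0\<close> has to be admitted: a constant nc rational function
  has no observable and controllable realization with \<open>L \<ge> 1\<close>. For \<open>L = 0\<close> the realization
  formula reduces to the constant \<open>I\<^sub>m \<otimes> D\<close>, so \<open>L \<ge> 1\<close> in all other cases. The scalar \<open>D\<close>
  is a \<open>1 \<times> 1\<close> matrix.\<close>

definition fm_realization :: "('a::field, 'd::finite) nc_rexp set \<Rightarrow> nat \<Rightarrow> ('d \<Rightarrow> 'a mat)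
    \<Rightarrow> ('d \<Rightarrow> 'a mat) \<Rightarrow> 'a mat \<Rightarrow> 'a mat \<Rightarrow> bool" where
  "fm_realization F L A B C D \<longleftrightarrow>
     (\<forall>k. A k \<in> carrier_mat L L) \<and> (\<forall>k. B k \<in> carrier_mat L 1) \<and>
     C \<in> carrier_mat 1 L \<and> D \<in> carrier_mat 1 1 \<and>
     (\<forall>m\<ge>1. \<forall>X \<in> rfun_dom m F.
        invertible_mat (fm_pencil L A m X) \<and> rfun_val m F X = fm_val L A B C D m X)"

definition fm_minimal :: "('a::field, 'd::finite) nc_rexp set \<Rightarrow> nat \<Rightarrow> ('d \<Rightarrow> 'a mat)
    \<Rightarrow> ('d \<Rightarrow> 'a mat) \<Rightarrow> 'a mat \<Rightarrow> 'a mat \<Rightarrow> bool" where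
  "fm_minimal F L A B C D \<longleftrightarrow> fm_realization F L A B C D \<and>
     (\<forall>L' A' B' C' D'. fm_realization F L' A' B' C' D' \<longrightarrow> L \<le> L')"

definition fm_observable :: "nat \<Rightarrow> ('d \<Rightarrow> 'a::field mat) \<Rightarrow> 'a mat \<Rightarrow> bool" where
  "fm_observable L A C \<longleftrightarrow> (\<Inter>w. mat_kernel (C * word_mat L A w)) = {0\<^sub>v L}"

definition fm_controllable :: "nat \<Rightarrow> ('d \<Rightarrow> 'a::field mat) \<Rightarrow> ('d \<Rightarrow> 'a mat) \<Rightarrow> bool" where
  "fm_controllable L A B \<longleftrightarrow>
     LinearCombinations.module.span class_ring (module_vec TYPE('a) L)
       {col (word_mat L A w * B j) 0 | w j. True} = carrier_vec L"

end

theory Submission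
  imports Defs
begin

text \<open>State space constructions for sums, products and inverses yield a realization of every
  expression that is defined at the origin; restricting it to the reachable states and dividing by
  the unobservable ones makes it observable and controllable. Expressions are compared along
  polynomial paths between points of their domains; since the field may be finite, the parameter
  of a path is specialized to matrices, not only to scalars.

  If the pencil were singular at a point \<open>X\<close> of the domain, its inverse would have a pole along a
  path through \<open>X\<close>. Observability and controllability carry the pole over to the values at
  suitable block upper triangular points, which lie in the domain. Conversely, at a point with
  invertible pencil, Gaussian elimination over nc rational expressions produces a member of the
  class that is defined there.

  The Markov parameters \<open>C A\<^sub>w B\<^sub>k\<close> are entries of values at nilpotent shift matrices, so they do not
  depend on the realization. The factorization of the resulting Hankel matrix yields both the
  minimality of observable and controllable realizations and the unique similarity.\<close>

text \<open>Realizations are treated through their state equations, not through an inverse of the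
  pencil. These equations make sense over any commutative ring, so the same definitions serve over K
  and over K[s], where determinants and adjugates replace inverses. A member R of the class may be
  defined where the realized expression R0 is not, and the two agree only at common points.
  Comparisons with R0 therefore run along a path from the domain of R to a strictly upper triangular
  tuple; there every expression regular at the origin is defined, whatever the size and the field.
  The obstacle is to show that the pencil is invertible on the whole domain: a pole of its inverse
  may cancel in \<open>C P\<inverse> B\<close>. Block points show the entries of the inverse between
  outer factors that may themselves vanish at s = 0, but only to a fixed order e. The middle block
  therefore follows a path along which the pencil multiplies a kernel vector at X by s^r with r = e
  + 1, too large a pole for the outer factors to absorb.\<close>

section \<open>Sums over split index ranges and entries of matrices\<close>

lemma sum_lessThan_mult:
  fixes f :: "nat \<Rightarrow> 'r::comm_monoid_add"
  shows "(\<Sum>p<n * k. f p) = (\<Sum>a<n. \<Sum>j<k. f (a * k + j))"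
proof -
  have "(\<Sum>p<n * k. f p) = (\<Sum>a<n. sum f {a * k..<a * k + k})"
    by (simp add: sum.nat_group)
  also have "\<dots> = (\<Sum>a<n. \<Sum>j<k. f (a * k + j))"
  proof (rule sum.cong[OF refl])
    fix a
    show "sum f {a * k..<a * k + k} = (\<Sum>j<k. f (a * k + j))"
      using sum.shift_bounds_nat_ivl[of f 0 "a * k" k] by (simp add: atLeast0LessThan add.commute)
  qed
  finally show ?thesis .
qed

lemma sum_lessThan_add:
  fixes f :: "nat \<Rightarrow> 'r::comm_monoid_add"
  shows "(\<Sum>p<n + k. f p) = (\<Sum>a<n. f a) + (\<Sum>j<k. f (n + j))"
proof -
  have "sum f {..<n + k} = sum f {0..<n} + sum f {n..<n + k}"
    using sum.atLeastLessThan_concat[of 0 n "n + k" f] by (simp add: atLeast0LessThan)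
  also have "sum f {n..<n + k} = (\<Sum>j<k. f (n + j))"
    using sum.shift_bounds_nat_ivl[of f 0 n k] by (simp add: atLeast0LessThan add.commute)
  finally show ?thesis by (simp add: atLeast0LessThan)
qed

text \<open>Conditional terms of later sums are first brought into the shape of a 0-1 factor times a
  term, which these rules collapse.\<close>

lemma sum_delta_mult [simp]:
  fixes f :: "nat \<Rightarrow> 'r::comm_ring_1"
  shows "(\<Sum>p<n. (if a = p then 1 else 0) * f p) = (if a < n then f a else 0)"
    "(\<Sum>p<n. (if p = a then 1 else 0) * f p) = (if a < n then f a else 0)"
    "(\<Sum>p<n. f p * (if a = p then 1 else 0)) = (if a < n then f a else 0)"
    "(\<Sum>p<n. f p * (if p = a then 1 else 0)) = (if a < n then f a else 0)"
  by (simp_all add: if_distrib[of "\<lambda>x. x * _"] if_distrib[of "\<lambda>x. _ * x"] cong: if_cong)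

lemma mult_add_less: "a < n \<Longrightarrow> i < k \<Longrightarrow> a * k + i < n * (k::nat)"
  using mult_le_mono1[of "Suc a" n k] by simp

lemma mult_add_less': "a < n \<Longrightarrow> i < k \<Longrightarrow> a * k + i < k * (n::nat)"
  using mult_add_less[of a n i k] by (simp add: mult.commute)

lemma div_less_of_less_mult: "(p::nat) < n * k \<Longrightarrow> p div k < n"
  by (simp add: less_mult_imp_div_less)

lemma mod_less_of_less_mult: "(p::nat) < n * k \<Longrightarrow> p mod k < k"
  by (cases "k = 0") auto

lemma index_mult_mat_sum:
  assumes "A \<in> carrier_mat n k" "B \<in> carrier_mat k m" "i < n" "j < m"
  shows "(A * B) $$ (i, j) = (\<Sum>l<k. A $$ (i, l) * B $$ (l, j))"
  using assms by (simp add: scalar_prod_def atLeast0LessThan)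

lemma index_mult_vec_sum:
  assumes "A \<in> carrier_mat n k" "v \<in> carrier_vec k" "i < n"
  shows "(A *\<^sub>v v) $ i = (\<Sum>l<k. A $$ (i, l) * v $ l)"
  using assms by (simp add: scalar_prod_def atLeast0LessThan)

text \<open>Carrier and entries are proved in one induction, because adding a summand entrywise
  requires the dimensions of the sum so far.\<close>

lemma module_mat_sum:
  fixes f :: "'i \<Rightarrow> 'a::field mat"
  assumes "finite I" "\<And>i. i \<in> I \<Longrightarrow> f i \<in> carrier_mat nr nc"
  shows "mat_sum nr nc f I \<in> carrier_mat nr nc \<and>
    (\<forall>a<nr. \<forall>b<nc. mat_sum nr nc f I $$ (a, b) = (\<Sum>i\<in>I. f i $$ (a, b)))"
  using assms
proof (induction I rule: finite_induct)
  case empty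
  interpret M: abelian_group "module_mat TYPE('a) nr nc" by (rule abelian_group_mat)
  show ?case unfolding mat_sum_def by (simp add: module_mat_simps)
next
  case (insert x I)
  interpret M: abelian_group "module_mat TYPE('a) nr nc" by (rule abelian_group_mat)
  have "mat_sum nr nc f (insert x I) = f x + mat_sum nr nc f I"
    unfolding mat_sum_def using insert
    by (subst M.finsum_insert) (auto simp: module_mat_simps)
  then show ?case using insert by auto
qed

lemma mat_sum_carrier:
  assumes "finite I" "\<And>i. i \<in> I \<Longrightarrow> f i \<in> carrier_mat nr nc"
  shows "mat_sum nr nc f I \<in> carrier_mat nr nc"
  using module_mat_sum[of I f nr nc] assms by auto

lemma mat_sum_index:
  assumes "finite I" "\<And>i. i \<in> I \<Longrightarrow> f i \<in> carrier_mat nr nc" "a < nr" "b < nc"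
  shows "mat_sum nr nc f I $$ (a, b) = (\<Sum>i\<in>I. f i $$ (a, b))"
  using module_mat_sum[of I f nr nc] assms by auto

lemma kronecker_carrier:
  "P \<in> carrier_mat a b \<Longrightarrow> Q \<in> carrier_mat c d \<Longrightarrow> P \<otimes>\<^sub>K Q \<in> carrier_mat (a * c) (b * d)"
  by (simp add: kronecker_def)

lemma kronecker_index:
  assumes "P \<in> carrier_mat n m" "Q \<in> carrier_mat r s" "a < n" "i < r" "b < m" "j < s"
  shows "(P \<otimes>\<^sub>K Q) $$ (a * r + i, b * s + j) = P $$ (a, b) * Q $$ (i, j)"
proof -
  have "a * r + i < n * r" "b * s + j < m * s" using assms by (auto intro!: mult_add_less)
  then show ?thesis using assms unfolding kronecker_def by simp
qed

section \<open>State equations\<close>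

text \<open>The operator \<open>\<Sum> X\<^sub>k \<otimes> A\<^sub>k\<close> on states with a block
  index a and a state index i. Points, coefficients and states are functions on nat over a
  commutative ring: K and K[s] are covered at once, and no dimensions have to be carried
  along.\<close>

definition fm_step :: "nat \<Rightarrow> nat \<Rightarrow> ('d::finite \<Rightarrow> nat \<Rightarrow> nat \<Rightarrow> 'r::comm_ring_1) \<Rightarrow> ('d \<Rightarrow> nat \<Rightarrow> nat \<Rightarrow> 'r)
    \<Rightarrow> (nat \<Rightarrow> nat \<Rightarrow> 'r) \<Rightarrow> nat \<Rightarrow> nat \<Rightarrow> 'r" where
  "fm_step n L X A x a i = (\<Sum>k\<in>UNIV. \<Sum>b<n. X k a b * (\<Sum>j<L. A k i j * x b j))"

definition fm_input :: "nat \<Rightarrow> ('d::finite \<Rightarrow> nat \<Rightarrow> nat \<Rightarrow> 'r::comm_ring_1) \<Rightarrow> ('d \<Rightarrow> nat \<Rightarrow> 'r)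
    \<Rightarrow> (nat \<Rightarrow> 'r) \<Rightarrow> nat \<Rightarrow> nat \<Rightarrow> 'r" where
  "fm_input n X B y a i = (\<Sum>k\<in>UNIV. \<Sum>b<n. X k a b * (B k i * y b))"

text \<open>\<open>x\<close> is a column of \<open>(I - \<Sum> X\<^sub>k \<otimes> A\<^sub>k)\<inverse> (\<Sum> X\<^sub>k \<otimes> B\<^sub>k)\<close> applied to \<open>y\<close>,
  with the index \<open>a * L + i\<close> of the Kronecker product split into \<open>a\<close> and \<open>i\<close>.\<close>

definition fm_sys :: "nat \<Rightarrow> nat \<Rightarrow> ('d::finite \<Rightarrow> nat \<Rightarrow> nat \<Rightarrow> 'r::comm_ring_1) \<Rightarrow> ('d \<Rightarrow> nat \<Rightarrow> nat \<Rightarrow> 'r)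
    \<Rightarrow> ('d \<Rightarrow> nat \<Rightarrow> 'r) \<Rightarrow> (nat \<Rightarrow> nat \<Rightarrow> 'r) \<Rightarrow> (nat \<Rightarrow> 'r) \<Rightarrow> bool" where
  "fm_sys n L X A B x y \<longleftrightarrow>
     (\<forall>a<n. \<forall>i<L. x a i = fm_step n L X A x a i + fm_input n X B y a i)"

text \<open>Injectivity stands in for invertibility of the pencil: no inverse has to be named, and
  block constructions are handled one solution at a time.\<close>

definition well_posed :: "nat \<Rightarrow> nat \<Rightarrow> ('d::finite \<Rightarrow> nat \<Rightarrow> nat \<Rightarrow> 'r::comm_ring_1) \<Rightarrow> ('d \<Rightarrow> nat \<Rightarrow> nat \<Rightarrow> 'r) \<Rightarrow> bool" where
  "well_posed n L X A \<longleftrightarrow>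
     (\<forall>x. (\<forall>a<n. \<forall>i<L. x a i = fm_step n L X A x a i) \<longrightarrow> (\<forall>a<n. \<forall>i<L. x a i = 0))"

definition pencil :: "nat \<Rightarrow> nat \<Rightarrow> ('d::finite \<Rightarrow> nat \<Rightarrow> nat \<Rightarrow> 'r::comm_ring_1) \<Rightarrow> ('d \<Rightarrow> nat \<Rightarrow> nat \<Rightarrow> 'r) \<Rightarrow> 'r mat" where
  "pencil n L X A = mat (L * n) (L * n) (\<lambda>(p, q). (if p = q then 1 else 0)
     - (\<Sum>k\<in>UNIV. X k (p div L) (q div L) * A k (p mod L) (q mod L)))"

abbreviation ent :: "'r mat \<Rightarrow> nat \<Rightarrow> nat \<Rightarrow> 'r" where
  "ent M \<equiv> (\<lambda>i j. M $$ (i, j))"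

lemma pencil_carrier [simp]: "pencil n L X A \<in> carrier_mat (L * n) (L * n)"
  by (simp add: pencil_def)

text \<open>The bridge between vectors of length L * n and states with two indices; facts about
  determinants and adjugates become facts about state equations through it.\<close>

lemma pencil_mult_vec:
  assumes v: "v \<in> carrier_vec (L * n)" and x: "\<And>a i. a < n \<Longrightarrow> i < L \<Longrightarrow> v $ (a * L + i) = x a i"
    and a: "a < n" and i: "i < L"
  shows "(pencil n L X A *\<^sub>v v) $ (a * L + i) = x a i - fm_step n L X A x a i"
proof -
  have p: "a * L + i < L * n" using mult_add_less'[OF a i] .
  have "(pencil n L X A *\<^sub>v v) $ (a * L + i) = (\<Sum>q<n * L. pencil n L X A $$ (a * L + i, q) * v $ q)"
    by (subst index_mult_vec_sum[OF pencil_carrier v p]) (simp add: mult.commute)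
  also have "\<dots> = (\<Sum>b<n. \<Sum>j<L. pencil n L X A $$ (a * L + i, b * L + j) * v $ (b * L + j))"
    by (rule sum_lessThan_mult)
  also have "\<dots> = (\<Sum>b<n. \<Sum>j<L. (if a * L + i = b * L + j then 1 else 0) * x b j
      - (\<Sum>k\<in>UNIV. X k a b * (A k i j * x b j)))"
  proof (intro sum.cong refl)
    fix b j assume "b \<in> {..<n}" "j \<in> {..<L}"
    then have b: "b < n" and j: "j < L" by auto
    have q: "b * L + j < L * n" using mult_add_less'[OF b j] .
    show "pencil n L X A $$ (a * L + i, b * L + j) * v $ (b * L + j) =
       (if a * L + i = b * L + j then 1 else 0) * x b j - (\<Sum>k\<in>UNIV. X k a b * (A k i j * x b j))"
      unfolding x[OF b j] pencil_def using p q i j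
      by (simp add: left_diff_distrib sum_distrib_right mult.assoc)
  qed
  also have "\<dots> = (\<Sum>b<n. \<Sum>j<L. (if a * L + i = b * L + j then 1 else 0) * x b j)
      - (\<Sum>b<n. \<Sum>j<L. \<Sum>k\<in>UNIV. X k a b * (A k i j * x b j))"
    by (simp add: sum_subtractf)
  also have "(\<Sum>b<n. \<Sum>j<L. (if a * L + i = b * L + j then 1 else 0) * x b j) =
      (\<Sum>q<n * L. (if a * L + i = q then 1 else 0) * x (q div L) (q mod L))"
    unfolding sum_lessThan_mult by (intro sum.cong refl) auto
  also have "\<dots> = x a i" using p i by (simp add: mult.commute)
  also have "(\<Sum>b<n. \<Sum>j<L. \<Sum>k\<in>UNIV. X k a b * (A k i j * x b j)) = fm_step n L X A x a i"
  proof -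
    have "(\<Sum>j<L. \<Sum>k\<in>UNIV. X k a b * (A k i j * x b j)) = (\<Sum>k\<in>UNIV. X k a b * (\<Sum>j<L. A k i j * x b j))" for b
      unfolding sum_distrib_left by (rule sum.swap)
    then show ?thesis unfolding fm_step_def by (simp add: sum.swap[of _ UNIV])
  qed
  finally show ?thesis .
qed

lemma vec_block_eqI:
  assumes "v \<in> carrier_vec (L * n)" "w \<in> carrier_vec (L * n)"
    and "\<And>a i. a < n \<Longrightarrow> i < L \<Longrightarrow> v $ (a * L + i) = w $ (a * L + i)"
  shows "v = w"
proof (rule eq_vecI)
  fix p assume "p < dim_vec w"
  then have p: "p < n * L" using assms by (simp add: mult.commute)
  show "v $ p = w $ p"
    using assms(3)[OF div_less_of_less_mult[OF p] mod_less_of_less_mult[OF p]] by simp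
qed (use assms in auto)

text \<open>Kernel vectors of the pencil are exactly the solutions of the homogeneous state
  equation, rewritten with one index.\<close>

lemma well_posed_iff_det:
  fixes X :: "'d::finite \<Rightarrow> nat \<Rightarrow> nat \<Rightarrow> 'r::idom"
  shows "well_posed n L X A \<longleftrightarrow> det (pencil n L X A) \<noteq> 0"
proof -
  let ?P = "pencil n L X A"
  have "det ?P = 0 \<longleftrightarrow> (\<exists>v. v \<in> carrier_vec (L * n) \<and> v \<noteq> 0\<^sub>v (L * n) \<and> ?P *\<^sub>v v = 0\<^sub>v (L * n))"
    by (rule det_0_iff_vec_prod_zero) simp
  also have "\<dots> \<longleftrightarrow> \<not> well_posed n L X A"
  proof
    assume "\<exists>v. v \<in> carrier_vec (L * n) \<and> v \<noteq> 0\<^sub>v (L * n) \<and> ?P *\<^sub>v v = 0\<^sub>v (L * n)"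
    then obtain v where v: "v \<in> carrier_vec (L * n)" "v \<noteq> 0\<^sub>v (L * n)" "?P *\<^sub>v v = 0\<^sub>v (L * n)" by blast
    define x where "x a i = v $ (a * L + i)" for a i
    have "x a i = fm_step n L X A x a i" if "a < n" "i < L" for a i
      using pencil_mult_vec[OF v(1) x_def[symmetric] that, of X A] v(3) mult_add_less'[OF that] by simp
    moreover have "\<exists>a<n. \<exists>i<L. x a i \<noteq> 0"
    proof (rule ccontr)
      assume "\<not> (\<exists>a<n. \<exists>i<L. x a i \<noteq> 0)"
      then have "v = 0\<^sub>v (L * n)"
        by (intro vec_block_eqI[OF v(1)]) (auto simp: x_def mult_add_less')
      then show False using v(2) by simp
    qed
    ultimately show "\<not> well_posed n L X A" unfolding well_posed_def by blast
  next
    assume "\<not> well_posed n L X A"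
    then obtain x a i where x: "\<forall>a<n. \<forall>i<L. x a i = fm_step n L X A x a i" and ai: "a < n" "i < L" "x a i \<noteq> 0"
      unfolding well_posed_def by blast
    define v where "v = vec (L * n) (\<lambda>p. x (p div L) (p mod L))"
    have v: "v \<in> carrier_vec (L * n)" by (simp add: v_def)
    have vx: "v $ (a * L + i) = x a i" if "a < n" "i < L" for a i
      using that mult_add_less'[OF that] by (simp add: v_def)
    have "v \<noteq> 0\<^sub>v (L * n)" using vx[OF ai(1,2)] ai mult_add_less'[OF ai(1,2)] by auto
    moreover have "?P *\<^sub>v v = 0\<^sub>v (L * n)"
    proof (rule vec_block_eqI)
      fix a i assume ai: "a < n" "i < L"
      have "(?P *\<^sub>v v) $ (a * L + i) = x a i - fm_step n L X A x a i"
        by (rule pencil_mult_vec[OF v]) (auto simp: vx ai)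
      then show "(?P *\<^sub>v v) $ (a * L + i) = 0\<^sub>v (L * n) $ (a * L + i)"
        using x ai mult_add_less'[OF ai] by simp
    qed (auto intro: mult_mat_vec_carrier[OF pencil_carrier v])
    ultimately show "\<exists>v. v \<in> carrier_vec (L * n) \<and> v \<noteq> 0\<^sub>v (L * n) \<and> ?P *\<^sub>v v = 0\<^sub>v (L * n)"
      using v by blast
  qed
  finally show ?thesis by blast
qed

section \<open>The Kronecker pencil and inverses of matrices\<close>

lemma fm_pencil_eq_pencil:
  assumes "\<And>k. A k \<in> carrier_mat L L" "\<And>k. X k \<in> carrier_mat m m"
  shows "fm_pencil L A m X = pencil m L (\<lambda>k. ent (X k)) (\<lambda>k. ent (A k))"
proof -
  have c: "X k \<otimes>\<^sub>K A k \<in> carrier_mat (L * m) (L * m)" for k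
    using kronecker_carrier[OF assms(2,1)] by (simp add: mult.commute)
  let ?S = "mat_sum (L * m) (L * m) (\<lambda>k. X k \<otimes>\<^sub>K A k) UNIV"
  have s1: "?S \<in> carrier_mat (L * m) (L * m)" by (rule mat_sum_carrier) (auto intro: c)
  have s2: "?S $$ (p, q) = (\<Sum>k\<in>UNIV. (X k \<otimes>\<^sub>K A k) $$ (p, q))" if "p < L * m" "q < L * m" for p q
    by (rule mat_sum_index) (auto intro: c that)
  have k: "(X k \<otimes>\<^sub>K A k) $$ (p, q) = X k $$ (p div L, q div L) * A k $$ (p mod L, q mod L)"
    if "p < L * m" "q < L * m" for k p q
    using that assms[of k] by (simp add: kronecker_def mult.commute)
  show ?thesis
    unfolding fm_pencil_def pencil_def
    by (rule eq_matI) (use s1 in \<open>auto simp: s2 k\<close>)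
qed

lemma invertible_mat_iff_det:
  fixes M :: "'a::field mat"
  assumes M: "M \<in> carrier_mat n n"
  shows "invertible_mat M \<longleftrightarrow> det M \<noteq> 0"
proof
  assume "invertible_mat M"
  then obtain N where N: "M * N = 1\<^sub>m n" "N * M = 1\<^sub>m (dim_row N)"
    unfolding invertible_mat_def inverts_mat_def using M by auto
  have "N \<in> carrier_mat n n"
    using arg_cong[OF N(1), of dim_col] arg_cong[OF N(2), of dim_col] M by auto
  from det_mult[OF M this] N(1) show "det M \<noteq> 0" by auto
next
  assume "det M \<noteq> 0"
  from det_non_zero_imp_unit[OF M this, of "()"] obtain N where
    "N * M = 1\<^sub>m n" "M * N = 1\<^sub>m n" "N \<in> carrier_mat n n"
    unfolding Units_def ring_mat_def by auto
  then show "invertible_mat M"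
    unfolding invertible_mat_def inverts_mat_def using M by auto
qed

text \<open>A right inverse of a square matrix over a field is two-sided, so a single product
  determines the result of \<open>mat_inverse\<close>.\<close>

lemma mat_inverse_eq_SomeI:
  fixes M :: "'a::field mat"
  assumes M: "M \<in> carrier_mat n n" and N: "N \<in> carrier_mat n n" and MN: "M * N = 1\<^sub>m n"
  shows "mat_inverse M = Some N"
proof -
  have NM: "N * M = 1\<^sub>m n" by (rule mat_mult_left_right_inverse[OF M N MN])
  have "M \<in> Units (ring_mat TYPE('a) n ())"
    unfolding Units_def ring_mat_def using M N MN NM by auto
  then obtain N' where N': "mat_inverse M = Some N'"
    using mat_inverse(1)[OF M, of "()"] by (cases "mat_inverse M") auto
  from mat_inverse(2)[OF M this] have "M * N' = 1\<^sub>m n" "N' \<in> carrier_mat n n" by auto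
  then have "N' = N * M * N'" using NM by simp
  also have "\<dots> = N" using M N \<open>M * N' = 1\<^sub>m n\<close> \<open>N' \<in> carrier_mat n n\<close> by (simp add: assoc_mult_mat[of _ n n _ n _ n])
  finally show ?thesis using N' by simp
qed

lemma mat_inv_props:
  fixes M :: "'a::field mat"
  assumes M: "M \<in> carrier_mat n n" and d: "invertible_mat M"
  shows "mat_inv M \<in> carrier_mat n n" "M * mat_inv M = 1\<^sub>m n" "mat_inv M * M = 1\<^sub>m n"
proof -
  have "det M \<noteq> 0" using invertible_mat_iff_det[OF M] d by simp
  from det_non_zero_imp_unit[OF M this, of "()"] obtain N where
    N: "N * M = 1\<^sub>m n" "M * N = 1\<^sub>m n" "N \<in> carrier_mat n n"
    unfolding Units_def ring_mat_def by auto
  have "mat_inv M = N" unfolding mat_inv_def using mat_inverse_eq_SomeI[OF M N(3,2)] by simp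
  then show "mat_inv M \<in> carrier_mat n n" "M * mat_inv M = 1\<^sub>m n" "mat_inv M * M = 1\<^sub>m n"
    using N by auto
qed

section \<open>Solutions of the state equation\<close>

lemma fm_step_diff:
  "fm_step n L X A (\<lambda>a i. x a i - x' a i) a i = fm_step n L X A x a i - fm_step n L X A x' a i"
  unfolding fm_step_def by (simp add: right_diff_distrib sum_subtractf)

lemma fm_step_mult:
  "fm_step n L X A (\<lambda>a i. c * x a i) a i = c * fm_step n L X A x a i"
  unfolding fm_step_def by (simp add: sum_distrib_left algebra_simps)

lemma fm_input_mult: "fm_input n X B (\<lambda>b. c * y b) a i = c * fm_input n X B y a i"
  unfolding fm_input_def by (simp add: sum_distrib_left algebra_simps)

lemma fm_step_cong:
  assumes "\<And>b j. b < n \<Longrightarrow> j < L \<Longrightarrow> x b j = x' b j"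
  shows "fm_step n L X A x a i = fm_step n L X A x' a i"
  unfolding fm_step_def by (intro sum.cong refl arg_cong2[where f = "(*)"]) (use assms in auto)

text \<open>The forcing term is arbitrary because \<open>adj_at_shift\<close> applies this to
  columns of an adjugate, which are forced by unit vectors and not by an input.\<close>

lemma forced_unique:
  assumes "well_posed n L X A"
    and "\<And>a i. a < n \<Longrightarrow> i < L \<Longrightarrow> x a i = fm_step n L X A x a i + z a i"
    and "\<And>a i. a < n \<Longrightarrow> i < L \<Longrightarrow> x' a i = fm_step n L X A x' a i + z a i"
    and "a < n" "i < L"
  shows "x a i = x' a i"
proof -
  have "x a i - x' a i = fm_step n L X A (\<lambda>a i. x a i - x' a i) a i" if "a < n" "i < L" for a i
    unfolding fm_step_diff by (subst assms(2)[OF that], subst assms(3)[OF that]) simp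
  with assms(1)[unfolded well_posed_def, rule_format, of "\<lambda>a i. x a i - x' a i"] assms(4,5)
  have "x a i - x' a i = 0" by blast
  then show ?thesis by simp
qed

lemma forced_solution:
  fixes X :: "'d::finite \<Rightarrow> nat \<Rightarrow> nat \<Rightarrow> 'a::field"
  assumes "well_posed n L X A"
  shows "\<exists>x. \<forall>a<n. \<forall>i<L. x a i = fm_step n L X A x a i + z a i"
proof -
  let ?P = "pencil n L X A"
  have P: "?P \<in> carrier_mat (L * n) (L * n)" by simp
  have "det ?P \<noteq> 0" using assms well_posed_iff_det by blast
  then have "invertible_mat ?P" using invertible_mat_iff_det[OF P] by simp
  note inv = mat_inv_props[OF P this]
  define w where "w = vec (L * n) (\<lambda>p. z (p div L) (p mod L))"
  have w: "w \<in> carrier_vec (L * n)" by (simp add: w_def)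
  define v where "v = mat_inv ?P *\<^sub>v w"
  have v: "v \<in> carrier_vec (L * n)" using inv(1) w by (auto simp: v_def)
  have "?P *\<^sub>v v = w"
    unfolding v_def using assoc_mult_mat_vec[OF P inv(1) w] inv(2) w by simp
  define x where "x a i = v $ (a * L + i)" for a i
  have "x a i = fm_step n L X A x a i + z a i" if "a < n" "i < L" for a i
  proof -
    have "(?P *\<^sub>v v) $ (a * L + i) = x a i - fm_step n L X A x a i"
      by (rule pencil_mult_vec[OF v _ that]) (simp add: x_def)
    moreover have "w $ (a * L + i) = z a i"
      using that mult_add_less'[OF that] by (simp add: w_def)
    ultimately have "x a i - fm_step n L X A x a i = z a i" using \<open>?P *\<^sub>v v = w\<close> by simp
    then show ?thesis by (simp only: diff_eq_eq add.commute)
  qed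
  then show ?thesis by blast
qed

lemma fm_sys_solution:
  fixes X :: "'d::finite \<Rightarrow> nat \<Rightarrow> nat \<Rightarrow> 'a::field"
  shows "well_posed n L X A \<Longrightarrow> \<exists>x. fm_sys n L X A B x y"
  unfolding fm_sys_def by (rule forced_solution)

lemma fm_sysD:
  assumes "fm_sys n L X A B x y" "a < n" "i < L"
  shows "x a i - fm_step n L X A x a i = fm_input n X B y a i"
proof -
  have "x a i = fm_step n L X A x a i + fm_input n X B y a i"
    using assms unfolding fm_sys_def by blast
  then show ?thesis by (metis add_diff_cancel_left')
qed

lemma fm_sys_unique:
  assumes "well_posed n L X A" "fm_sys n L X A B x y" "fm_sys n L X A B x' y" "a < n" "i < L"
  shows "x a i = x' a i"
  by (rule forced_unique[OF assms(1) _ _ assms(4,5), where z = "fm_input n X B y"])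
    (use assms(2,3) in \<open>unfold fm_sys_def, blast+\<close>)

lemma fm_sys_mult: "fm_sys n L X A B x y \<Longrightarrow> fm_sys n L X A B (\<lambda>a i. c * x a i) (\<lambda>b. c * y b)"
  unfolding fm_sys_def by (metis fm_step_mult fm_input_mult distrib_left)

text \<open>The transfer function as an input-output relation: V y is the output for the input y.
  Since no inverse occurs, realizations are combined by rearranging state equations.\<close>

definition realizes :: "nat \<Rightarrow> nat \<Rightarrow> ('d::finite \<Rightarrow> nat \<Rightarrow> nat \<Rightarrow> 'r::comm_ring_1) \<Rightarrow> ('d \<Rightarrow> nat \<Rightarrow> nat \<Rightarrow> 'r)
    \<Rightarrow> ('d \<Rightarrow> nat \<Rightarrow> 'r) \<Rightarrow> (nat \<Rightarrow> 'r) \<Rightarrow> 'r \<Rightarrow> (nat \<Rightarrow> nat \<Rightarrow> 'r) \<Rightarrow> bool" where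
  "realizes n L X A B C D V \<longleftrightarrow> well_posed n L X A \<and>
     (\<forall>x y. fm_sys n L X A B x y \<longrightarrow>
        (\<forall>a<n. (\<Sum>b<n. V a b * y b) = D * y a + (\<Sum>i<L. C i * x a i)))"

text \<open>Unit vectors as inputs read off the columns of V; well-posedness over a field provides a
  state for each of them.\<close>

lemma realizes_unique:
  fixes X :: "'d::finite \<Rightarrow> nat \<Rightarrow> nat \<Rightarrow> 'a::field"
  assumes "realizes n L X A B C D V" "realizes n L X A B C D V'" "a < n" "b < n"
  shows "V a b = V' a b"
proof -
  define y :: "nat \<Rightarrow> 'a" where "y c = (if c = b then 1 else 0)" for c
  obtain x where x: "fm_sys n L X A B x y"
    using fm_sys_solution assms(1) unfolding realizes_def by blast
  have "(\<Sum>c<n. V a c * y c) = D * y a + (\<Sum>i<L. C i * x a i)"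
    using assms(1,3) x unfolding realizes_def by blast
  also have "\<dots> = (\<Sum>c<n. V' a c * y c)"
    using assms(2,3) x unfolding realizes_def by metis
  finally have "(\<Sum>c<n. V a c * y c) = (\<Sum>c<n. V' a c * y c)" .
  then show ?thesis using \<open>b < n\<close> by (simp add: y_def)
qed

lemma fm_val_carrier:
  assumes "\<And>k. A k \<in> carrier_mat L L" "\<And>k. B k \<in> carrier_mat L 1" "C \<in> carrier_mat 1 L" "D \<in> carrier_mat 1 1"
    and "\<And>k. X k \<in> carrier_mat m m"
  shows "fm_val L A B C D m X \<in> carrier_mat m m"
proof -
  have "1\<^sub>m m \<otimes>\<^sub>K D \<in> carrier_mat m m" using kronecker_carrier[OF one_carrier_mat assms(4), of m] by simp
  moreover have "mat_sum (L * m) m (\<lambda>k. X k \<otimes>\<^sub>K B k) UNIV \<in> carrier_mat (L * m) m"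
    by (rule mat_sum_carrier) (use kronecker_carrier[OF assms(5,2)] in \<open>auto simp: mult.commute\<close>)
  ultimately show ?thesis unfolding fm_val_def
    using kronecker_carrier[OF one_carrier_mat assms(3), of m] by auto
qed

lemma realizes_fm_val:
  fixes A :: "'d::finite \<Rightarrow> 'a::field mat"
  assumes A: "\<And>k. A k \<in> carrier_mat L L" and B: "\<And>k. B k \<in> carrier_mat L 1"
    and C: "C \<in> carrier_mat 1 L" and D: "D \<in> carrier_mat 1 1"
    and X: "\<And>k. X k \<in> carrier_mat m m"
    and wp: "well_posed m L (\<lambda>k. ent (X k)) (\<lambda>k. ent (A k))"
  shows "realizes m L (\<lambda>k. ent (X k)) (\<lambda>k. ent (A k)) (\<lambda>k i. B k $$ (i, 0)) (\<lambda>i. C $$ (0, i)) (D $$ (0, 0))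
    (ent (fm_val L A B C D m X))"
  unfolding realizes_def
proof (intro conjI allI impI wp)
  fix x y a
  assume sys: "fm_sys m L (\<lambda>k. ent (X k)) (\<lambda>k. ent (A k)) (\<lambda>k i. B k $$ (i, 0)) x y" and a: "a < m"
  let ?P = "pencil m L (\<lambda>k. ent (X k)) (\<lambda>k. ent (A k))"
  have Peq: "fm_pencil L A m X = ?P" by (rule fm_pencil_eq_pencil[OF A X])
  have P: "?P \<in> carrier_mat (L * m) (L * m)" by simp
  have "det ?P \<noteq> 0" using wp well_posed_iff_det by blast
  then have "invertible_mat ?P" using invertible_mat_iff_det[OF P] by simp
  note inv = mat_inv_props[OF P this]
  let ?S = "mat_sum (L * m) m (\<lambda>k. X k \<otimes>\<^sub>K B k) UNIV"
  have c: "X k \<otimes>\<^sub>K B k \<in> carrier_mat (L * m) m" for k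
    using kronecker_carrier[OF X B, of k k] by (simp add: mult.commute)
  have S: "?S \<in> carrier_mat (L * m) m" by (rule mat_sum_carrier) (auto intro: c)
  have Sx: "?S $$ (a * L + i, b) = (\<Sum>k\<in>UNIV. X k $$ (a, b) * B k $$ (i, 0))" if "a < m" "i < L" "b < m" for a i b
    using that mult_add_less'[OF that(1,2)] kronecker_index[OF X B, where b = b and j = 0 and a = a and i = i]
    by (subst mat_sum_index) (auto intro: c)
  have Cc: "1\<^sub>m m \<otimes>\<^sub>K C \<in> carrier_mat m (L * m)"
    using kronecker_carrier[OF one_carrier_mat C, of m] by (simp add: mult.commute)
  have Dc: "1\<^sub>m m \<otimes>\<^sub>K D \<in> carrier_mat m m"
    using kronecker_carrier[OF one_carrier_mat D, of m] by simp
  define v where "v = vec (L * m) (\<lambda>p. x (p div L) (p mod L))"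
  define w where "w = vec m y"
  have v: "v \<in> carrier_vec (L * m)" and w: "w \<in> carrier_vec m" by (auto simp: v_def w_def)
  have vx: "v $ (a * L + i) = x a i" if "a < m" "i < L" for a i
    using that mult_add_less'[OF that] by (simp add: v_def)
  have "?P *\<^sub>v v = ?S *\<^sub>v w"
  proof (rule vec_block_eqI)
    fix a i assume ai: "a < m" "i < L"
    have "(?P *\<^sub>v v) $ (a * L + i) = x a i - fm_step m L (\<lambda>k. ent (X k)) (\<lambda>k. ent (A k)) x a i"
      by (rule pencil_mult_vec[OF v]) (auto simp: vx ai)
    also have "\<dots> = fm_input m (\<lambda>k. ent (X k)) (\<lambda>k i. B k $$ (i, 0)) y a i"
      using fm_sysD[OF sys ai] .
    also have "\<dots> = (\<Sum>b<m. (\<Sum>k\<in>UNIV. X k $$ (a, b) * B k $$ (i, 0)) * y b)"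
      unfolding fm_input_def by (subst sum.swap) (simp add: sum_distrib_right mult.assoc)
    also have "\<dots> = (?S *\<^sub>v w) $ (a * L + i)"
      using ai by (subst index_mult_vec_sum[OF S w mult_add_less'[OF ai]]) (simp add: Sx w_def)
    finally show "(?P *\<^sub>v v) $ (a * L + i) = (?S *\<^sub>v w) $ (a * L + i)" .
  qed (auto intro: mult_mat_vec_carrier[OF P v] mult_mat_vec_carrier[OF S w])
  then have "mat_inv ?P *\<^sub>v (?S *\<^sub>v w) = v"
    using assoc_mult_mat_vec[OF inv(1) P v] inv(3) v by simp
  then have vS: "(mat_inv ?P * ?S) *\<^sub>v w = v"
    using assoc_mult_mat_vec[OF inv(1) S w] by simp
  have "(fm_val L A B C D m X *\<^sub>v w) = (1\<^sub>m m \<otimes>\<^sub>K D) *\<^sub>v w + ((1\<^sub>m m \<otimes>\<^sub>K C) * (mat_inv ?P * ?S)) *\<^sub>v w"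
    unfolding fm_val_def Peq using Cc Dc inv(1) S w
    by (simp add: add_mult_distrib_mat_vec[of _ m m] assoc_mult_mat[OF Cc inv(1) S])
  also have "((1\<^sub>m m \<otimes>\<^sub>K C) * (mat_inv ?P * ?S)) *\<^sub>v w = (1\<^sub>m m \<otimes>\<^sub>K C) *\<^sub>v v"
    using assoc_mult_mat_vec[OF Cc mult_carrier_mat[OF inv(1) S] w] vS by simp
  finally have val: "fm_val L A B C D m X *\<^sub>v w = (1\<^sub>m m \<otimes>\<^sub>K D) *\<^sub>v w + (1\<^sub>m m \<otimes>\<^sub>K C) *\<^sub>v v" .
  have "((1\<^sub>m m \<otimes>\<^sub>K D) *\<^sub>v w) $ a = (\<Sum>b<m. (1\<^sub>m m \<otimes>\<^sub>K D) $$ (a, b) * w $ b)"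
    by (rule index_mult_vec_sum[OF Dc w a])
  also have "\<dots> = (\<Sum>b<m. (if a = b then 1 else 0) * (D $$ (0, 0) * y b))"
    using kronecker_index[OF one_carrier_mat D a, of 0 _ 0] a by (intro sum.cong) (auto simp: w_def)
  also have "\<dots> = D $$ (0, 0) * y a" using a by simp
  finally have 1: "((1\<^sub>m m \<otimes>\<^sub>K D) *\<^sub>v w) $ a = D $$ (0, 0) * y a" .
  have "((1\<^sub>m m \<otimes>\<^sub>K C) *\<^sub>v v) $ a = (\<Sum>p<m * L. (1\<^sub>m m \<otimes>\<^sub>K C) $$ (a, p) * v $ p)"
    by (subst index_mult_vec_sum[OF Cc v a]) (simp add: mult.commute)
  also have "\<dots> = (\<Sum>b<m. \<Sum>i<L. (1\<^sub>m m \<otimes>\<^sub>K C) $$ (a, b * L + i) * v $ (b * L + i))"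
    by (rule sum_lessThan_mult)
  also have "\<dots> = (\<Sum>b<m. (if a = b then 1 else 0) * (\<Sum>i<L. C $$ (0, i) * x b i))"
    using kronecker_index[OF one_carrier_mat C a, of 0] a
    by (intro sum.cong) (auto simp: vx sum_distrib_left)
  also have "\<dots> = (\<Sum>i<L. C $$ (0, i) * x a i)" using a by simp
  finally have 2: "((1\<^sub>m m \<otimes>\<^sub>K C) *\<^sub>v v) $ a = (\<Sum>i<L. C $$ (0, i) * x a i)" .
  have "(\<Sum>b<m. fm_val L A B C D m X $$ (a, b) * y b) = (fm_val L A B C D m X *\<^sub>v w) $ a"
    by (subst index_mult_vec_sum[OF fm_val_carrier[OF A B C D X] w a]) (simp add: w_def)
  also have "\<dots> = D $$ (0, 0) * y a + (\<Sum>i<L. C $$ (0, i) * x a i)"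
    unfolding val using a Cc Dc by (simp add: 1 2)
  finally show "(\<Sum>b<m. fm_val L A B C D m X $$ (a, b) * y b) = D $$ (0, 0) * y a + (\<Sum>i<L. C $$ (0, i) * x a i)" .
qed

text \<open>Replaces the explicit inverse in the definition of a realization by
  \<open>realizes\<close>. The direction from right to left uses that \<open>realizes\<close>
  determines the value.\<close>

lemma realizes_iff_fm_val:
  fixes A :: "'d::finite \<Rightarrow> 'a::field mat"
  assumes A: "\<And>k. A k \<in> carrier_mat L L" and B: "\<And>k. B k \<in> carrier_mat L 1"
    and C: "C \<in> carrier_mat 1 L" and D: "D \<in> carrier_mat 1 1"
    and X: "\<And>k. X k \<in> carrier_mat m m" and V: "V \<in> carrier_mat m m"
  shows "invertible_mat (fm_pencil L A m X) \<and> V = fm_val L A B C D m X \<longleftrightarrow>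
    realizes m L (\<lambda>k. ent (X k)) (\<lambda>k. ent (A k)) (\<lambda>k i. B k $$ (i, 0)) (\<lambda>i. C $$ (0, i)) (D $$ (0, 0)) (ent V)"
proof -
  let ?rel = "realizes m L (\<lambda>k. ent (X k)) (\<lambda>k. ent (A k)) (\<lambda>k i. B k $$ (i, 0)) (\<lambda>i. C $$ (0, i)) (D $$ (0, 0))"
  have i: "invertible_mat (fm_pencil L A m X) \<longleftrightarrow> well_posed m L (\<lambda>k. ent (X k)) (\<lambda>k. ent (A k))"
    unfolding fm_pencil_eq_pencil[OF A X] well_posed_iff_det by (rule invertible_mat_iff_det[OF pencil_carrier])
  have rv: "?rel (ent (fm_val L A B C D m X))" if "well_posed m L (\<lambda>k. ent (X k)) (\<lambda>k. ent (A k))"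
    by (rule realizes_fm_val) (fact A B C D X that)+
  have c: "fm_val L A B C D m X \<in> carrier_mat m m"
    by (rule fm_val_carrier) (fact A B C D X)+
  show ?thesis
  proof
    assume "invertible_mat (fm_pencil L A m X) \<and> V = fm_val L A B C D m X"
    then show "?rel (ent V)" using rv i by blast
  next
    assume r: "?rel (ent V)"
    then have wp: "well_posed m L (\<lambda>k. ent (X k)) (\<lambda>k. ent (A k))" by (simp add: realizes_def)
    have "V = fm_val L A B C D m X"
      by (rule eq_matI) (use c V realizes_unique[OF r rv[OF wp]] in auto)
    then show "invertible_mat (fm_pencil L A m X) \<and> V = fm_val L A B C D m X" using i wp by blast
  qed
qed

section \<open>Evaluation of expressions\<close>

lemma matrix_tuplesD: "X \<in> matrix_tuples n \<Longrightarrow> X k \<in> carrier_mat n n"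
  by (simp add: matrix_tuples_def)

lemma word_mat_Nil [simp]: "word_mat n X [] = 1\<^sub>m n"
  and word_mat_Cons [simp]: "word_mat n X (k # w) = X k * word_mat n X w"
  by (simp_all add: word_mat_def)

lemma word_mat_carrier: "(\<And>k. X k \<in> carrier_mat n n) \<Longrightarrow> word_mat n X w \<in> carrier_mat n n"
  by (induction w) (auto intro: mult_carrier_mat)

lemma mat_sum_empty: "mat_sum nr nc f {} = (0\<^sub>m nr nc :: 'a::field mat)"
proof -
  interpret M: abelian_group "module_mat TYPE('a) nr nc" by (rule abelian_group_mat)
  show ?thesis unfolding mat_sum_def by (simp add: module_mat_simps)
qed

lemma mat_sum_insert:
  fixes f :: "'i \<Rightarrow> 'a::field mat"
  assumes "finite I" "x \<notin> I" "\<And>i. f i \<in> carrier_mat nr nc"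
  shows "mat_sum nr nc f (insert x I) = f x + mat_sum nr nc f I"
proof -
  interpret M: abelian_group "module_mat TYPE('a) nr nc" by (rule abelian_group_mat)
  show ?thesis unfolding mat_sum_def using assms
    by (subst M.finsum_insert) (auto simp: module_mat_simps)
qed

text \<open>Closing the semantic functions under the five operations below makes induction over
  expressions independent of the representation of nc polynomials.\<close>

inductive nc_sem :: "(nat \<Rightarrow> ('d \<Rightarrow> 'a::field mat) \<Rightarrow> 'a mat option) \<Rightarrow> bool" where
  const: "nc_sem (\<lambda>n X. Some (c \<cdot>\<^sub>m 1\<^sub>m n))"
| letter: "nc_sem (\<lambda>n X. Some (X k))"
| add: "nc_sem f \<Longrightarrow> nc_sem g \<Longrightarrow>
    nc_sem (\<lambda>n X. Option.bind (f n X) (\<lambda>P. Option.bind (g n X) (\<lambda>Q. Some (P + Q))))"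
| mul: "nc_sem f \<Longrightarrow> nc_sem g \<Longrightarrow>
    nc_sem (\<lambda>n X. Option.bind (f n X) (\<lambda>P. Option.bind (g n X) (\<lambda>Q. Some (P * Q))))"
| inv: "nc_sem f \<Longrightarrow> nc_sem (\<lambda>n X. Option.bind (f n X) mat_inverse)"
| ext: "nc_sem f \<Longrightarrow> (\<And>n X. X \<in> matrix_tuples n \<Longrightarrow> f n X = g n X) \<Longrightarrow> nc_sem g"

lemma nc_sem_word: "nc_sem (\<lambda>n X. Some (word_mat n X w))"
proof (induction w)
  case Nil
  show ?case by (rule nc_sem.ext[OF nc_sem.const[of 1]]) auto
next
  case (Cons k w)
  show ?case by (rule nc_sem.ext[OF nc_sem.mul[OF nc_sem.letter[of k] Cons]]) simp
qed

text \<open>A polynomial is assembled from constants and letters by the operations of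
  \<open>nc_sem\<close>. The equations involved hold only for tuples of the right size, whence the
  rule \<open>ext\<close>.\<close>

lemma nc_sem_poly_sum:
  assumes "finite S"
  shows "nc_sem (\<lambda>n X. Some (mat_sum n n (\<lambda>w. c w \<cdot>\<^sub>m word_mat n X w) S))"
  using assms
proof (induction S rule: finite_induct)
  case empty
  show ?case by (rule nc_sem.ext[OF nc_sem.const[of 0]]) (auto simp: mat_sum_empty)
next
  case (insert w S)
  have m: "nc_sem (\<lambda>n X. Some ((c w \<cdot>\<^sub>m 1\<^sub>m n) * word_mat n X w))"
    by (rule nc_sem.ext[OF nc_sem.mul[OF nc_sem.const[of "c w"] nc_sem_word[of w]]]) simp
  show ?case
  proof (rule nc_sem.ext[OF nc_sem.add[OF m insert.IH]])
    fix n and X :: "'a \<Rightarrow> 'b mat" assume X: "X \<in> matrix_tuples n"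
    have "word_mat n X v \<in> carrier_mat n n" for v
      by (rule word_mat_carrier) (rule matrix_tuplesD[OF X])
    then show "Option.bind (Some (c w \<cdot>\<^sub>m 1\<^sub>m n * word_mat n X w))
         (\<lambda>P. Option.bind (Some (mat_sum n n (\<lambda>w. c w \<cdot>\<^sub>m word_mat n X w) S)) (\<lambda>Q. Some (P + Q))) =
        Some (mat_sum n n (\<lambda>w. c w \<cdot>\<^sub>m word_mat n X w) (insert w S))"
      using insert.hyps by (simp add: mat_sum_insert mult_smult_assoc_mat[of "1\<^sub>m n" n n _ n] left_mult_one_mat[of _ n n])
  qed
qed

lemma nc_sem_rexp_eval: "nc_sem (\<lambda>n X. rexp_eval n X R)"
proof (induction R)
  case (Poly p)
  show ?case unfolding rexp_eval.simps poly_eval_def by (rule nc_sem_poly_sum) simp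
qed (simp_all add: nc_sem.add nc_sem.mul nc_sem.inv)

lemma nc_sem_carrier:
  assumes "nc_sem f" "X \<in> matrix_tuples n" "f n X = Some V"
  shows "V \<in> carrier_mat n n"
  using assms
proof (induction arbitrary: V rule: nc_sem.induct)
  case (inv f)
  then obtain P where P: "f n X = Some P" "mat_inverse P = Some V" by (auto simp: bind_eq_Some_conv)
  then have "P \<in> carrier_mat n n" using inv by auto
  from mat_inverse(2)[OF this P(2)] show ?case by simp
next
  case (ext f g)
  then show ?case by simp
qed (auto simp: bind_eq_Some_conv dest: matrix_tuplesD)

lemma rexp_eval_carrier:
  "X \<in> matrix_tuples n \<Longrightarrow> rexp_eval n X R = Some V \<Longrightarrow> V \<in> carrier_mat n n"
  by (rule nc_sem_carrier[OF nc_sem_rexp_eval])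

section \<open>Realizations of expressions regular at the origin\<close>

text \<open>With zero input B is free, and choosing it to fit a construction lets the decomposition
  of systems also prove well-posedness.\<close>

lemma well_posed_iff_sys:
  "well_posed n L X A \<longleftrightarrow> (\<forall>x. fm_sys n L X A B x (\<lambda>_. 0) \<longrightarrow> (\<forall>a<n. \<forall>i<L. x a i = 0))"
  by (simp add: well_posed_def fm_sys_def fm_input_def)

lemma fm_sys_cong_input:
  assumes "fm_sys n L X A B x y" "\<And>b. b < n \<Longrightarrow> y b = y' b"
  shows "fm_sys n L X A B x y'"
proof -
  have "fm_input n X B y a i = fm_input n X B y' a i" for a i
    unfolding fm_input_def by (intro sum.cong refl) (simp add: assms(2))
  then show ?thesis using assms(1) unfolding fm_sys_def by simp
qed

lemma fm_sys_alt:
  "fm_sys n L X A B x y \<longleftrightarrow>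
   (\<forall>a<n. \<forall>i<L. x a i = (\<Sum>k\<in>UNIV. \<Sum>b<n. X k a b * ((\<Sum>j<L. A k i j * x b j) + B k i * y b)))"
  unfolding fm_sys_def fm_step_def fm_input_def by (simp add: sum.distrib distrib_left)

section \<open>State space constructions for sums, products and inverses\<close>

definition block_triangular :: "nat \<Rightarrow> (nat \<Rightarrow> nat \<Rightarrow> 'r) \<Rightarrow> (nat \<Rightarrow> nat \<Rightarrow> 'r) \<Rightarrow> (nat \<Rightarrow> nat \<Rightarrow> 'r)
    \<Rightarrow> nat \<Rightarrow> nat \<Rightarrow> 'r::zero" where
  "block_triangular L P G Q i j =
     (if i < L then if j < L then P i j else G i (j - L) else if j < L then 0 else Q (i - L) (j - L))"

definition block_vec :: "nat \<Rightarrow> (nat \<Rightarrow> 'r) \<Rightarrow> (nat \<Rightarrow> 'r) \<Rightarrow> nat \<Rightarrow> 'r" where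
  "block_vec L u v i = (if i < L then u i else v (i - L))"

lemma sum_block_vec:
  fixes u :: "nat \<Rightarrow> 'r::comm_ring_1"
  shows "(\<Sum>i<L + M. block_vec L u v i * x i) = (\<Sum>i<L. u i * x i) + (\<Sum>j<M. v j * x (L + j))"
  unfolding sum_lessThan_add block_vec_def by simp

text \<open>The lower states form a system of their own, and the upper ones see them through G as a
  further input.\<close>

lemma fm_sys_block:
  assumes sys: "fm_sys n (L + M) X (\<lambda>k. block_triangular L (A k) (G k) (A' k)) (\<lambda>k. block_vec L (B k) (B' k)) x y"
  shows "fm_sys n M X A' B' (\<lambda>a i. x a (L + i)) y"
    and "\<forall>a<n. \<forall>i<L. x a i = (\<Sum>k\<in>UNIV. \<Sum>b<n. X k a b *
      ((\<Sum>j<L. A k i j * x b j) + ((\<Sum>j<M. G k i j * x b (L + j)) + B k i * y b)))"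
proof -
  have sys': "x a i = (\<Sum>k\<in>UNIV. \<Sum>b<n. X k a b *
      ((\<Sum>j<L + M. block_triangular L (A k) (G k) (A' k) i j * x b j) + block_vec L (B k) (B' k) i * y b))"
    if "a < n" "i < L + M" for a i
    using sys that unfolding fm_sys_alt by blast
  have low: "(\<Sum>j<L + M. block_triangular L (A k) (G k) (A' k) (L + i) j * x b j) = (\<Sum>j<M. A' k i j * x b (L + j))" for k i b
    unfolding sum_lessThan_add by (simp add: block_triangular_def)
  have up: "(\<Sum>j<L + M. block_triangular L (A k) (G k) (A' k) i j * x b j) =
      (\<Sum>j<L. A k i j * x b j) + (\<Sum>j<M. G k i j * x b (L + j))" if "i < L" for k i b
    unfolding sum_lessThan_add using that by (simp add: block_triangular_def)
  show "fm_sys n M X A' B' (\<lambda>a i. x a (L + i)) y"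
    unfolding fm_sys_alt
  proof (intro allI impI)
    fix a i assume ai: "a < n" "i < M"
    then have "L + i < L + M" by simp
    from sys'[OF ai(1) this]
    show "x a (L + i) = (\<Sum>k\<in>UNIV. \<Sum>b<n. X k a b * ((\<Sum>j<M. A' k i j * x b (L + j)) + B' k i * y b))"
      unfolding low by (simp add: block_vec_def)
  qed
  show "\<forall>a<n. \<forall>i<L. x a i = (\<Sum>k\<in>UNIV. \<Sum>b<n. X k a b *
      ((\<Sum>j<L. A k i j * x b j) + ((\<Sum>j<M. G k i j * x b (L + j)) + B k i * y b)))"
  proof (intro allI impI)
    fix a i assume ai: "a < n" "i < L"
    then have "i < L + M" by simp
    from sys'[OF ai(1) this]
    show "x a i = (\<Sum>k\<in>UNIV. \<Sum>b<n. X k a b *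
      ((\<Sum>j<L. A k i j * x b j) + ((\<Sum>j<M. G k i j * x b (L + j)) + B k i * y b)))"
      unfolding up[OF ai(2)] using ai by (simp only: block_vec_def add.assoc if_True)
  qed
qed

text \<open>Parallel connection: both systems receive y, and their outputs add.\<close>

lemma realizes_add:
  assumes "realizes n L X A B C D V" "realizes n M X A' B' C' D' W"
  shows "realizes n (L + M) X (\<lambda>k. block_triangular L (A k) (\<lambda>_ _. 0) (A' k)) (\<lambda>k. block_vec L (B k) (B' k))
    (block_vec L C C') (D + D') (\<lambda>a b. V a b + W a b)"
proof -
  have split: "fm_sys n M X A' B' (\<lambda>a i. x a (L + i)) y" "fm_sys n L X A B x y"
    if "fm_sys n (L + M) X (\<lambda>k. block_triangular L (A k) (\<lambda>_ _. 0) (A' k)) (\<lambda>k. block_vec L (B k) (B' k)) x y" for x y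
    using fm_sys_block[OF that] by (simp_all only: fm_sys_alt[of n L] mult_zero_left sum.neutral_const add_0)
  show ?thesis unfolding realizes_def
  proof (intro conjI allI impI)
    show "well_posed n (L + M) X (\<lambda>k. block_triangular L (A k) (\<lambda>_ _. 0) (A' k))"
      unfolding well_posed_iff_sys[where B = "\<lambda>k. block_vec L (B k) (B' k)"]
    proof (intro allI impI)
      fix x a i
      assume s: "fm_sys n (L + M) X (\<lambda>k. block_triangular L (A k) (\<lambda>_ _. 0) (A' k)) (\<lambda>k. block_vec L (B k) (B' k)) x (\<lambda>_. 0)"
        and a: "a < n" and i: "i < L + M"
      note s' = split[OF s]
      show "x a i = 0"
      proof (cases "i < L")
        case True
        then show ?thesis using s'(2) assms(1) a unfolding realizes_def well_posed_iff_sys[where B = B] by blast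
      next
        case False
        then have "i - L < M" "x a i = x a (L + (i - L))" using i by auto
        then show ?thesis using s'(1) assms(2) a unfolding realizes_def well_posed_iff_sys[where B = B'] by metis
      qed
    qed
  next
    fix x y a
    assume s: "fm_sys n (L + M) X (\<lambda>k. block_triangular L (A k) (\<lambda>_ _. 0) (A' k)) (\<lambda>k. block_vec L (B k) (B' k)) x y"
      and a: "a < n"
    have "(\<Sum>b<n. V a b * y b) = D * y a + (\<Sum>i<L. C i * x a i)"
      using split(2)[OF s] assms(1) a unfolding realizes_def by blast
    moreover have "(\<Sum>b<n. W a b * y b) = D' * y a + (\<Sum>i<M. C' i * x a (L + i))"
      using split(1)[OF s] assms(2) a unfolding realizes_def by blast
    ultimately show "(\<Sum>b<n. (V a b + W a b) * y b) = (D + D') * y a + (\<Sum>i<L + M. block_vec L C C' i * x a i)"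
      unfolding sum_block_vec by (simp add: distrib_right sum.distrib)
  qed
qed

text \<open>Series connection: the output D' y + C' x of the second system is the input of the
  first. Inserting it into the first system produces the coupling B C' and the input matrix B
  D'.\<close>

lemma realizes_mult:
  fixes X :: "'d::finite \<Rightarrow> nat \<Rightarrow> nat \<Rightarrow> 'a::field"
  assumes "realizes n L X A B C D V" "realizes n M X A' B' C' D' W"
  shows "realizes n (L + M) X (\<lambda>k. block_triangular L (A k) (\<lambda>i j. B k i * C' j) (A' k))
    (\<lambda>k. block_vec L (\<lambda>i. B k i * D') (B' k))
    (block_vec L C (\<lambda>j. D * C' j)) (D * D') (\<lambda>a b. \<Sum>c<n. V a c * W c b)"
    (is "realizes n _ X ?A ?B _ _ _")
proof -
  have split: "fm_sys n M X A' B' (\<lambda>a i. x a (L + i)) y"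
      "fm_sys n L X A B x (\<lambda>b. D' * y b + (\<Sum>j<M. C' j * x b (L + j)))"
    if "fm_sys n (L + M) X ?A ?B x y" for x y
  proof -
    have "(\<Sum>j<M. B k i * C' j * x b (L + j)) + B k i * D' * y b = B k i * (D' * y b + (\<Sum>j<M. C' j * x b (L + j)))"
      for k i b by (simp add: distrib_left sum_distrib_left mult.assoc)
    with fm_sys_block(2)[OF that] show "fm_sys n L X A B x (\<lambda>b. D' * y b + (\<Sum>j<M. C' j * x b (L + j)))"
      by (simp only: fm_sys_alt[of n L])
  qed (rule fm_sys_block(1)[OF that])
  show ?thesis unfolding realizes_def
  proof (intro conjI allI impI)
    show "well_posed n (L + M) X ?A"
      unfolding well_posed_iff_sys[where B = ?B]
    proof (intro allI impI)
      fix x a i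
      assume s: "fm_sys n (L + M) X ?A ?B x (\<lambda>_. 0)" and a: "a < n" and i: "i < L + M"
      have 2: "x b (L + j) = 0" if "b < n" "j < M" for b j
        using split(1)[OF s] assms(2) that unfolding realizes_def well_posed_iff_sys[where B = B'] by blast
      have "fm_sys n L X A B x (\<lambda>_. 0)"
        by (rule fm_sys_cong_input[OF split(2)[OF s]]) (simp add: 2)
      then have 1: "x b j = 0" if "b < n" "j < L" for b j
        using assms(1) that unfolding realizes_def well_posed_iff_sys[where B = B] by blast
      show "x a i = 0"
        using 1[OF a, of i] 2[OF a, of "i - L"] i by (cases "i < L") auto
    qed
  next
    fix x y a
    assume s: "fm_sys n (L + M) X ?A ?B x y" and a: "a < n"
    have W: "(\<Sum>b<n. W c b * y b) = D' * y c + (\<Sum>i<M. C' i * x c (L + i))" if "c < n" for c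
      using split(1)[OF s] assms(2) that unfolding realizes_def by blast
    have "(\<Sum>b<n. (\<Sum>c<n. V a c * W c b) * y b) = (\<Sum>c<n. V a c * (\<Sum>b<n. W c b * y b))"
      unfolding sum_distrib_left sum_distrib_right mult.assoc by (rule sum.swap)
    also have "\<dots> = (\<Sum>c<n. V a c * (D' * y c + (\<Sum>i<M. C' i * x c (L + i))))"
      by (intro sum.cong refl) (simp add: W)
    also have "\<dots> = D * (D' * y a + (\<Sum>i<M. C' i * x a (L + i))) + (\<Sum>i<L. C i * x a i)"
      using split(2)[OF s] assms(1) a unfolding realizes_def by blast
    finally show "(\<Sum>b<n. (\<Sum>c<n. V a c * W c b) * y b) =
        D * D' * y a + (\<Sum>i<L + M. block_vec L C (\<lambda>j. D * C' j) i * x a i)"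
      unfolding sum_block_vec by (simp add: algebra_simps sum_distrib_left)
  qed
qed

text \<open>Feedback: the output equation u = D y + C x is solved for y, which is possible because D
  is nonzero, and the result is inserted into the state equation.\<close>

lemma realizes_inverse:
  fixes X :: "'d::finite \<Rightarrow> nat \<Rightarrow> nat \<Rightarrow> 'a::field"
  assumes r: "realizes n L X A B C D V" and D: "D \<noteq> 0"
    and W: "\<And>a b. a < n \<Longrightarrow> b < n \<Longrightarrow> (\<Sum>c<n. W a c * V c b) = (if a = b then 1 else 0)"
  shows "realizes n L X (\<lambda>k i j. A k i j - B k i * C j / D) (\<lambda>k i. B k i / D) (\<lambda>j. - C j / D) (1 / D) W"
    (is "realizes n L X ?A ?B _ _ _")
proof -
  \<comment> \<open>The input for which the original system, in state x, has the output u.\<close>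
  define out where "out x u b = (u b - (\<Sum>j<L. C j * x b j)) / D" for x :: "nat \<Rightarrow> nat \<Rightarrow> 'a" and u and b :: nat
  have sys: "fm_sys n L X A B x (out x u)" if "fm_sys n L X ?A ?B x u" for x u
  proof -
    have eq: "(\<Sum>j<L. (A k i j - B k i * C j / D) * x b j) + B k i / D * u b =
        (\<Sum>j<L. A k i j * x b j) + B k i * out x u b" for k i b
    proof -
      have "(\<Sum>j<L. (A k i j - B k i * C j / D) * x b j) = (\<Sum>j<L. A k i j * x b j) - B k i / D * (\<Sum>j<L. C j * x b j)"
        by (simp add: left_diff_distrib sum_subtractf sum_distrib_left mult.assoc)
      then show ?thesis unfolding out_def by (simp add: right_diff_distrib diff_divide_distrib)
    qed
    from that show ?thesis unfolding fm_sys_alt eq .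
  qed
  have val: "(\<Sum>b<n. V c b * out x u b) = u c" if "fm_sys n L X ?A ?B x u" "c < n" for x u c
  proof -
    have "(\<Sum>b<n. V c b * out x u b) = D * out x u c + (\<Sum>i<L. C i * x c i)"
      using sys[OF that(1)] r that(2) unfolding realizes_def by blast
    then show ?thesis using D by (simp add: out_def)
  qed
  have Wu: "(\<Sum>c<n. W a c * u c) = out x u a" if "fm_sys n L X ?A ?B x u" "a < n" for x u a
  proof -
    have "(\<Sum>c<n. W a c * u c) = (\<Sum>c<n. W a c * (\<Sum>b<n. V c b * out x u b))"
      by (intro sum.cong refl) (simp add: val[OF that(1)])
    also have "\<dots> = (\<Sum>b<n. (\<Sum>c<n. W a c * V c b) * out x u b)"
      unfolding sum_distrib_left sum_distrib_right by (subst sum.swap) (simp add: mult.assoc)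
    also have "\<dots> = (\<Sum>b<n. (if a = b then 1 else 0) * out x u b)"
      by (intro sum.cong refl) (simp add: W that)
    also have "\<dots> = out x u a" using that by simp
    finally show ?thesis .
  qed
  show ?thesis unfolding realizes_def
  proof (intro conjI allI impI)
    show "well_posed n L X ?A" unfolding well_posed_iff_sys[where B = ?B]
    proof (intro allI impI)
      fix x a i assume s: "fm_sys n L X ?A ?B x (\<lambda>_. 0)" and ai: "a < n" "i < L"
      have "out x (\<lambda>_. 0) b = 0" if "b < n" for b using Wu[OF s that] by simp
      then have "fm_sys n L X A B x (\<lambda>_. 0)" by (rule fm_sys_cong_input[OF sys[OF s]])
      then show "x a i = 0" using r ai unfolding realizes_def well_posed_iff_sys[where B = B] by blast
    qed
  next
    fix x u a assume s: "fm_sys n L X ?A ?B x u" and a: "a < n"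
    show "(\<Sum>b<n. W a b * u b) = 1 / D * u a + (\<Sum>i<L. - C i / D * x a i)"
      unfolding Wu[OF s a] out_def
      by (simp add: diff_divide_distrib sum_divide_distrib sum_negf)
  qed
qed

lemma realizes_cong:
  assumes "\<And>a b. a < n \<Longrightarrow> b < n \<Longrightarrow> V a b = W a b"
  shows "realizes n L X A B C D V \<longleftrightarrow> realizes n L X A B C D W"
proof -
  have "(\<Sum>b<n. V a b * y b) = (\<Sum>b<n. W a b * y b)" if "a < n" for a y
    by (intro sum.cong refl) (simp add: assms that)
  then show ?thesis unfolding realizes_def by auto
qed

text \<open>The constant term is pinned to the value at the origin: for an inverse this makes it
  nonzero, as \<open>realizes_inverse\<close> demands. One choice of coefficients serves all sizes
  n.\<close>

lemma nc_sem_realization: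
  fixes f :: "nat \<Rightarrow> ('d::finite \<Rightarrow> 'a::field mat) \<Rightarrow> 'a mat option"
  assumes "nc_sem f" "f 1 (\<lambda>_. 0\<^sub>m 1 1) = Some V0"
  shows "\<exists>L A B C. \<forall>n. \<forall>X\<in>matrix_tuples n. \<forall>V. f n X = Some V \<longrightarrow>
    realizes n L (\<lambda>k. ent (X k)) A B C (V0 $$ (0, 0)) (ent V)"
  using assms
proof (induction arbitrary: V0 rule: nc_sem.induct)
  case (const c)
  have "realizes n 0 (\<lambda>k. ent (X k)) (\<lambda>_ _ _. 0) (\<lambda>_ _. 0) (\<lambda>_. 0) c (ent (c \<cdot>\<^sub>m 1\<^sub>m n))" for n and X :: "'d \<Rightarrow> 'a mat"
    unfolding realizes_def well_posed_def
  proof (intro conjI allI impI)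
    fix y :: "nat \<Rightarrow> 'a" and a assume a: "a < n"
    have "(\<Sum>b<n. (c \<cdot>\<^sub>m 1\<^sub>m n) $$ (a, b) * y b) = (\<Sum>b<n. (if a = b then 1 else 0) * (c * y b))"
      using a by (intro sum.cong) auto
    then show "(\<Sum>b<n. (c \<cdot>\<^sub>m 1\<^sub>m n) $$ (a, b) * y b) = c * y a + (\<Sum>i<0. 0 * x a i)" for x :: "nat \<Rightarrow> nat \<Rightarrow> 'a"
      using a by simp
  qed simp
  moreover have "V0 $$ (0, 0) = c" using const by auto
  ultimately show ?case by (metis option.inject)
next
  case (letter k)
  \<comment> \<open>One state with A = 0: it stores \<open>X\<^sub>k\<close> y and passes it on
    unchanged.\<close>
  have "realizes n 1 (\<lambda>k. ent (X k)) (\<lambda>_ _ _. 0) (\<lambda>k' _. if k' = k then 1 else 0) (\<lambda>_. 1) 0 (ent (X k))"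
    for n and X :: "'d \<Rightarrow> 'a mat"
    unfolding realizes_def
  proof (intro conjI allI impI)
    show "well_posed n 1 (\<lambda>k. ent (X k)) (\<lambda>_ _ _. 0)" by (simp add: well_posed_def fm_step_def)
    fix x y a assume s: "fm_sys n 1 (\<lambda>k. ent (X k)) (\<lambda>_ _ _. 0) (\<lambda>k' _. if k' = k then 1 else 0) x y" and a: "a < n"
    have "x a 0 = (\<Sum>k'\<in>UNIV. \<Sum>b<n. X k' $$ (a, b) * ((if k' = k then 1 else 0) * y b))"
      using s a unfolding fm_sys_alt by simp
    also have "\<dots> = (\<Sum>k'\<in>UNIV. if k' = k then \<Sum>b<n. X k' $$ (a, b) * y b else 0)"
      by (intro sum.cong) auto
    finally show "(\<Sum>b<n. X k $$ (a, b) * y b) = 0 * y a + (\<Sum>i<1. 1 * x a i)"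
      by simp
  qed
  moreover have "V0 $$ (0, 0) = 0" using letter by auto
  ultimately show ?case by (metis option.inject)
next
  case (add f g)
  from add.prems obtain P0 Q0 where 0: "f 1 (\<lambda>_. 0\<^sub>m 1 1) = Some P0" "g 1 (\<lambda>_. 0\<^sub>m 1 1) = Some Q0" "V0 = P0 + Q0"
    by (auto simp: bind_eq_Some_conv)
  have Z: "(\<lambda>_. 0\<^sub>m 1 1) \<in> matrix_tuples 1" by (simp add: matrix_tuples_def)
  have c: "Q0 \<in> carrier_mat 1 1" "P0 \<in> carrier_mat 1 1"
    using nc_sem_carrier[OF add.hyps(2) Z 0(2)] nc_sem_carrier[OF add.hyps(1) Z 0(1)] .
  from add.IH(1)[OF 0(1)] obtain L A B C where 1: "\<And>n X V. X \<in> matrix_tuples n \<Longrightarrow> f n X = Some V \<Longrightarrow>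
    realizes n L (\<lambda>k. ent (X k)) A B C (P0 $$ (0, 0)) (ent V)" by blast
  from add.IH(2)[OF 0(2)] obtain M A' B' C' where 2: "\<And>n X V. X \<in> matrix_tuples n \<Longrightarrow> g n X = Some V \<Longrightarrow>
    realizes n M (\<lambda>k. ent (X k)) A' B' C' (Q0 $$ (0, 0)) (ent V)" by blast
  show ?case
  proof (intro exI allI ballI impI)
    fix n and X :: "'d \<Rightarrow> 'a mat" and V
    assume X: "X \<in> matrix_tuples n" and V: "Option.bind (f n X) (\<lambda>P. Option.bind (g n X) (\<lambda>Q. Some (P + Q))) = Some V"
    then obtain P Q where PQ: "f n X = Some P" "g n X = Some Q" "V = P + Q" by (auto simp: bind_eq_Some_conv)
    have cc: "P \<in> carrier_mat n n" "Q \<in> carrier_mat n n"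
      using nc_sem_carrier[OF add.hyps(1) X PQ(1)] nc_sem_carrier[OF add.hyps(2) X PQ(2)] .
    have v: "V0 $$ (0, 0) = P0 $$ (0, 0) + Q0 $$ (0, 0)" using c 0 by simp
    show "realizes n (L + M) (\<lambda>k. ent (X k)) (\<lambda>k. block_triangular L (A k) (\<lambda>_ _. 0) (A' k)) (\<lambda>k. block_vec L (B k) (B' k))
      (block_vec L C C') (V0 $$ (0, 0)) (ent V)"
      unfolding v by (rule iffD1[OF realizes_cong realizes_add[OF 1[OF X PQ(1)] 2[OF X PQ(2)]]]) (use cc PQ in auto)
  qed
next
  case (mul f g)
  from mul.prems obtain P0 Q0 where 0: "f 1 (\<lambda>_. 0\<^sub>m 1 1) = Some P0" "g 1 (\<lambda>_. 0\<^sub>m 1 1) = Some Q0" "V0 = P0 * Q0"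
    by (auto simp: bind_eq_Some_conv)
  have Z: "(\<lambda>_. 0\<^sub>m 1 1) \<in> matrix_tuples 1" by (simp add: matrix_tuples_def)
  have c: "Q0 \<in> carrier_mat 1 1" "P0 \<in> carrier_mat 1 1"
    using nc_sem_carrier[OF mul.hyps(2) Z 0(2)] nc_sem_carrier[OF mul.hyps(1) Z 0(1)] .
  from mul.IH(1)[OF 0(1)] obtain L A B C where 1: "\<And>n X V. X \<in> matrix_tuples n \<Longrightarrow> f n X = Some V \<Longrightarrow>
    realizes n L (\<lambda>k. ent (X k)) A B C (P0 $$ (0, 0)) (ent V)" by blast
  from mul.IH(2)[OF 0(2)] obtain M A' B' C' where 2: "\<And>n X V. X \<in> matrix_tuples n \<Longrightarrow> g n X = Some V \<Longrightarrow>
    realizes n M (\<lambda>k. ent (X k)) A' B' C' (Q0 $$ (0, 0)) (ent V)" by blast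
  show ?case
  proof (intro exI allI ballI impI)
    fix n and X :: "'d \<Rightarrow> 'a mat" and V
    assume X: "X \<in> matrix_tuples n" and V: "Option.bind (f n X) (\<lambda>P. Option.bind (g n X) (\<lambda>Q. Some (P * Q))) = Some V"
    then obtain P Q where PQ: "f n X = Some P" "g n X = Some Q" "V = P * Q" by (auto simp: bind_eq_Some_conv)
    have cc: "P \<in> carrier_mat n n" "Q \<in> carrier_mat n n"
      using nc_sem_carrier[OF mul.hyps(1) X PQ(1)] nc_sem_carrier[OF mul.hyps(2) X PQ(2)] .
    have v: "V0 $$ (0, 0) = P0 $$ (0, 0) * Q0 $$ (0, 0)" using index_mult_mat_sum[OF c(2,1), of 0 0] 0 by simp
    show "realizes n (L + M) (\<lambda>k. ent (X k)) (\<lambda>k. block_triangular L (A k) (\<lambda>i j. B k i * C' j) (A' k))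
      (\<lambda>k. block_vec L (\<lambda>i. B k i * Q0 $$ (0, 0)) (B' k))
      (block_vec L C (\<lambda>j. P0 $$ (0, 0) * C' j)) (V0 $$ (0, 0)) (ent V)"
      unfolding v by (rule iffD1[OF realizes_cong realizes_mult[OF 1[OF X PQ(1)] 2[OF X PQ(2)]]])
        (simp add: PQ index_mult_mat_sum[OF cc])
  qed
next
  case (inv f)
  from inv.prems obtain P0 where 0: "f 1 (\<lambda>_. 0\<^sub>m 1 1) = Some P0" "mat_inverse P0 = Some V0"
    by (auto simp: bind_eq_Some_conv)
  have Z: "(\<lambda>_. 0\<^sub>m 1 1) \<in> matrix_tuples 1" by (simp add: matrix_tuples_def)
  have c: "P0 \<in> carrier_mat 1 1" using nc_sem_carrier[OF inv.hyps Z 0(1)] .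
  have c': "P0 * V0 = 1\<^sub>m 1" "V0 \<in> carrier_mat 1 1" using mat_inverse(2)[OF c 0(2)] by auto
  have p: "P0 $$ (0, 0) * V0 $$ (0, 0) = 1" using index_mult_mat_sum[OF c c'(2), of 0 0] c' by simp
  then have nz: "P0 $$ (0, 0) \<noteq> 0" by auto
  with p have v: "V0 $$ (0, 0) = 1 / P0 $$ (0, 0)" by (simp add: field_simps)
  from inv.IH[OF 0(1)] obtain L A B C where 1: "\<And>n X V. X \<in> matrix_tuples n \<Longrightarrow> f n X = Some V \<Longrightarrow>
    realizes n L (\<lambda>k. ent (X k)) A B C (P0 $$ (0, 0)) (ent V)" by blast
  show ?case
  proof (intro exI allI ballI impI)
    fix n and X :: "'d \<Rightarrow> 'a mat" and V
    assume X: "X \<in> matrix_tuples n" and V: "Option.bind (f n X) mat_inverse = Some V"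
    then obtain P where P: "f n X = Some P" "mat_inverse P = Some V" by (auto simp: bind_eq_Some_conv)
    have cc: "P \<in> carrier_mat n n" using nc_sem_carrier[OF inv.hyps X P(1)] .
    note V' = mat_inverse(2)[OF cc P(2)]
    show "realizes n L (\<lambda>k. ent (X k)) (\<lambda>k i j. A k i j - B k i * C j / P0 $$ (0, 0)) (\<lambda>k i. B k i / P0 $$ (0, 0))
      (\<lambda>j. - C j / P0 $$ (0, 0)) (V0 $$ (0, 0)) (ent V)"
      unfolding v
    proof (rule realizes_inverse[OF 1[OF X P(1)] nz])
      fix a b assume "a < n" "b < n"
      then show "(\<Sum>c<n. V $$ (a, c) * P $$ (c, b)) = (if a = b then 1 else 0)"
        using index_mult_mat_sum[of V n n P n a b] V' cc by simp
    qed
  qed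
next
  case (ext f g)
  have Z: "(\<lambda>_. 0\<^sub>m 1 1) \<in> matrix_tuples 1" by (simp add: matrix_tuples_def)
  have "f 1 (\<lambda>_. 0\<^sub>m 1 1) = Some V0" using ext.hyps(2)[OF Z] ext.prems by simp
  from ext.IH[OF this] show ?case using ext.hyps(2) by metis
qed

section \<open>Matrix points close to the origin\<close>

text \<open>At a strictly upper triangular tuple each value is upper triangular with the value at
  the origin all along its diagonal. An inverse that exists at the origin thus exists here as well,
  which provides points of every size in the domain, even over a finite field.\<close>

lemma nc_sem_upper_triangular:
  fixes f :: "nat \<Rightarrow> ('d::finite \<Rightarrow> 'a::field mat) \<Rightarrow> 'a mat option"
  assumes "nc_sem f" "f 1 (\<lambda>_. 0\<^sub>m 1 1) = Some V0" "X \<in> matrix_tuples n"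
    and "\<And>k a b. a < n \<Longrightarrow> b \<le> a \<Longrightarrow> X k $$ (a, b) = 0"
  shows "\<exists>V. f n X = Some V \<and> (\<forall>a<n. V $$ (a, a) = V0 $$ (0, 0) \<and> (\<forall>b<a. V $$ (a, b) = 0))"
  using assms
proof (induction arbitrary: V0 rule: nc_sem.induct)
  case (const c)
  then show ?case by auto
next
  case (letter k)
  then show ?case by auto
next
  case (add f g)
  from add.prems obtain P0 Q0 where 0: "f 1 (\<lambda>_. 0\<^sub>m 1 1) = Some P0" "g 1 (\<lambda>_. 0\<^sub>m 1 1) = Some Q0" "V0 = P0 + Q0"
    by (auto simp: bind_eq_Some_conv)
  have Z: "(\<lambda>_. 0\<^sub>m 1 1) \<in> matrix_tuples 1" by (simp add: matrix_tuples_def)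
  have c: "Q0 \<in> carrier_mat 1 1" "P0 \<in> carrier_mat 1 1"
    using nc_sem_carrier[OF add.hyps(2) Z 0(2)] nc_sem_carrier[OF add.hyps(1) Z 0(1)] .
  from add.IH(1)[OF 0(1) add.prems(2,3)] add.IH(2)[OF 0(2) add.prems(2,3)] obtain P Q
    where P: "f n X = Some P" "\<forall>a<n. P $$ (a, a) = P0 $$ (0, 0) \<and> (\<forall>b<a. P $$ (a, b) = 0)"
      and Q: "g n X = Some Q" "\<forall>a<n. Q $$ (a, a) = Q0 $$ (0, 0) \<and> (\<forall>b<a. Q $$ (a, b) = 0)"
    by blast
  have cc: "P \<in> carrier_mat n n" "Q \<in> carrier_mat n n"
    using nc_sem_carrier[OF add.hyps(1) add.prems(2) P(1)] nc_sem_carrier[OF add.hyps(2) add.prems(2) Q(1)] .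
  show ?case using P Q cc c 0(3) by (intro exI[of _ "P + Q"]) auto
next
  case (mul f g)
  from mul.prems obtain P0 Q0 where 0: "f 1 (\<lambda>_. 0\<^sub>m 1 1) = Some P0" "g 1 (\<lambda>_. 0\<^sub>m 1 1) = Some Q0" "V0 = P0 * Q0"
    by (auto simp: bind_eq_Some_conv)
  have Z: "(\<lambda>_. 0\<^sub>m 1 1) \<in> matrix_tuples 1" by (simp add: matrix_tuples_def)
  have c: "Q0 \<in> carrier_mat 1 1" "P0 \<in> carrier_mat 1 1"
    using nc_sem_carrier[OF mul.hyps(2) Z 0(2)] nc_sem_carrier[OF mul.hyps(1) Z 0(1)] .
  from mul.IH(1)[OF 0(1) mul.prems(2,3)] mul.IH(2)[OF 0(2) mul.prems(2,3)] obtain P Q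
    where P: "f n X = Some P" "\<forall>a<n. P $$ (a, a) = P0 $$ (0, 0) \<and> (\<forall>b<a. P $$ (a, b) = 0)"
      and Q: "g n X = Some Q" "\<forall>a<n. Q $$ (a, a) = Q0 $$ (0, 0) \<and> (\<forall>b<a. Q $$ (a, b) = 0)"
    by blast
  have cc: "P \<in> carrier_mat n n" "Q \<in> carrier_mat n n"
    using nc_sem_carrier[OF mul.hyps(1) mul.prems(2) P(1)] nc_sem_carrier[OF mul.hyps(2) mul.prems(2) Q(1)] .
  have v0: "V0 $$ (0, 0) = P0 $$ (0, 0) * Q0 $$ (0, 0)" using index_mult_mat_sum[OF c(2,1), of 0 0] 0 by simp
  have "(P * Q) $$ (a, b) = (if a = b then V0 $$ (0, 0) else 0)" if a: "a < n" and b: "b \<le> a" for a b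
  proof -
    have "(P * Q) $$ (a, b) = (\<Sum>l<n. P $$ (a, l) * Q $$ (l, b))"
      using index_mult_mat_sum[OF cc, of a b] a b by simp
    also have "\<dots> = (\<Sum>l<n. if l = a then (if a = b then V0 $$ (0, 0) else 0) else 0)"
    proof (intro sum.cong refl)
      fix l assume l: "l \<in> {..<n}"
      consider "l < a" | "l = a" | "l > a" by linarith
      then show "P $$ (a, l) * Q $$ (l, b) = (if l = a then (if a = b then V0 $$ (0, 0) else 0) else 0)"
        by cases (use P(2) Q(2) l a b v0 in auto)
    qed
    also have "\<dots> = (if a = b then V0 $$ (0, 0) else 0)" using a by simp
    finally show ?thesis .
  qed
  then show ?case using P Q by (intro exI[of _ "P * Q"]) auto
next
  case (inv f)
  from inv.prems obtain P0 where 0: "f 1 (\<lambda>_. 0\<^sub>m 1 1) = Some P0" "mat_inverse P0 = Some V0"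
    by (auto simp: bind_eq_Some_conv)
  have Z: "(\<lambda>_. 0\<^sub>m 1 1) \<in> matrix_tuples 1" by (simp add: matrix_tuples_def)
  have c: "P0 \<in> carrier_mat 1 1" using nc_sem_carrier[OF inv.hyps Z 0(1)] .
  have c': "P0 * V0 = 1\<^sub>m 1" "V0 \<in> carrier_mat 1 1" using mat_inverse(2)[OF c 0(2)] by auto
  have p: "P0 $$ (0, 0) * V0 $$ (0, 0) = 1" using index_mult_mat_sum[OF c c'(2), of 0 0] c' by simp
  from inv.IH[OF 0(1) inv.prems(2,3)] obtain P
    where P: "f n X = Some P" "\<forall>a<n. P $$ (a, a) = P0 $$ (0, 0) \<and> (\<forall>b<a. P $$ (a, b) = 0)" by blast
  have cc: "P \<in> carrier_mat n n" using nc_sem_carrier[OF inv.hyps inv.prems(2) P(1)] .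
  have "det P = prod_list (diag_mat P)"
    by (rule det_upper_triangular[OF _ cc]) (use P(2) cc in \<open>auto intro!: upper_triangularI\<close>)
  also have "\<dots> \<noteq> 0" using P(2) cc p by (auto simp: diag_mat_def prod_list_zero_iff)
  finally have "invertible_mat P" using invertible_mat_iff_det[OF cc] by simp
  note inv = mat_inv_props[OF cc this]
  define V where "V = mat_inv P"
  have V: "V \<in> carrier_mat n n" "P * V = 1\<^sub>m n" "V * P = 1\<^sub>m n" using inv by (auto simp: V_def)
  have VP: "V $$ (a, b) * P0 $$ (0, 0) + (\<Sum>l<b. V $$ (a, l) * P $$ (l, b)) = (if a = b then 1 else 0)"
    if a: "a < n" and b: "b < n" for a b
  proof -
    have "(if a = b then 1 else 0) = (\<Sum>l<n. V $$ (a, l) * P $$ (l, b))"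
      using index_mult_mat_sum[OF V(1) cc a b] V(3) a b by simp
    also have "\<dots> = (\<Sum>l<Suc b. V $$ (a, l) * P $$ (l, b))"
      by (rule sum.mono_neutral_right) (use b P(2) in auto)
    finally show ?thesis using P(2) b by (simp add: add.commute)
  qed
  \<comment> \<open>Forward substitution along row a of V P = I.\<close>
  have low: "V $$ (a, b) = 0" if "a < n" "b < a" for a b
    using that(2)
  proof (induction b rule: less_induct)
    case (less b)
    then have "(\<Sum>l<b. V $$ (a, l) * P $$ (l, b)) = 0" by (intro sum.neutral) auto
    then show ?case using VP[of a b] less.prems that p by auto
  qed
  moreover have "V $$ (a, a) = V0 $$ (0, 0)" if "a < n" for a
  proof -
    have "(\<Sum>l<a. V $$ (a, l) * P $$ (l, a)) = 0" using low[OF that] by (intro sum.neutral) auto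
    then have "V $$ (a, a) * P0 $$ (0, 0) = V0 $$ (0, 0) * P0 $$ (0, 0)"
      using VP[OF that that] p by (simp add: mult.commute)
    then show ?thesis using p by auto
  qed
  ultimately show ?case
    using P(1) mat_inverse_eq_SomeI[OF cc V(1,2)] by (intro exI[of _ V]) auto
next
  case (ext f g)
  have Z: "(\<lambda>_. 0\<^sub>m 1 1) \<in> matrix_tuples 1" by (simp add: matrix_tuples_def)
  have "f 1 (\<lambda>_. 0\<^sub>m 1 1) = Some V0" using ext.hyps(2)[OF Z] ext.prems by simp
  from ext.IH[OF this ext.prems(2,3)] show ?case using ext.hyps(2) ext.prems(2) by metis
qed

section \<open>Polynomial paths\<close>

text \<open>A finite-dimensional matrix representation of \<open>K[s]\<close>. Over a finite field scalars do not
  separate polynomials, so the parameter of a path is specialized to matrices instead.\<close>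

definition is_rep :: "nat \<Rightarrow> ('a::field poly \<Rightarrow> nat \<Rightarrow> nat \<Rightarrow> 'a) \<Rightarrow> bool" where
  "is_rep N \<phi> \<longleftrightarrow> 0 < N \<and>
     (\<forall>p q. \<forall>i<N. \<forall>j<N. \<phi> (p + q) i j = \<phi> p i j + \<phi> q i j) \<and>
     (\<forall>p q. \<forall>i<N. \<forall>j<N. \<phi> (p * q) i j = (\<Sum>l<N. \<phi> p i l * \<phi> q l j)) \<and>
     (\<forall>c. \<forall>i<N. \<forall>j<N. \<phi> [:c:] i j = (if i = j then c else 0))"

text \<open>Invertibility of d in the representation. The inverse is the image of a polynomial, so
  rational functions never have to be formed.\<close>

definition rep_inverse :: "nat \<Rightarrow> ('a::field poly \<Rightarrow> nat \<Rightarrow> nat \<Rightarrow> 'a) \<Rightarrow> 'a poly \<Rightarrow> 'a poly \<Rightarrow> bool" where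
  "rep_inverse N \<phi> d g \<longleftrightarrow> (\<forall>i<N. \<forall>j<N. \<phi> (d * g) i j = (if i = j then 1 else 0))"

text \<open>The representation index is the outer one. For N = 1 this is literally evaluation of the
  entries, and for a representation by scalar matrices it is a direct sum of copies.\<close>

definition lift_mat :: "nat \<Rightarrow> nat \<Rightarrow> ('a::field poly \<Rightarrow> nat \<Rightarrow> nat \<Rightarrow> 'a) \<Rightarrow> 'a poly mat \<Rightarrow> 'a mat" where
  "lift_mat N m \<phi> M = mat (N * m) (N * m) (\<lambda>(p, q). \<phi> (M $$ (p mod m, q mod m)) (p div m) (q div m))"

lemma is_repD:
  assumes "is_rep N \<phi>"
  shows "0 < N"
    and "i < N \<Longrightarrow> j < N \<Longrightarrow> \<phi> (p + q) i j = \<phi> p i j + \<phi> q i j"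
    and "i < N \<Longrightarrow> j < N \<Longrightarrow> \<phi> (p * q) i j = (\<Sum>l<N. \<phi> p i l * \<phi> q l j)"
    and "i < N \<Longrightarrow> j < N \<Longrightarrow> \<phi> [:c:] i j = (if i = j then c else 0)"
    and "i < N \<Longrightarrow> j < N \<Longrightarrow> \<phi> 1 i j = (if i = j then 1 else 0)"
    and "i < N \<Longrightarrow> j < N \<Longrightarrow> \<phi> 0 i j = 0"
proof -
  show c: "i < N \<Longrightarrow> j < N \<Longrightarrow> \<phi> [:c:] i j = (if i = j then c else 0)" for c
    using assms by (simp add: is_rep_def)
  show "i < N \<Longrightarrow> j < N \<Longrightarrow> \<phi> 1 i j = (if i = j then 1 else 0)"
    using c[of 1] by (simp add: one_pCons)
  show "i < N \<Longrightarrow> j < N \<Longrightarrow> \<phi> 0 i j = 0"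
    using c[of 0] by simp
qed (use assms in \<open>simp_all add: is_rep_def\<close>)

lemma rep_sum:
  assumes "is_rep N \<phi>" "i < N" "j < N"
  shows "\<phi> (sum f S) i j = (\<Sum>s\<in>S. \<phi> (f s) i j)"
  by (induction S rule: infinite_finite_induct) (simp_all add: is_repD[OF assms(1)] assms)

lemma rep_diff:
  assumes "is_rep N \<phi>" "i < N" "j < N"
  shows "\<phi> (p - q) i j = \<phi> p i j - \<phi> q i j"
  using is_repD(2)[OF assms, of "p - q" q] by simp

lemma rep_inverse_absorb:
  assumes "is_rep N \<phi>" "rep_inverse N \<phi> d g" "i < N" "j < N"
  shows "\<phi> (d * g * p) i j = \<phi> p i j"
proof -
  have "\<phi> (d * g * p) i j = (\<Sum>l<N. (if i = l then 1 else 0) * \<phi> p l j)"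
    unfolding is_repD(3)[OF assms(1,3,4)] using assms unfolding rep_inverse_def
    by (intro sum.cong) auto
  then show ?thesis using assms by simp
qed

lemma lift_mat_carrier [simp]: "lift_mat N m \<phi> M \<in> carrier_mat (N * m) (N * m)"
  by (simp add: lift_mat_def)

lemma lift_mat_index:
  assumes "i < N" "j < N" "a < m" "b < m"
  shows "lift_mat N m \<phi> M $$ (i * m + a, j * m + b) = \<phi> (M $$ (a, b)) i j"
  using assms mult_add_less[OF assms(1,3)] mult_add_less[OF assms(2,4)] by (simp add: lift_mat_def)

lemma lift_mat_eqI:
  assumes "V \<in> carrier_mat (N * m) (N * m)"
    and "\<And>i j a b. i < N \<Longrightarrow> j < N \<Longrightarrow> a < m \<Longrightarrow> b < m \<Longrightarrow> V $$ (i * m + a, j * m + b) = \<phi> (M $$ (a, b)) i j"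
  shows "V = lift_mat N m \<phi> M"
proof (rule eq_matI)
  fix p q assume "p < dim_row (lift_mat N m \<phi> M)" "q < dim_col (lift_mat N m \<phi> M)"
  then have p: "p < N * m" and q: "q < N * m" by (auto simp: lift_mat_def)
  show "V $$ (p, q) = lift_mat N m \<phi> M $$ (p, q)"
    using assms(2)[of "p div m" "q div m" "p mod m" "q mod m"] p q
      div_less_of_less_mult[OF p] div_less_of_less_mult[OF q] mod_less_of_less_mult[OF p] mod_less_of_less_mult[OF q]
    by (simp add: lift_mat_def)
qed (use assms in \<open>auto simp: lift_mat_def\<close>)

lemma lift_mat_mult:
  assumes rep: "is_rep N \<phi>" and M: "M \<in> carrier_mat m m" and M': "M' \<in> carrier_mat m m"
  shows "lift_mat N m \<phi> M * lift_mat N m \<phi> M' = lift_mat N m \<phi> (M * M')"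
proof (rule lift_mat_eqI)
  fix i j a b assume i: "i < N" and j: "j < N" and a: "a < m" and b: "b < m"
  have "(lift_mat N m \<phi> M * lift_mat N m \<phi> M') $$ (i * m + a, j * m + b) =
      (\<Sum>p<N * m. lift_mat N m \<phi> M $$ (i * m + a, p) * lift_mat N m \<phi> M' $$ (p, j * m + b))"
    by (rule index_mult_mat_sum[OF lift_mat_carrier lift_mat_carrier mult_add_less[OF i a] mult_add_less[OF j b]])
  also have "\<dots> = (\<Sum>l<N. \<Sum>c<m. \<phi> (M $$ (a, c)) i l * \<phi> (M' $$ (c, b)) l j)"
    unfolding sum_lessThan_mult by (intro sum.cong refl) (simp add: lift_mat_index i j a b)
  also have "\<dots> = (\<Sum>c<m. \<phi> (M $$ (a, c) * M' $$ (c, b)) i j)"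
    by (subst sum.swap) (simp add: is_repD(3)[OF rep i j])
  also have "\<dots> = \<phi> ((M * M') $$ (a, b)) i j"
    by (simp only: index_mult_mat_sum[OF M M' a b] rep_sum[OF rep i j])
  finally show "(lift_mat N m \<phi> M * lift_mat N m \<phi> M') $$ (i * m + a, j * m + b) = \<phi> ((M * M') $$ (a, b)) i j" .
qed (rule mult_carrier_mat[OF lift_mat_carrier lift_mat_carrier])

lemma lift_mat_cong:
  assumes "\<And>a b i j. a < m \<Longrightarrow> b < m \<Longrightarrow> i < N \<Longrightarrow> j < N \<Longrightarrow> \<phi> (M $$ (a, b)) i j = \<phi> (M' $$ (a, b)) i j"
  shows "lift_mat N m \<phi> M = lift_mat N m \<phi> M'"
  by (rule lift_mat_eqI) (simp_all add: lift_mat_index assms)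

lemma is_rep_eval: "is_rep 1 (\<lambda>p _ _. poly p c)"
  by (simp add: is_rep_def)

lemma lift_mat_eval: "M \<in> carrier_mat m m \<Longrightarrow> lift_mat 1 m (\<lambda>p _ _. poly p c) M = map_mat (\<lambda>p. poly p c) M"
  by (rule eq_matI) (auto simp: lift_mat_def)

text \<open>The quotient K[s]/(G), acting on itself by multiplication, for a modulus G such that d
  becomes a unit and p stays nonzero. This works over every field.\<close>

lemma generic_rep:
  fixes d p :: "'a::field poly"
  assumes d: "d \<noteq> 0" and p: "p \<noteq> 0"
  shows "\<exists>N \<phi> g. is_rep N \<phi> \<and> rep_inverse N \<phi> d g \<and> (\<exists>i<N. \<exists>j<N. \<phi> p i j \<noteq> 0)"
proof -
  define n where "n = Suc (degree p)"
  \<comment> \<open>Modulo G the polynomial - s^n inverts d, and the choice of n makes the degree of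
    G exceed that of p.\<close>
  define G where "G = 1 + d * monom 1 n"
  define N where "N = degree G"
  \<comment> \<open>Column j holds the coefficients of q s^j modulo G: multiplication by q in the
    basis 1, s, s^2, and so on.\<close>
  define \<phi> where "\<phi> q i j = coeff ((q * monom 1 j) mod G) i" for q i j
  have dm: "degree (d * monom 1 n) = degree d + n"
    using d by (simp add: degree_mult_eq degree_monom_eq)
  have N: "N = degree d + n"
    unfolding N_def G_def using dm by (subst degree_add_eq_right) (auto simp: n_def)
  have G0: "G \<noteq> 0" using N unfolding N_def n_def by auto
  have red: "degree (q mod G) < N" for q
    using degree_mod_less[OF G0, of q] N unfolding N_def n_def by auto
  have expand: "q mod G = (\<Sum>l<N. monom (coeff (q mod G) l) l)" for q
    using poly_as_sum_of_monoms'[of "q mod G" "N - 1"] red[of q]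
    by (cases N) (auto simp: lessThan_Suc_atMost)
  have small: "(q mod G) = q" if "degree q < N" for q
    using that unfolding N_def by (rule mod_poly_less)
  have mod_sum: "(\<Sum>l\<in>S. h l) mod G = (\<Sum>l\<in>S. h l mod G)" for S :: "nat set" and h
    by (induction S rule: infinite_finite_induct) (simp_all add: poly_mod_add_left)
  have rep: "is_rep N \<phi>"
    unfolding is_rep_def
  proof (intro conjI allI impI)
    show "0 < N" using N by (simp add: n_def)
    show "\<phi> (q + r) i j = \<phi> q i j + \<phi> r i j" for q r i j
      unfolding \<phi>_def by (simp add: distrib_right poly_mod_add_left)
    show "\<phi> [:c:] i j = (if i = j then c else 0)" if "i < N" "j < N" for c i j
    proof -
      have "[:c:] * monom 1 j = monom c j" by (simp add: smult_monom)
      moreover have "degree (monom c j) < N" using degree_monom_le[of c j] that by linarith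
      ultimately show ?thesis unfolding \<phi>_def using small by auto
    qed
    show "\<phi> (q * r) i j = (\<Sum>l<N. \<phi> q i l * \<phi> r l j)" if "i < N" "j < N" for q r i j
    proof -
      have "(q * r * monom 1 j) mod G = (q * ((r * monom 1 j) mod G)) mod G"
        by (simp add: mod_mult_right_eq mult.assoc)
      also have "(r * monom 1 j) mod G = (\<Sum>l<N. monom (\<phi> r l j) l)"
        unfolding \<phi>_def by (rule expand)
      also have "q * (\<Sum>l<N. monom (\<phi> r l j) l) = (\<Sum>l<N. Polynomial.smult (\<phi> r l j) (q * monom 1 l))"
        by (simp add: sum_distrib_left mult_smult_right[symmetric] smult_monom)
      also have "\<dots> mod G = (\<Sum>l<N. Polynomial.smult (\<phi> r l j) ((q * monom 1 l) mod G))"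
        by (simp add: mod_sum mod_smult_left)
      finally show ?thesis unfolding \<phi>_def by (simp add: coeff_sum mult.commute)
    qed
  qed
  have "rep_inverse N \<phi> d (- monom 1 n)"
    unfolding rep_inverse_def
  proof (intro allI impI)
    fix i j assume ij: "i < N" "j < N"
    have "\<phi> (d * - monom 1 n) i j = \<phi> (1 - G) i j" by (simp add: G_def)
    also have "\<dots> = \<phi> 1 i j - \<phi> G i j" by (rule rep_diff[OF rep ij])
    also have "\<phi> G i j = 0" unfolding \<phi>_def by simp
    finally show "\<phi> (d * - monom 1 n) i j = (if i = j then 1 else 0)" using is_repD(5)[OF rep ij] by simp
  qed
  \<comment> \<open>Column 0 contains p itself, whose degree is too small for a reduction; the entry
    is its leading coefficient.\<close>
  moreover have "\<phi> p (degree p) 0 \<noteq> 0"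
    unfolding \<phi>_def using small[of p] p N by (simp add: n_def)
  ultimately show ?thesis using rep N by (metis n_def less_Suc_eq_0_disj lessI trans_less_add2)
qed

lemma block_index_eq:
  "a < m \<Longrightarrow> b < m \<Longrightarrow> i * m + a = j * m + (b::nat) \<longleftrightarrow> i = j \<and> a = b"
  by (metis div_mult_self3 div_less mod_less mod_mult_self3 add.commute add.right_neutral less_nat_zero_code)

text \<open>Along a polynomial path, a value is a polynomial matrix \<open>V\<close> over a polynomial denominator
  \<open>d\<close> that does not vanish where the expression is defined; \<open>g\<close> stands for \<open>1 / d\<close>.\<close>

lemma nc_sem_lift:
  fixes f :: "nat \<Rightarrow> ('d::finite \<Rightarrow> 'a::field mat) \<Rightarrow> 'a mat option"
  assumes "nc_sem f" "\<And>k. Y k \<in> carrier_mat m m"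
    "f m (\<lambda>k. map_mat (\<lambda>p. poly p c) (Y k)) = Some V0"
  shows "\<exists>d V. V \<in> carrier_mat m m \<and> poly d c \<noteq> 0 \<and>
    (\<forall>N \<phi> g. is_rep N \<phi> \<longrightarrow> rep_inverse N \<phi> d g \<longrightarrow>
      f (N * m) (\<lambda>k. lift_mat N m \<phi> (Y k)) = Some (lift_mat N m \<phi> (g \<cdot>\<^sub>m V)))"
  using assms
proof (induction arbitrary: V0 rule: nc_sem.induct)
  case (const e)
  have "e \<cdot>\<^sub>m 1\<^sub>m (N * m) = lift_mat N m \<phi> (g \<cdot>\<^sub>m ([:e:] \<cdot>\<^sub>m 1\<^sub>m m))"
    if rep: "is_rep N \<phi>" and inv: "rep_inverse N \<phi> 1 g" for N \<phi> g
  proof (rule lift_mat_eqI)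
    fix i j a b assume ij: "i < N" "j < N" and ab: "a < m" "b < m"
    have "\<phi> (g * [:e:]) i j = (if i = j then e else 0)"
      using rep_inverse_absorb[OF rep inv ij, of "[:e:]"] is_repD(4)[OF rep ij] by simp
    then show "(e \<cdot>\<^sub>m 1\<^sub>m (N * m)) $$ (i * m + a, j * m + b) = \<phi> ((g \<cdot>\<^sub>m ([:e:] \<cdot>\<^sub>m 1\<^sub>m m)) $$ (a, b)) i j"
      using ab ij mult_add_less[OF ij(1) ab(1)] mult_add_less[OF ij(2) ab(2)] is_repD(6)[OF rep ij]
      by (auto simp: block_index_eq)
  qed simp
  note eq = this
  show ?case
  proof (intro exI conjI allI impI)
    show "[:e:] \<cdot>\<^sub>m 1\<^sub>m m \<in> carrier_mat m m" "poly 1 c \<noteq> 0" by auto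
    fix N and \<phi> :: "'a poly \<Rightarrow> nat \<Rightarrow> nat \<Rightarrow> 'a" and g assume "is_rep N \<phi>" "rep_inverse N \<phi> 1 g"
    from eq[OF this] show "Some (e \<cdot>\<^sub>m 1\<^sub>m (N * m)) = Some (lift_mat N m \<phi> (g \<cdot>\<^sub>m ([:e:] \<cdot>\<^sub>m 1\<^sub>m m)))" by (rule arg_cong)
  qed
next
  case (letter k)
  show ?case
  proof (intro exI conjI allI impI)
    show "Y k \<in> carrier_mat m m" "poly 1 c \<noteq> 0" using letter(1) by auto
    fix N and \<phi> :: "'a poly \<Rightarrow> nat \<Rightarrow> nat \<Rightarrow> 'a" and g assume rep: "is_rep N \<phi>" and inv: "rep_inverse N \<phi> 1 g"
    have "lift_mat N m \<phi> (Y k) = lift_mat N m \<phi> (g \<cdot>\<^sub>m Y k)"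
    proof (rule lift_mat_cong)
      fix a b i j assume ab: "a < m" "b < m" and ij: "i < N" "j < N"
      show "\<phi> (Y k $$ (a, b)) i j = \<phi> ((g \<cdot>\<^sub>m Y k) $$ (a, b)) i j"
        using rep_inverse_absorb[OF rep inv ij, of "Y k $$ (a, b)"] ab letter(1)[of k] by simp
    qed
    then show "Some (lift_mat N m \<phi> (Y k)) = Some (lift_mat N m \<phi> (g \<cdot>\<^sub>m Y k))" by (rule arg_cong)
  qed
next
  case (add f1 f2)
  let ?Y0 = "\<lambda>k. map_mat (\<lambda>p. poly p c) (Y k)"
  from add.prems(2) obtain P0 Q0 where 0: "f1 m ?Y0 = Some P0" "f2 m ?Y0 = Some Q0"
    by (auto simp: bind_eq_Some_conv)
  from add.IH(1)[OF add.prems(1) 0(1)] obtain d1 V1 where 1: "V1 \<in> carrier_mat m m" "poly d1 c \<noteq> 0"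
    "\<And>N \<phi> g. is_rep N \<phi> \<Longrightarrow> rep_inverse N \<phi> d1 g \<Longrightarrow>
      f1 (N * m) (\<lambda>k. lift_mat N m \<phi> (Y k)) = Some (lift_mat N m \<phi> (g \<cdot>\<^sub>m V1))" by blast
  from add.IH(2)[OF add.prems(1) 0(2)] obtain d2 V2 where 2: "V2 \<in> carrier_mat m m" "poly d2 c \<noteq> 0"
    "\<And>N \<phi> g. is_rep N \<phi> \<Longrightarrow> rep_inverse N \<phi> d2 g \<Longrightarrow>
      f2 (N * m) (\<lambda>k. lift_mat N m \<phi> (Y k)) = Some (lift_mat N m \<phi> (g \<cdot>\<^sub>m V2))" by blast
  \<comment> \<open>Numerator of V1 / d1 + V2 / d2 over the common denominator.\<close>
  let ?V = "d2 \<cdot>\<^sub>m V1 + d1 \<cdot>\<^sub>m V2"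
  show ?case
  proof (intro exI conjI allI impI)
    show "?V \<in> carrier_mat m m" using 1 2 by auto
    show "poly (d1 * d2) c \<noteq> 0" using 1 2 by simp
    fix N \<phi> g assume rep: "is_rep N \<phi>" and inv: "rep_inverse N \<phi> (d1 * d2) g"
    have i: "rep_inverse N \<phi> d1 (d2 * g)" "rep_inverse N \<phi> d2 (d1 * g)"
      using inv unfolding rep_inverse_def by (simp_all add: mult_ac)
    have "lift_mat N m \<phi> ((d2 * g) \<cdot>\<^sub>m V1) + lift_mat N m \<phi> ((d1 * g) \<cdot>\<^sub>m V2) = lift_mat N m \<phi> (g \<cdot>\<^sub>m ?V)"
    proof (rule lift_mat_eqI)
      fix i j a b assume ij: "i < N" "j < N" and ab: "a < m" "b < m"
      have "\<phi> (d2 * g * V1 $$ (a, b)) i j + \<phi> (d1 * g * V2 $$ (a, b)) i j =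
          \<phi> (g * (d2 * V1 $$ (a, b) + d1 * V2 $$ (a, b))) i j"
        by (subst is_repD(2)[OF rep ij, symmetric]) (simp add: algebra_simps)
      then show "(lift_mat N m \<phi> ((d2 * g) \<cdot>\<^sub>m V1) + lift_mat N m \<phi> ((d1 * g) \<cdot>\<^sub>m V2)) $$ (i * m + a, j * m + b) =
          \<phi> ((g \<cdot>\<^sub>m ?V) $$ (a, b)) i j"
        using 1(1) 2(1) ij ab mult_add_less[OF ij(1) ab(1)] mult_add_less[OF ij(2) ab(2)]
        by (simp add: lift_mat_index carrier_matD[OF lift_mat_carrier])
    qed (intro add_carrier_mat lift_mat_carrier)
    then show "Option.bind (f1 (N * m) (\<lambda>k. lift_mat N m \<phi> (Y k)))
         (\<lambda>P. Option.bind (f2 (N * m) (\<lambda>k. lift_mat N m \<phi> (Y k))) (\<lambda>Q. Some (P + Q))) =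
        Some (lift_mat N m \<phi> (g \<cdot>\<^sub>m ?V))"
      using 1(3)[OF rep i(1)] 2(3)[OF rep i(2)] by simp
  qed
next
  case (mul f1 f2)
  let ?Y0 = "\<lambda>k. map_mat (\<lambda>p. poly p c) (Y k)"
  from mul.prems(2) obtain P0 Q0 where 0: "f1 m ?Y0 = Some P0" "f2 m ?Y0 = Some Q0"
    by (auto simp: bind_eq_Some_conv)
  from mul.IH(1)[OF mul.prems(1) 0(1)] obtain d1 V1 where 1: "V1 \<in> carrier_mat m m" "poly d1 c \<noteq> 0"
    "\<And>N \<phi> g. is_rep N \<phi> \<Longrightarrow> rep_inverse N \<phi> d1 g \<Longrightarrow>
      f1 (N * m) (\<lambda>k. lift_mat N m \<phi> (Y k)) = Some (lift_mat N m \<phi> (g \<cdot>\<^sub>m V1))" by blast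
  from mul.IH(2)[OF mul.prems(1) 0(2)] obtain d2 V2 where 2: "V2 \<in> carrier_mat m m" "poly d2 c \<noteq> 0"
    "\<And>N \<phi> g. is_rep N \<phi> \<Longrightarrow> rep_inverse N \<phi> d2 g \<Longrightarrow>
      f2 (N * m) (\<lambda>k. lift_mat N m \<phi> (Y k)) = Some (lift_mat N m \<phi> (g \<cdot>\<^sub>m V2))" by blast
  show ?case
  proof (intro exI conjI allI impI)
    show "V1 * V2 \<in> carrier_mat m m" using 1 2 by auto
    show "poly (d1 * d2) c \<noteq> 0" using 1 2 by simp
    fix N \<phi> g assume rep: "is_rep N \<phi>" and inv: "rep_inverse N \<phi> (d1 * d2) g"
    have i: "rep_inverse N \<phi> d1 (d2 * g)" "rep_inverse N \<phi> d2 (d1 * g)"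
      using inv unfolding rep_inverse_def by (simp_all add: mult_ac)
    have "lift_mat N m \<phi> ((d2 * g) \<cdot>\<^sub>m V1) * lift_mat N m \<phi> ((d1 * g) \<cdot>\<^sub>m V2) =
        lift_mat N m \<phi> (((d2 * g) \<cdot>\<^sub>m V1) * ((d1 * g) \<cdot>\<^sub>m V2))"
      by (rule lift_mat_mult[OF rep]) (use 1 2 in auto)
    also have "\<dots> = lift_mat N m \<phi> (g \<cdot>\<^sub>m (V1 * V2))"
    proof (rule lift_mat_cong)
      fix a b i j assume ab: "a < m" "b < m" and ij: "i < N" "j < N"
      have "(((d2 * g) \<cdot>\<^sub>m V1) * ((d1 * g) \<cdot>\<^sub>m V2)) $$ (a, b) =
          (\<Sum>l<m. ((d2 * g) \<cdot>\<^sub>m V1) $$ (a, l) * ((d1 * g) \<cdot>\<^sub>m V2) $$ (l, b))"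
        by (rule index_mult_mat_sum) (use 1 2 ab in auto)
      also have "\<dots> = d1 * d2 * g * (g * (\<Sum>l<m. V1 $$ (a, l) * V2 $$ (l, b)))"
        unfolding sum_distrib_left using 1 2 ab by (intro sum.cong) (auto simp: mult_ac)
      also have "(\<Sum>l<m. V1 $$ (a, l) * V2 $$ (l, b)) = (V1 * V2) $$ (a, b)"
        by (rule index_mult_mat_sum[OF 1(1) 2(1) ab, symmetric])
      finally have e: "(((d2 * g) \<cdot>\<^sub>m V1) * ((d1 * g) \<cdot>\<^sub>m V2)) $$ (a, b) = d1 * d2 * g * (g * (V1 * V2) $$ (a, b))" .
      have "(g \<cdot>\<^sub>m (V1 * V2)) $$ (a, b) = g * (V1 * V2) $$ (a, b)"
        by (rule index_smult_mat) (use 1 2 ab in auto)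
      then show "\<phi> ((((d2 * g) \<cdot>\<^sub>m V1) * ((d1 * g) \<cdot>\<^sub>m V2)) $$ (a, b)) i j = \<phi> ((g \<cdot>\<^sub>m (V1 * V2)) $$ (a, b)) i j"
        unfolding e by (simp only: rep_inverse_absorb[OF rep inv ij])
    qed
    finally show "Option.bind (f1 (N * m) (\<lambda>k. lift_mat N m \<phi> (Y k)))
         (\<lambda>P. Option.bind (f2 (N * m) (\<lambda>k. lift_mat N m \<phi> (Y k))) (\<lambda>Q. Some (P * Q))) =
        Some (lift_mat N m \<phi> (g \<cdot>\<^sub>m (V1 * V2)))"
      using 1(3)[OF rep i(1)] 2(3)[OF rep i(2)] by simp
  qed
next
  case (inv f1)
  let ?Y0 = "\<lambda>k. map_mat (\<lambda>p. poly p c) (Y k)"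
  have Y0: "?Y0 \<in> matrix_tuples m" using inv.prems(1) by (simp add: matrix_tuples_def)
  from inv.prems(2) obtain P0 where 0: "f1 m ?Y0 = Some P0" "mat_inverse P0 = Some V0"
    by (auto simp: bind_eq_Some_conv)
  from inv.IH[OF inv.prems(1) 0(1)] obtain d V where 1: "V \<in> carrier_mat m m" "poly d c \<noteq> 0"
    "\<And>N \<phi> g. is_rep N \<phi> \<Longrightarrow> rep_inverse N \<phi> d g \<Longrightarrow>
      f1 (N * m) (\<lambda>k. lift_mat N m \<phi> (Y k)) = Some (lift_mat N m \<phi> (g \<cdot>\<^sub>m V))" by blast
  have P0: "P0 \<in> carrier_mat m m" by (rule nc_sem_carrier[OF inv.hyps Y0 0(1)])
  interpret ev: comm_ring_hom "\<lambda>p. poly p c" by unfold_locales auto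
  \<comment> \<open>Evaluation at c is a representation of dimension 1. It identifies the invertible
    value \<open>P0\<close> with V / d at c, so det V does not vanish at c.\<close>
  have "rep_inverse 1 (\<lambda>p _ _. poly p c) d [:1 / poly d c:]" using 1(2) by (simp add: rep_inverse_def)
  note v = 1(3)[OF is_rep_eval this]
  have "(\<lambda>k. lift_mat 1 m (\<lambda>p _ _. poly p c) (Y k)) = ?Y0"
    by (rule HOL.ext) (rule lift_mat_eval[OF inv.prems(1)])
  moreover have "lift_mat 1 m (\<lambda>p _ _. poly p c) ([:1 / poly d c:] \<cdot>\<^sub>m V) = map_mat (\<lambda>p. poly p c) ([:1 / poly d c:] \<cdot>\<^sub>m V)"
    by (rule lift_mat_eval) (use 1(1) in simp)
  ultimately have "P0 = map_mat (\<lambda>p. poly p c) ([:1 / poly d c:] \<cdot>\<^sub>m V)"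
    using v 0(1) by (simp only: mult_1 option.inject)
  also have "\<dots> = (1 / poly d c) \<cdot>\<^sub>m map_mat (\<lambda>p. poly p c) V" by (rule eq_matI) auto
  finally have "det P0 = (1 / poly d c) ^ m * poly (det V) c"
    using 1(1) by (simp add: det_smult ev.hom_det)
  moreover have "det P0 \<noteq> 0"
    using mat_inverse(2)[OF P0 0(2)] det_mult[of P0 m V0] P0 by auto
  ultimately have dV: "poly (det V) c \<noteq> 0" by auto
  \<comment> \<open>The inverse of V / d is d adj(V) / det V. It is expanded by d, because the
    denominator d det V is invertible in a representation only if d is, as the induction hypothesis
    requires.\<close>
  let ?W = "(d * d) \<cdot>\<^sub>m adj_mat V"
  note adj = adj_mat[OF 1(1)]
  show ?case
  proof (intro exI conjI allI impI)
    show "?W \<in> carrier_mat m m" using adj by auto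
    show "poly (d * det V) c \<noteq> 0" using 1 dV by simp
    fix N \<phi> g assume rep: "is_rep N \<phi>" and inv: "rep_inverse N \<phi> (d * det V) g"
    have i: "rep_inverse N \<phi> d (det V * g)" using inv unfolding rep_inverse_def by (simp add: mult_ac)
    have "lift_mat N m \<phi> ((det V * g) \<cdot>\<^sub>m V) * lift_mat N m \<phi> (g \<cdot>\<^sub>m ?W) =
        lift_mat N m \<phi> (((det V * g) \<cdot>\<^sub>m V) * (g \<cdot>\<^sub>m ?W))"
      by (rule lift_mat_mult[OF rep]) (use 1 adj in auto)
    also have "\<dots> = 1\<^sub>m (N * m)"
    proof (rule lift_mat_eqI[symmetric])
      fix i j a b assume ij: "i < N" "j < N" and ab: "a < m" "b < m"
      have "(((det V * g) \<cdot>\<^sub>m V) * (g \<cdot>\<^sub>m ?W)) $$ (a, b) =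
          (\<Sum>l<m. ((det V * g) \<cdot>\<^sub>m V) $$ (a, l) * (g \<cdot>\<^sub>m ?W) $$ (l, b))"
        by (rule index_mult_mat_sum) (use 1 adj ab in auto)
      also have "\<dots> = (d * det V * g) * (g * d) * (\<Sum>l<m. V $$ (a, l) * adj_mat V $$ (l, b))"
        unfolding sum_distrib_left using 1 adj ab by (intro sum.cong) (auto simp: mult_ac)
      also have "(\<Sum>l<m. V $$ (a, l) * adj_mat V $$ (l, b)) = (V * adj_mat V) $$ (a, b)"
        by (rule index_mult_mat_sum[OF 1(1) adj(1) ab, symmetric])
      also have "\<dots> = (if a = b then det V else 0)" using adj(2) ab by simp
      finally have e: "(((det V * g) \<cdot>\<^sub>m V) * (g \<cdot>\<^sub>m ?W)) $$ (a, b) =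
          (if a = b then (d * det V * g) * ((d * det V * g) * 1) else 0)" by (simp add: mult_ac)
      have "\<phi> ((d * det V * g) * ((d * det V * g) * 1)) i j = (if i = j then 1 else 0)"
        unfolding rep_inverse_absorb[OF rep inv ij] by (rule is_repD(5)[OF rep ij])
      then show "1\<^sub>m (N * m) $$ (i * m + a, j * m + b) = \<phi> ((((det V * g) \<cdot>\<^sub>m V) * (g \<cdot>\<^sub>m ?W)) $$ (a, b)) i j"
        unfolding e using ij ab mult_add_less[OF ij(1) ab(1)] mult_add_less[OF ij(2) ab(2)] is_repD(6)[OF rep ij]
        by (cases "i = j"; cases "a = b"; simp add: block_index_eq)
    qed simp
    finally have "mat_inverse (lift_mat N m \<phi> ((det V * g) \<cdot>\<^sub>m V)) = Some (lift_mat N m \<phi> (g \<cdot>\<^sub>m ?W))"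
      by (intro mat_inverse_eq_SomeI[OF lift_mat_carrier lift_mat_carrier])
    then show "Option.bind (f1 (N * m) (\<lambda>k. lift_mat N m \<phi> (Y k))) mat_inverse = Some (lift_mat N m \<phi> (g \<cdot>\<^sub>m ?W))"
      using 1(3)[OF rep i] by simp
  qed
next
  case (ext f1 f2)
  have "(\<lambda>k. map_mat (\<lambda>p. poly p c) (Y k)) \<in> matrix_tuples m"
    using ext.prems(1) by (simp add: matrix_tuples_def)
  then have "f1 m (\<lambda>k. map_mat (\<lambda>p. poly p c) (Y k)) = Some V0" using ext by simp
  from ext.IH[OF ext.prems(1) this] obtain d V where 1: "V \<in> carrier_mat m m" "poly d c \<noteq> 0"
    "\<And>N \<phi> g. is_rep N \<phi> \<Longrightarrow> rep_inverse N \<phi> d g \<Longrightarrow>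
      f1 (N * m) (\<lambda>k. lift_mat N m \<phi> (Y k)) = Some (lift_mat N m \<phi> (g \<cdot>\<^sub>m V))" by blast
  show ?case
  proof (intro exI conjI allI impI)
    fix N and \<phi> :: "'a poly \<Rightarrow> nat \<Rightarrow> nat \<Rightarrow> 'a" and g assume rep: "is_rep N \<phi>" "rep_inverse N \<phi> d g"
    have "(\<lambda>k. lift_mat N m \<phi> (Y k)) \<in> matrix_tuples (N * m)" by (simp add: matrix_tuples_def)
    then show "f2 (N * m) (\<lambda>k. lift_mat N m \<phi> (Y k)) = Some (lift_mat N m \<phi> (g \<cdot>\<^sub>m V))"
      using 1(3)[OF rep] ext.hyps(2) by simp
  qed (use 1 in auto)
qed

section \<open>Values of expressions along a path\<close>

definition path_value :: "('a::field, 'd::finite) nc_rexp \<Rightarrow> nat \<Rightarrow> ('d \<Rightarrow> 'a poly mat) \<Rightarrow> 'a poly \<Rightarrow> 'a poly mat \<Rightarrow> bool" where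
  "path_value R m Y d V \<longleftrightarrow> V \<in> carrier_mat m m \<and>
    (\<forall>N \<phi> g. is_rep N \<phi> \<longrightarrow> rep_inverse N \<phi> d g \<longrightarrow>
      (\<lambda>k. lift_mat N m \<phi> (Y k)) \<in> rexp_dom (N * m) R \<and>
      rexp_val (N * m) R (\<lambda>k. lift_mat N m \<phi> (Y k)) = lift_mat N m \<phi> (g \<cdot>\<^sub>m V))"

definition eval_path :: "'a::field \<Rightarrow> ('d \<Rightarrow> 'a poly mat) \<Rightarrow> 'd \<Rightarrow> 'a mat" where
  "eval_path c Y k = map_mat (\<lambda>p. poly p c) (Y k)"

lemma rexp_domD:
  assumes "X \<in> rexp_dom n R"
  shows "X \<in> matrix_tuples n" "rexp_eval n X R = Some (rexp_val n R X)" "rexp_val n R X \<in> carrier_mat n n"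
  using assms rexp_eval_carrier[of X n R] by (auto simp: rexp_dom_def rexp_val_def)

text \<open>A single point of the path in the domain makes the expression defined generically along
  the path, with a denominator that is nonzero at that point.\<close>

lemma path_value_exists:
  assumes Y: "\<forall>k. Y k \<in> carrier_mat m m" and dom: "eval_path c Y \<in> rexp_dom m R"
  shows "\<exists>d V. path_value R m Y d V \<and> poly d c \<noteq> 0"
proof -
  have "rexp_eval m (\<lambda>k. map_mat (\<lambda>p. poly p c) (Y k)) R = Some (rexp_val m R (eval_path c Y))"
    using rexp_domD(2)[OF dom] by (simp add: eval_path_def[abs_def])
  from nc_sem_lift[OF nc_sem_rexp_eval Y[rule_format] this] obtain d V where dV: "V \<in> carrier_mat m m" "poly d c \<noteq> 0"
    "\<And>N \<phi> g. is_rep N \<phi> \<Longrightarrow> rep_inverse N \<phi> d g \<Longrightarrow>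
      rexp_eval (N * m) (\<lambda>k. lift_mat N m \<phi> (Y k)) R = Some (lift_mat N m \<phi> (g \<cdot>\<^sub>m V))" by blast
  then have "path_value R m Y d V"
    unfolding path_value_def rexp_dom_def rexp_val_def by (simp add: matrix_tuples_def)
  with dV(2) show ?thesis by blast
qed

lemma path_value_carrier: "path_value R m Y d V \<Longrightarrow> V \<in> carrier_mat m m"
  by (simp add: path_value_def)

lemma path_valueD:
  assumes "path_value R m Y d V" "is_rep N \<phi>" "rep_inverse N \<phi> d g"
  shows "(\<lambda>k. lift_mat N m \<phi> (Y k)) \<in> rexp_dom (N * m) R"
    "rexp_val (N * m) R (\<lambda>k. lift_mat N m \<phi> (Y k)) = lift_mat N m \<phi> (g \<cdot>\<^sub>m V)"
  using assms unfolding path_value_def by blast+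

lemma path_value_eval:
  assumes pv: "path_value R m Y d V" and Y: "\<forall>k. Y k \<in> carrier_mat m m" and d: "poly d c \<noteq> 0"
  shows "eval_path c Y \<in> rexp_dom m R"
    and "a < m \<Longrightarrow> b < m \<Longrightarrow> poly (V $$ (a, b)) c = poly d c * rexp_val m R (eval_path c Y) $$ (a, b)"
proof -
  have inv: "rep_inverse 1 (\<lambda>p _ _. poly p c) d [:1 / poly d c:]" using d by (simp add: rep_inverse_def)
  note v = path_valueD[OF pv is_rep_eval inv]
  have Y': "(\<lambda>k. lift_mat 1 m (\<lambda>p _ _. poly p c) (Y k)) = eval_path c Y"
    by (rule HOL.ext) (simp only: lift_mat_eval[OF Y[rule_format]] eval_path_def)
  have V: "V \<in> carrier_mat m m" by (rule path_value_carrier[OF pv])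
  have V': "lift_mat 1 m (\<lambda>p _ _. poly p c) ([:1 / poly d c:] \<cdot>\<^sub>m V) = map_mat (\<lambda>p. poly p c) ([:1 / poly d c:] \<cdot>\<^sub>m V)"
    by (rule lift_mat_eval) (use V in simp)
  show "eval_path c Y \<in> rexp_dom m R" using v(1) unfolding Y' mult_1 .
  have "rexp_val m R (eval_path c Y) = map_mat (\<lambda>p. poly p c) ([:1 / poly d c:] \<cdot>\<^sub>m V)"
    using v(2) unfolding Y' V' mult_1 .
  then show "a < m \<Longrightarrow> b < m \<Longrightarrow> poly (V $$ (a, b)) c = poly d c * rexp_val m R (eval_path c Y) $$ (a, b)"
    using V d by simp
qed

definition agree :: "('a::field, 'd::finite) nc_rexp \<Rightarrow> ('a, 'd) nc_rexp \<Rightarrow> bool" where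
  "agree R S \<longleftrightarrow> (\<forall>n\<ge>1. \<forall>X \<in> rexp_dom n R \<inter> rexp_dom n S. rexp_val n R X = rexp_val n S X)"

text \<open>A nonzero difference of the cross products would survive in some representation where d
  e is invertible. There both expressions are defined at the same matrix point, where they agree.
  Neither needs to be defined at a common scalar parameter.\<close>

lemma path_value_unique:
  assumes ag: "agree R S" and m: "m \<ge> 1"
    and R: "path_value R m Y d V" and S: "path_value S m Y e W" and nz: "d \<noteq> 0" "e \<noteq> 0"
    and ab: "a < m" "b < m"
  shows "V $$ (a, b) * e = W $$ (a, b) * d"
proof (rule ccontr)
  let ?p = "e * V $$ (a, b) - d * W $$ (a, b)"
  assume "V $$ (a, b) * e \<noteq> W $$ (a, b) * d"
  then have "?p \<noteq> 0" by (simp add: mult.commute)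
  from generic_rep[OF _ this, of "d * e"] nz obtain N \<phi> g i j where
    rep: "is_rep N \<phi>" and inv: "rep_inverse N \<phi> (d * e) g" and ij: "i < N" "j < N" "\<phi> ?p i j \<noteq> 0" by auto
  \<comment> \<open>An inverse of d e yields inverses of d and of e, so both values are available at
    this point.\<close>
  have i: "rep_inverse N \<phi> d (e * g)" "rep_inverse N \<phi> e (d * g)"
    using inv unfolding rep_inverse_def by (simp_all add: mult_ac)
  have N: "1 \<le> N * m" using is_repD(1)[OF rep] m by simp
  note VW = path_value_carrier[OF R] path_value_carrier[OF S]
  have "lift_mat N m \<phi> ((e * g) \<cdot>\<^sub>m V) = lift_mat N m \<phi> ((d * g) \<cdot>\<^sub>m W)"
    using ag N path_valueD[OF R rep i(1)] path_valueD[OF S rep i(2)] unfolding agree_def by auto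
  then have eq: "\<phi> (e * g * V $$ (a, b)) l j = \<phi> (d * g * W $$ (a, b)) l j" if "l < N" for l
    using lift_mat_index[OF that ij(2) ab, of \<phi> "(e * g) \<cdot>\<^sub>m V"] lift_mat_index[OF that ij(2) ab, of \<phi> "(d * g) \<cdot>\<^sub>m W"]
      VW ab by simp
  have z: "\<phi> (g * ?p) l j = 0" if "l < N" for l
  proof -
    have "g * ?p = e * g * V $$ (a, b) - d * g * W $$ (a, b)" by (simp add: algebra_simps)
    then show ?thesis using eq[OF that] rep_diff[OF rep that ij(2)] by simp
  qed
  have "\<phi> ?p i j = \<phi> (d * e * g * ?p) i j" by (rule rep_inverse_absorb[OF rep inv ij(1,2), symmetric])
  also have "\<dots> = \<phi> ((d * e) * (g * ?p)) i j" by (simp only: mult.assoc)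
  also have "\<dots> = 0" unfolding is_repD(3)[OF rep ij(1,2)] by (intro sum.neutral) (auto simp: z)
  finally show False using ij(3) by simp
qed

lemma rep_const_mult:
  assumes "is_rep N \<phi>" "i < N" "j < N"
  shows "\<phi> ([:c:] * p) i j = c * \<phi> p i j"
proof -
  have "\<phi> ([:c:] * p) i j = (\<Sum>l<N. \<phi> [:c:] i l * \<phi> p l j)" by (rule is_repD(3)[OF assms])
  also have "\<dots> = (\<Sum>l<N. (if i = l then 1 else 0) * (c * \<phi> p l j))"
    using is_repD(4)[OF assms(1)] assms by (intro sum.cong refl) auto
  also have "\<dots> = c * \<phi> p i j" using assms by simp
  finally show ?thesis .
qed

text \<open>Applying \<open>\<phi>\<close> to a polynomial solution and keeping its column e gives a
  solution at the lifted point, since \<open>\<phi>\<close> turns constants into scalar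
  multiples.\<close>

lemma fm_sys_lift:
  assumes rep: "is_rep N \<phi>" and Y: "\<forall>k. Y k \<in> carrier_mat m m" and e: "e < N"
    and sys: "fm_sys m L (\<lambda>k. ent (Y k)) (\<lambda>k i j. [:A k i j:]) (\<lambda>k i. [:B k i:]) x y"
  shows "fm_sys (N * m) L (\<lambda>k. ent (lift_mat N m \<phi> (Y k))) A B
    (\<lambda>q i. \<phi> (x (q mod m) i) (q div m) e) (\<lambda>q. \<phi> (y (q mod m)) (q div m) e)"
  unfolding fm_sys_alt
proof (intro allI impI)
  fix q i assume q: "q < N * m" and i: "i < L"
  define f where "f = q div m"
  define a where "a = q mod m"
  have fa: "f < N" "a < m" "q = f * m + a"
    using div_less_of_less_mult[OF q] mod_less_of_less_mult[OF q] by (auto simp: f_def a_def)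
  define u where "u k b = (\<Sum>j<L. [:A k i j:] * x b j) + [:B k i:] * y b" for k b
  have phu: "\<phi> (u k b) l e = (\<Sum>j<L. A k i j * \<phi> (x b j) l e) + B k i * \<phi> (y b) l e" if "l < N" for k b l
    unfolding u_def is_repD(2)[OF rep that e] rep_sum[OF rep that e] rep_const_mult[OF rep that e] ..
  have "x a i = (\<Sum>k\<in>UNIV. \<Sum>b<m. Y k $$ (a, b) * u k b)"
    using sys fa(2) i unfolding fm_sys_alt u_def by blast
  then have "\<phi> (x a i) f e = (\<Sum>k\<in>UNIV. \<Sum>b<m. \<phi> (Y k $$ (a, b) * u k b) f e)"
    by (simp only: rep_sum[OF rep fa(1) e])
  also have "\<dots> = (\<Sum>k\<in>UNIV. \<Sum>b<m. \<Sum>l<N. \<phi> (Y k $$ (a, b)) f l * \<phi> (u k b) l e)"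
    by (simp only: is_repD(3)[OF rep fa(1) e])
  also have "\<dots> = (\<Sum>k\<in>UNIV. \<Sum>l<N. \<Sum>b<m. \<phi> (Y k $$ (a, b)) f l * \<phi> (u k b) l e)"
    by (rule sum.cong[OF refl], rule sum.swap)
  also have "\<dots> = (\<Sum>k\<in>UNIV. \<Sum>l<N. \<Sum>b<m. lift_mat N m \<phi> (Y k) $$ (q, l * m + b) *
     ((\<Sum>j<L. A k i j * \<phi> (x ((l * m + b) mod m) j) ((l * m + b) div m) e)
        + B k i * \<phi> (y ((l * m + b) mod m)) ((l * m + b) div m) e))"
    unfolding fa(3) by (intro sum.cong refl) (simp add: lift_mat_index fa phu)
  also have "\<dots> = (\<Sum>k\<in>UNIV. \<Sum>p<N * m. lift_mat N m \<phi> (Y k) $$ (q, p) *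
     ((\<Sum>j<L. A k i j * \<phi> (x (p mod m) j) (p div m) e) + B k i * \<phi> (y (p mod m)) (p div m) e))"
    by (simp only: sum_lessThan_mult)
  finally show "\<phi> (x (q mod m) i) (q div m) e = \<dots>" unfolding f_def a_def .
qed

text \<open>The output equation passes from matrix points to K[s] by the argument of
  \<open>path_value_unique\<close>: a nonzero defect would be visible in a representation in which d
  is invertible, where the realization applies.\<close>

lemma path_value_realization:
  assumes m: "m \<ge> 1" and pv: "path_value R m Y d V" and Y: "\<forall>k. Y k \<in> carrier_mat m m" and d: "d \<noteq> 0"
    and real: "\<And>n X. n \<ge> 1 \<Longrightarrow> X \<in> rexp_dom n R \<Longrightarrow> realizes n L (\<lambda>k. ent (X k)) A B C D (ent (rexp_val n R X))"
    and sys: "fm_sys m L (\<lambda>k. ent (Y k)) (\<lambda>k i j. [:A k i j:]) (\<lambda>k i. [:B k i:]) x y"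
    and a: "a < m"
  shows "(\<Sum>b<m. V $$ (a, b) * y b) = d * ([:D:] * y a + (\<Sum>i<L. [:C i:] * x a i))"
proof (rule ccontr)
  define w where "w = [:D:] * y a + (\<Sum>i<L. [:C i:] * x a i)"
  define v where "v = (\<Sum>b<m. V $$ (a, b) * y b)"
  assume "(\<Sum>b<m. V $$ (a, b) * y b) \<noteq> d * ([:D:] * y a + (\<Sum>i<L. [:C i:] * x a i))"
  then have "v - d * w \<noteq> 0" by (simp add: v_def w_def)
  from generic_rep[OF d this] obtain N \<phi> g f e where
    rep: "is_rep N \<phi>" and inv: "rep_inverse N \<phi> d g" and fe: "f < N" "e < N" "\<phi> (v - d * w) f e \<noteq> 0" by auto
  have N: "1 \<le> N * m" using is_repD(1)[OF rep] m by simp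
  note V = path_value_carrier[OF pv]
  have eq: "\<phi> (g * v) l e = \<phi> w l e" if l: "l < N" for l
  proof -
    have "\<phi> (g * v) l e = (\<Sum>b<m. \<phi> (g * V $$ (a, b) * y b) l e)"
      unfolding v_def sum_distrib_left rep_sum[OF rep l fe(2)] by (simp only: mult.assoc)
    also have "\<dots> = (\<Sum>b<m. \<Sum>i<N. \<phi> (g * V $$ (a, b)) l i * \<phi> (y b) i e)"
      by (simp only: is_repD(3)[OF rep l fe(2)])
    also have "\<dots> = (\<Sum>i<N. \<Sum>b<m. \<phi> (g * V $$ (a, b)) l i * \<phi> (y b) i e)" by (rule sum.swap)
    also have "\<dots> = (\<Sum>i<N. \<Sum>b<m. lift_mat N m \<phi> (g \<cdot>\<^sub>m V) $$ (l * m + a, i * m + b)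
        * \<phi> (y ((i * m + b) mod m)) ((i * m + b) div m) e)"
      using V a l by (intro sum.cong refl) (simp add: lift_mat_index)
    also have "\<dots> = (\<Sum>q<N * m. lift_mat N m \<phi> (g \<cdot>\<^sub>m V) $$ (l * m + a, q) * \<phi> (y (q mod m)) (q div m) e)"
      by (simp only: sum_lessThan_mult)
    also have "\<dots> = D * \<phi> (y ((l * m + a) mod m)) ((l * m + a) div m) e
        + (\<Sum>i<L. C i * \<phi> (x ((l * m + a) mod m) i) ((l * m + a) div m) e)"
      using real[OF N path_valueD(1)[OF pv rep inv]] fm_sys_lift[OF rep Y fe(2) sys] mult_add_less[OF l a]
      unfolding realizes_def path_valueD(2)[OF pv rep inv] by blast
    also have "\<dots> = \<phi> w l e"
      unfolding w_def is_repD(2)[OF rep l fe(2)] rep_sum[OF rep l fe(2)] rep_const_mult[OF rep l fe(2)]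
      using a by simp
    finally show ?thesis .
  qed
  have "\<phi> v f e = \<phi> (d * g * v) f e" by (rule rep_inverse_absorb[OF rep inv fe(1,2), symmetric])
  also have "\<dots> = \<phi> (d * (g * v)) f e" by (simp only: mult.assoc)
  also have "\<dots> = (\<Sum>l<N. \<phi> d f l * \<phi> w l e)"
    unfolding is_repD(3)[OF rep fe(1,2)] by (intro sum.cong refl) (simp add: eq)
  also have "\<dots> = \<phi> (d * w) f e" by (rule is_repD(3)[OF rep fe(1,2), symmetric])
  finally show False using fe(3) rep_diff[OF rep fe(1,2)] by simp
qed

section \<open>Equivalence of expressions\<close>

text \<open>The direct sum of p copies of M, used to bring points of different sizes to a common
  one.\<close>

definition amplify :: "nat \<Rightarrow> nat \<Rightarrow> 'a::zero mat \<Rightarrow> 'a mat" where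
  "amplify p m M = mat (p * m) (p * m) (\<lambda>(i, j). if i div m = j div m then M $$ (i mod m, j mod m) else 0)"

lemma amplify_carrier [simp]: "amplify p m M \<in> carrier_mat (p * m) (p * m)"
  by (simp add: amplify_def)

lemma amplify_index:
  assumes "i < p" "j < p" "a < m" "b < m"
  shows "amplify p m M $$ (i * m + a, j * m + b) = (if i = j then M $$ (a, b) else 0)"
  using assms mult_add_less[OF assms(1,3)] mult_add_less[OF assms(2,4)] by (simp add: amplify_def)

text \<open>The path is constant, and the representation by the scalar matrices q(0) I turns it into
  p copies of X. No induction over the expression is needed beyond that of
  \<open>nc_sem_lift\<close>.\<close>

lemma amplify_dom:
  fixes R :: "('a::field, 'd::finite) nc_rexp"
  assumes X: "X \<in> rexp_dom m R" and p: "p > 0"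
  shows "(\<lambda>k. amplify p m (X k)) \<in> rexp_dom (p * m) R"
    and "rexp_val (p * m) R (\<lambda>k. amplify p m (X k)) = amplify p m (rexp_val m R X)"
proof -
  define Y where "Y k = map_mat (\<lambda>c. [:c:]) (X k)" for k
  have Xc: "X k \<in> carrier_mat m m" for k by (rule matrix_tuplesD[OF rexp_domD(1)[OF X]])
  have Y: "\<forall>k. Y k \<in> carrier_mat m m" using Xc by (simp add: Y_def)
  have Y0: "eval_path 0 Y = X"
    by (rule HOL.ext, rule eq_matI) (auto simp: eval_path_def Y_def)
  obtain d V where dV: "path_value R m Y d V" "poly d 0 \<noteq> 0"
    using path_value_exists[OF Y, where c = 0 and R = R] X unfolding Y0 by blast
  note V = path_value_carrier[OF dV(1)]
  let ?\<phi> = "\<lambda>q i j. if i = j then poly q 0 else (0::'a)"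
  have rep: "is_rep p ?\<phi>"
    unfolding is_rep_def
  proof (intro conjI allI impI)
    fix q r :: "'a poly" and i j assume ij: "i < p" "j < p"
    have "(\<Sum>l<p. ?\<phi> q i l * ?\<phi> r l j) = (\<Sum>l<p. (if i = l then 1 else 0) * (poly q 0 * ?\<phi> r l j))"
      by (intro sum.cong) auto
    then show "?\<phi> (q * r) i j = (\<Sum>l<p. ?\<phi> q i l * ?\<phi> r l j)" using ij by simp
  qed (use p in auto)
  have inv: "rep_inverse p ?\<phi> d [:1 / poly d 0:]" using dV(2) by (simp add: rep_inverse_def)
  have Yk: "(\<lambda>k. lift_mat p m ?\<phi> (Y k)) = (\<lambda>k. amplify p m (X k))"
  proof
    fix k show "lift_mat p m ?\<phi> (Y k) = amplify p m (X k)"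
      by (rule lift_mat_eqI[symmetric]) (use Xc[of k] in \<open>auto simp: amplify_index Y_def\<close>)
  qed
  have v: "poly (V $$ (a, b)) 0 = poly d 0 * rexp_val m R X $$ (a, b)" if "a < m" "b < m" for a b
    using path_value_eval(2)[OF dV(1) Y dV(2) that] unfolding Y0 .
  have "amplify p m (rexp_val m R X) = lift_mat p m ?\<phi> ([:1 / poly d 0:] \<cdot>\<^sub>m V)"
    by (rule lift_mat_eqI) (use V v dV(2) in \<open>auto simp: amplify_index\<close>)
  then show "(\<lambda>k. amplify p m (X k)) \<in> rexp_dom (p * m) R"
    "rexp_val (p * m) R (\<lambda>k. amplify p m (X k)) = amplify p m (rexp_val m R X)"
    using path_valueD[OF dV(1) rep inv] unfolding Yk by simp_all
qed

text \<open>The line (1 - s) M + s M'.\<close>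

definition segment :: "nat \<Rightarrow> 'a::field mat \<Rightarrow> 'a mat \<Rightarrow> 'a poly mat" where
  "segment n M M' = mat n n (\<lambda>(i, j). [:M $$ (i, j), M' $$ (i, j) - M $$ (i, j):])"

lemma segment_carrier [simp]: "segment n M M' \<in> carrier_mat n n"
  by (simp add: segment_def)

lemma eval_path_segment:
  assumes "\<And>k. X k \<in> carrier_mat n n" "\<And>k. X' k \<in> carrier_mat n n"
  shows "eval_path 0 (\<lambda>k. segment n (X k) (X' k)) = X" "eval_path 1 (\<lambda>k. segment n (X k) (X' k)) = X'"
proof -
  show "eval_path 0 (\<lambda>k. segment n (X k) (X' k)) = X"
  proof
    fix k show "eval_path 0 (\<lambda>k. segment n (X k) (X' k)) k = X k"
      by (rule eq_matI) (use assms(1)[of k] in \<open>auto simp: eval_path_def segment_def\<close>)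
  qed
  show "eval_path 1 (\<lambda>k. segment n (X k) (X' k)) = X'"
  proof
    fix k show "eval_path 1 (\<lambda>k. segment n (X k) (X' k)) k = X' k"
      by (rule eq_matI) (use assms(2)[of k] in \<open>auto simp: eval_path_def segment_def\<close>)
  qed
qed

text \<open>S need not be defined where R and T are compared. A segment is drawn from the common
  point of R and T to a point of S, all three values are compared as fractions over K[s], and the
  result for R and T is evaluated back at s = 0.\<close>

lemma agree_trans:
  fixes R S T :: "('a::field, 'd::finite) nc_rexp"
  assumes RS: "agree R S" and ST: "agree S T" and S: "nondegenerate S"
  shows "agree R T"
  unfolding agree_def
proof (intro allI impI ballI)
  fix n X assume n: "1 \<le> n" and X: "X \<in> rexp_dom n R \<inter> rexp_dom n T"
  from S obtain m Z where m: "m \<ge> 1" and Z: "Z \<in> rexp_dom m S" unfolding nondegenerate_def by auto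
  \<comment> \<open>Copies bring X, of size n, and Z, of size m, to the common size m * n.\<close>
  define X' where "X' k = amplify m n (X k)" for k
  define Z' where "Z' k = amplify n m (Z k)" for k
  have X': "X' \<in> rexp_dom (m * n) R" "X' \<in> rexp_dom (m * n) T"
    "rexp_val (m * n) R X' = amplify m n (rexp_val n R X)"
    "rexp_val (m * n) T X' = amplify m n (rexp_val n T X)"
    using amplify_dom[of X n R m] amplify_dom[of X n T m] X m unfolding X'_def by auto
  have Z': "Z' \<in> rexp_dom (m * n) S"
    using amplify_dom(1)[OF Z, of n] n unfolding Z'_def by (simp add: mult.commute)
  let ?Y = "\<lambda>k. segment (m * n) (X' k) (Z' k)"
  have c: "X' k \<in> carrier_mat (m * n) (m * n)" "Z' k \<in> carrier_mat (m * n) (m * n)" for k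
    by (rule matrix_tuplesD[OF rexp_domD(1)[OF X'(1)]], rule matrix_tuplesD[OF rexp_domD(1)[OF Z']])
  have Y: "\<forall>k. ?Y k \<in> carrier_mat (m * n) (m * n)" by simp
  have e: "eval_path 0 ?Y = X'" "eval_path 1 ?Y = Z'" by (rule eval_path_segment; rule c)+
  have mn: "1 \<le> m * n" using m n by simp
  obtain d V where R: "path_value R (m * n) ?Y d V" "poly d 0 \<noteq> 0"
    using path_value_exists[OF Y, where c = 0 and R = R] X' unfolding e by blast
  obtain d' V' where T: "path_value T (m * n) ?Y d' V'" "poly d' 0 \<noteq> 0"
    using path_value_exists[OF Y, where c = 0 and R = T] X' unfolding e by blast
  obtain d'' V'' where S: "path_value S (m * n) ?Y d'' V''" "poly d'' 1 \<noteq> 0"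
    using path_value_exists[OF Y, where c = 1 and R = S] Z' unfolding e by blast
  have nz: "d \<noteq> 0" "d' \<noteq> 0" "d'' \<noteq> 0" using R T S by auto
  have eq: "rexp_val (m * n) R X' $$ (a, b) = rexp_val (m * n) T X' $$ (a, b)" if ab: "a < m * n" "b < m * n" for a b
  proof -
    have 1: "V $$ (a, b) * d'' = V'' $$ (a, b) * d" by (rule path_value_unique[OF RS mn R(1) S(1) nz(1,3) ab])
    have 2: "V'' $$ (a, b) * d' = V' $$ (a, b) * d''" by (rule path_value_unique[OF ST mn S(1) T(1) nz(3,2) ab])
    have "d'' * (V $$ (a, b) * d') = V $$ (a, b) * d'' * d'" by (simp only: mult_ac)
    also have "\<dots> = V'' $$ (a, b) * d' * d" unfolding 1 by (simp only: mult_ac)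
    also have "\<dots> = d'' * (V' $$ (a, b) * d)" unfolding 2 by (simp only: mult_ac)
    finally have "d'' * (V $$ (a, b) * d') = d'' * (V' $$ (a, b) * d)" .
    then have "V $$ (a, b) * d' = V' $$ (a, b) * d" using nz by simp
    then have "poly (V $$ (a, b) * d') 0 = poly (V' $$ (a, b) * d) 0" by simp
    then show ?thesis
      using path_value_eval(2)[OF R(1) Y R(2) ab] path_value_eval(2)[OF T(1) Y T(2) ab] R(2) T(2)
      unfolding e by simp
  qed
  show "rexp_val n R X = rexp_val n T X"
  proof (rule eq_matI)
    fix a b assume "a < dim_row (rexp_val n T X)" "b < dim_col (rexp_val n T X)"
    then have ab: "a < n" "b < n" using rexp_domD(3)[of X n T] X by auto
    have "0 * n + a < m * n" "0 * n + b < m * n" by (rule mult_add_less; use m ab in simp)+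
    moreover have "amplify m n M $$ (0 * n + a, 0 * n + b) = M $$ (a, b)" for M :: "'a mat"
      using amplify_index[of 0 m 0 a n b M] m ab by simp
    ultimately show "rexp_val n R X $$ (a, b) = rexp_val n T X $$ (a, b)"
      using eq[of "0 * n + a" "0 * n + b"] unfolding X' by metis
  qed (use rexp_domD(3)[of X n T] rexp_domD(3)[of X n R] X in auto)
qed

section \<open>The adjugate of the pencil\<close>

definition pencil_adj :: "nat \<Rightarrow> nat \<Rightarrow> ('d::finite \<Rightarrow> nat \<Rightarrow> nat \<Rightarrow> 'r::comm_ring_1) \<Rightarrow> ('d \<Rightarrow> nat \<Rightarrow> nat \<Rightarrow> 'r)
    \<Rightarrow> nat \<Rightarrow> nat \<Rightarrow> nat \<Rightarrow> nat \<Rightarrow> 'r" where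
  "pencil_adj n L X A a c i l = adj_mat (pencil n L X A) $$ (a * L + i, c * L + l)"

lemma block_index_eq': "i < L \<Longrightarrow> l < L \<Longrightarrow> a * L + i = c * L + (l::nat) \<longleftrightarrow> a = c \<and> i = l"
  by (rule block_index_eq)

text \<open>Column (c, l) of P adj(P) = det(P) I, read as a state equation with a unit forcing
  scaled by the determinant.\<close>

lemma pencil_adj_right:
  assumes a: "a < n" and i: "i < L" and c: "c < n" and l: "l < L"
  shows "pencil_adj n L X A a c i l = fm_step n L X A (\<lambda>b j. pencil_adj n L X A b c j l) a i
    + (if a = c \<and> i = l then det (pencil n L X A) else 0)"
proof -
  let ?P = "pencil n L X A"
  note adj = adj_mat[OF pencil_carrier[of n L X A]]
  define v where "v = col (adj_mat ?P) (c * L + l)"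
  have cl: "c * L + l < L * n" by (rule mult_add_less'[OF c l])
  note dims = carrier_matD[OF adj(1)]
  have v: "v \<in> carrier_vec (L * n)" unfolding v_def by (rule carrier_vecI) (simp only: dim_col dims)
  have vx: "v $ (b * L + j) = pencil_adj n L X A b c j l" if "b < n" "j < L" for b j
    unfolding v_def pencil_adj_def by (rule index_col) (simp_all only: dims mult_add_less'[OF that] cl)
  have "(?P *\<^sub>v v) $ (a * L + i) = pencil_adj n L X A a c i l - fm_step n L X A (\<lambda>b j. pencil_adj n L X A b c j l) a i"
    by (rule pencil_mult_vec[OF v]) (auto simp: vx a i)
  moreover have "?P *\<^sub>v v = col (?P * adj_mat ?P) (c * L + l)"
    unfolding v_def by (rule col_mult2[OF pencil_carrier adj(1) cl, symmetric])
  moreover have "col (?P * adj_mat ?P) (c * L + l) $ (a * L + i) = (if a = c \<and> i = l then det ?P else 0)"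
    unfolding adj(2) using mult_add_less'[OF a i] cl block_index_eq'[OF i l, of a c] by simp
  ultimately show ?thesis by (simp add: diff_eq_eq add.commute)
qed

text \<open>The identity adj(P) P = det(P) I applied to an arbitrary state x.\<close>

lemma pencil_adj_left:
  assumes a: "a < n" and i: "i < L"
  shows "det (pencil n L X A) * x a i = (\<Sum>c<n. \<Sum>l<L. pencil_adj n L X A a c i l * (x c l - fm_step n L X A x c l))"
proof -
  let ?P = "pencil n L X A"
  note adj = adj_mat[OF pencil_carrier[of n L X A]]
  define v where "v = vec (L * n) (\<lambda>p. x (p div L) (p mod L))"
  have v: "v \<in> carrier_vec (L * n)" by (simp add: v_def)
  have vx: "v $ (b * L + j) = x b j" if "b < n" "j < L" for b j
    using that mult_add_less'[OF that] by (simp add: v_def)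
  have Pv: "(?P *\<^sub>v v) $ (c * L + l) = x c l - fm_step n L X A x c l" if "c < n" "l < L" for c l
    by (rule pencil_mult_vec[OF v]) (auto simp: vx that)
  have "(adj_mat ?P * ?P) *\<^sub>v v = adj_mat ?P *\<^sub>v (?P *\<^sub>v v)"
    by (rule assoc_mult_mat_vec[OF adj(1) pencil_carrier v])
  then have "((det ?P \<cdot>\<^sub>m 1\<^sub>m (L * n)) *\<^sub>v v) $ (a * L + i) = (adj_mat ?P *\<^sub>v (?P *\<^sub>v v)) $ (a * L + i)"
    unfolding adj(3) by simp
  moreover have "((det ?P \<cdot>\<^sub>m 1\<^sub>m (L * n)) *\<^sub>v v) $ (a * L + i) = det ?P * x a i"
  proof -
    have ai: "a * L + i < L * n" by (rule mult_add_less'[OF a i])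
    have "((det ?P \<cdot>\<^sub>m 1\<^sub>m (L * n)) *\<^sub>v v) $ (a * L + i) =
        (\<Sum>q<L * n. (det ?P \<cdot>\<^sub>m 1\<^sub>m (L * n)) $$ (a * L + i, q) * v $ q)"
      by (rule index_mult_vec_sum[OF _ v ai]) simp
    also have "\<dots> = (\<Sum>q<L * n. (if a * L + i = q then 1 else 0) * (det ?P * v $ q))"
      using ai by (intro sum.cong refl) simp
    also have "\<dots> = det ?P * x a i" unfolding sum_delta_mult using ai vx[OF a i] by simp
    finally show ?thesis .
  qed
  ultimately have "det ?P * x a i = (adj_mat ?P *\<^sub>v (?P *\<^sub>v v)) $ (a * L + i)" by simp
  also have "\<dots> = (\<Sum>q<n * L. adj_mat ?P $$ (a * L + i, q) * (?P *\<^sub>v v) $ q)"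
    by (subst index_mult_vec_sum[OF adj(1) mult_mat_vec_carrier[OF pencil_carrier v] mult_add_less'[OF a i]])
      (simp add: mult.commute)
  also have "\<dots> = (\<Sum>c<n. \<Sum>l<L. pencil_adj n L X A a c i l * (x c l - fm_step n L X A x c l))"
    unfolding sum_lessThan_mult pencil_adj_def by (intro sum.cong refl) (simp add: Pv)
  finally show ?thesis .
qed

lemma fm_step_sum:
  "fm_step n L X A (\<lambda>a i. \<Sum>s\<in>S. x s a i * c s) a i = (\<Sum>s\<in>S. fm_step n L X A (x s) a i * c s)"
proof -
  have "fm_step n L X A (\<lambda>a i. \<Sum>s\<in>S. x s a i * c s) a i =
      (\<Sum>k\<in>UNIV. \<Sum>b<n. \<Sum>j<L. \<Sum>s\<in>S. X k a b * (A k i j * (x s b j * c s)))"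
    unfolding fm_step_def by (simp only: sum_distrib_left)
  also have "\<dots> = (\<Sum>k\<in>UNIV. \<Sum>b<n. \<Sum>s\<in>S. \<Sum>j<L. X k a b * (A k i j * (x s b j * c s)))"
    by (rule sum.cong[OF refl], rule sum.cong[OF refl], rule sum.swap)
  also have "\<dots> = (\<Sum>k\<in>UNIV. \<Sum>s\<in>S. \<Sum>b<n. \<Sum>j<L. X k a b * (A k i j * (x s b j * c s)))"
    by (rule sum.cong[OF refl], rule sum.swap)
  also have "\<dots> = (\<Sum>s\<in>S. \<Sum>k\<in>UNIV. \<Sum>b<n. \<Sum>j<L. X k a b * (A k i j * (x s b j * c s)))"
    by (rule sum.swap)
  also have "\<dots> = (\<Sum>s\<in>S. fm_step n L X A (x s) a i * c s)"
    unfolding fm_step_def sum_distrib_left sum_distrib_right by (simp only: mult.assoc)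
  finally show ?thesis .
qed

text \<open>A solution of the system with forcing \<open>z\<close>, scaled by the determinant of the pencil so that no
  division is needed.\<close>

definition adj_sol :: "nat \<Rightarrow> nat \<Rightarrow> ('d::finite \<Rightarrow> nat \<Rightarrow> nat \<Rightarrow> 'r::comm_ring_1) \<Rightarrow> ('d \<Rightarrow> nat \<Rightarrow> nat \<Rightarrow> 'r)
    \<Rightarrow> (nat \<Rightarrow> nat \<Rightarrow> 'r) \<Rightarrow> nat \<Rightarrow> nat \<Rightarrow> 'r" where
  "adj_sol n L X A z a i = (\<Sum>p<n * L. pencil_adj n L X A a (p div L) i (p mod L) * z (p div L) (p mod L))"

lemma adj_sol_eq: "adj_sol n L X A z a i = (\<Sum>c<n. \<Sum>l<L. pencil_adj n L X A a c i l * z c l)"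
  unfolding adj_sol_def sum_lessThan_mult by (intro sum.cong refl) simp

text \<open>Superposition of the columns in \<open>pencil_adj_right\<close>, weighted by the entries
  of z.\<close>

lemma adj_sol_forced:
  assumes a: "a < n" and i: "i < L"
  shows "adj_sol n L X A z a i = fm_step n L X A (adj_sol n L X A z) a i + det (pencil n L X A) * z a i"
proof -
  let ?K = "pencil_adj n L X A"
  let ?d = "det (pencil n L X A)"
  have "adj_sol n L X A z a i = (\<Sum>p<n * L. (fm_step n L X A (\<lambda>b j. ?K b (p div L) j (p mod L)) a i
      + (if a = p div L \<and> i = p mod L then ?d else 0)) * z (p div L) (p mod L))"
    unfolding adj_sol_def
  proof (rule sum.cong[OF refl])
    fix p assume "p \<in> {..<n * L}"
    then have p: "p < n * L" by simp
    show "?K a (p div L) i (p mod L) * z (p div L) (p mod L) = (fm_step n L X A (\<lambda>b j. ?K b (p div L) j (p mod L)) a i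
      + (if a = p div L \<and> i = p mod L then ?d else 0)) * z (p div L) (p mod L)"
      by (subst pencil_adj_right[OF a i div_less_of_less_mult[OF p] mod_less_of_less_mult[OF p]]) (rule refl)
  qed
  also have "\<dots> = (\<Sum>p<n * L. fm_step n L X A (\<lambda>b j. ?K b (p div L) j (p mod L)) a i * z (p div L) (p mod L))
      + (\<Sum>p<n * L. (if a * L + i = p then 1 else 0) * (?d * z (p div L) (p mod L)))"
    unfolding distrib_right sum.distrib
  proof (intro arg_cong2[where f = "(+)"] refl sum.cong)
    fix p assume "p \<in> {..<n * L}"
    show "(if a = p div L \<and> i = p mod L then ?d else 0) * z (p div L) (p mod L) =
        (if a * L + i = p then 1 else 0) * (?d * z (p div L) (p mod L))"
      using i by auto
  qed
  also have "(\<Sum>p<n * L. (if a * L + i = p then 1 else 0) * (?d * z (p div L) (p mod L))) = ?d * z a i"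
    using mult_add_less[OF a i] i by simp
  also have "(\<Sum>p<n * L. fm_step n L X A (\<lambda>b j. ?K b (p div L) j (p mod L)) a i * z (p div L) (p mod L)) =
      fm_step n L X A (adj_sol n L X A z) a i"
    unfolding adj_sol_def[abs_def] by (rule fm_step_sum[symmetric])
  finally show ?thesis .
qed

section \<open>Words\<close>

primrec word_act :: "nat \<Rightarrow> ('d \<Rightarrow> nat \<Rightarrow> nat \<Rightarrow> 'r::comm_ring_1) \<Rightarrow> 'd list \<Rightarrow> (nat \<Rightarrow> 'r) \<Rightarrow> nat \<Rightarrow> 'r" where
  "word_act L A [] v = v"
| "word_act L A (k # w) v = (\<lambda>i. \<Sum>j<L. A k i j * word_act L A w v j)"

lemma word_act_append: "word_act L A (u @ w) v = word_act L A u (word_act L A w v)"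
  by (induction u) simp_all

lemma word_act_cong:
  "(\<And>j. j < L \<Longrightarrow> v j = v' j) \<Longrightarrow> i < L \<Longrightarrow> word_act L A w v i = word_act L A w v' i"
  by (induction w arbitrary: i) auto

lemma word_act_sum:
  "i < L \<Longrightarrow> word_act L A w (\<lambda>i. \<Sum>s\<in>S. v s i * c s) i = (\<Sum>s\<in>S. word_act L A w (v s) i * c s)"
proof (induction w arbitrary: i)
  case (Cons k w)
  have "(\<Sum>j<L. A k i j * word_act L A w (\<lambda>i. \<Sum>s\<in>S. v s i * c s) j) =
      (\<Sum>j<L. \<Sum>s\<in>S. A k i j * (word_act L A w (v s) j * c s))"
    by (intro sum.cong refl) (simp add: Cons.IH sum_distrib_left)
  also have "\<dots> = (\<Sum>s\<in>S. \<Sum>j<L. A k i j * (word_act L A w (v s) j * c s))" by (rule sum.swap)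
  finally show ?case by (simp add: sum_distrib_right mult.assoc)
qed simp

definition unit_fun :: "nat \<Rightarrow> nat \<Rightarrow> 'r::zero_neq_one" where
  "unit_fun l i = (if i = l then 1 else 0)"

lemma word_act_expand:
  assumes "i < L"
  shows "word_act L A w v i = (\<Sum>l<L. word_act L A w (unit_fun l) i * v l)"
proof -
  have "word_act L A w v i = word_act L A w (\<lambda>i. \<Sum>l<L. unit_fun l i * v l) i"
    by (rule word_act_cong[OF _ assms]) (simp add: unit_fun_def)
  also have "\<dots> = (\<Sum>l<L. word_act L A w (unit_fun l) i * v l)" by (rule word_act_sum[OF assms])
  finally show ?thesis .
qed

text \<open>The shift along a word \<open>W\<close>: its products select the factors of \<open>W\<close>.\<close>

definition shift_mat :: "nat \<Rightarrow> 'd list \<Rightarrow> 'd \<Rightarrow> 'r::zero_neq_one mat" where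
  "shift_mat M W k = mat M M (\<lambda>(a, b). if a < length W \<and> b = Suc a \<and> W ! a = k then 1 else 0)"

lemma shift_mat_carrier [simp]: "shift_mat M W k \<in> carrier_mat M M"
  by (simp add: shift_mat_def)

text \<open>The letters of W at the positions c, ..., i - 1, which the shift traverses between c and
  i.\<close>

definition factor :: "'d list \<Rightarrow> nat \<Rightarrow> nat \<Rightarrow> 'd list" where
  "factor W c i = take (i - c) (drop c W)"

lemma factor_same [simp]: "factor W i i = []"
  by (simp add: factor_def)

lemma factor_step: "c < i \<Longrightarrow> i \<le> length W \<Longrightarrow> factor W c i = (W ! c) # factor W (Suc c) i"
  unfolding factor_def by (simp add: Cons_nth_drop_Suc[symmetric] take_Cons' )

lemma fm_step_shift:
  fixes A :: "'d::finite \<Rightarrow> nat \<Rightarrow> nat \<Rightarrow> 'r::comm_ring_1"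
  assumes a: "a < M" and W: "length W < M"
  shows "fm_step M L (\<lambda>k. ent (shift_mat M W k)) A x a i =
    (if a < length W then \<Sum>j<L. A (W ! a) i j * x (Suc a) j else 0)"
proof (cases "a < length W")
  case True
  have "fm_step M L (\<lambda>k. ent (shift_mat M W k)) A x a i =
      (\<Sum>k\<in>UNIV. \<Sum>b<M. (if b = Suc a then 1 else 0) * (if k = W ! a then \<Sum>j<L. A k i j * x b j else 0))"
    unfolding fm_step_def using a True by (intro sum.cong refl) (simp add: shift_mat_def)
  also have "\<dots> = (\<Sum>k\<in>UNIV. if k = W ! a then \<Sum>j<L. A k i j * x (Suc a) j else 0)"
    using True W by (intro sum.cong refl) simp
  also have "\<dots> = (\<Sum>j<L. A (W ! a) i j * x (Suc a) j)" by simp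
  finally show ?thesis using True by simp
next
  case False
  then show ?thesis unfolding fm_step_def using a by (simp add: shift_mat_def)
qed

text \<open>The shift is nilpotent, so its state equation is solved explicitly: a forcing v at
  position i travels back through the word and acquires at position a the letters between a and
  i.\<close>

lemma shift_solution:
  assumes i: "i \<le> length W" and W: "length W < M" and a: "a < M"
  shows "(if a \<le> i then word_act L A (factor W a i) v l else 0) =
    fm_step M L (\<lambda>k. ent (shift_mat M W k)) A (\<lambda>c l. if c \<le> i then word_act L A (factor W c i) v l else 0) a l
      + (if a = i then v l else 0)"
proof -
  consider "a < i" | "a = i" | "a > i" by linarith
  then show ?thesis
    unfolding fm_step_shift[OF a W] by cases (use i W in \<open>auto simp: factor_step\<close>)
qed

section \<open>Points with three diagonal blocks\<close>

lemma sum_unit_pair: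
  fixes g :: "'d::finite \<Rightarrow> nat \<Rightarrow> 'r::comm_ring_1"
  assumes "j < M"
  shows "(\<Sum>k\<in>UNIV. \<Sum>c<M. (if k = \<kappa> \<and> a = i \<and> c = j then s else 0) * g k c) = (if a = i then s * g \<kappa> j else 0)"
proof -
  have "(\<Sum>k\<in>UNIV. \<Sum>c<M. (if k = \<kappa> \<and> a = i \<and> c = j then s else 0) * g k c) =
      (\<Sum>k\<in>UNIV. \<Sum>c<M. (if c = j then 1 else 0) * (if k = \<kappa> then if a = i then s * g k c else 0 else 0))"
    by (intro sum.cong refl) auto
  also have "\<dots> = (if a = i then s * g \<kappa> j else 0)" using assms by simp
  finally show ?thesis .
qed

text \<open>A block upper triangular point with diagonal blocks \<open>Y\<^sub>1, Y\<^sub>2, Y\<^sub>1\<close> and matrix units, scaled by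
  \<open>s\<close>, in the variables \<open>\<kappa>\<close> and \<open>\<kappa>'\<close> above the diagonal. The corner of a value at this point is
  a product of the form \<open>C P(Y\<^sub>1)\<inverse> A P(Y\<^sub>2)\<inverse> A' P(Y\<^sub>1)\<inverse> B\<close>.\<close>

definition three_block :: "nat \<Rightarrow> ('d \<Rightarrow> nat \<Rightarrow> nat \<Rightarrow> 'r::comm_ring_1) \<Rightarrow> ('d \<Rightarrow> nat \<Rightarrow> nat \<Rightarrow> 'r) \<Rightarrow> 'r
    \<Rightarrow> 'd \<Rightarrow> nat \<Rightarrow> nat \<Rightarrow> 'd \<Rightarrow> nat \<Rightarrow> nat \<Rightarrow> 'd \<Rightarrow> nat \<Rightarrow> nat \<Rightarrow> 'r" where
  "three_block M Y1 Y2 s \<kappa> i j \<kappa>' i' j' k u v =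
     (if u div M = v div M then (if u div M = 1 then Y2 k (u mod M) (v mod M) else Y1 k (u mod M) (v mod M))
      else if u div M = 0 \<and> v div M = 1 then (if k = \<kappa> \<and> u mod M = i \<and> v mod M = j then s else 0)
      else if u div M = 1 \<and> v div M = 2 then (if k = \<kappa>' \<and> u mod M = i' \<and> v mod M = j' then s else 0)
      else 0)"

text \<open>Each block row consists of its diagonal block and at most one matrix unit to the right
  of it.\<close>

lemma sum_three_block:
  fixes g :: "'d::finite \<Rightarrow> nat \<Rightarrow> 'r::comm_ring_1" and Y1 Y2 and s :: 'r and \<kappa> \<kappa>' :: 'd and i i' j j' a M :: nat
  assumes a: "a < M" and j: "j < M" "j' < M"
  defines "S \<equiv> \<lambda>U. \<Sum>k\<in>UNIV. \<Sum>v<3 * M. three_block M Y1 Y2 s \<kappa> i j \<kappa>' i' j' k (U * M + a) v * g k v"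
  shows "S 0 = (\<Sum>k\<in>UNIV. \<Sum>c<M. Y1 k a c * g k c) + (if a = i then s * g \<kappa> (M + j) else 0)"
    and "S 1 = (\<Sum>k\<in>UNIV. \<Sum>c<M. Y2 k a c * g k (M + c)) + (if a = i' then s * g \<kappa>' (2 * M + j') else 0)"
    and "S 2 = (\<Sum>k\<in>UNIV. \<Sum>c<M. Y1 k a c * g k (2 * M + c))"
proof -
  let ?Z = "three_block M Y1 Y2 s \<kappa> i j \<kappa>' i' j'"
  have S: "S U = (\<Sum>k\<in>UNIV. \<Sum>c<M. ?Z k (U * M + a) c * g k c) + (\<Sum>k\<in>UNIV. \<Sum>c<M. ?Z k (U * M + a) (M + c) * g k (M + c))
      + (\<Sum>k\<in>UNIV. \<Sum>c<M. ?Z k (U * M + a) (2 * M + c) * g k (2 * M + c))" for U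
    unfolding S_def sum_lessThan_mult by (simp add: numeral_3_eq_3 numeral_2_eq_2 sum.distrib)
  have d: "(U * M + a) div M = U" "(U * M + a) mod M = a" for U using a by auto
  have e: "c div M = 0" "c mod M = c" "(M + c) div M = 1" "(M + c) mod M = c"
    "(2 * M + c) div M = 2" "(2 * M + c) mod M = c" if "c < M" for c
    using that div_mult_self3[of M 2 c] mod_mult_self3[of 2 M c] by auto
  have Z0: "?Z k (0 * M + a) c = Y1 k a c" "?Z k (0 * M + a) (M + c) = (if k = \<kappa> \<and> a = i \<and> c = j then s else 0)"
    "?Z k (0 * M + a) (2 * M + c) = 0" if "c < M" for k c
    unfolding three_block_def d e[OF that] by simp_all
  have Z1: "?Z k (1 * M + a) c = 0" "?Z k (1 * M + a) (M + c) = Y2 k a c"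
    "?Z k (1 * M + a) (2 * M + c) = (if k = \<kappa>' \<and> a = i' \<and> c = j' then s else 0)" if "c < M" for k c
    unfolding three_block_def d e[OF that] by simp_all
  have Z2: "?Z k (2 * M + a) c = 0" "?Z k (2 * M + a) (M + c) = 0"
    "?Z k (2 * M + a) (2 * M + c) = Y1 k a c" if "c < M" for k c
    unfolding three_block_def d e[OF that] by simp_all
  have "S 0 = (\<Sum>k\<in>UNIV. \<Sum>c<M. Y1 k a c * g k c) +
      (\<Sum>k\<in>UNIV. \<Sum>c<M. (if k = \<kappa> \<and> a = i \<and> c = j then s else 0) * g k (M + c)) + (\<Sum>k\<in>UNIV. \<Sum>c<M. 0 * g k (2 * M + c))"
    unfolding S by (intro arg_cong2[where f = "(+)"] sum.cong refl) (simp_all only: Z0 lessThan_iff)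
  then show "S 0 = (\<Sum>k\<in>UNIV. \<Sum>c<M. Y1 k a c * g k c) + (if a = i then s * g \<kappa> (M + j) else 0)"
    unfolding sum_unit_pair[OF j(1)] by simp
  have "S 1 = (\<Sum>k\<in>UNIV. \<Sum>c<M. 0 * g k c) + (\<Sum>k\<in>UNIV. \<Sum>c<M. Y2 k a c * g k (M + c)) +
      (\<Sum>k\<in>UNIV. \<Sum>c<M. (if k = \<kappa>' \<and> a = i' \<and> c = j' then s else 0) * g k (2 * M + c))"
    unfolding S by (intro arg_cong2[where f = "(+)"] sum.cong refl) (simp_all only: Z1 lessThan_iff)
  then show "S 1 = (\<Sum>k\<in>UNIV. \<Sum>c<M. Y2 k a c * g k (M + c)) + (if a = i' then s * g \<kappa>' (2 * M + j') else 0)"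
    unfolding sum_unit_pair[OF j(2)] by simp
  have "S 2 = (\<Sum>k\<in>UNIV. \<Sum>c<M. 0 * g k c) + (\<Sum>k\<in>UNIV. \<Sum>c<M. 0 * g k (M + c)) +
      (\<Sum>k\<in>UNIV. \<Sum>c<M. Y1 k a c * g k (2 * M + c))"
    unfolding S by (intro arg_cong2[where f = "(+)"] sum.cong refl) (simp_all only: Z2 lessThan_iff)
  then show "S 2 = (\<Sum>k\<in>UNIV. \<Sum>c<M. Y1 k a c * g k (2 * M + c))" by simp
qed

text \<open>What a diagonal block passes to the block above it through a matrix unit in the variable
  \<open>\<kappa>\<close>, namely \<open>A\<^sub>\<kappa> x + B\<^sub>\<kappa> y\<close> at position
  j, for the unit input y at b and scaled by the determinant of the pencil.\<close>

definition head_vec :: "nat \<Rightarrow> nat \<Rightarrow> ('d::finite \<Rightarrow> nat \<Rightarrow> nat \<Rightarrow> 'r::comm_ring_1) \<Rightarrow> ('d \<Rightarrow> nat \<Rightarrow> nat \<Rightarrow> 'r)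
    \<Rightarrow> ('d \<Rightarrow> nat \<Rightarrow> 'r) \<Rightarrow> 'd \<Rightarrow> nat \<Rightarrow> nat \<Rightarrow> nat \<Rightarrow> 'r" where
  "head_vec M L Y A B \<kappa> j b l =
     (\<Sum>l'<L. A \<kappa> l l' * adj_sol M L Y A (\<lambda>c l. \<Sum>k\<in>UNIV. Y k c b * B k l) j l')
     + (if j = b then det (pencil M L Y A) * B \<kappa> l else 0)"

lemma adj_sol_unit:
  assumes "i < n"
  shows "adj_sol n L X A (\<lambda>c l. if c = i then h l else 0) a l = (\<Sum>l'<L. pencil_adj n L X A a i l l' * h l')"
proof -
  have "adj_sol n L X A (\<lambda>c l. if c = i then h l else 0) a l =
      (\<Sum>c<n. (if c = i then 1 else 0) * (\<Sum>l'<L. pencil_adj n L X A a c l l' * h l'))"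
    unfolding adj_sol_eq by (intro sum.cong refl) simp
  then show ?thesis using assms by simp
qed

text \<open>The blocks are solved from the last to the first, each one forced by the next through a
  matrix unit. The weights in the state bring all three to the common factor \<delta>1 \<delta>1
  \<delta>2, which is why the input carries it; every matrix unit contributes one factor s.\<close>

lemma three_block_sys:
  fixes Y1 Y2 A :: "'d::finite \<Rightarrow> nat \<Rightarrow> nat \<Rightarrow> 'r::comm_ring_1" and B :: "'d \<Rightarrow> nat \<Rightarrow> 'r" and s :: 'r
    and \<kappa> \<kappa>' :: 'd and i i' j j' b L M :: nat
  assumes lt: "j < M" "j' < M" "b < M"
  defines "\<delta>1 \<equiv> det (pencil M L Y1 A)" and "\<delta>2 \<equiv> det (pencil M L Y2 A)"
  defines "h \<equiv> head_vec M L Y1 A B \<kappa>' j' b"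
  defines "x1 \<equiv> adj_sol M L Y2 A (\<lambda>c l. if c = i' then h l else 0)"
  defines "x0 \<equiv> adj_sol M L Y1 A (\<lambda>c l. if c = i then \<Sum>l'<L. A \<kappa> l l' * x1 j l' else 0)"
  defines "x2 \<equiv> adj_sol M L Y1 A (\<lambda>c l. \<Sum>k\<in>UNIV. Y1 k c b * B k l)"
  shows "fm_sys (3 * M) L (three_block M Y1 Y2 s \<kappa> i j \<kappa>' i' j') A B
    (\<lambda>u l. if u div M = 0 then s * s * x0 (u mod M) l else if u div M = 1 then \<delta>1 * s * x1 (u mod M) l
       else \<delta>1 * \<delta>2 * x2 (u mod M) l)
    (\<lambda>u. if u = 2 * M + b then \<delta>1 * \<delta>1 * \<delta>2 else 0)"
    (is "fm_sys _ _ ?Z _ _ ?x ?y")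
  unfolding fm_sys_alt
proof (intro allI impI)
  fix u l assume u: "u < 3 * M" and l: "l < L"
  define a where "a = u mod M"
  have a: "a < M" using mod_less_of_less_mult[OF u] by (simp add: a_def)
  have U: "u div M = 0 \<or> u div M = 1 \<or> u div M = 2" using div_less_of_less_mult[OF u] by linarith
  have ua: "u = (u div M) * M + a" by (simp add: a_def)
  define g where "g k v = (\<Sum>l'<L. A k l l' * ?x v l') + B k l * ?y v" for k v
  have e: "c div M = 0" "c mod M = c" "(M + c) div M = 1" "(M + c) mod M = c"
    "(2 * M + c) div M = 2" "(2 * M + c) mod M = c" if "c < M" for c
    using that div_mult_self3[of M 2 c] mod_mult_self3[of 2 M c] by auto
  have g0: "g k c = s * s * (\<Sum>l'<L. A k l l' * x0 c l')" if "c < M" for k c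
    unfolding g_def e[OF that] using that by (simp add: sum_distrib_left mult_ac)
  have g1: "g k (M + c) = \<delta>1 * s * (\<Sum>l'<L. A k l l' * x1 c l')" if "c < M" for k c
    unfolding g_def e[OF that] using that by (simp add: sum_distrib_left mult_ac)
  have g2: "g k (2 * M + c) = \<delta>1 * \<delta>2 * ((\<Sum>l'<L. A k l l' * x2 c l') + (if c = b then \<delta>1 * B k l else 0))" if "c < M" for k c
    unfolding g_def e[OF that] using that by (simp add: sum_distrib_left distrib_left mult_ac)
  have f0: "x0 a l = fm_step M L Y1 A x0 a l + \<delta>1 * (if a = i then \<Sum>l'<L. A \<kappa> l l' * x1 j l' else 0)"
    unfolding x0_def \<delta>1_def by (rule adj_sol_forced[OF a l])
  have f1: "x1 a l = fm_step M L Y2 A x1 a l + \<delta>2 * (if a = i' then h l else 0)"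
    unfolding x1_def \<delta>2_def by (rule adj_sol_forced[OF a l])
  have f2: "x2 a l = fm_step M L Y1 A x2 a l + \<delta>1 * (\<Sum>k\<in>UNIV. Y1 k a b * B k l)"
    unfolding x2_def \<delta>1_def by (rule adj_sol_forced[OF a l])
  have h: "h l = (\<Sum>l'<L. A \<kappa>' l l' * x2 j' l') + (if j' = b then \<delta>1 * B \<kappa>' l else 0)"
    unfolding h_def head_vec_def x2_def \<delta>1_def ..
  note S = sum_three_block[OF a lt(1,2), where g = g and s = s and ?Y1.0 = Y1 and ?Y2.0 = Y2 and \<kappa> = \<kappa> and \<kappa>' = \<kappa>' and i = i and i' = i']
  have "?x u l = (\<Sum>k\<in>UNIV. \<Sum>v<3 * M. ?Z k u v * g k v)"
  proof -
    consider "u div M = 0" | "u div M = 1" | "u div M = 2" using U by (elim disjE)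
    then show ?thesis
    proof cases
      case 1
      have "?x u l = s * s * x0 a l" using 1 by (simp add: a_def)
      also have "\<dots> = s * s * fm_step M L Y1 A x0 a l + s * s * (\<delta>1 * (if a = i then \<Sum>l'<L. A \<kappa> l l' * x1 j l' else 0))"
        by (subst f0) (rule distrib_left)
      also have "s * s * fm_step M L Y1 A x0 a l = (\<Sum>k\<in>UNIV. \<Sum>c<M. Y1 k a c * g k c)"
        unfolding fm_step_def sum_distrib_left[where r = "s * s"] by (intro sum.cong refl) (simp add: g0 mult_ac)
      also have "s * s * (\<delta>1 * (if a = i then \<Sum>l'<L. A \<kappa> l l' * x1 j l' else 0)) = (if a = i then s * g \<kappa> (M + j) else 0)"
        by (simp add: g1[OF lt(1)] mult_ac)
      also have "(\<Sum>k\<in>UNIV. \<Sum>c<M. Y1 k a c * g k c) + (if a = i then s * g \<kappa> (M + j) else 0) = (\<Sum>k\<in>UNIV. \<Sum>v<3 * M. ?Z k u v * g k v)"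
        by (subst ua, subst 1, rule S(1)[symmetric])
      finally show ?thesis .
    next
      case 2
      have "?x u l = \<delta>1 * s * x1 a l" using 2 by (simp add: a_def)
      also have "\<dots> = \<delta>1 * s * fm_step M L Y2 A x1 a l + \<delta>1 * s * (\<delta>2 * (if a = i' then h l else 0))"
        by (subst f1) (rule distrib_left)
      also have "\<delta>1 * s * fm_step M L Y2 A x1 a l = (\<Sum>k\<in>UNIV. \<Sum>c<M. Y2 k a c * g k (M + c))"
        unfolding fm_step_def sum_distrib_left[where r = "\<delta>1 * s"] by (intro sum.cong refl) (simp add: g1 mult_ac)
      also have "\<delta>1 * s * (\<delta>2 * (if a = i' then h l else 0)) = (if a = i' then s * g \<kappa>' (2 * M + j') else 0)"
        unfolding g2[OF lt(2)] by (auto simp: h mult_ac)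
      also have "(\<Sum>k\<in>UNIV. \<Sum>c<M. Y2 k a c * g k (M + c)) + (if a = i' then s * g \<kappa>' (2 * M + j') else 0) = (\<Sum>k\<in>UNIV. \<Sum>v<3 * M. ?Z k u v * g k v)"
        by (subst ua, subst 2, rule S(2)[symmetric])
      finally show ?thesis .
    next
      case 3
      have "(\<Sum>k\<in>UNIV. \<Sum>c<M. Y1 k a c * g k (2 * M + c)) = (\<Sum>k\<in>UNIV. \<Sum>c<M. \<delta>1 * \<delta>2 * (Y1 k a c * (\<Sum>l'<L. A k l l' * x2 c l')) +
          (if c = b then 1 else 0) * (\<delta>1 * \<delta>2 * (\<delta>1 * (Y1 k a c * B k l))))"
      proof (intro sum.cong refl)
        fix k c assume "c \<in> {..<M}"
        then show "Y1 k a c * g k (2 * M + c) = \<delta>1 * \<delta>2 * (Y1 k a c * (\<Sum>l'<L. A k l l' * x2 c l')) +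
          (if c = b then 1 else 0) * (\<delta>1 * \<delta>2 * (\<delta>1 * (Y1 k a c * B k l)))"
          by (subst g2) (auto simp: distrib_left mult_ac)
      qed
      also have "\<dots> = (\<Sum>k\<in>UNIV. \<Sum>c<M. \<delta>1 * \<delta>2 * (Y1 k a c * (\<Sum>l'<L. A k l l' * x2 c l')))
          + (\<Sum>k\<in>UNIV. \<delta>1 * \<delta>2 * (\<delta>1 * (Y1 k a b * B k l)))"
        unfolding sum.distrib sum_delta_mult using lt(3) by simp
      also have "\<dots> = \<delta>1 * \<delta>2 * (fm_step M L Y1 A x2 a l + \<delta>1 * (\<Sum>k\<in>UNIV. Y1 k a b * B k l))"
        unfolding fm_step_def distrib_left sum_distrib_left ..
      also have "\<dots> = \<delta>1 * \<delta>2 * x2 a l" by (simp only: f2[symmetric])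
      also have "\<dots> = ?x u l" using 3 by (simp add: a_def)
      finally have "?x u l = (\<Sum>k\<in>UNIV. \<Sum>c<M. Y1 k a c * g k (2 * M + c))" ..
      also have "\<dots> = (\<Sum>k\<in>UNIV. \<Sum>v<3 * M. ?Z k u v * g k v)"
        by (subst ua, subst 3, rule S(3)[symmetric])
      finally show ?thesis .
    qed
  qed
  then show "?x u l = (\<Sum>k\<in>UNIV. \<Sum>v<3 * M. ?Z k u v * ((\<Sum>l'<L. A k l l' * ?x v l') + B k l * ?y v))"
    unfolding g_def .
qed

definition realized :: "('a::field, 'd::finite) nc_rexp \<Rightarrow> nat \<Rightarrow> ('d \<Rightarrow> nat \<Rightarrow> nat \<Rightarrow> 'a) \<Rightarrow> ('d \<Rightarrow> nat \<Rightarrow> 'a)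
    \<Rightarrow> (nat \<Rightarrow> 'a) \<Rightarrow> 'a \<Rightarrow> bool" where
  "realized R L A B C D \<longleftrightarrow>
     (\<forall>n\<ge>1. \<forall>X\<in>rexp_dom n R. realizes n L (\<lambda>k. ent (X k)) A B C D (ent (rexp_val n R X)))"

abbreviation const_mat :: "('d \<Rightarrow> nat \<Rightarrow> nat \<Rightarrow> 'a::zero) \<Rightarrow> 'd \<Rightarrow> nat \<Rightarrow> nat \<Rightarrow> 'a poly" where
  "const_mat A \<equiv> (\<lambda>k i j. [:A k i j:])"

abbreviation const_vec :: "('d \<Rightarrow> nat \<Rightarrow> 'a::zero) \<Rightarrow> 'd \<Rightarrow> nat \<Rightarrow> 'a poly" where
  "const_vec B \<equiv> (\<lambda>k i. [:B k i:])"

text \<open>Carries the realization of R0 over to R. At s = 1 the expression R0 is defined, so its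
  output equation holds over K[s]; R has the same fraction as its value; and the denominator d of
  that fraction is nonzero at s = 0, where R is defined.\<close>

lemma path_realization:
  fixes R R0 :: "('a::field, 'd::finite) nc_rexp"
  assumes ag: "agree R R0" and real: "realized R0 L A B C D" and m: "m \<ge> 1"
    and Y: "\<forall>k. Y k \<in> carrier_mat m m"
    and dom: "eval_path 0 Y \<in> rexp_dom m R" and dom0: "eval_path 1 Y \<in> rexp_dom m R0"
  obtains d V where "poly d 0 \<noteq> 0"
    "\<And>a b. a < m \<Longrightarrow> b < m \<Longrightarrow> poly (V $$ (a, b)) 0 = poly d 0 * rexp_val m R (eval_path 0 Y) $$ (a, b)"
    "\<And>x y a. fm_sys m L (\<lambda>k. ent (Y k)) (const_mat A) (const_vec B) x y \<Longrightarrow> a < m \<Longrightarrow>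
       (\<Sum>b<m. V $$ (a, b) * y b) = d * ([:D:] * y a + (\<Sum>i<L. [:C i:] * x a i))"
proof -
  obtain d V where dV: "path_value R m Y d V" "poly d 0 \<noteq> 0"
    using path_value_exists[OF Y dom] by blast
  obtain e U where eU: "path_value R0 m Y e U" "poly e 1 \<noteq> 0"
    using path_value_exists[OF Y dom0] by blast
  have nz: "d \<noteq> 0" "e \<noteq> 0" using dV eU by auto
  show thesis
  proof (rule that[OF dV(2)])
    show "poly (V $$ (a, b)) 0 = poly d 0 * rexp_val m R (eval_path 0 Y) $$ (a, b)" if "a < m" "b < m" for a b
      by (rule path_value_eval(2)[OF dV(1) Y dV(2) that])
    fix x y a assume sys: "fm_sys m L (\<lambda>k. ent (Y k)) (const_mat A) (const_vec B) x y" and a: "a < m"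
    have "(\<Sum>b<m. U $$ (a, b) * y b) = e * ([:D:] * y a + (\<Sum>i<L. [:C i:] * x a i))"
      by (rule path_value_realization[OF m eU(1) Y nz(2) _ sys a]) (use real in \<open>simp add: realized_def\<close>)
    moreover have "e * (\<Sum>b<m. V $$ (a, b) * y b) = d * (\<Sum>b<m. U $$ (a, b) * y b)"
      unfolding sum_distrib_left
    proof (intro sum.cong refl)
      fix b assume "b \<in> {..<m}"
      then have h: "V $$ (a, b) * e = U $$ (a, b) * d"
        using path_value_unique[OF ag m dV(1) eU(1) nz a] by simp
      have "e * (V $$ (a, b) * y b) = V $$ (a, b) * e * y b" by (simp only: mult_ac)
      also have "\<dots> = d * (U $$ (a, b) * y b)" unfolding h by (simp only: mult_ac)
      finally show "e * (V $$ (a, b) * y b) = d * (U $$ (a, b) * y b)" .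
    qed
    ultimately have "e * (\<Sum>b<m. V $$ (a, b) * y b) = e * (d * ([:D:] * y a + (\<Sum>i<L. [:C i:] * x a i)))"
      by (simp only: mult.left_commute)
    then show "(\<Sum>b<m. V $$ (a, b) * y b) = d * ([:D:] * y a + (\<Sum>i<L. [:C i:] * x a i))"
      using mult_left_cancel[OF nz(2)] by blast
  qed
qed

lemma upper_triangular_dom:
  fixes R :: "('a::field, 'd::finite) nc_rexp"
  assumes "(\<lambda>_. 0\<^sub>m 1 1) \<in> rexp_dom 1 R" "\<And>k. X k \<in> carrier_mat n n"
    and "\<And>k a b. a < n \<Longrightarrow> b \<le> a \<Longrightarrow> X k $$ (a, b) = 0"
  shows "X \<in> rexp_dom n R"
proof -
  have X: "X \<in> matrix_tuples n" using assms(2) by (simp add: matrix_tuples_def)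
  from nc_sem_upper_triangular[OF nc_sem_rexp_eval rexp_domD(2)[OF assms(1)] X assms(3)]
  show ?thesis using X by (auto simp: rexp_dom_def)
qed

lemma poly_fm_step:
  "poly (fm_step n L X (const_mat A) x a i) c =
    fm_step n L (\<lambda>k a b. poly (X k a b) c) A (\<lambda>a i. poly (x a i) c) a i"
  unfolding fm_step_def by (simp add: poly_sum)

lemma poly_fm_input:
  "poly (fm_input n X (const_vec B) y a i) c =
    fm_input n (\<lambda>k a b. poly (X k a b) c) B (\<lambda>b. poly (y b) c) a i"
  unfolding fm_input_def by (simp add: poly_sum mult.left_commute)

lemma fm_step_cong_point:
  "(\<And>k b. b < n \<Longrightarrow> X k a b = X' k a b) \<Longrightarrow> fm_step n L X A x a i = fm_step n L X' A x a i"
  unfolding fm_step_def by simp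

lemma fm_input_cong_point:
  "(\<And>k b. b < n \<Longrightarrow> X k a b = X' k a b) \<Longrightarrow> fm_input n X B y a i = fm_input n X' B y a i"
  unfolding fm_input_def by simp

lemma fm_sys_cong_point:
  assumes "\<And>k a b. a < n \<Longrightarrow> b < n \<Longrightarrow> X k a b = X' k a b" "fm_sys n L X A B x y"
  shows "fm_sys n L X' A B x y"
  unfolding fm_sys_def
proof (intro allI impI)
  fix a i assume a: "a < n" and i: "i < L"
  have 1: "fm_step n L X A x a i = fm_step n L X' A x a i"
    by (rule fm_step_cong_point) (rule assms(1)[OF a])
  have 2: "fm_input n X B y a i = fm_input n X' B y a i"
    by (rule fm_input_cong_point) (rule assms(1)[OF a])
  show "x a i = fm_step n L X' A x a i + fm_input n X' B y a i"
    unfolding 1[symmetric] 2[symmetric] using assms(2) a i unfolding fm_sys_def by blast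
qed

lemma well_posed_cong_point:
  assumes "\<And>k a b. a < n \<Longrightarrow> b < n \<Longrightarrow> X k a b = X' k a b"
  shows "well_posed n L X A \<longleftrightarrow> well_posed n L X' A"
  unfolding well_posed_iff_sys[where B = "\<lambda>_ _. 0"]
proof -
  have "fm_sys n L X A (\<lambda>_ _. 0) x (\<lambda>_. 0) \<longleftrightarrow> fm_sys n L X' A (\<lambda>_ _. 0) x (\<lambda>_. 0)" for x
    using fm_sys_cong_point[of n X X' L A "\<lambda>_ _. 0" x "\<lambda>_. 0"] fm_sys_cong_point[of n X' X L A "\<lambda>_ _. 0" x "\<lambda>_. 0"]
      assms by (metis (no_types))
  then show "(\<forall>x. fm_sys n L X A (\<lambda>_ _. 0) x (\<lambda>_. 0) \<longrightarrow> (\<forall>a<n. \<forall>i<L. x a i = 0)) \<longleftrightarrow>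
    (\<forall>x. fm_sys n L X' A (\<lambda>_ _. 0) x (\<lambda>_. 0) \<longrightarrow> (\<forall>a<n. \<forall>i<L. x a i = 0))" by simp
qed

lemma poly_det_pencil:
  fixes X :: "'d::finite \<Rightarrow> nat \<Rightarrow> nat \<Rightarrow> 'a::field poly"
  shows "poly (det (pencil n L X (const_mat A))) c = det (pencil n L (\<lambda>k a b. poly (X k a b) c) A)"
proof -
  interpret ev: comm_ring_hom "\<lambda>p. poly p c" by unfold_locales auto
  have "map_mat (\<lambda>p. poly p c) (pencil n L X (const_mat A)) = pencil n L (\<lambda>k a b. poly (X k a b) c) A"
    by (rule eq_matI) (auto simp: pencil_def poly_sum mult.commute)
  then show ?thesis using ev.hom_det[of "pencil n L X (const_mat A)"] by simp
qed

text \<open>Once the pencil is invertible at X, the output equation over K[s] on the segment from X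
  to the origin can be evaluated at X: neither the denominator of R nor the determinant of the
  pencil vanishes there.\<close>

lemma realizes_at_domain:
  fixes R R0 :: "('a::field, 'd::finite) nc_rexp"
  assumes ag: "agree R R0" and real: "realized R0 L A B C D" and m: "m \<ge> 1"
    and zero: "(\<lambda>_. 0\<^sub>m 1 1) \<in> rexp_dom 1 R0"
    and X: "X \<in> rexp_dom m R" and wp: "well_posed m L (\<lambda>k. ent (X k)) A"
  shows "realizes m L (\<lambda>k. ent (X k)) A B C D (ent (rexp_val m R X))"
  unfolding realizes_def
proof (intro conjI allI impI wp)
  fix x0 y0 a assume sys0: "fm_sys m L (\<lambda>k. ent (X k)) A B x0 y0" and a: "a < m"
  have Xc: "X k \<in> carrier_mat m m" for k by (rule matrix_tuplesD[OF rexp_domD(1)[OF X]])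
  have Zc: "0\<^sub>m m m \<in> carrier_mat m m" for k :: 'd by simp
  define Y where "Y k = segment m (X k) (0\<^sub>m m m)" for k
  have Y: "\<forall>k. Y k \<in> carrier_mat m m" by (simp add: Y_def)
  have e0: "eval_path 0 Y = X" using eval_path_segment(1)[of X m "\<lambda>_. 0\<^sub>m m m"] Xc by (simp add: Y_def[abs_def])
  have e1: "eval_path 1 Y = (\<lambda>_. 0\<^sub>m m m)" using eval_path_segment(2)[of X m "\<lambda>_. 0\<^sub>m m m"] Xc by (simp add: Y_def[abs_def])
  have d0: "(\<lambda>_. 0\<^sub>m m m) \<in> rexp_dom m R0" by (rule upper_triangular_dom[OF zero]) auto
  obtain d V where d: "poly d 0 \<noteq> 0"
    and V: "\<And>a b. a < m \<Longrightarrow> b < m \<Longrightarrow> poly (V $$ (a, b)) 0 = poly d 0 * rexp_val m R X $$ (a, b)"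
    and val: "\<And>x y a. fm_sys m L (\<lambda>k. ent (Y k)) (const_mat A) (const_vec B) x y \<Longrightarrow> a < m \<Longrightarrow>
       (\<Sum>b<m. V $$ (a, b) * y b) = d * ([:D:] * y a + (\<Sum>i<L. [:C i:] * x a i))"
    by (rule path_realization[OF ag real m Y]) (use X d0 in \<open>auto simp: e0 e1\<close>)
  define \<delta> where "\<delta> = det (pencil m L (\<lambda>k. ent (Y k)) (const_mat A))"
  define y where "y b = [:y0 b:]" for b
  \<comment> \<open>A polynomial state for the input scaled by \<delta>; at s = 0 it becomes the
    multiple of x0 by the value of \<delta> there.\<close>
  define x where "x = adj_sol m L (\<lambda>k. ent (Y k)) (const_mat A) (fm_input m (\<lambda>k. ent (Y k)) (const_vec B) y)"
  have sys: "fm_sys m L (\<lambda>k. ent (Y k)) (const_mat A) (const_vec B) x (\<lambda>b. \<delta> * y b)"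
    unfolding fm_sys_def
  proof (intro allI impI)
    fix a i assume ai: "a < m" "i < L"
    show "x a i = fm_step m L (\<lambda>k. ent (Y k)) (const_mat A) x a i + fm_input m (\<lambda>k. ent (Y k)) (const_vec B) (\<lambda>b. \<delta> * y b) a i"
      unfolding fm_input_mult x_def \<delta>_def by (rule adj_sol_forced[OF ai])
  qed
  have pY: "poly (Y k $$ (a, b)) 0 = X k $$ (a, b)" if "a < m" "b < m" for k a b
    using that by (simp add: Y_def segment_def)
  have "poly \<delta> 0 = det (pencil m L (\<lambda>k a b. poly (Y k $$ (a, b)) 0) A)"
    unfolding \<delta>_def by (rule poly_det_pencil)
  moreover have "well_posed m L (\<lambda>k a b. poly (Y k $$ (a, b)) 0) A"
    by (rule iffD2[OF well_posed_cong_point wp]) (rule pY)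
  ultimately have \<delta>0: "poly \<delta> 0 \<noteq> 0" by (simp add: well_posed_iff_det)
  have sx: "fm_sys m L (\<lambda>k a b. poly (Y k $$ (a, b)) 0) A B (\<lambda>a i. poly (x a i) 0) (\<lambda>b. poly \<delta> 0 * y0 b)"
    unfolding fm_sys_def
  proof (intro allI impI)
    fix a i assume ai: "a < m" "i < L"
    have "x a i = fm_step m L (\<lambda>k. ent (Y k)) (const_mat A) x a i + fm_input m (\<lambda>k. ent (Y k)) (const_vec B) (\<lambda>b. \<delta> * y b) a i"
      using sys ai unfolding fm_sys_def by blast
    from arg_cong[OF this, of "\<lambda>p. poly p 0"]
    show "poly (x a i) 0 = fm_step m L (\<lambda>k a b. poly (Y k $$ (a, b)) 0) A (\<lambda>a i. poly (x a i) 0) a i +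
        fm_input m (\<lambda>k a b. poly (Y k $$ (a, b)) 0) B (\<lambda>b. poly \<delta> 0 * y0 b) a i"
      unfolding poly_add poly_fm_step poly_fm_input by (simp add: y_def mult.commute)
  qed
  have sx': "fm_sys m L (\<lambda>k. ent (X k)) A B (\<lambda>a i. poly (x a i) 0) (\<lambda>b. poly \<delta> 0 * y0 b)"
    by (rule fm_sys_cong_point[OF pY sx])
  have xx: "poly (x a i) 0 = poly \<delta> 0 * x0 a i" if "i < L" for i
    by (rule fm_sys_unique[OF wp sx' fm_sys_mult[OF sys0] a that])
  have "(\<Sum>b<m. V $$ (a, b) * (\<delta> * y b)) = d * ([:D:] * (\<delta> * y a) + (\<Sum>i<L. [:C i:] * x a i))"
    by (rule val[OF sys a])
  from arg_cong[OF this, of "\<lambda>p. poly p 0"]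
  have "(\<Sum>b<m. poly d 0 * rexp_val m R X $$ (a, b) * (poly \<delta> 0 * y0 b)) =
      poly d 0 * (D * (poly \<delta> 0 * y0 a) + (\<Sum>i<L. C i * (poly \<delta> 0 * x0 a i)))"
    by (simp add: poly_sum V a y_def xx mult_ac)
  also have "(\<Sum>b<m. poly d 0 * rexp_val m R X $$ (a, b) * (poly \<delta> 0 * y0 b)) =
      poly d 0 * poly \<delta> 0 * (\<Sum>b<m. rexp_val m R X $$ (a, b) * y0 b)"
    by (simp add: sum_distrib_left mult_ac)
  also have "poly d 0 * (D * (poly \<delta> 0 * y0 a) + (\<Sum>i<L. C i * (poly \<delta> 0 * x0 a i))) =
      poly d 0 * poly \<delta> 0 * (D * y0 a + (\<Sum>i<L. C i * x0 a i))"
    by (simp add: sum_distrib_left distrib_left mult_ac)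
  finally show "(\<Sum>b<m. rexp_val m R X $$ (a, b) * y0 b) = D * y0 a + (\<Sum>i<L. C i * x0 a i)"
    using d \<delta>0 by simp
qed

section \<open>Values along a path to a shift\<close>

text \<open>Since d is a unit in the local ring at 0, only the power of s contained in \<delta>
  matters, and it must divide t.\<close>

lemma order_dvd_cancel:
  fixes d t \<delta> :: "'a::field poly"
  assumes "\<delta> dvd d * t" "poly d 0 \<noteq> 0"
  shows "[:0, 1:] ^ order 0 \<delta> dvd t"
proof (cases "t = 0")
  case False
  have nz: "d * t \<noteq> 0" using assms(2) False by auto
  have "[:0, 1:] ^ order 0 \<delta> dvd d * t" using order_1[of 0 \<delta>] assms(1) by (simp add: dvd_trans)
  then have "order 0 \<delta> \<le> order 0 (d * t)" using order_divides[of 0 "order 0 \<delta>" "d * t"] nz by simp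
  also have "\<dots> = order 0 t" using order_mult[OF nz] order_0I[OF assms(2)] by simp
  finally show ?thesis using order_divides[of 0 "order 0 \<delta>" t] False by simp
qed simp

text \<open>In the local ring at 0, t and the power of s contained in it differ by a unit.\<close>

lemma order_dvd_swap:
  fixes t q :: "'a::field poly"
  assumes "[:0, 1:] ^ v dvd t * q" "t \<noteq> 0"
  shows "[:0, 1:] ^ v dvd [:0, 1:] ^ order 0 t * q"
proof (cases "q = 0")
  case False
  have e: "order 0 ([:0, 1:] ^ order 0 t :: 'a poly) = order 0 t"
    using order_power_n_n[of 0 "order 0 t"] by simp
  have "v \<le> order 0 (t * q)" using assms False order_divides[of 0 v "t * q"] by simp
  also have "\<dots> = order 0 ([:0, 1:] ^ order 0 t * q)" using assms(2) False e by (simp add: order_mult)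
  finally show ?thesis using order_divides[of 0 v "[:0, 1:] ^ order 0 t * q"] by simp
qed simp

text \<open>Y leads from X at s = 0 to the shift along W at s = 1. All lemmas of this context
  evaluate at s = 1, where the state equation is solved explicitly.\<close>

context
  fixes A :: "'d::finite \<Rightarrow> nat \<Rightarrow> nat \<Rightarrow> 'a::field" and L M :: nat and X :: "'d \<Rightarrow> 'a mat" and W :: "'d list"
    and Y :: "'d \<Rightarrow> nat \<Rightarrow> nat \<Rightarrow> 'a poly"
  defines "Y \<equiv> \<lambda>k. ent (segment M (X k) (shift_mat M W k))"
  assumes W: "length W < M" and wp: "well_posed M L (\<lambda>k. ent (shift_mat M W k)) A"
begin

lemma poly_path_at_shift: "a < M \<Longrightarrow> b < M \<Longrightarrow> poly (Y k a b) 1 = shift_mat M W k $$ (a, b)"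
  by (simp add: Y_def segment_def)

lemma det_at_shift: "poly (det (pencil M L Y (const_mat A))) 1 \<noteq> 0"
  unfolding poly_det_pencil well_posed_iff_det[symmetric]
  by (rule iffD2[OF well_posed_cong_point wp]) (rule poly_path_at_shift)

text \<open>Both sides solve the same well-posed system at the shift: the adjugate by its column
  equation, and the words by \<open>shift_solution\<close>.\<close>

lemma adj_at_shift:
  assumes a: "a < M" and i: "i < L" and c: "c \<le> length W" and l: "l < L"
  shows "poly (pencil_adj M L Y (const_mat A) a c i l) 1 =
    poly (det (pencil M L Y (const_mat A))) 1 * (if a \<le> c then word_act L A (factor W a c) (unit_fun l) i else 0)"
proof (rule forced_unique[OF wp _ _ a i])
  let ?\<delta> = "det (pencil M L Y (const_mat A))"
  let ?z = "\<lambda>a i. poly ?\<delta> 1 * (if a = c then unit_fun l i else 0)"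
  fix a i assume ai: "a < M" "i < L"
  have "poly (pencil_adj M L Y (const_mat A) a c i l) 1 =
      poly (fm_step M L Y (const_mat A) (\<lambda>b j. pencil_adj M L Y (const_mat A) b c j l) a i
        + (if a = c \<and> i = l then ?\<delta> else 0)) 1"
    by (subst pencil_adj_right[OF ai _ l]) (use c W in simp_all)
  also have "\<dots> = fm_step M L (\<lambda>k a b. poly (Y k a b) 1) A (\<lambda>b j. poly (pencil_adj M L Y (const_mat A) b c j l) 1) a i + ?z a i"
    unfolding poly_add poly_fm_step by (simp add: unit_fun_def)
  also have "fm_step M L (\<lambda>k a b. poly (Y k a b) 1) A (\<lambda>b j. poly (pencil_adj M L Y (const_mat A) b c j l) 1) a i =
      fm_step M L (\<lambda>k. ent (shift_mat M W k)) A (\<lambda>b j. poly (pencil_adj M L Y (const_mat A) b c j l) 1) a i"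
    by (rule fm_step_cong_point) (rule poly_path_at_shift[OF ai(1)])
  finally show "poly (pencil_adj M L Y (const_mat A) a c i l) 1 =
      fm_step M L (\<lambda>k. ent (shift_mat M W k)) A (\<lambda>b j. poly (pencil_adj M L Y (const_mat A) b c j l) 1) a i + ?z a i" .
  show "poly ?\<delta> 1 * (if a \<le> c then word_act L A (factor W a c) (unit_fun l) i else 0) =
      fm_step M L (\<lambda>k. ent (shift_mat M W k)) A
        (\<lambda>b j. poly ?\<delta> 1 * (if b \<le> c then word_act L A (factor W b c) (unit_fun l) j else 0)) a i + ?z a i"
    unfolding fm_step_mult by (subst shift_solution[OF c W ai(1)]) (simp only: distrib_left)
qed

text \<open>An input at position Suc \<epsilon> enters at \<epsilon> through the letter
  \<open>W ! \<epsilon>\<close> and B, then moves back to j; the matrix unit prepends \<kappa>. The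
  result is a multiple of a controllability column.\<close>

lemma head_vec_at_shift:
  assumes l: "l < L" and j: "j \<le> \<epsilon>" and \<epsilon>: "\<epsilon> < length W"
  shows "poly (head_vec M L Y (const_mat A) (const_vec B) \<kappa> j (Suc \<epsilon>) l) 1 =
    poly (det (pencil M L Y (const_mat A))) 1 * word_act L A (\<kappa> # factor W j \<epsilon>) (B (W ! \<epsilon>)) l"
proof -
  let ?\<delta> = "det (pencil M L Y (const_mat A))"
  have jM: "j < M" using j \<epsilon> W by simp
  have z: "poly (\<Sum>k\<in>UNIV. Y k c (Suc \<epsilon>) * [:B k l:]) 1 = (if c = \<epsilon> then B (W ! \<epsilon>) l else 0)" if c: "c < M" for c l
  proof -
    have "poly (\<Sum>k\<in>UNIV. Y k c (Suc \<epsilon>) * [:B k l:]) 1 = (\<Sum>k\<in>UNIV. if k = W ! \<epsilon> then if c = \<epsilon> then B k l else 0 else 0)"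
      unfolding poly_sum using c \<epsilon> W
      by (intro sum.cong refl) (simp add: poly_path_at_shift[OF c] shift_mat_def)
    then show ?thesis by simp
  qed
  have x: "poly (adj_sol M L Y (const_mat A) (\<lambda>c l. \<Sum>k\<in>UNIV. Y k c (Suc \<epsilon>) * [:B k l:]) j i) 1 =
      poly ?\<delta> 1 * word_act L A (factor W j \<epsilon>) (B (W ! \<epsilon>)) i" if i: "i < L" for i
  proof -
    have "poly (adj_sol M L Y (const_mat A) (\<lambda>c l. \<Sum>k\<in>UNIV. Y k c (Suc \<epsilon>) * [:B k l:]) j i) 1 =
        (\<Sum>c<M. \<Sum>l<L. poly (pencil_adj M L Y (const_mat A) j c i l) 1 * (if c = \<epsilon> then B (W ! \<epsilon>) l else 0))"
      unfolding adj_sol_eq poly_sum[of _ "{..<M}"] poly_sum[of _ "{..<L}"] poly_mult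
      by (intro sum.cong refl arg_cong2[where f = "(*)"]) (simp only: z lessThan_iff)
    also have "\<dots> = (\<Sum>c<M. (if c = \<epsilon> then 1 else 0) * (\<Sum>l<L. poly (pencil_adj M L Y (const_mat A) j c i l) 1 * B (W ! \<epsilon>) l))"
      by (intro sum.cong refl) simp
    also have "\<dots> = (\<Sum>l<L. poly (pencil_adj M L Y (const_mat A) j \<epsilon> i l) 1 * B (W ! \<epsilon>) l)"
      using \<epsilon> W by simp
    also have "\<dots> = (\<Sum>l<L. poly ?\<delta> 1 * (word_act L A (factor W j \<epsilon>) (unit_fun l) i * B (W ! \<epsilon>) l))"
      using adj_at_shift[OF jM i, of \<epsilon>] j \<epsilon> by (intro sum.cong refl) (simp add: mult.assoc)
    also have "\<dots> = poly ?\<delta> 1 * word_act L A (factor W j \<epsilon>) (B (W ! \<epsilon>)) i"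
      unfolding sum_distrib_left[symmetric] by (simp only: word_act_expand[OF i, symmetric])
    finally show ?thesis .
  qed
  have "poly (head_vec M L Y (const_mat A) (const_vec B) \<kappa> j (Suc \<epsilon>) l) 1 =
      (\<Sum>l'<L. A \<kappa> l l' * (poly ?\<delta> 1 * word_act L A (factor W j \<epsilon>) (B (W ! \<epsilon>)) l'))"
  proof -
    have j': "(if j = Suc \<epsilon> then ?\<delta> * [:B \<kappa> l:] else 0) = 0" using j by simp
    show ?thesis
      unfolding head_vec_def j' poly_add poly_sum[of _ "{..<L}"] poly_mult poly_0 add_0_right
      by (intro sum.cong refl arg_cong2[where f = "(*)"]) (simp_all only: x lessThan_iff poly_pCons poly_0 mult_zero_right add_0_right)
  qed
  then show ?thesis by (simp add: sum_distrib_left mult_ac)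
qed

text \<open>Column 0 of a shift vanishes, so with j = b = 0 only the direct term B of the matrix
  unit remains. This supplies the controllability columns of the empty word.\<close>

lemma head_vec_at_shift_0:
  assumes l: "l < L"
  shows "poly (head_vec M L Y (const_mat A) (const_vec B) \<kappa> 0 0 l) 1 =
    poly (det (pencil M L Y (const_mat A))) 1 * B \<kappa> l"
proof -
  have z: "poly (\<Sum>k\<in>UNIV. Y k c 0 * [:B k l:]) 1 = 0" if c: "c < M" for c l
    unfolding poly_sum using c W
    by (intro sum.neutral ballI) (simp add: poly_path_at_shift[OF c] shift_mat_def)
  have "poly (adj_sol M L Y (const_mat A) (\<lambda>c l. \<Sum>k\<in>UNIV. Y k c 0 * [:B k l:]) 0 i) 1 = 0" for i
    unfolding adj_sol_eq poly_sum[of _ "{..<M}"] poly_sum[of _ "{..<L}"] poly_mult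
    by (intro sum.neutral ballI) (simp only: z lessThan_iff mult_zero_right)
  then show ?thesis
    unfolding head_vec_def poly_add poly_sum[of _ "{..<L}"] poly_mult by simp
qed

end

section \<open>Invertibility of the pencil on the domain\<close>

text \<open>Lets one word, hence one shift, serve all rows and columns of the observability and
  controllability matrices.\<close>

lemma factor_concat:
  assumes "w \<in> set ws"
  shows "\<exists>c i. c \<le> i \<and> i \<le> length (concat ws) \<and> factor (concat ws) c i = w"
proof -
  from split_list[OF assms] obtain us vs where ws: "ws = us @ w # vs" by blast
  show ?thesis
    by (rule exI[of _ "length (concat us)"], rule exI[of _ "length (concat us) + length w"])
      (simp add: ws factor_def)
qed

lemma factor_snocD:
  assumes "factor W c i = v @ [k]" "c \<le> i" "i \<le> length W"
  shows "\<exists>\<epsilon>. i = Suc \<epsilon> \<and> c \<le> \<epsilon> \<and> factor W c \<epsilon> = v \<and> W ! \<epsilon> = k"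
proof -
  have len: "length (factor W c i) = i - c" using assms(2,3) by (simp add: factor_def)
  have "length (v @ [k]) = i - c" using len unfolding assms(1) .
  then have ci: "i - c = Suc (length v)" by simp
  then obtain \<epsilon> where \<epsilon>: "i = Suc \<epsilon>" by (cases i) auto
  have c\<epsilon>: "c \<le> \<epsilon>" using ci \<epsilon> by simp
  have "factor W c i = factor W c \<epsilon> @ [W ! \<epsilon>]"
    unfolding factor_def using \<epsilon> c\<epsilon> assms(3) by (simp add: Suc_diff_le take_Suc_conv_app_nth)
  then show ?thesis using assms(1) \<epsilon> c\<epsilon> by auto
qed

lemma factor_ConsD:
  assumes "factor W c i = k # v" "c \<le> i" "i \<le> length W"
  shows "c < i \<and> factor W (Suc c) i = v"
proof -
  have "c < i" using assms by (cases "c = i") auto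
  then show ?thesis using factor_step[of c i W] assms by simp
qed

lemma poly_det_mat:
  fixes F :: "nat \<times> nat \<Rightarrow> 'a::field poly"
  shows "poly (det (mat L L F)) c = det (mat L L (\<lambda>ij. poly (F ij) c))"
proof -
  interpret ev: comm_ring_hom "\<lambda>p. poly p c" by unfold_locales auto
  have "map_mat (\<lambda>p. poly p c) (mat L L F) = mat L L (\<lambda>ij. poly (F ij) c)" by auto
  then show ?thesis using ev.hom_det[of "mat L L F"] by simp
qed

text \<open>Multiplying S Q T by the adjugates of S and T on the two sides leaves Q times both
  determinants and preserves divisibility of the entries.\<close>

lemma dvd_matrix_cancel:
  fixes S Q T :: "'r::comm_ring_1 mat"
  assumes S: "S \<in> carrier_mat L L" and Q: "Q \<in> carrier_mat L L" and T: "T \<in> carrier_mat L L"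
    and dvd: "\<And>p q. p < L \<Longrightarrow> q < L \<Longrightarrow> e dvd t * (S * Q * T) $$ (p, q)"
    and ij: "i < L" "j < L"
  shows "e dvd t * det S * det T * Q $$ (i, j)"
proof -
  note aS = adj_mat[OF S] and aT = adj_mat[OF T]
  have "adj_mat S * (S * Q * T) * adj_mat T = (adj_mat S * S) * Q * (T * adj_mat T)"
    using S Q T aS(1) aT(1) by (simp add: assoc_mult_mat[of _ L L _ L _ L])
  also have "(adj_mat S * S) * Q = det S \<cdot>\<^sub>m Q"
    unfolding aS(3) using mult_smult_assoc_mat[OF one_carrier_mat Q] left_mult_one_mat[OF Q] by simp
  also have "(det S \<cdot>\<^sub>m Q) * (T * adj_mat T) = det T \<cdot>\<^sub>m (det S \<cdot>\<^sub>m Q)"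
    unfolding aT(2) using mult_smult_distrib[of "det S \<cdot>\<^sub>m Q" L L "1\<^sub>m L" L] right_mult_one_mat[of "det S \<cdot>\<^sub>m Q" L L] Q by simp
  also have "\<dots> = (det S * det T) \<cdot>\<^sub>m Q" by (rule eq_matI) (auto simp: mult_ac)
  finally have eq: "adj_mat S * (S * Q * T) * adj_mat T = (det S * det T) \<cdot>\<^sub>m Q" .
  have SQT: "S * Q * T \<in> carrier_mat L L" using S Q T by simp
  have "(adj_mat S * (S * Q * T) * adj_mat T) $$ (i, j) =
      (\<Sum>q<L. (\<Sum>p<L. adj_mat S $$ (i, p) * (S * Q * T) $$ (p, q)) * adj_mat T $$ (q, j))"
    by (subst index_mult_mat_sum[OF mult_carrier_mat[OF aS(1) SQT] aT(1) ij])
      (intro sum.cong refl, simp only: index_mult_mat_sum[OF aS(1) SQT] ij lessThan_iff)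
  then have "t * (adj_mat S * (S * Q * T) * adj_mat T) $$ (i, j) =
      (\<Sum>q<L. \<Sum>p<L. t * (S * Q * T) $$ (p, q) * (adj_mat S $$ (i, p) * adj_mat T $$ (q, j)))"
    by (simp only: sum_distrib_left sum_distrib_right mult_ac)
  moreover have "e dvd \<dots>" by (intro dvd_sum dvd_mult2 dvd) auto
  ultimately show ?thesis unfolding eq using Q ij by (simp add: mult.assoc)
qed

lemma sum_const_poly: "(\<Sum>i\<in>I. [:f i:]) = [:\<Sum>i\<in>I. f i:]"
  by (induction I rule: infinite_finite_induct) auto

lemma det_mat_scale:
  fixes c :: "'a::comm_ring_1"
  shows "det (mat L L (\<lambda>ij. c * f ij)) = c ^ L * det (mat L L f)"
proof -
  have "mat L L (\<lambda>ij. c * f ij) = c \<cdot>\<^sub>m mat L L f" by auto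
  then show ?thesis by simp
qed

text \<open>If the pencil were singular at \<open>X\<close>, the path \<open>(1 - s^r) X\<close> would make its inverse have a pole
  of order \<open>r\<close> at \<open>s = 0\<close>. But values of \<open>R\<close> at the three block points have no pole there, and the
  outer factors, which do not depend on \<open>r\<close>, are invertible over \<open>K(s)\<close>, since at \<open>s = 1\<close> they become
  an observability and a controllability matrix.\<close>

lemma well_posed_on_domain:
  fixes R R0 :: "('a::field, 'd::finite) nc_rexp"
  assumes ag: "agree R R0" and real: "realized R0 L A B C D"
    and zero: "(\<lambda>_. 0\<^sub>m 1 1) \<in> rexp_dom 1 R0"
    and obs: "det (mat L L (\<lambda>(p, l). \<Sum>i<L. C i * word_act L A (ws p) (unit_fun l) i)) \<noteq> 0"
    and ctr: "det (mat L L (\<lambda>(l, p). word_act L A (vs p) (B (ks p)) l)) \<noteq> 0"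
    and X: "X \<in> rexp_dom m R" and m: "m \<ge> 1"
  shows "well_posed m L (\<lambda>k. ent (X k)) A"
proof (rule ccontr)
  assume nwp: "\<not> well_posed m L (\<lambda>k. ent (X k)) A"
  then obtain x0 a0 i0 where x0: "\<forall>a<m. \<forall>i<L. x0 a i = fm_step m L (\<lambda>k. ent (X k)) A x0 a i"
    and ai0: "a0 < m" "i0 < L" "x0 a0 i0 \<noteq> 0"
    unfolding well_posed_def not_all not_imp by (elim exE conjE)
  \<comment> \<open>The input letter of each controllability column is appended to its word, so that
    the shift also reads the step through B.\<close>
  define W where "W = concat (map ws [0..<L] @ map (\<lambda>p. vs p @ [ks p]) [0..<L])"
  \<comment> \<open>Enough copies of X for the size M to exceed the length of W while remaining a
    multiple of m.\<close>
  define p0 where "p0 = Suc (length W)"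
  define M where "M = p0 * m"
  have WM: "length W < M" using m by (cases m) (auto simp: M_def p0_def)
  have M1: "M \<ge> 1" using WM by simp
  define X' where "X' k = amplify p0 m (X k)" for k
  have X': "X' \<in> rexp_dom M R" unfolding X'_def[abs_def] M_def by (rule amplify_dom(1)[OF X]) (simp add: p0_def)
  have X'c: "X' k \<in> carrier_mat M M" for k by (simp add: X'_def M_def)
  \<comment> \<open>A kernel vector at the amplified point: x0 repeated in each copy.\<close>
  define x where "x q i = x0 (q mod m) i" for q i
  have x: "x q i = fm_step M L (\<lambda>k. ent (X' k)) A x q i" if q: "q < M" and i: "i < L" for q i
  proof -
    have qm: "q div m < p0" "q mod m < m" and qe: "q = (q div m) * m + q mod m"
      using div_less_of_less_mult[of q p0 m] mod_less_of_less_mult[of q p0 m] q by (auto simp: M_def)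
    have "fm_step M L (\<lambda>k. ent (X' k)) A x q i =
        (\<Sum>k\<in>UNIV. \<Sum>f<p0. \<Sum>b<m. X' k $$ (q, f * m + b) * (\<Sum>j<L. A k i j * x (f * m + b) j))"
      unfolding fm_step_def M_def sum_lessThan_mult ..
    also have "\<dots> = (\<Sum>k\<in>UNIV. \<Sum>f<p0. (if q div m = f then 1 else 0) *
        (\<Sum>b<m. X k $$ (q mod m, b) * (\<Sum>j<L. A k i j * x0 b j)))"
    proof (intro sum.cong refl)
      fix k f assume f: "f \<in> {..<p0}"
      have "X' k $$ (q, f * m + b) = (if q div m = f then X k $$ (q mod m, b) else 0)" if "b < m" for b
        using amplify_index[OF qm(1) _ qm(2) that, of f "X k"] f by (simp add: X'_def)
      then show "(\<Sum>b<m. X' k $$ (q, f * m + b) * (\<Sum>j<L. A k i j * x (f * m + b) j)) =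
        (if q div m = f then 1 else 0) * (\<Sum>b<m. X k $$ (q mod m, b) * (\<Sum>j<L. A k i j * x0 b j))"
        by (simp add: x_def)
    qed
    also have "\<dots> = fm_step m L (\<lambda>k. ent (X k)) A x0 (q mod m) i"
      unfolding fm_step_def using qm by simp
    also have "\<dots> = x q i" using x0 qm(2) i unfolding x_def by simp
    finally show ?thesis by simp
  qed
  have a0M: "a0 < M" and xa0: "x a0 i0 \<noteq> 0"
    using ai0 m by (auto simp: M_def p0_def x_def)

  have "\<exists>c i. c \<le> i \<and> i \<le> length W \<and> factor W c i = ws p" if "p < L" for p
    unfolding W_def by (rule factor_concat) (use that in auto)
  then obtain \<alpha> \<beta> where \<alpha>\<beta>: "\<And>p. p < L \<Longrightarrow> \<alpha> p \<le> \<beta> p \<and> \<beta> p \<le> length W \<and> factor W (\<alpha> p) (\<beta> p) = ws p"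
    by metis
  have shift_dom: "shift_mat M W \<in> rexp_dom M R0"
    by (rule upper_triangular_dom[OF zero]) (auto simp: shift_mat_def)
  have wp: "well_posed M L (\<lambda>k. ent (shift_mat M W k)) A"
    using real M1 shift_dom unfolding realized_def realizes_def by blast
  define Y where "Y k = ent (segment M (X' k) (shift_mat M W k))" for k
  define \<delta>1 where "\<delta>1 = det (pencil M L Y (const_mat A))"
  have \<delta>1: "poly \<delta>1 1 \<noteq> 0" unfolding \<delta>1_def Y_def by (rule det_at_shift[OF WM wp])
  \<comment> \<open>A choice of matrix unit and input position that produces column p of the
    controllability matrix at s = 1.\<close>
  define good where "good p \<kappa> j b \<longleftrightarrow> j < M \<and> b < M \<and> (\<forall>l<L.
      poly (head_vec M L Y (const_mat A) (const_vec B) \<kappa> j b l) 1 = poly \<delta>1 1 * word_act L A (vs p) (B (ks p)) l)" for p \<kappa> j b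
  have "\<exists>\<kappa> j b. good p \<kappa> j b" if p: "p < L" for p
  proof -
    have "\<exists>c i. c \<le> i \<and> i \<le> length W \<and> factor W c i = vs p @ [ks p]"
      unfolding W_def by (rule factor_concat) (use p in auto)
    then obtain c i where ci: "c \<le> i" "i \<le> length W" "factor W c i = vs p @ [ks p]" by blast
    from factor_snocD[OF ci(3,1,2)] obtain \<epsilon> where \<epsilon>: "i = Suc \<epsilon>" "c \<le> \<epsilon>" "factor W c \<epsilon> = vs p" "W ! \<epsilon> = ks p" by blast
    have \<epsilon>W: "\<epsilon> < length W" using ci \<epsilon> by simp
    show ?thesis
    proof (cases "vs p")
      \<comment> \<open>The column is B for the letter \<open>ks p\<close>; the matrix unit itself
        carries this letter.\<close>
      case Nil
      have "good p (ks p) 0 0"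
        unfolding good_def
      proof (intro conjI allI impI)
        fix l assume l: "l < L"
        show "poly (head_vec M L Y (const_mat A) (const_vec B) (ks p) 0 0 l) 1 = poly \<delta>1 1 * word_act L A (vs p) (B (ks p)) l"
          unfolding Nil word_act.simps \<delta>1_def Y_def[abs_def] by (rule head_vec_at_shift_0[OF WM wp l])
      qed (use M1 in auto)
      then show ?thesis by blast
    next
      \<comment> \<open>The matrix unit carries the first letter, and the shift reads the rest of
        the word.\<close>
      case (Cons \<kappa> v)
      have 1: "c < \<epsilon>" "factor W (Suc c) \<epsilon> = v"
        using factor_ConsD[of W c \<epsilon> \<kappa> v] \<epsilon> \<epsilon>W Cons by auto
      have "good p \<kappa> (Suc c) (Suc \<epsilon>)"
        unfolding good_def
      proof (intro conjI allI impI)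
        fix l assume l: "l < L"
        have "Suc c \<le> \<epsilon>" using 1 by simp
        from head_vec_at_shift[OF WM wp l this \<epsilon>W, of X' B \<kappa>]
        show "poly (head_vec M L Y (const_mat A) (const_vec B) \<kappa> (Suc c) (Suc \<epsilon>) l) 1 = poly \<delta>1 1 * word_act L A (vs p) (B (ks p)) l"
          unfolding Cons 1(2) \<epsilon>(4) \<delta>1_def Y_def[abs_def] .
      qed (use 1 \<epsilon>W WM in auto)
      then show ?thesis by blast
    qed
  qed
  then obtain \<kappa>p jp bp where hp: "\<And>p. p < L \<Longrightarrow> good p (\<kappa>p p) (jp p) (bp p)"
    by metis
  define K where "K = pencil_adj M L Y (const_mat A)"
  \<comment> \<open>S and T are the outer factors of the corner of the value at a three block point.
    At s = 1 they are multiples of the observability and the controllability matrix, so their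
    determinants are nonzero polynomials.\<close>
  define S where "S = mat L L (\<lambda>(p, l'). \<Sum>l<L. [:C l:] * K (\<alpha> p) (\<beta> p) l l')"
  define T where "T = mat L L (\<lambda>(l, p). head_vec M L Y (const_mat A) (const_vec B) (\<kappa>p p) (jp p) (bp p) l)"
  have Sc: "S \<in> carrier_mat L L" and Tc: "T \<in> carrier_mat L L" by (auto simp: S_def T_def)
  have "poly (det S) 1 = det (mat L L (\<lambda>(p, l). poly \<delta>1 1 * (\<Sum>i<L. C i * word_act L A (ws p) (unit_fun l) i)))"
    unfolding S_def poly_det_mat
  proof (intro arg_cong[where f = det] cong_mat refl)
    fix p l' assume p: "p < L" and l': "l' < L"
    note \<alpha>\<beta>' = \<alpha>\<beta>[OF p]
    have "poly (K (\<alpha> p) (\<beta> p) l l') 1 = poly \<delta>1 1 * word_act L A (ws p) (unit_fun l') l" if "l < L" for l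
      unfolding K_def \<delta>1_def Y_def using adj_at_shift[OF WM wp, of "\<alpha> p" l "\<beta> p" l' X'] that l' \<alpha>\<beta>' WM by simp
    then show "poly (case (p, l') of (p, l') \<Rightarrow> \<Sum>l<L. [:C l:] * K (\<alpha> p) (\<beta> p) l l') 1 =
        (case (p, l') of (p, l) \<Rightarrow> poly \<delta>1 1 * (\<Sum>i<L. C i * word_act L A (ws p) (unit_fun l) i))"
      by (simp add: poly_sum sum_distrib_left mult_ac)
  qed
  also have "\<dots> = poly \<delta>1 1 ^ L * det (mat L L (\<lambda>(p, l). \<Sum>i<L. C i * word_act L A (ws p) (unit_fun l) i))"
    unfolding det_mat_scale[symmetric] by (intro arg_cong[where f = det] cong_mat) auto
  finally have dS: "det S \<noteq> 0" using obs \<delta>1 by auto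
  have "poly (det T) 1 = det (mat L L (\<lambda>(l, p). poly \<delta>1 1 * word_act L A (vs p) (B (ks p)) l))"
    unfolding T_def poly_det_mat
  proof (intro arg_cong[where f = det] cong_mat refl)
    fix l p assume l: "l < L" and p: "p < L"
    have "poly (head_vec M L Y (const_mat A) (const_vec B) (\<kappa>p p) (jp p) (bp p) l) 1 = poly \<delta>1 1 * word_act L A (vs p) (B (ks p)) l"
      using hp[OF p] l unfolding good_def by blast
    then show "poly (case (l, p) of (l, p) \<Rightarrow> head_vec M L Y (const_mat A) (const_vec B) (\<kappa>p p) (jp p) (bp p) l) 1 =
        (case (l, p) of (l, p) \<Rightarrow> poly \<delta>1 1 * word_act L A (vs p) (B (ks p)) l)" by simp
  qed
  also have "\<dots> = poly \<delta>1 1 ^ L * det (mat L L (\<lambda>(l, p). word_act L A (vs p) (B (ks p)) l))"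
    unfolding det_mat_scale[symmetric] by (intro arg_cong[where f = det] cong_mat) auto
  finally have dT: "det T \<noteq> 0" using ctr \<delta>1 by auto
  define s :: "'a poly" where "s = [:0, 1:]"
  define t where "t = s * s * det S * det T"
  have t: "t \<noteq> 0" using dS dT by (simp add: t_def s_def)
  define e where "e = order 0 t"
  \<comment> \<open>One more than the order at 0 of everything that stands around the middle block:
    the two factors s of the matrix units and the determinants of S and T. None of these depends on
    r.\<close>
  define r where "r = Suc e"
  \<comment> \<open>Equal to X' at s = 0 and to the zero tuple at s = 1. The three block point is
    therefore a direct sum of copies of X' at s = 0 and strictly upper triangular at s = 1.\<close>
  define Y2 where "Y2 k a b = (1 - s ^ r) * [:X' k $$ (a, b):]" for k a b
  define \<delta>2 where "\<delta>2 = det (pencil M L Y2 (const_mat A))"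
  define K2 where "K2 = pencil_adj M L Y2 (const_mat A)"
  have "poly \<delta>2 1 \<noteq> 0"
  proof -
    have "poly \<delta>2 1 = det (pencil M L (\<lambda>k a b. 0) A)"
      unfolding \<delta>2_def poly_det_pencil by (simp add: Y2_def s_def)
    moreover have "well_posed M L (\<lambda>k a b. 0) A" by (simp add: well_posed_def fm_step_def)
    ultimately show ?thesis by (simp add: well_posed_iff_det)
  qed
  then have \<delta>2: "\<delta>2 \<noteq> 0" by auto
  define v where "v = order 0 \<delta>2"

  \<comment> \<open>The values of R have no pole at s = 0, so the power of s in the determinant of
    the middle pencil is already absorbed by the polynomial corner entry.\<close>
  have SQT: "s ^ v dvd s * s * (S * mat L L (\<lambda>(l', l). \<Sum>l''<L. [:A \<kappa> l' l'':] * K2 j i' l'' l) * T) $$ (p, q)"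
    if j: "j < M" and i': "i' < M" and p: "p < L" and q: "q < L" for \<kappa> j i' p q
  proof -
    \<comment> \<open>The first matrix unit continues from column \<beta> p of the observability
      factor, and the second feeds the head vector of column q into the middle block. The variable
      \<kappa> and the positions j and i' stay free, to reach every entry of the inner
      factor.\<close>
    define Z where "Z = three_block M Y Y2 s \<kappa> (\<beta> p) j (\<kappa>p q) i' (jp q)"
    define Zm where "Zm k = mat (3 * M) (3 * M) (\<lambda>(u, v). Z k u v)" for k
    have Zc: "\<forall>k. Zm k \<in> carrier_mat (3 * M) (3 * M)" by (simp add: Zm_def)
    have M3: "3 * M \<ge> 1" using M1 by simp
    have e0: "eval_path 0 Zm = (\<lambda>k. amplify 3 M (X' k))"
    proof
      fix k show "eval_path 0 Zm k = amplify 3 M (X' k)"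
      proof (rule eq_matI)
        fix u w assume "u < dim_row (amplify 3 M (X' k))" "w < dim_col (amplify 3 M (X' k))"
        then have uw: "u < 3 * M" "w < 3 * M" by (simp_all add: amplify_def)
        note mods = mod_less_of_less_mult[OF uw(1)] mod_less_of_less_mult[OF uw(2)]
        have "poly (Y k (u mod M) (w mod M)) 0 = X' k $$ (u mod M, w mod M)"
          using mods by (simp add: Y_def segment_def)
        moreover have "poly (Y2 k (u mod M) (w mod M)) 0 = X' k $$ (u mod M, w mod M)"
          by (simp add: Y2_def s_def r_def)
        ultimately have "poly (Z k u w) 0 = (if u div M = w div M then X' k $$ (u mod M, w mod M) else 0)"
          by (cases "u div M = w div M")
            (simp_all add: Z_def three_block_def s_def if_distrib[of "\<lambda>p. poly p 0"] cong: if_cong)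
        then show "eval_path 0 Zm k $$ (u, w) = amplify 3 M (X' k) $$ (u, w)"
          using uw by (simp add: eval_path_def Zm_def amplify_def)
      qed (auto simp: eval_path_def Zm_def amplify_def)
    qed
    have dom: "eval_path 0 Zm \<in> rexp_dom (3 * M) R"
      unfolding e0 by (rule amplify_dom(1)[OF X']) simp
    have dom0: "eval_path 1 Zm \<in> rexp_dom (3 * M) R0"
    proof (rule upper_triangular_dom[OF zero])
      show "eval_path 1 Zm k \<in> carrier_mat (3 * M) (3 * M)" for k by (simp add: eval_path_def Zm_def)
      fix k u w assume u: "u < 3 * M" and wu: "w \<le> u"
      then have w: "w < 3 * M" by simp
      have le: "w div M \<le> u div M" using wu by (rule div_le_mono)
      note mods = mod_less_of_less_mult[OF u] mod_less_of_less_mult[OF w]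
      have 1: "poly (Y k (u mod M) (w mod M)) 1 = shift_mat M W k $$ (u mod M, w mod M)"
        using mods by (simp add: Y_def segment_def)
      have 2: "poly (Y2 k (u mod M) (w mod M)) 1 = 0" by (simp add: Y2_def s_def)
      have 3: "shift_mat M W k $$ (u mod M, w mod M) = (0::'a)" if "u div M = w div M"
      proof -
        have "w mod M \<le> u mod M"
          using wu that div_mult_mod_eq[of u M] div_mult_mod_eq[of w M] by (metis add_le_cancel_left)
        then show ?thesis using mods by (simp add: shift_mat_def)
      qed
      show "eval_path 1 Zm k $$ (u, w) = 0"
        using u w le 1 2 3 by (auto simp: eval_path_def Zm_def Z_def three_block_def)
    qed
    obtain d V where d: "poly d 0 \<noteq> 0"
      and val: "\<And>x y a. fm_sys (3 * M) L (\<lambda>k. ent (Zm k)) (const_mat A) (const_vec B) x y \<Longrightarrow> a < 3 * M \<Longrightarrow>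
         (\<Sum>b<3 * M. V $$ (a, b) * y b) = d * ([:D:] * y a + (\<Sum>i<L. [:C i:] * x a i))"
      by (rule path_realization[OF ag real M3 Zc dom dom0]) blast
    have jb: "jp q < M" "bp q < M" using hp[OF q] unfolding good_def by blast+
    define h where "h = head_vec M L Y (const_mat A) (const_vec B) (\<kappa>p q) (jp q) (bp q)"
    define x1 where "x1 = adj_sol M L Y2 (const_mat A) (\<lambda>c l. if c = i' then h l else 0)"
    define x0' where "x0' = adj_sol M L Y (const_mat A) (\<lambda>c l. if c = \<beta> p then \<Sum>l'<L. [:A \<kappa> l l':] * x1 j l' else 0)"
    define x2 where "x2 = adj_sol M L Y (const_mat A) (\<lambda>c l. \<Sum>k\<in>UNIV. Y k c (bp q) * [:B k l:])"
    define xx where "xx u l = (if u div M = 0 then s * s * x0' (u mod M) l else if u div M = 1 then \<delta>1 * s * x1 (u mod M) l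
       else \<delta>1 * \<delta>2 * x2 (u mod M) l)" for u l
    define y where "y u = (if u = 2 * M + bp q then \<delta>1 * \<delta>1 * \<delta>2 else 0)" for u
    have "fm_sys (3 * M) L Z (const_mat A) (const_vec B) xx y"
      unfolding Z_def xx_def[abs_def] y_def[abs_def] x0'_def x1_def x2_def h_def \<delta>1_def \<delta>2_def
      by (rule three_block_sys[OF j jb])
    then have sys: "fm_sys (3 * M) L (\<lambda>k. ent (Zm k)) (const_mat A) (const_vec B) xx y"
      by (rule fm_sys_cong_point[rotated]) (simp add: Zm_def)
    have \<alpha>M: "\<alpha> p < M" and \<beta>M: "\<beta> p < M" using \<alpha>\<beta>[OF p] WM by auto
    have "(\<Sum>b<3 * M. V $$ (\<alpha> p, b) * y b) = d * ([:D:] * y (\<alpha> p) + (\<Sum>l<L. [:C l:] * xx (\<alpha> p) l))"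
      by (rule val[OF sys]) (use \<alpha>M in simp)
    moreover have "(\<Sum>b<3 * M. V $$ (\<alpha> p, b) * y b) = V $$ (\<alpha> p, 2 * M + bp q) * (\<delta>1 * \<delta>1 * \<delta>2)"
    proof -
      have "(\<Sum>b<3 * M. V $$ (\<alpha> p, b) * y b) =
          (\<Sum>b<3 * M. (if b = 2 * M + bp q then 1 else 0) * (V $$ (\<alpha> p, b) * (\<delta>1 * \<delta>1 * \<delta>2)))"
        by (intro sum.cong refl) (simp add: y_def)
      then show ?thesis using jb by simp
    qed
    moreover have "y (\<alpha> p) = 0" using \<alpha>M by (simp add: y_def)
    moreover have "xx (\<alpha> p) l = s * s * x0' (\<alpha> p) l" for l using \<alpha>M by (simp add: xx_def)
    ultimately have "d * (s * s * (\<Sum>l<L. [:C l:] * x0' (\<alpha> p) l)) = \<delta>2 * (V $$ (\<alpha> p, 2 * M + bp q) * (\<delta>1 * \<delta>1))"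
      by (simp add: sum_distrib_left mult_ac)
    \<comment> \<open>The numerator V is polynomial and the input contains the factor
      \<delta>2.\<close>
    then have "\<delta>2 dvd d * (s * s * (\<Sum>l<L. [:C l:] * x0' (\<alpha> p) l))" by simp
    from order_dvd_cancel[OF this d] have dvd: "s ^ v dvd s * s * (\<Sum>l<L. [:C l:] * x0' (\<alpha> p) l)"
      unfolding v_def s_def .
    let ?Q = "mat L L (\<lambda>(l', l). \<Sum>l''<L. [:A \<kappa> l' l'':] * K2 j i' l'' l)"
    have Qc: "?Q \<in> carrier_mat L L" by simp
    have "(\<Sum>l<L. [:C l:] * x0' (\<alpha> p) l) = (S * ?Q * T) $$ (p, q)"
    proof -
      have "(S * ?Q * T) $$ (p, q) = (\<Sum>l3<L. (S * ?Q) $$ (p, l3) * T $$ (l3, q))"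
        by (rule index_mult_mat_sum[OF mult_carrier_mat[OF Sc Qc] Tc p q])
      also have "\<dots> = (\<Sum>l3<L. (\<Sum>l'<L. S $$ (p, l') * ?Q $$ (l', l3)) * h l3)"
      proof (intro sum.cong refl)
        fix l3 assume "l3 \<in> {..<L}"
        then have l3: "l3 < L" by simp
        show "(S * ?Q) $$ (p, l3) * T $$ (l3, q) = (\<Sum>l'<L. S $$ (p, l') * ?Q $$ (l', l3)) * h l3"
          unfolding index_mult_mat_sum[OF Sc Qc p l3] using l3 q by (simp add: T_def h_def)
      qed
      also have "\<dots> = (\<Sum>l'<L. S $$ (p, l') * (\<Sum>l3<L. ?Q $$ (l', l3) * h l3))"
        unfolding sum_distrib_left sum_distrib_right mult.assoc by (rule sum.swap)
      also have "\<dots> = (\<Sum>l'<L. S $$ (p, l') * (\<Sum>l''<L. [:A \<kappa> l' l'':] * x1 j l''))"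
      proof (rule sum.cong[OF refl])
        fix l' assume "l' \<in> {..<L}"
        then have l': "l' < L" by simp
        have "(\<Sum>l''<L. [:A \<kappa> l' l'':] * x1 j l'') = (\<Sum>l''<L. \<Sum>l3<L. [:A \<kappa> l' l'':] * (K2 j i' l'' l3 * h l3))"
          unfolding x1_def adj_sol_unit[OF i'] K2_def sum_distrib_left ..
        also have "\<dots> = (\<Sum>l3<L. \<Sum>l''<L. [:A \<kappa> l' l'':] * (K2 j i' l'' l3 * h l3))" by (rule sum.swap)
        also have "\<dots> = (\<Sum>l3<L. ?Q $$ (l', l3) * h l3)"
          using l' by (intro sum.cong refl) (simp add: sum_distrib_right mult.assoc)
        finally show "S $$ (p, l') * (\<Sum>l3<L. ?Q $$ (l', l3) * h l3) = S $$ (p, l') * (\<Sum>l''<L. [:A \<kappa> l' l'':] * x1 j l'')"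
          by (rule arg_cong[OF sym])
      qed
      also have "\<dots> = (\<Sum>l'<L. \<Sum>l<L. [:C l:] * (K (\<alpha> p) (\<beta> p) l l' * (\<Sum>l''<L. [:A \<kappa> l' l'':] * x1 j l'')))"
        using p by (intro sum.cong refl) (simp add: S_def sum_distrib_right mult.assoc)
      also have "\<dots> = (\<Sum>l<L. \<Sum>l'<L. [:C l:] * (K (\<alpha> p) (\<beta> p) l l' * (\<Sum>l''<L. [:A \<kappa> l' l'':] * x1 j l'')))"
        by (rule sum.swap)
      also have "\<dots> = (\<Sum>l<L. [:C l:] * x0' (\<alpha> p) l)"
        unfolding x0'_def adj_sol_unit[OF \<beta>M] K_def sum_distrib_left ..
      finally show ?thesis ..
    qed
    then show ?thesis using dvd by simp
  qed
  \<comment> \<open>The outer factors are cancelled at the price of the power s^e.\<close>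
  have Q: "s ^ v dvd s ^ e * (\<Sum>l''<L. [:A \<kappa> l' l'':] * K2 j i' l'' l)"
    if "j < M" "i' < M" "l' < L" "l < L" for \<kappa> j i' l' l
  proof -
    let ?Q = "mat L L (\<lambda>(l', l). \<Sum>l''<L. [:A \<kappa> l' l'':] * K2 j i' l'' l)"
    have "s ^ v dvd s * s * det S * det T * ?Q $$ (l', l)"
      by (rule dvd_matrix_cancel[OF Sc _ Tc _ that(3,4)]) (use SQT[OF that(1,2)] in auto)
    then have "s ^ v dvd t * (\<Sum>l''<L. [:A \<kappa> l' l'':] * K2 j i' l'' l)" using that by (simp add: t_def)
    from order_dvd_swap[OF this[unfolded s_def] t] show ?thesis unfolding s_def e_def .
  qed
  have s\<delta>2: "s ^ v dvd \<delta>2" unfolding s_def v_def using order_1[of 0 \<delta>2] by simp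
  \<comment> \<open>So far only the products of the coefficients A with the adjugate are controlled.
    The column equation of the adjugate expresses the adjugate itself by these products and
    \<delta>2.\<close>
  have K2: "s ^ v dvd s ^ e * K2 c i' l l3" if "c < M" "i' < M" "l < L" "l3 < L" for c i' l l3
  proof -
    have "K2 c i' l l3 = (\<Sum>k\<in>UNIV. \<Sum>b<M. Y2 k c b * (\<Sum>j<L. [:A k l j:] * K2 b i' j l3)) + (if c = i' \<and> l = l3 then \<delta>2 else 0)"
      unfolding K2_def \<delta>2_def by (subst pencil_adj_right[OF that(1,3,2,4)]) (simp only: fm_step_def)
    then have "s ^ e * K2 c i' l l3 = (\<Sum>k\<in>UNIV. \<Sum>b<M. Y2 k c b * (s ^ e * (\<Sum>j<L. [:A k l j:] * K2 b i' j l3)))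
        + s ^ e * (if c = i' \<and> l = l3 then \<delta>2 else 0)"
      by (simp only: distrib_left sum_distrib_left mult.left_commute)
    moreover have "s ^ v dvd (\<Sum>k\<in>UNIV. \<Sum>b<M. Y2 k c b * (s ^ e * (\<Sum>j<L. [:A k l j:] * K2 b i' j l3)))"
      by (intro dvd_sum dvd_mult Q) (use that in auto)
    moreover have "s ^ v dvd s ^ e * (if c = i' \<and> l = l3 then \<delta>2 else 0)" using s\<delta>2 by auto
    ultimately show ?thesis by (simp only: dvd_add)
  qed
  \<comment> \<open>The identity adj(P) P = \<delta>2 I is applied to the kernel vector x of the
    pencil at X', which the pencil at \<open>Y2\<close> multiplies by s^r.\<close>
  have "\<delta>2 * [:x a0 i0:] = (\<Sum>c<M. \<Sum>l<L. K2 a0 c i0 l * ([:x c l:] - fm_step M L Y2 (const_mat A) (\<lambda>c l. [:x c l:]) c l))"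
    unfolding \<delta>2_def K2_def by (rule pencil_adj_left[OF a0M ai0(2)])
  also have "\<dots> = (\<Sum>c<M. \<Sum>l<L. K2 a0 c i0 l * (s ^ r * [:x c l:]))"
  proof (intro sum.cong refl arg_cong2[where f = "(*)"])
    fix c l assume "c \<in> {..<M}" "l \<in> {..<L}"
    then have c: "c < M" and l: "l < L" by auto
    have "fm_step M L Y2 (const_mat A) (\<lambda>c l. [:x c l:]) c l =
        (1 - s ^ r) * (\<Sum>k\<in>UNIV. \<Sum>b<M. [:X' k $$ (c, b):] * (\<Sum>j<L. [:A k l j:] * [:x b j:]))"
      unfolding fm_step_def Y2_def sum_distrib_left[of "1 - s ^ r"] by (simp only: mult.assoc)
    also have "(\<Sum>k\<in>UNIV. \<Sum>b<M. [:X' k $$ (c, b):] * (\<Sum>j<L. [:A k l j:] * [:x b j:])) =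
        [:fm_step M L (\<lambda>k. ent (X' k)) A x c l:]"
      unfolding fm_step_def by (simp add: sum_const_poly mult.commute)
    also have "\<dots> = [:x c l:]" by (simp only: x[OF c l, symmetric])
    finally show "[:x c l:] - fm_step M L Y2 (const_mat A) (\<lambda>c l. [:x c l:]) c l = s ^ r * [:x c l:]"
      by (simp only: left_diff_distrib mult_1) simp
  qed
  finally have "s ^ e * (\<delta>2 * [:x a0 i0:]) = (\<Sum>c<M. \<Sum>l<L. (s ^ e * K2 a0 c i0 l) * s ^ r * [:x c l:])"
    by (simp only: sum_distrib_left mult.assoc)
  moreover have "s ^ v * s ^ r dvd \<dots>"
    by (intro dvd_sum dvd_mult2 mult_dvd_mono K2 dvd_refl) (use a0M ai0 in auto)
  ultimately have "s ^ (v + r) dvd s ^ e * (\<delta>2 * [:x a0 i0:])" by (simp add: power_add)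
  moreover have nz: "s ^ e * (\<delta>2 * [:x a0 i0:]) \<noteq> 0" using \<delta>2 xa0 by (simp add: s_def)
  moreover have "[:0, 1:] ^ n dvd q \<longleftrightarrow> q = 0 \<or> n \<le> order 0 q" for n and q :: "'a poly"
    using order_divides[of 0 n q] by simp
  \<comment> \<open>Comparison of orders at 0: the right side of the identity gives at least v + r,
    while the left side has order exactly e + v.\<close>
  ultimately have "v + r \<le> order 0 (s ^ e * (\<delta>2 * [:x a0 i0:]))"
    unfolding s_def by blast
  also have "\<dots> = e + v"
  proof -
    have nz': "\<delta>2 * [:x a0 i0:] \<noteq> 0" using nz by auto
    have "order 0 (s ^ e) = e" using order_power_n_n[of 0 e] by (simp add: s_def)
    moreover have "order 0 [:x a0 i0:] = 0" using xa0 by (intro order_0I) simp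
    ultimately show ?thesis unfolding order_mult[OF nz] order_mult[OF nz'] v_def by simp
  qed
  finally show False by (simp add: r_def)
qed

section \<open>Independent families\<close>

text \<open>If L < r, padding with zeros to square matrices would give S T = I and hence T S = I,
  although row L of T vanishes.\<close>

lemma rect_inverse_le:
  fixes F G :: "nat \<Rightarrow> nat \<Rightarrow> 'a::field"
  assumes "\<And>i j. i < r \<Longrightarrow> j < r \<Longrightarrow> (\<Sum>l<L. F i l * G l j) = (if i = j then 1 else 0)"
  shows "r \<le> L"
proof (rule ccontr)
  assume "\<not> r \<le> L"
  then have L: "L < r" by simp
  define S where "S = mat r r (\<lambda>(i, l). if l < L then F i l else 0)"
  define T where "T = mat r r (\<lambda>(l, j). if l < L then G l j else 0)"
  have c: "S \<in> carrier_mat r r" "T \<in> carrier_mat r r" by (auto simp: S_def T_def)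
  have "S * T = 1\<^sub>m r"
  proof (rule eq_matI)
    fix i j assume "i < dim_row (1\<^sub>m r :: 'a mat)" "j < dim_col (1\<^sub>m r :: 'a mat)"
    then have ij: "i < r" "j < r" by auto
    have "(S * T) $$ (i, j) = (\<Sum>l<r. S $$ (i, l) * T $$ (l, j))" by (rule index_mult_mat_sum[OF c ij])
    also have "\<dots> = (\<Sum>l<L. S $$ (i, l) * T $$ (l, j))"
      by (rule sum.mono_neutral_right) (use L ij in \<open>auto simp: S_def\<close>)
    also have "\<dots> = (\<Sum>l<L. F i l * G l j)" using L ij by (intro sum.cong) (auto simp: S_def T_def)
    finally show "(S * T) $$ (i, j) = 1\<^sub>m r $$ (i, j)" using assms[OF ij] ij by simp
  qed (use c in auto)
  then have "T * S = 1\<^sub>m r" by (rule mat_mult_left_right_inverse[OF c])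
  moreover have "(T * S) $$ (L, L) = (\<Sum>l<r. T $$ (L, l) * S $$ (l, L))"
    by (rule index_mult_mat_sum[OF c(2,1) L L])
  ultimately show False using L by (simp add: T_def)
qed

text \<open>The vectors \<open>f (ws i)\<close> form a basis of the span of the family f inside
  \<open>K^L\<close>, and the columns of \<iota> are functionals dual to it. The second clause is
  the expansion of each member in this basis.\<close>

definition dual_basis :: "nat \<Rightarrow> ('w \<Rightarrow> nat \<Rightarrow> 'a::field) \<Rightarrow> nat \<Rightarrow> (nat \<Rightarrow> 'w) \<Rightarrow> (nat \<Rightarrow> nat \<Rightarrow> 'a) \<Rightarrow> bool" where
  "dual_basis L f r ws \<iota> \<longleftrightarrow>
     (\<forall>i<r. \<forall>j<r. (\<Sum>l<L. f (ws i) l * \<iota> l j) = (if i = j then 1 else 0)) \<and>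
     (\<forall>w. \<forall>l<L. f w l = (\<Sum>i<r. (\<Sum>l'<L. f w l' * \<iota> l' i) * f (ws i) l))"

lemma dual_basisD:
  assumes "dual_basis L f r ws \<iota>"
  shows "i < r \<Longrightarrow> j < r \<Longrightarrow> (\<Sum>l<L. f (ws i) l * \<iota> l j) = (if i = j then 1 else 0)"
    and "l < L \<Longrightarrow> f w l = (\<Sum>i<r. (\<Sum>l'<L. f w l' * \<iota> l' i) * f (ws i) l)"
  using assms unfolding dual_basis_def by blast+

lemma dual_basis_le: "dual_basis L f r ws \<iota> \<Longrightarrow> r \<le> L"
  by (rule rect_inverse_le[where F = "\<lambda>i. f (ws i)" and G = \<iota>]) (rule dual_basisD(1))

text \<open>A biorthogonal system of greatest size spans the family, because a member outside its
  span would allow an extension.\<close>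

lemma dual_basis_exists:
  fixes f :: "'w \<Rightarrow> nat \<Rightarrow> 'a::field"
  shows "\<exists>r ws \<iota>. dual_basis L f r ws \<iota>"
proof -
  define P where "P r \<longleftrightarrow> (\<exists>ws \<iota>. \<forall>i<r. \<forall>j<r. (\<Sum>l<L. f (ws i) l * \<iota> l j) = (if i = j then 1 else 0))" for r :: nat
  have P0: "P 0" by (simp add: P_def)
  have bound: "r \<le> L" if "P r" for r
  proof -
    from that obtain ws \<iota> where "\<forall>i<r. \<forall>j<r. (\<Sum>l<L. f (ws i) l * \<iota> l j) = (if i = j then 1 else 0)"
      unfolding P_def by blast
    then show ?thesis by (intro rect_inverse_le[where F = "\<lambda>i. f (ws i)" and G = \<iota>]) blast
  qed
  define r where "r = (GREATEST r. P r)"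
  have Pr: "P r" unfolding r_def by (rule GreatestI_nat[where P = P and k = 0 and b = L]) (fact P0, rule bound)
  have maxr: "s \<le> r" if "P s" for s unfolding r_def by (rule Greatest_le_nat[where P = P and b = L]) (fact that, rule bound)
  from Pr obtain ws \<iota> where dual: "\<And>i j. i < r \<Longrightarrow> j < r \<Longrightarrow> (\<Sum>l<L. f (ws i) l * \<iota> l j) = (if i = j then 1 else 0)"
    unfolding P_def by blast
  have "f w l0 = (\<Sum>i<r. (\<Sum>l'<L. f w l' * \<iota> l' i) * f (ws i) l0)" if l0: "l0 < L" for w l0
  proof (rule ccontr)
    define c where "c i = (\<Sum>l'<L. f w l' * \<iota> l' i)" for i
    define q where "q = f w l0 - (\<Sum>i<r. c i * f (ws i) l0)"
    assume "f w l0 \<noteq> (\<Sum>i<r. (\<Sum>l'<L. f w l' * \<iota> l' i) * f (ws i) l0)"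
    then have q: "q \<noteq> 0" by (simp add: q_def c_def)
    \<comment> \<open>The unit vector at l0 minus its projection along the old system, scaled by q:
      it pairs to 0 with each \<open>f (ws j)\<close> and to 1 with \<open>f w\<close>.\<close>
    define u where "u l = ((if l = l0 then 1 else 0) - (\<Sum>i<r. \<iota> l i * f (ws i) l0)) / q" for l
    have fu: "(\<Sum>l<L. g l * u l) = (g l0 - (\<Sum>i<r. (\<Sum>l<L. g l * \<iota> l i) * f (ws i) l0)) / q" for g
    proof -
      have "(\<Sum>l<L. g l * u l) = (\<Sum>l<L. g l * (if l = l0 then 1 else 0) - (\<Sum>i<r. g l * \<iota> l i * f (ws i) l0)) / q"
        unfolding u_def sum_divide_distrib[where r = q]
        by (intro sum.cong refl) (simp add: right_diff_distrib sum_distrib_left mult.assoc)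
      also have "\<dots> = ((\<Sum>l<L. g l * (if l = l0 then 1 else 0)) - (\<Sum>l<L. \<Sum>i<r. g l * \<iota> l i * f (ws i) l0)) / q"
        by (simp only: sum_subtractf)
      also have "(\<Sum>l<L. \<Sum>i<r. g l * \<iota> l i * f (ws i) l0) = (\<Sum>i<r. (\<Sum>l<L. g l * \<iota> l i) * f (ws i) l0)"
        unfolding sum_distrib_right by (rule sum.swap)
      finally show ?thesis using l0 by simp
    qed
    have u0: "(\<Sum>l<L. f (ws j) l * u l) = 0" if "j < r" for j
    proof -
      have "(\<Sum>i<r. (\<Sum>l<L. f (ws j) l * \<iota> l i) * f (ws i) l0) = (\<Sum>i<r. (if j = i then 1 else 0) * f (ws i) l0)"
        by (intro sum.cong refl) (simp add: dual that)
      then show ?thesis unfolding fu using that by simp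
    qed
    have u1: "(\<Sum>l<L. f w l * u l) = 1"
      unfolding fu c_def[symmetric] q_def[symmetric] using q by simp
    define ws' where "ws' i = (if i < r then ws i else w)" for i
    \<comment> \<open>The old dual vectors are corrected by multiples of u so that they pair to 0
      with the new member.\<close>
    define \<iota>' where "\<iota>' l j = (if j < r then \<iota> l j - u l * c j else u l)" for l j
    have e: "(\<Sum>l<L. g l * \<iota>' l j) = (if j < r then (\<Sum>l<L. g l * \<iota> l j) - (\<Sum>l<L. g l * u l) * c j else (\<Sum>l<L. g l * u l))" for g j
      unfolding \<iota>'_def by (simp add: right_diff_distrib sum_subtractf sum_distrib_right mult.assoc)
    have "(\<Sum>l<L. f (ws' i) l * \<iota>' l j) = (if i = j then 1 else 0)" if "i < Suc r" "j < Suc r" for i j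
      unfolding e using that dual[of i j] u0[of i] u1 by (cases "i < r"; cases "j < r") (auto simp: ws'_def c_def[symmetric])
    then have "P (Suc r)" unfolding P_def by blast
    from maxr[OF this] show False by simp
  qed
  then show ?thesis using dual unfolding dual_basis_def by blast
qed

lemma dual_basis_full:
  fixes f :: "'w \<Rightarrow> nat \<Rightarrow> 'a::field"
  assumes "dual_basis L f L ws \<iota>"
  shows "det (mat L L (\<lambda>(i, l). f (ws i) l)) \<noteq> 0" "det (mat L L (\<lambda>(l, i). f (ws i) l)) \<noteq> 0"
proof -
  let ?S = "mat L L (\<lambda>(i, l). f (ws i) l)" and ?T = "mat L L (\<lambda>(l, j). \<iota> l j)"
  have c: "?S \<in> carrier_mat L L" "?T \<in> carrier_mat L L" by auto
  have "?S * ?T = 1\<^sub>m L"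
  proof (rule eq_matI)
    fix i j assume "i < dim_row (1\<^sub>m L :: 'a mat)" "j < dim_col (1\<^sub>m L :: 'a mat)"
    then have ij: "i < L" "j < L" by auto
    show "(?S * ?T) $$ (i, j) = 1\<^sub>m L $$ (i, j)"
      unfolding index_mult_mat_sum[OF c ij] using dual_basisD(1)[OF assms ij] ij by simp
  qed auto
  then have d: "det ?S * det ?T = 1" using det_mult[OF c] by simp
  then show "det ?S \<noteq> 0" by auto
  have "mat L L (\<lambda>(l, i). f (ws i) l) = transpose_mat ?S" by (rule eq_matI) auto
  then show "det (mat L L (\<lambda>(l, i). f (ws i) l)) \<noteq> 0" using d det_transpose[OF c(1)] by auto
qed

text \<open>The projection built from a dual basis has rank r < L, hence is not the identity; a
  nonzero column of the complementary projection annihilates the family.\<close>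

lemma dual_basis_annihilator:
  fixes f :: "'w \<Rightarrow> nat \<Rightarrow> 'a::field"
  assumes b: "dual_basis L f r ws \<iota>" and r: "r < L"
  shows "\<exists>v. (\<exists>l<L. v l \<noteq> 0) \<and> (\<forall>w. (\<Sum>l<L. f w l * v l) = 0)"
proof -
  have "\<exists>l<L. \<exists>l'<L. (\<Sum>i<r. \<iota> l i * f (ws i) l') \<noteq> (if l = l' then 1 else 0)"
    using rect_inverse_le[where r = L and L = r and F = \<iota> and G = "\<lambda>i. f (ws i)"] r by (meson not_le)
  then obtain l l' where l: "l < L" "l' < L" "(\<Sum>i<r. \<iota> l i * f (ws i) l') \<noteq> (if l = l' then 1 else 0)" by blast
  \<comment> \<open>Column l' of the identity minus the projection.\<close>
  define v where "v l = (if l = l' then 1 else 0) - (\<Sum>i<r. \<iota> l i * f (ws i) l')" for l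
  have "(\<Sum>l<L. f w l * v l) = 0" for w
  proof -
    have "(\<Sum>l<L. f w l * v l) = (\<Sum>l<L. f w l * (if l = l' then 1 else 0)) - (\<Sum>l<L. \<Sum>i<r. f w l * \<iota> l i * f (ws i) l')"
      unfolding v_def by (simp add: right_diff_distrib sum_subtractf sum_distrib_left mult.assoc)
    also have "(\<Sum>l<L. \<Sum>i<r. f w l * \<iota> l i * f (ws i) l') = (\<Sum>i<r. (\<Sum>l<L. f w l * \<iota> l i) * f (ws i) l')"
      unfolding sum_distrib_right by (rule sum.swap)
    also have "\<dots> = f w l'" by (rule dual_basisD(2)[OF b l(2), symmetric])
    finally show ?thesis using l(2) by simp
  qed
  moreover have "v l \<noteq> 0" using l(3) by (simp add: v_def)
  ultimately show ?thesis using l(1) by blast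
qed

section \<open>Reduction of realizations\<close>

definition obs_row :: "nat \<Rightarrow> ('d \<Rightarrow> nat \<Rightarrow> nat \<Rightarrow> 'r::comm_ring_1) \<Rightarrow> (nat \<Rightarrow> 'r) \<Rightarrow> 'd list \<Rightarrow> nat \<Rightarrow> 'r" where
  "obs_row L A C w l = (\<Sum>i<L. C i * word_act L A w (unit_fun l) i)"

definition ctr_col :: "nat \<Rightarrow> ('d \<Rightarrow> nat \<Rightarrow> nat \<Rightarrow> 'r::comm_ring_1) \<Rightarrow> ('d \<Rightarrow> nat \<Rightarrow> 'r) \<Rightarrow> 'd list \<times> 'd \<Rightarrow> nat \<Rightarrow> 'r" where
  "ctr_col L A B wk l = word_act L A (fst wk) (B (snd wk)) l"

lemma obs_row_act: "(\<Sum>l<L. obs_row L A C w l * x l) = (\<Sum>i<L. C i * word_act L A w x i)"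
proof -
  have "(\<Sum>l<L. obs_row L A C w l * x l) = (\<Sum>l<L. \<Sum>i<L. C i * (word_act L A w (unit_fun l) i * x l))"
    unfolding obs_row_def by (simp add: sum_distrib_right mult.assoc)
  also have "\<dots> = (\<Sum>i<L. \<Sum>l<L. C i * (word_act L A w (unit_fun l) i * x l))" by (rule sum.swap)
  also have "\<dots> = (\<Sum>i<L. C i * word_act L A w x i)"
    unfolding sum_distrib_left[symmetric] by (intro sum.cong refl) (simp add: word_act_expand[symmetric])
  finally show ?thesis .
qed

lemma obs_row_Nil: "l < L \<Longrightarrow> obs_row L A C [] l = C l"
  by (simp add: obs_row_def unit_fun_def)

text \<open>Rows grow at the last letter, whereas \<open>word_act\<close> recurses on the first one;
  splitting the word by \<open>word_act_append\<close> reconciles them.\<close>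

lemma obs_row_snoc:
  assumes "l < L"
  shows "obs_row L A C (w @ [k]) l = (\<Sum>j<L. obs_row L A C w j * A k j l)"
proof -
  have "(\<Sum>j<L. obs_row L A C w j * A k j l) = (\<Sum>i<L. C i * word_act L A w (\<lambda>j. A k j l) i)"
    by (rule obs_row_act)
  also have "\<dots> = obs_row L A C (w @ [k]) l"
    unfolding obs_row_def word_act_append
    by (intro sum.cong refl arg_cong2[where f = "(*)"] word_act_cong) (use assms in \<open>auto simp: unit_fun_def\<close>)
  finally show ?thesis ..
qed

text \<open>For a square system over a field, solvability for all forcings provides a right inverse
  of the pencil. Quotients inherit surjectivity more easily than injectivity.\<close>

lemma well_posedI_surj:
  fixes X :: "'d::finite \<Rightarrow> nat \<Rightarrow> nat \<Rightarrow> 'a::field"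
  assumes "\<And>z. \<exists>x. \<forall>a<n. \<forall>i<L. x a i = fm_step n L X A x a i + z a i"
  shows "well_posed n L X A"
proof -
  let ?P = "pencil n L X A"
  have "\<exists>v\<in>carrier_vec (L * n). ?P *\<^sub>v v = unit_vec (L * n) q" for q
  proof -
    obtain x where x: "\<forall>a<n. \<forall>i<L. x a i = fm_step n L X A x a i + (if a * L + i = q then 1 else 0)"
      using assms[of "\<lambda>a i. if a * L + i = q then 1 else 0"] by blast
    define v where "v = vec (L * n) (\<lambda>p. x (p div L) (p mod L))"
    have v: "v \<in> carrier_vec (L * n)" by (simp add: v_def)
    have vx: "v $ (b * L + j) = x b j" if "b < n" "j < L" for b j
      using that mult_add_less'[OF that] by (simp add: v_def)
    have "?P *\<^sub>v v = unit_vec (L * n) q"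
    proof (rule vec_block_eqI)
      fix a i assume ai: "a < n" "i < L"
      have 1: "(?P *\<^sub>v v) $ (a * L + i) = x a i - fm_step n L X A x a i"
        by (rule pencil_mult_vec[OF v]) (auto simp: vx ai)
      have 2: "x a i = fm_step n L X A x a i + (if a * L + i = q then 1 else 0)" using x ai by blast
      have 3: "unit_vec (L * n) q $ (a * L + i) = (if a * L + i = q then 1 else (0::'a))"
        unfolding unit_vec_def by (rule index_vec) (rule mult_add_less'[OF ai])
      show "(?P *\<^sub>v v) $ (a * L + i) = unit_vec (L * n) q $ (a * L + i)"
        unfolding 1 3 diff_eq_eq by (subst 2) (rule add.commute)
    qed (auto intro: mult_mat_vec_carrier[OF pencil_carrier v])
    then show ?thesis using v by blast
  qed
  then obtain V where V: "\<And>q. V q \<in> carrier_vec (L * n)" "\<And>q. ?P *\<^sub>v V q = unit_vec (L * n) q" by metis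
  define N where "N = mat (L * n) (L * n) (\<lambda>(p, q). V q $ p)"
  have N: "N \<in> carrier_mat (L * n) (L * n)" by (simp add: N_def)
  have "?P * N = 1\<^sub>m (L * n)"
  proof (rule eq_matI)
    fix p q assume "p < dim_row (1\<^sub>m (L * n) :: 'a mat)" "q < dim_col (1\<^sub>m (L * n) :: 'a mat)"
    then have pq: "p < L * n" "q < L * n" by auto
    have "(?P * N) $$ (p, q) = (\<Sum>l<L * n. ?P $$ (p, l) * N $$ (l, q))"
      by (rule index_mult_mat_sum[OF pencil_carrier N pq])
    also have "\<dots> = (?P *\<^sub>v V q) $ p"
      unfolding index_mult_vec_sum[OF pencil_carrier V(1) pq(1)] using pq by (intro sum.cong refl) (simp add: N_def)
    finally show "(?P * N) $$ (p, q) = 1\<^sub>m (L * n) $$ (p, q)" using V(2) pq by (auto simp: unit_vec_def)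
  qed (use N carrier_matD[OF pencil_carrier[of n L X A]] in auto)
  then have "det ?P * det N = 1" using det_mult[OF pencil_carrier[of n L X A] N] by simp
  then show ?thesis unfolding well_posed_iff_det by auto
qed

lemma fm_step_intertwine:
  assumes "\<And>k i l. i < r \<Longrightarrow> l < L \<Longrightarrow> (\<Sum>j<L. S i j * A k j l) = (\<Sum>j<r. A' k i j * S j l)" "i < r"
  shows "(\<Sum>l<L. S i l * fm_step n L X A x a l) = fm_step n r X A' (\<lambda>b j. \<Sum>l<L. S j l * x b l) a i"
proof -
  have "(\<Sum>l<L. S i l * (\<Sum>j<L. A k l j * x b j)) = (\<Sum>j<r. A' k i j * (\<Sum>l<L. S j l * x b l))" for k b
  proof -
    have "(\<Sum>l<L. S i l * (\<Sum>j<L. A k l j * x b j)) = (\<Sum>l<L. \<Sum>j<L. S i l * A k l j * x b j)"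
      by (simp add: sum_distrib_left mult.assoc)
    also have "\<dots> = (\<Sum>j<L. (\<Sum>l<L. S i l * A k l j) * x b j)"
      unfolding sum_distrib_right by (rule sum.swap)
    also have "\<dots> = (\<Sum>j<L. \<Sum>j'<r. A' k i j' * S j' j * x b j)"
      by (intro sum.cong refl) (simp add: assms sum_distrib_right)
    also have "\<dots> = (\<Sum>j'<r. \<Sum>j<L. A' k i j' * S j' j * x b j)" by (rule sum.swap)
    finally show ?thesis by (simp add: sum_distrib_left mult.assoc)
  qed
  note key = this
  have "(\<Sum>l<L. S i l * fm_step n L X A x a l) = (\<Sum>l<L. \<Sum>k\<in>UNIV. \<Sum>b<n. X k a b * (S i l * (\<Sum>j<L. A k l j * x b j)))"
    unfolding fm_step_def by (simp only: sum_distrib_left mult.left_commute)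
  also have "\<dots> = (\<Sum>k\<in>UNIV. \<Sum>l<L. \<Sum>b<n. X k a b * (S i l * (\<Sum>j<L. A k l j * x b j)))" by (rule sum.swap)
  also have "\<dots> = (\<Sum>k\<in>UNIV. \<Sum>b<n. \<Sum>l<L. X k a b * (S i l * (\<Sum>j<L. A k l j * x b j)))"
    by (rule sum.cong[OF refl], rule sum.swap)
  also have "\<dots> = fm_step n r X A' (\<lambda>b j. \<Sum>l<L. S j l * x b l) a i"
    unfolding fm_step_def by (simp only: sum_distrib_left[symmetric] key)
  finally show ?thesis .
qed

lemma fm_input_intertwine:
  assumes "\<And>k. (\<Sum>l<L. S i l * B k l) = B' k i"
  shows "(\<Sum>l<L. S i l * fm_input n X B y a l) = fm_input n X B' y a i"
proof -
  have "(\<Sum>l<L. S i l * fm_input n X B y a l) = (\<Sum>l<L. \<Sum>k\<in>UNIV. \<Sum>b<n. X k a b * (S i l * B k l * y b))"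
    unfolding fm_input_def by (simp only: sum_distrib_left mult_ac)
  also have "\<dots> = (\<Sum>k\<in>UNIV. \<Sum>l<L. \<Sum>b<n. X k a b * (S i l * B k l * y b))" by (rule sum.swap)
  also have "\<dots> = (\<Sum>k\<in>UNIV. \<Sum>b<n. \<Sum>l<L. X k a b * (S i l * B k l * y b))"
    by (rule sum.cong[OF refl], rule sum.swap)
  also have "\<dots> = fm_input n X B' y a i"
    unfolding fm_input_def by (simp only: sum_distrib_left[symmetric] sum_distrib_right[symmetric] assms)
  finally show ?thesis .
qed

text \<open>S is the projection to a quotient of the state space on which the system is still
  defined and through which C factors; \<iota> is a section of S.\<close>

lemma realizes_quotient:
  fixes X :: "'d::finite \<Rightarrow> nat \<Rightarrow> nat \<Rightarrow> 'a::field"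
  assumes real: "realizes n L X A B C D V"
    and SA: "\<And>k i l. i < r \<Longrightarrow> l < L \<Longrightarrow> (\<Sum>j<L. S i j * A k j l) = (\<Sum>j<r. A' k i j * S j l)"
    and SB: "\<And>k i. i < r \<Longrightarrow> (\<Sum>l<L. S i l * B k l) = B' k i"
    and CS: "\<And>l. l < L \<Longrightarrow> C l = (\<Sum>i<r. C' i * S i l)"
    and S\<iota>: "\<And>i j. i < r \<Longrightarrow> j < r \<Longrightarrow> (\<Sum>l<L. S i l * \<iota> l j) = (if i = j then 1 else 0)"
  shows "realizes n r X A' B' C' D V"
proof -
  have wp: "well_posed n L X A" using real by (simp add: realizes_def)
  have step: "(\<Sum>l<L. S i l * fm_step n L X A x a l) = fm_step n r X A' (\<lambda>b j. \<Sum>l<L. S j l * x b l) a i"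
    if "i < r" for x a i by (rule fm_step_intertwine[OF _ that]) (rule SA)
  have inp: "(\<Sum>l<L. S i l * fm_input n X B y a l) = fm_input n X B' y a i" if "i < r" for y a i
    by (rule fm_input_intertwine) (rule SB[OF that])
  have wp': "well_posed n r X A'"
  proof (rule well_posedI_surj)
    fix z :: "nat \<Rightarrow> nat \<Rightarrow> 'a"
    obtain x where x: "\<forall>a<n. \<forall>l<L. x a l = fm_step n L X A x a l + (\<Sum>j<r. \<iota> l j * z a j)"
      \<comment> \<open>The forcing z of the quotient is lifted by the section; the projected
        solution then has forcing z.\<close>
      using forced_solution[OF wp, of "\<lambda>a l. \<Sum>j<r. \<iota> l j * z a j"] by blast
    have sol: "(\<Sum>l<L. S i l * x a l) = fm_step n r X A' (\<lambda>b j. \<Sum>l<L. S j l * x b l) a i + z a i" if a: "a < n" and i: "i < r" for a i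
    proof -
      have "(\<Sum>l<L. S i l * x a l) = (\<Sum>l<L. S i l * (fm_step n L X A x a l + (\<Sum>j<r. \<iota> l j * z a j)))"
        by (rule sum.cong[OF refl], rule arg_cong[where f = "(*) _"]) (use x a in blast)
      also have "\<dots> = (\<Sum>l<L. S i l * fm_step n L X A x a l) + (\<Sum>l<L. \<Sum>j<r. S i l * \<iota> l j * z a j)"
        by (simp add: distrib_left sum.distrib sum_distrib_left mult.assoc)
      also have "(\<Sum>l<L. \<Sum>j<r. S i l * \<iota> l j * z a j) = (\<Sum>j<r. (\<Sum>l<L. S i l * \<iota> l j) * z a j)"
        unfolding sum_distrib_right by (rule sum.swap)
      also have "\<dots> = (\<Sum>j<r. (if i = j then 1 else 0) * z a j)"
        by (intro sum.cong refl) (simp add: S\<iota> i)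
      also have "\<dots> = z a i" using i by simp
      finally show ?thesis unfolding step[OF i] .
    qed
    show "\<exists>x. \<forall>a<n. \<forall>i<r. x a i = fm_step n r X A' x a i + z a i"
      by (rule exI[of _ "\<lambda>b j. \<Sum>l<L. S j l * x b l"], intro allI impI, rule sol)
  qed
  show ?thesis unfolding realizes_def
  proof (intro conjI allI impI wp')
    fix x' y a assume s': "fm_sys n r X A' B' x' y" and a: "a < n"
    obtain x where s: "fm_sys n L X A B x y" using fm_sys_solution[OF wp] by blast
    have "fm_sys n r X A' B' (\<lambda>a i. \<Sum>l<L. S i l * x a l) y"
      unfolding fm_sys_def
    proof (intro allI impI)
      fix a i assume a: "a < n" and i: "i < r"
      have "(\<Sum>l<L. S i l * x a l) = (\<Sum>l<L. S i l * (fm_step n L X A x a l + fm_input n X B y a l))"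
        by (rule sum.cong[OF refl], rule arg_cong[where f = "(*) _"]) (use s a in \<open>unfold fm_sys_def, blast\<close>)
      also have "\<dots> = (\<Sum>l<L. S i l * fm_step n L X A x a l) + (\<Sum>l<L. S i l * fm_input n X B y a l)"
        by (simp add: distrib_left sum.distrib)
      finally show "(\<Sum>l<L. S i l * x a l) = fm_step n r X A' (\<lambda>a i. \<Sum>l<L. S i l * x a l) a i + fm_input n X B' y a i"
        unfolding step[OF i] inp[OF i] .
    qed
    from fm_sys_unique[OF wp' s' this a] have x': "x' a i = (\<Sum>l<L. S i l * x a l)" if "i < r" for i using that .
    have "(\<Sum>i<r. C' i * x' a i) = (\<Sum>i<r. \<Sum>l<L. C' i * S i l * x a l)"
      by (intro sum.cong refl) (simp add: x' sum_distrib_left mult.assoc)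
    also have "\<dots> = (\<Sum>l<L. (\<Sum>i<r. C' i * S i l) * x a l)"
      unfolding sum_distrib_right by (rule sum.swap)
    also have "\<dots> = (\<Sum>l<L. C l * x a l)" by (intro sum.cong refl) (simp add: CS)
    finally show "(\<Sum>b<n. V a b * y b) = D * y a + (\<Sum>i<r. C' i * x' a i)"
      using real s a unfolding realizes_def by simp
  qed
qed

text \<open>T embeds an invariant subspace that contains the columns of B, so a state of the small
  system becomes one of the large system.\<close>

lemma realizes_subspace:
  fixes X :: "'d::finite \<Rightarrow> nat \<Rightarrow> nat \<Rightarrow> 'a::field"
  assumes real: "realizes n L X A B C D V"
    and AT: "\<And>k l i. l < L \<Longrightarrow> i < r \<Longrightarrow> (\<Sum>j<L. A k l j * T j i) = (\<Sum>j<r. T l j * A' k j i)"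
    and BT: "\<And>k l. l < L \<Longrightarrow> B k l = (\<Sum>i<r. T l i * B' k i)"
    and CT: "\<And>i. i < r \<Longrightarrow> C' i = (\<Sum>l<L. C l * T l i)"
    and T\<iota>: "\<And>i j. i < r \<Longrightarrow> j < r \<Longrightarrow> (\<Sum>l<L. T l i * \<iota> l j) = (if i = j then 1 else 0)"
  shows "realizes n r X A' B' C' D V"
proof -
  have wp: "well_posed n L X A" using real by (simp add: realizes_def)
  have lift: "fm_sys n L X A B (\<lambda>a l. \<Sum>i<r. T l i * x a i) y" if s: "fm_sys n r X A' B' x y" for x y
    unfolding fm_sys_def
  proof (intro allI impI)
    fix a l assume a: "a < n" and l: "l < L"
    have "(\<Sum>i<r. T l i * x a i) = (\<Sum>i<r. T l i * (fm_step n r X A' x a i + fm_input n X B' y a i))"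
      by (rule sum.cong[OF refl], rule arg_cong[where f = "(*) _"]) (use s a in \<open>unfold fm_sys_def, blast\<close>)
    also have "\<dots> = (\<Sum>i<r. T l i * fm_step n r X A' x a i) + (\<Sum>i<r. T l i * fm_input n X B' y a i)"
      by (simp add: distrib_left sum.distrib)
    also have "(\<Sum>i<r. T l i * fm_step n r X A' x a i) = fm_step n L X A (\<lambda>a l. \<Sum>i<r. T l i * x a i) a l"
      by (rule fm_step_intertwine[OF _ l]) (rule AT[symmetric])
    also have "(\<Sum>i<r. T l i * fm_input n X B' y a i) = fm_input n X B y a l"
      by (rule fm_input_intertwine) (rule BT[OF l, symmetric])
    finally show "(\<Sum>i<r. T l i * x a i) = fm_step n L X A (\<lambda>a l. \<Sum>i<r. T l i * x a i) a l + fm_input n X B y a l" .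
  qed
  show ?thesis unfolding realizes_def
  proof (intro conjI allI impI)
    show "well_posed n r X A'" unfolding well_posed_iff_sys[where B = B']
    proof (intro allI impI)
      fix x a i assume s: "fm_sys n r X A' B' x (\<lambda>_. 0)" and a: "a < n" and i: "i < r"
      have z: "(\<Sum>i<r. T l i * x a i) = 0" if "l < L" for l
        using lift[OF s] wp a that unfolding well_posed_iff_sys[where B = B] by blast
      \<comment> \<open>The dual vectors \<iota> invert T from the left, so T x = 0 gives x =
        0.\<close>
      have "x a i = (\<Sum>j<r. (if j = i then 1 else 0) * x a j)" using i by simp
      also have "\<dots> = (\<Sum>j<r. (\<Sum>l<L. T l j * \<iota> l i) * x a j)" by (intro sum.cong refl) (simp add: T\<iota> i)
      also have "\<dots> = (\<Sum>l<L. \<iota> l i * (\<Sum>j<r. T l j * x a j))"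
        unfolding sum_distrib_left sum_distrib_right by (subst sum.swap) (simp only: mult_ac)
      also have "\<dots> = 0" by (intro sum.neutral ballI) (simp add: z)
      finally show "x a i = 0" .
    qed
  next
    fix x y a assume s: "fm_sys n r X A' B' x y" and a: "a < n"
    have "(\<Sum>b<n. V a b * y b) = D * y a + (\<Sum>l<L. C l * (\<Sum>i<r. T l i * x a i))"
      using real lift[OF s] a unfolding realizes_def by blast
    also have "(\<Sum>l<L. C l * (\<Sum>i<r. T l i * x a i)) = (\<Sum>l<L. \<Sum>i<r. C l * T l i * x a i)"
      by (simp add: sum_distrib_left mult.assoc)
    also have "\<dots> = (\<Sum>i<r. (\<Sum>l<L. C l * T l i) * x a i)"
      unfolding sum_distrib_right by (rule sum.swap)
    also have "\<dots> = (\<Sum>i<r. C' i * x a i)" by (intro sum.cong refl) (simp add: CT)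
    finally show "(\<Sum>b<n. V a b * y b) = D * y a + (\<Sum>i<r. C' i * x a i)" .
  qed
qed

text \<open>The rows \<open>C A\<^sub>w\<close> span a space that contains C and is invariant under
  multiplication by \<open>A\<^sub>k\<close> from the right. A basis of it is the projection modulo
  the unobservable states.\<close>

lemma reduce_observable:
  fixes A :: "'d::finite \<Rightarrow> nat \<Rightarrow> nat \<Rightarrow> 'a::field"
  assumes b: "dual_basis L (obs_row L A C) r ws \<iota>"
  shows "\<exists>A' B' C'. \<forall>n X V D. realizes n L X A B C D V \<longrightarrow> realizes n r X A' B' C' D V"
proof -
  let ?f = "obs_row L A C"
  have dual: "(\<Sum>l<L. ?f (ws i) l * \<iota> l j) = (if i = j then 1 else 0)" if "i < r" "j < r" for i j
    using b that unfolding dual_basis_def by blast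
  have span: "?f w l = (\<Sum>i<r. (\<Sum>l'<L. ?f w l' * \<iota> l' i) * ?f (ws i) l)" if "l < L" for w l
    using b that unfolding dual_basis_def by blast
  define A' where "A' k i j = (\<Sum>l<L. ?f (ws i @ [k]) l * \<iota> l j)" for k i j
  define B' where "B' k i = (\<Sum>l<L. ?f (ws i) l * B k l)" for k i
  define C' where "C' i = (\<Sum>l<L. ?f [] l * \<iota> l i)" for i
  have R: "realizes n r X A' B' C' D V" if real: "realizes n L X A B C D V" for n X V D
  proof (rule realizes_quotient[OF real, where S = "\<lambda>i. ?f (ws i)" and \<iota> = \<iota>])
    show "(\<Sum>j<L. ?f (ws i) j * A k j l) = (\<Sum>j<r. A' k i j * ?f (ws j) l)" if "i < r" "l < L" for k i l
      using span[OF that(2), of "ws i @ [k]"] unfolding obs_row_snoc[OF that(2), symmetric] A'_def .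
    show "C l = (\<Sum>i<r. C' i * ?f (ws i) l)" if "l < L" for l
      using span[OF that, of "[]"] obs_row_Nil[OF that] unfolding C'_def by metis
  qed (simp_all only: B'_def dual)
  show ?thesis by (rule exI[of _ A'], rule exI[of _ B'], rule exI[of _ C'], intro allI impI, rule R)
qed

text \<open>The columns \<open>A\<^sub>w B\<^sub>k\<close> span an invariant subspace that contains
  all \<open>B\<^sub>k\<close>; the reduced coefficients are coordinates in a basis of it.\<close>

lemma reduce_controllable:
  fixes A :: "'d::finite \<Rightarrow> nat \<Rightarrow> nat \<Rightarrow> 'a::field"
  assumes b: "dual_basis L (ctr_col L A B) r ws \<iota>"
  shows "\<exists>A' B' C'. \<forall>n X V D. realizes n L X A B C D V \<longrightarrow> realizes n r X A' B' C' D V"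
proof -
  let ?f = "ctr_col L A B"
  have dual: "(\<Sum>l<L. ?f (ws i) l * \<iota> l j) = (if i = j then 1 else 0)" if "i < r" "j < r" for i j
    using b that unfolding dual_basis_def by blast
  have span: "?f w l = (\<Sum>i<r. ?f (ws i) l * (\<Sum>l'<L. ?f w l' * \<iota> l' i))" if "l < L" for w l
    using dual_basisD(2)[OF b that, of w] by (simp only: mult.commute)
  define A' where "A' k i j = (\<Sum>l<L. ?f (k # fst (ws j), snd (ws j)) l * \<iota> l i)" for k i j
  define B' where "B' k i = (\<Sum>l<L. ?f ([], k) l * \<iota> l i)" for k i
  define C' where "C' i = (\<Sum>l<L. C l * ?f (ws i) l)" for i
  have R: "realizes n r X A' B' C' D V" if real: "realizes n L X A B C D V" for n X V D
  proof (rule realizes_subspace[OF real, where T = "\<lambda>l i. ?f (ws i) l" and \<iota> = \<iota>])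
    show "(\<Sum>j<L. A k l j * ?f (ws i) j) = (\<Sum>j<r. ?f (ws j) l * A' k j i)" if "l < L" "i < r" for k l i
      using span[OF that(1), of "(k # fst (ws i), snd (ws i))"] unfolding A'_def by (simp add: ctr_col_def)
    show "B k l = (\<Sum>i<r. ?f (ws i) l * B' k i)" if "l < L" for k l
      using span[OF that, of "([], k)"] unfolding B'_def by (simp add: ctr_col_def)
  qed (simp_all only: C'_def dual)
  show ?thesis by (rule exI[of _ A'], rule exI[of _ B'], rule exI[of _ C'], intro allI impI, rule R)
qed

section \<open>Markov parameters\<close>

lemma realizes_at_origin:
  fixes X :: "'d::finite \<Rightarrow> nat \<Rightarrow> nat \<Rightarrow> 'a::field"
  assumes "realizes 1 L X A B C D V" "\<And>k. X k 0 0 = 0"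
  shows "V 0 0 = D"
proof -
  have "fm_sys 1 L X A B (\<lambda>_ _. 0) (\<lambda>_. 1)"
    by (simp add: fm_sys_alt assms(2))
  then show ?thesis using assms(1) unfolding realizes_def by fastforce
qed

text \<open>At the shift along w k the input at the last position enters through B with the letter k
  and travels back through w to position 0. The w k has one letter more than w, and positions
  outnumber letters by one, whence the size.\<close>

lemma markov_value:
  fixes A :: "'d::finite \<Rightarrow> nat \<Rightarrow> nat \<Rightarrow> 'a::field"
  defines "\<And>w k. N w k \<equiv> \<lambda>k'. ent (shift_mat (Suc (Suc (length w))) (w @ [k]) k')"
  assumes real: "realizes (Suc (Suc (length w))) L (N w k) A B C D V"
  shows "V 0 (Suc (length w)) = (\<Sum>i<L. C i * word_act L A w (B k) i)"
proof -
  let ?l = "length w" and ?M = "Suc (Suc (length w))" and ?W = "w @ [k]"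
  define y :: "nat \<Rightarrow> 'a" where "y b = (if b = Suc ?l then 1 else 0)" for b
  define x where "x a i = (if a \<le> ?l then word_act L A (factor ?W a ?l) (B k) i else 0)" for a i
  have "fm_sys ?M L (N w k) A B x y"
    unfolding fm_sys_def
  proof (intro allI impI)
    fix a i assume a: "a < ?M" and i: "i < L"
    have "fm_input ?M (N w k) B y a i = (\<Sum>k'\<in>UNIV. \<Sum>b<?M. N w k k' a b * (B k' i * y b))"
      by (simp add: fm_input_def)
    also have "\<dots> = (\<Sum>k'\<in>UNIV. \<Sum>b<?M. (if b = Suc ?l then 1 else 0) * (if k' = k then if a = ?l then B k' i else 0 else 0))"
      unfolding N_def y_def using a by (intro sum.cong refl) (auto simp: shift_mat_def nth_append)
    also have "\<dots> = (if a = ?l then B k i else 0)" unfolding sum_delta_mult by simp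
    finally have inp: "fm_input ?M (N w k) B y a i = (if a = ?l then B k i else 0)" .
    show "x a i = fm_step ?M L (N w k) A x a i + fm_input ?M (N w k) B y a i"
      unfolding inp unfolding x_def N_def by (rule shift_solution) (use a in auto)
  qed
  then have "(\<Sum>b<?M. V 0 b * y b) = D * y 0 + (\<Sum>i<L. C i * x 0 i)"
    using real unfolding realizes_def by blast
  moreover have "(\<Sum>b<?M. V 0 b * y b) = V 0 (Suc ?l)" by (simp add: y_def)
  moreover have "factor ?W 0 ?l = w" by (simp add: factor_def)
  ultimately show ?thesis by (simp add: y_def x_def)
qed

section \<open>Inverting a matrix of expressions\<close>

lemma rexp_dom_Add: "Y \<in> rexp_dom n (Add R S) \<longleftrightarrow> Y \<in> rexp_dom n R \<and> Y \<in> rexp_dom n S"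
  and rexp_dom_Mul: "Y \<in> rexp_dom n (Mul R S) \<longleftrightarrow> Y \<in> rexp_dom n R \<and> Y \<in> rexp_dom n S"
  and rexp_dom_Poly: "Y \<in> rexp_dom n (Poly p) \<longleftrightarrow> Y \<in> matrix_tuples n"
  and rexp_dom_Inv: "Y \<in> rexp_dom n (Inv R) \<longleftrightarrow> Y \<in> rexp_dom n R \<and> mat_inverse (rexp_val n R Y) \<noteq> None"
  by (auto simp: rexp_dom_def rexp_val_def bind_eq_Some_conv)

lemma rexp_val_Add: "Y \<in> rexp_dom n (Add R S) \<Longrightarrow> rexp_val n (Add R S) Y = rexp_val n R Y + rexp_val n S Y"
  and rexp_val_Mul: "Y \<in> rexp_dom n (Mul R S) \<Longrightarrow> rexp_val n (Mul R S) Y = rexp_val n R Y * rexp_val n S Y"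
  and rexp_val_Inv: "Y \<in> rexp_dom n (Inv R) \<Longrightarrow> mat_inverse (rexp_val n R Y) = Some (rexp_val n (Inv R) Y)"
  by (auto simp: rexp_dom_def rexp_val_def bind_eq_Some_conv)

text \<open>Expressions are compared through their action on inputs: products become compositions,
  and elimination works on plain equations.\<close>

definition rexp_app :: "nat \<Rightarrow> ('d \<Rightarrow> 'a::field mat) \<Rightarrow> ('a, 'd) nc_rexp \<Rightarrow> (nat \<Rightarrow> 'a) \<Rightarrow> nat \<Rightarrow> 'a" where
  "rexp_app n Y R y a = (\<Sum>b<n. rexp_val n R Y $$ (a, b) * y b)"

lemma rexp_app_cong: "(\<And>b. b < n \<Longrightarrow> y b = y' b) \<Longrightarrow> rexp_app n Y R y a = rexp_app n Y R y' a"
  unfolding rexp_app_def by (intro sum.cong refl) simp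

lemma rexp_app_sum: "rexp_app n Y R (\<lambda>b. \<Sum>s\<in>S. y s b) a = (\<Sum>s\<in>S. rexp_app n Y R (y s) a)"
  unfolding rexp_app_def sum_distrib_left by (rule sum.swap)

lemma rexp_app_diff: "rexp_app n Y R (\<lambda>b. y b - y' b) a = rexp_app n Y R y a - rexp_app n Y R y' a"
  unfolding rexp_app_def by (simp add: right_diff_distrib sum_subtractf)

lemma rexp_app_zero [simp]: "rexp_app n Y R (\<lambda>b. 0) a = 0"
  by (simp add: rexp_app_def)

lemma rexp_app_Add:
  assumes "Y \<in> rexp_dom n (Add R S)" "a < n"
  shows "rexp_app n Y (Add R S) y a = rexp_app n Y R y a + rexp_app n Y S y a"
proof -
  have "Y \<in> rexp_dom n R" "Y \<in> rexp_dom n S" using assms(1) by (simp_all add: rexp_dom_Add)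
  note c = rexp_domD(3)[OF this(1)] rexp_domD(3)[OF this(2)]
  show ?thesis
    unfolding rexp_app_def rexp_val_Add[OF assms(1)] sum.distrib[symmetric]
    using c assms(2) by (intro sum.cong refl) (simp add: distrib_right)
qed

lemma mat_mult_app:
  assumes "P \<in> carrier_mat n n" "Q \<in> carrier_mat n n" "a < n"
  shows "(\<Sum>b<n. (P * Q) $$ (a, b) * y b) = (\<Sum>c<n. P $$ (a, c) * (\<Sum>b<n. Q $$ (c, b) * y b))"
proof -
  have "(\<Sum>b<n. (P * Q) $$ (a, b) * y b) = (\<Sum>b<n. \<Sum>c<n. P $$ (a, c) * (Q $$ (c, b) * y b))"
    using assms by (intro sum.cong refl) (simp add: index_mult_mat_sum sum_distrib_right mult.assoc del: index_mult_mat)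
  also have "\<dots> = (\<Sum>c<n. P $$ (a, c) * (\<Sum>b<n. Q $$ (c, b) * y b))"
    unfolding sum_distrib_left by (rule sum.swap)
  finally show ?thesis .
qed

lemma rexp_app_Mul:
  assumes "Y \<in> rexp_dom n (Mul R S)" "a < n"
  shows "rexp_app n Y (Mul R S) y a = rexp_app n Y R (rexp_app n Y S y) a"
proof -
  have "Y \<in> rexp_dom n R" "Y \<in> rexp_dom n S" using assms(1) by (simp_all add: rexp_dom_Mul)
  note c = rexp_domD(3)[OF this(1)] rexp_domD(3)[OF this(2)]
  show ?thesis
    unfolding rexp_app_def[abs_def] rexp_val_Mul[OF assms(1)] by (rule mat_mult_app[OF c assms(2)])
qed

lemma rexp_app_Inv:
  assumes "Y \<in> rexp_dom n (Inv R)" "a < n"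
  shows "rexp_app n Y (Inv R) (rexp_app n Y R y) a = y a"
proof -
  have "Y \<in> rexp_dom n R" using assms(1) by (simp add: rexp_dom_Inv)
  note c = rexp_domD(3)[OF this] rexp_domD(3)[OF assms(1)]
  have "rexp_val n (Inv R) Y * rexp_val n R Y = 1\<^sub>m n"
    using mat_inverse(2)[OF c(1) rexp_val_Inv[OF assms(1)]] by simp
  then have "rexp_app n Y (Inv R) (rexp_app n Y R y) a = (\<Sum>b<n. (1\<^sub>m n) $$ (a, b) * y b)"
    unfolding rexp_app_def[abs_def] mat_mult_app[OF c(2,1) assms(2), symmetric] by simp
  also have "\<dots> = (\<Sum>b<n. (if a = b then 1 else 0) * y b)"
    using assms(2) by (intro sum.cong) auto
  finally show ?thesis using assms(2) by simp
qed

definition rexp_const :: "'a::field \<Rightarrow> ('a, 'd) nc_rexp" where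
  "rexp_const c = Poly (Poly_Mapping.single [] c)"

definition rexp_var :: "'d \<Rightarrow> ('a::field, 'd) nc_rexp" where
  "rexp_var k = Poly (Poly_Mapping.single [k] 1)"

lemma rexp_dom_const [simp]: "Y \<in> rexp_dom n (rexp_const c) \<longleftrightarrow> Y \<in> matrix_tuples n"
  and rexp_dom_var [simp]: "Y \<in> rexp_dom n (rexp_var k) \<longleftrightarrow> Y \<in> matrix_tuples n"
  by (simp_all add: rexp_const_def rexp_var_def rexp_dom_Poly)

lemma rexp_val_var:
  fixes Y :: "'d \<Rightarrow> 'a::field mat"
  assumes "Y \<in> matrix_tuples n"
  shows "rexp_val n (rexp_var k) Y = Y k"
proof -
  have w: "word_mat n Y w \<in> carrier_mat n n" for w by (rule word_mat_carrier) (rule matrix_tuplesD[OF assms])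
  have k: "Poly_Mapping.keys (Poly_Mapping.single [k] (1::'a)) = insert [k] {}" by simp
  have "poly_eval n Y (Poly_Mapping.single [k] 1) = Y k"
    unfolding poly_eval_def k
    by (subst mat_sum_insert) (use w matrix_tuplesD[OF assms, of k] in \<open>auto simp: mat_sum_empty intro!: eq_matI\<close>)
  then show ?thesis by (simp add: rexp_var_def rexp_val_def)
qed

lemma rexp_val_const:
  fixes Y :: "'d \<Rightarrow> 'a::field mat"
  assumes "Y \<in> matrix_tuples n"
  shows "rexp_val n (rexp_const c) Y = c \<cdot>\<^sub>m 1\<^sub>m n"
proof -
  have w: "word_mat n Y w \<in> carrier_mat n n" for w by (rule word_mat_carrier) (rule matrix_tuplesD[OF assms])
  have "poly_eval n Y (Poly_Mapping.single [] c) = c \<cdot>\<^sub>m 1\<^sub>m n"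
  proof (cases "c = 0")
    case True
    then show ?thesis unfolding poly_eval_def by (auto simp: mat_sum_empty intro!: eq_matI)
  next
    case False
    then have k: "Poly_Mapping.keys (Poly_Mapping.single [] c) = insert ([]::'d list) {}" by simp
    show ?thesis unfolding poly_eval_def k
      by (subst mat_sum_insert) (use w in \<open>auto simp: mat_sum_empty intro!: eq_matI\<close>)
  qed
  then show ?thesis by (simp add: rexp_const_def rexp_val_def)
qed

lemma rexp_app_var: "Y \<in> matrix_tuples n \<Longrightarrow> rexp_app n Y (rexp_var k) y a = (\<Sum>b<n. Y k $$ (a, b) * y b)"
  by (simp add: rexp_app_def rexp_val_var)

lemma rexp_app_const:
  assumes "Y \<in> matrix_tuples n" "a < n"
  shows "rexp_app n Y (rexp_const c) y a = c * y a"
proof -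
  have "rexp_app n Y (rexp_const c) y a = (\<Sum>b<n. (if a = b then 1 else 0) * (c * y b))"
    unfolding rexp_app_def rexp_val_const[OF assms(1)] using assms(2) by (intro sum.cong) auto
  then show ?thesis using assms(2) by simp
qed

definition rexp_diff :: "('a::field, 'd) nc_rexp \<Rightarrow> ('a, 'd) nc_rexp \<Rightarrow> ('a, 'd) nc_rexp" where
  "rexp_diff R S = Add R (Mul (rexp_const (- 1)) S)"

lemma rexp_dom_diff: "Y \<in> rexp_dom n (rexp_diff R S) \<longleftrightarrow> Y \<in> rexp_dom n R \<and> Y \<in> rexp_dom n S"
  by (auto simp: rexp_diff_def rexp_dom_Add rexp_dom_Mul dest: rexp_domD(1))

lemma rexp_app_diff_rexp:
  assumes "Y \<in> rexp_dom n (rexp_diff R S)" "a < n"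
  shows "rexp_app n Y (rexp_diff R S) y a = rexp_app n Y R y a - rexp_app n Y S y a"
proof -
  have d: "Y \<in> rexp_dom n (Mul (rexp_const (- 1)) S)" "Y \<in> matrix_tuples n"
    using assms(1) by (auto simp: rexp_diff_def rexp_dom_Add dest: rexp_domD(1))
  show ?thesis
    using assms d unfolding rexp_diff_def by (simp add: rexp_app_Add rexp_app_Mul rexp_app_const)
qed

text \<open>Formal addition is neither associative nor commutative, so some enumeration of the index
  set is chosen; afterwards only domain and action are used.\<close>

definition rexp_sum :: "('k \<Rightarrow> ('a::field, 'd) nc_rexp) \<Rightarrow> 'k set \<Rightarrow> ('a, 'd) nc_rexp" where
  "rexp_sum f I = foldr (\<lambda>k R. Add (f k) R) (SOME ks. distinct ks \<and> set ks = I) (rexp_const 0)"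

lemma rexp_sum:
  assumes "finite I"
  shows rexp_dom_sum: "Y \<in> rexp_dom n (rexp_sum f I) \<longleftrightarrow> Y \<in> matrix_tuples n \<and> (\<forall>k\<in>I. Y \<in> rexp_dom n (f k))"
    and rexp_app_sum_rexp: "Y \<in> rexp_dom n (rexp_sum f I) \<Longrightarrow> a < n \<Longrightarrow>
      rexp_app n Y (rexp_sum f I) y a = (\<Sum>k\<in>I. rexp_app n Y (f k) y a)"
proof -
  have "\<exists>ks. distinct ks \<and> set ks = I" using finite_distinct_list[OF assms] by blast
  from someI_ex[OF this] obtain ks where ks: "distinct ks" "set ks = I"
    and s: "rexp_sum f I = foldr (\<lambda>k R. Add (f k) R) ks (rexp_const 0)"
    unfolding rexp_sum_def by blast
  have dom: "Y \<in> rexp_dom n (foldr (\<lambda>k R. Add (f k) R) ks (rexp_const 0)) \<longleftrightarrow>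
    Y \<in> matrix_tuples n \<and> (\<forall>k\<in>set ks. Y \<in> rexp_dom n (f k))" for ks
    by (induction ks) (auto simp: rexp_dom_Add)
  then show "Y \<in> rexp_dom n (rexp_sum f I) \<longleftrightarrow> Y \<in> matrix_tuples n \<and> (\<forall>k\<in>I. Y \<in> rexp_dom n (f k))"
    unfolding s unfolding ks(2)[symmetric] .
  assume Y: "Y \<in> rexp_dom n (rexp_sum f I)" and a: "a < n"
  have "rexp_app n Y (foldr (\<lambda>k R. Add (f k) R) ks (rexp_const 0)) y a = (\<Sum>k\<in>set ks. rexp_app n Y (f k) y a)"
    using Y[unfolded s] ks(1)
  proof (induction ks)
    case Nil
    then show ?case using a by (simp add: rexp_app_const)
  next
    case (Cons k ks)
    then show ?case using a by (simp add: rexp_app_Add rexp_dom_Add)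
  qed
  then show "rexp_app n Y (rexp_sum f I) y a = (\<Sum>k\<in>I. rexp_app n Y (f k) y a)"
    unfolding s unfolding ks(2)[symmetric] .
qed

lemma rexp_val_eqI:
  assumes "Y \<in> rexp_dom n R" "M \<in> carrier_mat n n"
    and "\<And>a y. a < n \<Longrightarrow> rexp_app n Y R y a = (\<Sum>b<n. M $$ (a, b) * y b)"
  shows "rexp_val n R Y = M"
proof (rule eq_matI)
  fix a b assume "a < dim_row M" "b < dim_col M"
  then have ab: "a < n" "b < n" using assms(2) by auto
  show "rexp_val n R Y $$ (a, b) = M $$ (a, b)"
    using assms(3)[OF ab(1), of "\<lambda>c. if c = b then 1 else 0"] ab(2) by (simp add: rexp_app_def)
qed (use rexp_domD(3)[OF assms(1)] assms(2) in auto)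

text \<open>Gaussian elimination without row exchanges. The solution expressions contain all pivots,
  so that wherever they are defined they are the only solution.\<close>

lemma gaussian_elimination_rexp:
  fixes N :: "nat \<Rightarrow> nat \<Rightarrow> ('a::field, 'd) nc_rexp"
  assumes "\<forall>i<L. X \<in> rexp_dom m (b i)"
    and "\<forall>i<L. \<forall>j<L. X \<in> rexp_dom m (N i j) \<and> rexp_val m (N i j) X = (if i = j then 1\<^sub>m m else 0\<^sub>m m m)"
  shows "\<exists>\<xi>. (\<forall>i<L. X \<in> rexp_dom m (\<xi> i)) \<and>
    (\<forall>n Y. (\<forall>i<L. Y \<in> rexp_dom n (\<xi> i)) \<longrightarrow>
       (\<forall>i<L. Y \<in> rexp_dom n (b i) \<and> (\<forall>j<L. Y \<in> rexp_dom n (N i j))) \<and>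
       (\<forall>y z. (\<forall>i<L. \<forall>a<n. (\<Sum>j<L. rexp_app n Y (N i j) (z j) a) = rexp_app n Y (b i) y a) \<longrightarrow>
          (\<forall>j<L. \<forall>a<n. z j a = rexp_app n Y (\<xi> j) y a)))"
  using assms
proof (induction L arbitrary: N b)
  case 0
  then show ?case by simp
next
  case (Suc L)
  define p where "p = Inv (N 0 0)"
  \<comment> \<open>The Schur complement of the pivot, with right-hand side c.\<close>
  define S where "S i j = rexp_diff (N (Suc i) (Suc j)) (Mul (N (Suc i) 0) (Mul p (N 0 (Suc j))))" for i j
  define c where "c i = rexp_diff (b (Suc i)) (Mul (N (Suc i) 0) (Mul p (b 0)))" for i
  have N: "X \<in> rexp_dom m (N i j)" "rexp_val m (N i j) X = (if i = j then 1\<^sub>m m else 0\<^sub>m m m)"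
    if "i \<le> L" "j \<le> L" for i j using Suc.prems(2) that by auto
  have b: "X \<in> rexp_dom m (b i)" if "i \<le> L" for i using Suc.prems(1) that by auto
  have one: "mat_inverse (1\<^sub>m m :: 'a mat) = Some (1\<^sub>m m)" by (rule mat_inverse_eq_SomeI) auto
  have pX: "X \<in> rexp_dom m p"
    unfolding p_def rexp_dom_Inv using N[of 0 0] by (simp add: one)
  have SX: "X \<in> rexp_dom m (S i j)" "rexp_val m (S i j) X = (if i = j then 1\<^sub>m m else 0\<^sub>m m m)"
    if ij: "i < L" "j < L" for i j
  proof -
    show d: "X \<in> rexp_dom m (S i j)" using N ij pX unfolding S_def by (simp add: rexp_dom_diff rexp_dom_Mul)
    \<comment> \<open>The first column vanishes below the pivot at X, so the Schur complement is
      again the identity at X and the induction hypothesis applies.\<close>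
    have z: "rexp_app m X (N (Suc i) 0) y a = 0" if "a < m" for y a
      using N(2)[of "Suc i" 0] ij that by (simp add: rexp_app_def)
    show "rexp_val m (S i j) X = (if i = j then 1\<^sub>m m else 0\<^sub>m m m)"
    proof (rule rexp_val_eqI[OF d])
      fix a y assume a: "a < m"
      have d': "X \<in> rexp_dom m (Mul (N (Suc i) 0) (Mul p (N 0 (Suc j))))" using d unfolding S_def by (simp add: rexp_dom_diff)
      have "rexp_app m X (S i j) y a = rexp_app m X (N (Suc i) (Suc j)) y a"
        using rexp_app_diff_rexp[OF d[unfolded S_def] a, of y]
        unfolding S_def[symmetric] rexp_app_Mul[OF d' a] z[OF a] by simp
      then show "rexp_app m X (S i j) y a = (\<Sum>b<m. (if i = j then 1\<^sub>m m else 0\<^sub>m m m) $$ (a, b) * y b)"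
        using N(2)[of "Suc i" "Suc j"] ij by (simp add: rexp_app_def)
    qed auto
  qed
  have cX: "X \<in> rexp_dom m (c i)" if "i < L" for i
    using N b that pX unfolding c_def by (simp add: rexp_dom_diff rexp_dom_Mul)
  obtain \<xi> where \<xi>X: "\<forall>i<L. X \<in> rexp_dom m (\<xi> i)"
    and \<xi>: "\<And>n Y. (\<forall>i<L. Y \<in> rexp_dom n (\<xi> i)) \<Longrightarrow>
       (\<forall>i<L. Y \<in> rexp_dom n (c i) \<and> (\<forall>j<L. Y \<in> rexp_dom n (S i j))) \<and>
       (\<forall>y z. (\<forall>i<L. \<forall>a<n. (\<Sum>j<L. rexp_app n Y (S i j) (z j) a) = rexp_app n Y (c i) y a) \<longrightarrow>
          (\<forall>j<L. \<forall>a<n. z j a = rexp_app n Y (\<xi> j) y a))"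
    using Suc.IH[of c S] cX SX by blast
  \<comment> \<open>Back substitution for the first unknown. It mentions the first row and
    \<open>b 0\<close>, which makes their domains part of the domain of the solution.\<close>
  define \<xi>0 where "\<xi>0 = Mul p (rexp_diff (b 0) (rexp_sum (\<lambda>j. Mul (N 0 (Suc j)) (\<xi> j)) {..<L}))"
  define \<xi>' where "\<xi>' = case_nat \<xi>0 \<xi>"
  have XT: "X \<in> matrix_tuples m" by (rule rexp_domD(1)[OF pX])
  have \<xi>0X: "X \<in> rexp_dom m \<xi>0"
    using pX b N \<xi>X XT unfolding \<xi>0_def by (simp add: rexp_dom_Mul rexp_dom_diff rexp_dom_sum)
  show ?case
  proof (rule exI[of _ \<xi>'], rule conjI)
    show "\<forall>i<Suc L. X \<in> rexp_dom m (\<xi>' i)"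
      using \<xi>0X \<xi>X by (auto simp: \<xi>'_def split: nat.split)
    show "\<forall>n Y. (\<forall>i<Suc L. Y \<in> rexp_dom n (\<xi>' i)) \<longrightarrow>
       (\<forall>i<Suc L. Y \<in> rexp_dom n (b i) \<and> (\<forall>j<Suc L. Y \<in> rexp_dom n (N i j))) \<and>
       (\<forall>y z. (\<forall>i<Suc L. \<forall>a<n. (\<Sum>j<Suc L. rexp_app n Y (N i j) (z j) a) = rexp_app n Y (b i) y a) \<longrightarrow>
          (\<forall>j<Suc L. \<forall>a<n. z j a = rexp_app n Y (\<xi>' j) y a))"
    proof (intro allI impI)
      fix n Y assume d: "\<forall>i<Suc L. Y \<in> rexp_dom n (\<xi>' i)"
      have d0: "Y \<in> rexp_dom n \<xi>0" using spec[OF d, of 0] by (simp add: \<xi>'_def)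
      have d1: "Y \<in> rexp_dom n (\<xi> i)" if "i < L" for i using spec[OF d, of "Suc i"] that by (simp add: \<xi>'_def)
      have d1': "\<forall>i<L. Y \<in> rexp_dom n (\<xi> i)" using d1 by blast
      have Yt: "Y \<in> matrix_tuples n" by (rule rexp_domD(1)[OF d0])
      have c1: "Y \<in> rexp_dom n (c i)" and S1: "j < L \<Longrightarrow> Y \<in> rexp_dom n (S i j)" if "i < L" for i j
        using \<xi>[OF d1'] that by blast+
      have p1: "Y \<in> rexp_dom n p" and b0: "Y \<in> rexp_dom n (b 0)" and N0: "j < L \<Longrightarrow> Y \<in> rexp_dom n (N 0 (Suc j))" for j
        using d0 unfolding \<xi>0_def by (simp_all add: rexp_dom_Mul rexp_dom_diff rexp_dom_sum)
      have N00: "Y \<in> rexp_dom n (N 0 0)" using p1 by (simp add: p_def rexp_dom_Inv)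
      have b1: "Y \<in> rexp_dom n (b (Suc i))" and Ni: "Y \<in> rexp_dom n (N (Suc i) 0)" if "i < L" for i
        using c1[OF that] unfolding c_def by (simp_all add: rexp_dom_Mul rexp_dom_diff)
      have NN: "Y \<in> rexp_dom n (N (Suc i) (Suc j))" if "i < L" "j < L" for i j
        using S1[OF that] unfolding S_def by (simp_all add: rexp_dom_Mul rexp_dom_diff)
      have D1: "\<forall>i<Suc L. Y \<in> rexp_dom n (b i) \<and> (\<forall>j<Suc L. Y \<in> rexp_dom n (N i j))"
        unfolding All_less_Suc2 using b0 b1 N00 N0 Ni NN by blast
      let ?p = "rexp_app n Y p" and ?N = "\<lambda>i j. rexp_app n Y (N i j)" and ?b = "\<lambda>i. rexp_app n Y (b i)"
      have D2: "z j a = rexp_app n Y (\<xi>' j) y a" if eq: "\<forall>i<Suc L. \<forall>a<n. (\<Sum>j<Suc L. ?N i j (z j) a) = ?b i y a"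
        and j: "j < Suc L" and a: "a < n" for y z j a
      proof -
        define s where "s a = (\<Sum>j<L. ?N 0 (Suc j) (z (Suc j)) a)" for a
        have e0: "?N 0 0 (z 0) a = ?b 0 y a - s a" if "a < n" for a
          using eq that by (simp add: sum.lessThan_Suc_shift s_def algebra_simps del: sum.lessThan_Suc)
        have e1: "?N (Suc i) 0 (z 0) a + (\<Sum>j<L. ?N (Suc i) (Suc j) (z (Suc j)) a) = ?b (Suc i) y a"
          if "i < L" "a < n" for i a
          using eq that by (simp add: sum.lessThan_Suc_shift del: sum.lessThan_Suc)
        have z0: "z 0 a = ?p (?b 0 y) a - ?p s a" if a: "a < n" for a
        proof -
          have "z 0 a = ?p (?N 0 0 (z 0)) a" unfolding p_def by (rule rexp_app_Inv[OF p1[unfolded p_def] a, symmetric])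
          also have "\<dots> = ?p (\<lambda>a. ?b 0 y a - s a) a" by (rule rexp_app_cong) (rule e0)
          finally show ?thesis by (simp only: rexp_app_diff)
        qed
        have "\<forall>i<L. \<forall>a<n. (\<Sum>j<L. rexp_app n Y (S i j) (z (Suc j)) a) = rexp_app n Y (c i) y a"
        proof (intro allI impI)
          fix i a assume i: "i < L" and a: "a < n"
          have Sa: "rexp_app n Y (S i j) (z (Suc j)) a =
            ?N (Suc i) (Suc j) (z (Suc j)) a - ?N (Suc i) 0 (?p (?N 0 (Suc j) (z (Suc j)))) a" if j: "j < L" for j
          proof -
            have d2: "Y \<in> rexp_dom n (Mul p (N 0 (Suc j)))" using p1 N0 j by (simp add: rexp_dom_Mul)
            have d3: "Y \<in> rexp_dom n (Mul (N (Suc i) 0) (Mul p (N 0 (Suc j))))" using d2 Ni i by (simp add: rexp_dom_Mul)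
            show ?thesis
              unfolding S_def rexp_app_diff_rexp[OF S1[OF i j, unfolded S_def] a] rexp_app_Mul[OF d3 a]
              by (rule arg_cong[where f = "\<lambda>t. _ - t"], rule rexp_app_cong) (rule rexp_app_Mul[OF d2])
          qed
          have ca: "rexp_app n Y (c i) y a = ?b (Suc i) y a - ?N (Suc i) 0 (?p (?b 0 y)) a"
          proof -
            have d2: "Y \<in> rexp_dom n (Mul p (b 0))" using p1 b0 by (simp add: rexp_dom_Mul)
            have d3: "Y \<in> rexp_dom n (Mul (N (Suc i) 0) (Mul p (b 0)))" using d2 Ni i by (simp add: rexp_dom_Mul)
            show ?thesis
              unfolding c_def rexp_app_diff_rexp[OF c1[OF i, unfolded c_def] a] rexp_app_Mul[OF d3 a]
              by (rule arg_cong[where f = "\<lambda>t. _ - t"], rule rexp_app_cong) (rule rexp_app_Mul[OF d2])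
          qed
          have "(\<Sum>j<L. rexp_app n Y (S i j) (z (Suc j)) a) =
            (\<Sum>j<L. ?N (Suc i) (Suc j) (z (Suc j)) a) - (\<Sum>j<L. ?N (Suc i) 0 (?p (?N 0 (Suc j) (z (Suc j)))) a)"
            unfolding sum_subtractf[symmetric] by (intro sum.cong refl) (simp add: Sa)
          also have "(\<Sum>j<L. ?N (Suc i) 0 (?p (?N 0 (Suc j) (z (Suc j)))) a) = ?N (Suc i) 0 (?p s) a"
            unfolding rexp_app_sum[symmetric] s_def[abs_def] ..
          also have "?N (Suc i) 0 (?p s) a = ?N (Suc i) 0 (\<lambda>a. ?p (?b 0 y) a - z 0 a) a"
            by (rule rexp_app_cong) (simp add: z0)
          also have "\<dots> = ?N (Suc i) 0 (?p (?b 0 y)) a - ?N (Suc i) 0 (z 0) a" by (rule rexp_app_diff)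
          finally show "(\<Sum>j<L. rexp_app n Y (S i j) (z (Suc j)) a) = rexp_app n Y (c i) y a"
            unfolding ca e1[OF i a, symmetric] by simp
        qed
        then have zs: "z (Suc j) a = rexp_app n Y (\<xi> j) y a" if "j < L" "a < n" for j a
          using \<xi>[OF d1', THEN conjunct2, rule_format, of "\<lambda>j. z (Suc j)"] that by blast
        have "z 0 a = rexp_app n Y \<xi>0 y a" if a: "a < n" for a
        proof -
          let ?q = "rexp_sum (\<lambda>j. Mul (N 0 (Suc j)) (\<xi> j)) {..<L}"
          have d2: "Y \<in> rexp_dom n (rexp_diff (b 0) ?q)" using d0 unfolding \<xi>0_def by (simp add: rexp_dom_Mul)
          then have d3: "Y \<in> rexp_dom n ?q" by (simp add: rexp_dom_diff)
          have q: "rexp_app n Y ?q y a = s a" if a: "a < n" for a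
            unfolding s_def rexp_app_sum_rexp[OF finite_lessThan d3 a]
          proof (intro sum.cong refl)
            fix j assume "j \<in> {..<L}"
            then have j: "j < L" by simp
            have d4: "Y \<in> rexp_dom n (Mul (N 0 (Suc j)) (\<xi> j))" using N0 d1 j by (simp add: rexp_dom_Mul)
            show "rexp_app n Y (Mul (N 0 (Suc j)) (\<xi> j)) y a = ?N 0 (Suc j) (z (Suc j)) a"
              unfolding rexp_app_Mul[OF d4 a] by (rule rexp_app_cong) (simp add: zs j)
          qed
          have "rexp_app n Y \<xi>0 y a = ?p (\<lambda>a. ?b 0 y a - s a) a"
            unfolding \<xi>0_def rexp_app_Mul[OF d0[unfolded \<xi>0_def] a]
            by (rule rexp_app_cong) (simp add: rexp_app_diff_rexp[OF d2] q)
          then show ?thesis unfolding z0[OF a] by (simp only: rexp_app_diff)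
        qed
        then show ?thesis using zs j a by (cases j) (simp_all add: \<xi>'_def)
      qed
      show "(\<forall>i<Suc L. Y \<in> rexp_dom n (b i) \<and> (\<forall>j<Suc L. Y \<in> rexp_dom n (N i j))) \<and>
       (\<forall>y z. (\<forall>i<Suc L. \<forall>a<n. (\<Sum>j<Suc L. ?N i j (z j) a) = ?b i y a) \<longrightarrow>
          (\<forall>j<Suc L. \<forall>a<n. z j a = rexp_app n Y (\<xi>' j) y a))"
        by (intro conjI allI impI D1) (rule D2)
    qed
  qed
qed

text \<open>D linear equations in D + 1 unknowns have a nontrivial solution: a dual basis of the
  equations has at most D members, so something nonzero is annihilated.\<close>

lemma linear_dependence:
  fixes g :: "nat \<Rightarrow> nat \<Rightarrow> 'a::field"
  shows "\<exists>c. (\<exists>t\<le>D. c t \<noteq> 0) \<and> (\<forall>p<D. (\<Sum>t<Suc D. c t * g p t) = 0)"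
proof -
  define f where "f p = (if p < D then g p else (\<lambda>_. 0))" for p
  obtain r ws \<iota> where b: "dual_basis (Suc D) f r ws \<iota>" using dual_basis_exists by blast
  have "r \<le> D"
  \<comment> \<open>The chosen functionals factor through the D given ones, which bounds their
    number by D.\<close>
  proof (rule rect_inverse_le[where F = "\<lambda>i l. if ws i = l then 1 else 0" and G = "\<lambda>l j. \<Sum>t<Suc D. g l t * \<iota> t j"])
    fix i j assume "i < r" "j < r"
    then show "(\<Sum>l<D. (if ws i = l then 1 else 0) * (\<Sum>t<Suc D. g l t * \<iota> t j)) = (if i = j then 1 else 0)"
      unfolding sum_delta_mult using dual_basisD(1)[OF b, of i j] by (auto simp: f_def simp del: sum.lessThan_Suc split: if_splits)
  qed
  then obtain v where "\<exists>t<Suc D. v t \<noteq> 0" "\<And>p. (\<Sum>t<Suc D. f p t * v t) = 0"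
    using dual_basis_annihilator[OF b] by (auto simp: le_imp_less_Suc)
  note v = this
  have "(\<Sum>t<Suc D. v t * g p t) = 0" if "p < D" for p
    using v(2)[of p] that by (simp only: f_def if_True mult.commute)
  then show ?thesis using v(1) unfolding less_Suc_eq_le by blast
qed

text \<open>The pencil as an operator on states, so that its powers are iterates.\<close>

definition fm_op :: "nat \<Rightarrow> nat \<Rightarrow> ('d::finite \<Rightarrow> nat \<Rightarrow> nat \<Rightarrow> 'r::comm_ring_1) \<Rightarrow> ('d \<Rightarrow> nat \<Rightarrow> nat \<Rightarrow> 'r)
    \<Rightarrow> (nat \<Rightarrow> nat \<Rightarrow> 'r) \<Rightarrow> nat \<Rightarrow> nat \<Rightarrow> 'r" where
  "fm_op n L X A z a i = z a i - fm_step n L X A z a i"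

lemma fm_op_pow_Suc:
  "(fm_op n L X A ^^ Suc t) z a i = (fm_op n L X A ^^ t) z a i - fm_step n L X A ((fm_op n L X A ^^ t) z) a i"
  by (simp only: funpow.simps comp_def) (rule fm_op_def)

lemma fm_op_pow_sum:
  "(fm_op n L X A ^^ t) (\<lambda>a i. \<Sum>s\<in>S. c s * y s a i) = (\<lambda>a i. \<Sum>s\<in>S. c s * (fm_op n L X A ^^ t) (y s) a i)"
proof (induction t)
  case (Suc t)
  have "fm_op n L X A (\<lambda>a i. \<Sum>s\<in>S. c s * y s a i) a i = (\<Sum>s\<in>S. c s * fm_op n L X A (y s) a i)" for y a i
  proof -
    have "fm_step n L X A (\<lambda>a i. \<Sum>s\<in>S. y s a i * c s) a i = (\<Sum>s\<in>S. fm_step n L X A (y s) a i * c s)"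
      by (rule fm_step_sum)
    then show ?thesis unfolding fm_op_def by (simp add: right_diff_distrib sum_subtractf mult.commute)
  qed
  note step = this
  have "fm_op n L X A (\<lambda>a i. \<Sum>s\<in>S. c s * y s a i) = (\<lambda>a i. \<Sum>s\<in>S. c s * fm_op n L X A (y s) a i)" for y
    by (rule HOL.ext, rule HOL.ext) (rule step)
  then show ?case unfolding funpow.simps comp_def Suc .
qed simp

lemma fm_op_pow_cong:
  assumes "\<And>a i. a < n \<Longrightarrow> i < L \<Longrightarrow> z a i = z' a i" "a < n" "i < L"
  shows "(fm_op n L X A ^^ t) z a i = (fm_op n L X A ^^ t) z' a i"
  using assms(2,3)
proof (induction t arbitrary: a i)
  case 0
  then show ?case using assms(1) by simp
next
  case (Suc t)
  have "fm_step n L X A ((fm_op n L X A ^^ t) z) a i = fm_step n L X A ((fm_op n L X A ^^ t) z') a i"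
    by (rule fm_step_cong) (rule Suc.IH)
  then show ?case unfolding fm_op_pow_Suc using Suc.IH[OF Suc.prems] by simp
qed

lemma fm_op_pow_inj:
  assumes "well_posed n L X A" "\<forall>a<n. \<forall>i<L. (fm_op n L X A ^^ t) z a i = 0"
  shows "\<forall>a<n. \<forall>i<L. z a i = 0"
  using assms(2)
proof (induction t)
  case (Suc t)
  have "\<forall>a<n. \<forall>i<L. (fm_op n L X A ^^ t) z a i = fm_step n L X A ((fm_op n L X A ^^ t) z) a i"
    using Suc.prems unfolding fm_op_pow_Suc eq_iff_diff_eq_0[symmetric] .
  then show ?case using assms(1) Suc.IH unfolding well_posed_def by blast
qed simp

text \<open>The inverse of an invertible matrix is a polynomial in that matrix.\<close>

lemma fm_op_inverse:
  fixes X :: "'d::finite \<Rightarrow> nat \<Rightarrow> nat \<Rightarrow> 'a::field"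
  assumes wp: "well_posed n L X A"
  shows "\<exists>T c. \<forall>z. \<forall>a<n. \<forall>i<L. (\<Sum>t<T. c t * (fm_op n L X A ^^ Suc t) z a i) = z a i"
proof -
  let ?P = "fm_op n L X A" and ?N = "n * L"
  define E :: "nat \<Rightarrow> nat \<Rightarrow> nat \<Rightarrow> 'a" where "E q a i = (if a * L + i = q then 1 else 0)" for q a i
  \<comment> \<open>The number w encodes an entry of the t-th power: its column
    \<open>w div ?N\<close> and its row \<open>w mod ?N\<close>.\<close>
  define g where "g w t = (?P ^^ t) (E (w div ?N)) ((w mod ?N) div L) ((w mod ?N) mod L)" for w t
  \<comment> \<open>The powers with exponents 0, ..., D are D + 1 matrices with D entries each,
    hence linearly dependent.\<close>
  define D where "D = ?N * ?N"
  obtain c s0 where c: "s0 \<le> D" "c s0 \<noteq> 0" "\<forall>p<D. (\<Sum>t<Suc D. c t * g p t) = 0"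
    using linear_dependence[of D g] by blast
  have cE: "(\<Sum>t<Suc D. c t * (?P ^^ t) (E q) a i) = 0" if "q < ?N" "a < n" "i < L" for q a i
  proof -
    have p: "a * L + i < ?N" by (rule mult_add_less[OF that(2,3)])
    then have "q * ?N + (a * L + i) < D" unfolding D_def by (rule mult_add_less[OF that(1)])
    note w = c(3)[rule_format, OF this]
    have "(q * N + r) div N = q" "(q * N + r) mod N = r" if "r < N" for N r using that by simp_all
    note this[OF p]
    then show ?thesis
      using w that(3) by (simp only: g_def) simp
  qed
  have c0: "(\<Sum>t<Suc D. c t * (?P ^^ t) z a i) = 0" if ai: "a < n" "i < L" for z a i
  proof -
    have zE: "z a i = (\<Sum>q<?N. z (q div L) (q mod L) * E q a i)" if "a < n" "i < L" for a i
      using mult_add_less[OF that] that(2) unfolding E_def by simp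
    have "(?P ^^ t) z a i = (\<Sum>q<?N. z (q div L) (q mod L) * (?P ^^ t) (E q) a i)" for t
    proof -
      have "(?P ^^ t) z a i = (?P ^^ t) (\<lambda>a i. \<Sum>q<?N. z (q div L) (q mod L) * E q a i) a i"
        by (rule fm_op_pow_cong[OF _ ai]) (rule zE)
      then show ?thesis unfolding fm_op_pow_sum .
    qed
    then have "(\<Sum>t<Suc D. c t * (?P ^^ t) z a i) = (\<Sum>t<Suc D. \<Sum>q<?N. z (q div L) (q mod L) * (c t * (?P ^^ t) (E q) a i))"
      by (simp only: sum_distrib_left mult.left_commute)
    also have "\<dots> = (\<Sum>q<?N. z (q div L) (q mod L) * (\<Sum>t<Suc D. c t * (?P ^^ t) (E q) a i))"
      unfolding sum_distrib_left by (rule sum.swap)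
    also have "\<dots> = 0" by (rule sum.neutral) (use cE ai in \<open>auto simp del: sum.lessThan_Suc\<close>)
    finally show ?thesis .
  qed
  \<comment> \<open>The lowest nonzero coefficient of the dependence. The s-th power is injective
    and can be cancelled, which leaves a relation with nonzero constant term that is solved for
    z.\<close>
  define s where "s = (LEAST t. c t \<noteq> 0)"
  have s: "c s \<noteq> 0" "s \<le> D" "\<And>t. t < s \<Longrightarrow> c t = 0"
    unfolding s_def using LeastI[of "\<lambda>t. c t \<noteq> 0", OF c(2)] Least_le[of "\<lambda>t. c t \<noteq> 0", OF c(2)] c(1)
    by (auto dest: not_less_Least)
  have "(\<Sum>t<D - s. - c (s + Suc t) / c s * (?P ^^ Suc t) z a i) = z a i" if ai: "a < n" "i < L" for z a i
  proof -
    define y where "y a i = (\<Sum>t<Suc (D - s). c (s + t) * (?P ^^ t) z a i)" for a i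
    have "(?P ^^ s) y a i = 0" if ai: "a < n" "i < L" for a i
    proof -
      have "(?P ^^ s) y a i = (\<Sum>t<Suc (D - s). c (s + t) * (?P ^^ (s + t)) z a i)"
        unfolding y_def[abs_def] fm_op_pow_sum funpow_add comp_def ..
      also have "\<dots> = (\<Sum>t<s. c t * (?P ^^ t) z a i) + \<dots>" by (simp add: s(3) del: sum.lessThan_Suc)
      also have "\<dots> = (\<Sum>t<s + Suc (D - s). c t * (?P ^^ t) z a i)" by (rule sum_lessThan_add[symmetric])
      also have "s + Suc (D - s) = Suc D" using s(2) by simp
      finally show ?thesis using c0[OF ai] by simp
    qed
    then have "y a i = 0" using fm_op_pow_inj[OF wp, where z = y and t = s] ai by blast
    then have "c s * z a i + (\<Sum>t<D - s. c (s + Suc t) * (?P ^^ Suc t) z a i) = 0"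
      unfolding y_def sum.lessThan_Suc_shift by simp
    then have "z a i = - (\<Sum>t<D - s. c (s + Suc t) * (?P ^^ Suc t) z a i) / c s"
      using s(1) by (simp add: field_simps eq_neg_iff_add_eq_0)
    then show ?thesis by (simp add: sum_divide_distrib sum_negf)
  qed
  note key = this
  show ?thesis
    by (rule exI[of _ "D - s"], rule exI[of _ "\<lambda>t. - c (s + Suc t) / c s"], intro allI impI, rule key)
qed

section \<open>Expressions for a realization\<close>

definition rexp_pencil :: "('d::finite \<Rightarrow> nat \<Rightarrow> nat \<Rightarrow> 'a::field) \<Rightarrow> nat \<Rightarrow> nat \<Rightarrow> ('a, 'd) nc_rexp" where
  "rexp_pencil A i j = rexp_diff (rexp_const (if i = j then 1 else 0))
     (rexp_sum (\<lambda>k. Mul (rexp_const (A k i j)) (rexp_var k)) UNIV)"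

primrec rexp_pencil_pow :: "nat \<Rightarrow> ('d::finite \<Rightarrow> nat \<Rightarrow> nat \<Rightarrow> 'a::field) \<Rightarrow> nat \<Rightarrow> nat \<Rightarrow> nat \<Rightarrow> ('a, 'd) nc_rexp" where
  "rexp_pencil_pow L A 0 = (\<lambda>i j. rexp_const (if i = j then 1 else 0))"
| "rexp_pencil_pow L A (Suc t) = (\<lambda>i j. rexp_sum (\<lambda>l. Mul (rexp_pencil_pow L A t i l) (rexp_pencil A l j)) {..<L})"

definition rexp_input :: "('d::finite \<Rightarrow> nat \<Rightarrow> 'a::field) \<Rightarrow> nat \<Rightarrow> ('a, 'd) nc_rexp" where
  "rexp_input B i = rexp_sum (\<lambda>k. Mul (rexp_const (B k i)) (rexp_var k)) UNIV"

lemma rexp_dom_scaled_var [simp]: "Y \<in> rexp_dom n (Mul (rexp_const c) (rexp_var k)) \<longleftrightarrow> Y \<in> matrix_tuples n"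
  by (simp add: rexp_dom_Mul)

lemma rexp_app_scaled:
  assumes "Y \<in> rexp_dom n R" "a < n"
  shows "rexp_app n Y (Mul (rexp_const c) R) y a = c * rexp_app n Y R y a"
proof -
  have "Y \<in> matrix_tuples n" by (rule rexp_domD(1)[OF assms(1)])
  moreover have "Y \<in> rexp_dom n (Mul (rexp_const c) R)" using calculation assms(1) by (simp add: rexp_dom_Mul)
  ultimately show ?thesis using assms(2) by (simp add: rexp_app_Mul rexp_app_const)
qed

lemma rexp_dom_input [simp]: "Y \<in> rexp_dom n (rexp_input B i) \<longleftrightarrow> Y \<in> matrix_tuples n"
  by (auto simp: rexp_input_def rexp_dom_sum)

lemma rexp_dom_pencil [simp]: "Y \<in> rexp_dom n (rexp_pencil A i j) \<longleftrightarrow> Y \<in> matrix_tuples n"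
  by (auto simp: rexp_pencil_def rexp_dom_diff rexp_dom_sum)

lemma rexp_dom_pencil_pow [simp]: "Y \<in> rexp_dom n (rexp_pencil_pow L A t i j) \<longleftrightarrow> Y \<in> matrix_tuples n"
proof (induction t arbitrary: i j)
  case (Suc t)
  then show ?case by (auto simp: rexp_dom_sum rexp_dom_Mul)
qed simp

lemma rexp_app_input:
  assumes "Y \<in> matrix_tuples n" "a < n"
  shows "rexp_app n Y (rexp_input B i) y a = fm_input n (\<lambda>k. ent (Y k)) B y a i"
proof -
  have "Y \<in> rexp_dom n (rexp_input B i)" using assms(1) by simp
  from rexp_app_sum_rexp[OF finite this[unfolded rexp_input_def] assms(2)]
  have "rexp_app n Y (rexp_input B i) y a = (\<Sum>k\<in>UNIV. B k i * (\<Sum>b<n. Y k $$ (a, b) * y b))"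
    using assms by (simp add: rexp_input_def rexp_app_scaled rexp_app_var)
  then show ?thesis unfolding fm_input_def by (simp add: sum_distrib_left mult.left_commute)
qed

lemma rexp_app_pencil:
  assumes "Y \<in> matrix_tuples n" "a < n" "i < L"
  shows "(\<Sum>j<L. rexp_app n Y (rexp_pencil A i j) (\<lambda>b. z b j) a) = fm_op n L (\<lambda>k. ent (Y k)) A z a i"
proof -
  let ?S = "\<lambda>j. rexp_sum (\<lambda>k. Mul (rexp_const (A k i j)) (rexp_var k)) UNIV"
  have S: "Y \<in> rexp_dom n (?S j)" for j using assms(1) by (simp add: rexp_dom_sum)
  have "rexp_app n Y (rexp_pencil A i j) (\<lambda>b. z b j) a =
    (if i = j then 1 else 0) * z a j - (\<Sum>k\<in>UNIV. A k i j * (\<Sum>b<n. Y k $$ (a, b) * z b j))" for j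
  proof -
    have "Y \<in> rexp_dom n (rexp_pencil A i j)" using assms(1) by simp
    from rexp_app_diff_rexp[OF this[unfolded rexp_pencil_def] assms(2)]
    have "rexp_app n Y (rexp_pencil A i j) (\<lambda>b. z b j) a =
      rexp_app n Y (rexp_const (if i = j then 1 else 0)) (\<lambda>b. z b j) a - rexp_app n Y (?S j) (\<lambda>b. z b j) a"
      unfolding rexp_pencil_def[symmetric] .
    then show ?thesis
      unfolding rexp_app_const[OF assms(1,2)] rexp_app_sum_rexp[OF finite S assms(2)]
      using assms by (simp add: rexp_app_scaled rexp_app_var)
  qed
  then have "(\<Sum>j<L. rexp_app n Y (rexp_pencil A i j) (\<lambda>b. z b j) a) =
    z a i - (\<Sum>j<L. \<Sum>k\<in>UNIV. A k i j * (\<Sum>b<n. Y k $$ (a, b) * z b j))"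
    using assms(3) by (simp add: sum_subtractf)
  also have "(\<Sum>j<L. \<Sum>k\<in>UNIV. A k i j * (\<Sum>b<n. Y k $$ (a, b) * z b j)) = fm_step n L (\<lambda>k. ent (Y k)) A z a i"
  proof -
    have "(\<Sum>j<L. A k i j * (\<Sum>b<n. Y k $$ (a, b) * z b j)) = (\<Sum>b<n. Y k $$ (a, b) * (\<Sum>j<L. A k i j * z b j))" for k
      unfolding sum_distrib_left by (subst sum.swap) (simp only: mult.left_commute)
    then show ?thesis unfolding fm_step_def by (subst sum.swap) simp
  qed
  finally show ?thesis by (simp add: fm_op_def)
qed

lemma rexp_app_pencil_pow:
  assumes "Y \<in> matrix_tuples n" "a < n" "i < L"
  shows "(\<Sum>j<L. rexp_app n Y (rexp_pencil_pow L A t i j) (\<lambda>b. z b j) a) =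
    (fm_op n L (\<lambda>k. ent (Y k)) A ^^ t) z a i"
  using assms(2,3)
proof (induction t arbitrary: z a i)
  case 0
  then show ?case using assms(1) by (simp add: rexp_app_const)
next
  case (Suc t)
  let ?F = "rexp_pencil_pow L A t i" and ?P = "fm_op n L (\<lambda>k. ent (Y k)) A"
  have d: "Y \<in> rexp_dom n (rexp_sum (\<lambda>l. Mul (?F l) (rexp_pencil A l j)) {..<L})" for j
    using assms(1) by (simp add: rexp_dom_sum rexp_dom_Mul)
  have d': "Y \<in> rexp_dom n (Mul (?F l) (rexp_pencil A l j))" for l j
    using assms(1) by (simp add: rexp_dom_Mul)
  have "(\<Sum>j<L. rexp_app n Y (rexp_pencil_pow L A (Suc t) i j) (\<lambda>b. z b j) a) =
    (\<Sum>j<L. \<Sum>l<L. rexp_app n Y (?F l) (rexp_app n Y (rexp_pencil A l j) (\<lambda>b. z b j)) a)"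
    using rexp_app_sum_rexp[OF finite_lessThan d Suc.prems(1)] rexp_app_Mul[OF d' Suc.prems(1)] by simp
  also have "\<dots> = (\<Sum>l<L. rexp_app n Y (?F l) (\<lambda>b. \<Sum>j<L. rexp_app n Y (rexp_pencil A l j) (\<lambda>b. z b j) b) a)"
    unfolding rexp_app_sum by (rule sum.swap)
  also have "\<dots> = (\<Sum>l<L. rexp_app n Y (?F l) (\<lambda>b. ?P z b l) a)"
    by (intro sum.cong refl rexp_app_cong rexp_app_pencil[OF assms(1)]) auto
  also have "\<dots> = (?P ^^ t) (?P z) a i" by (rule Suc.IH[OF Suc.prems])
  finally show ?case by (simp only: funpow_Suc_right comp_def)
qed

text \<open>An invertible block matrix need not have an invertible block, so the pencil \<open>P\<close> is first
  multiplied by a matrix \<open>U\<close> of nc polynomials with \<open>U(X) P(X) = I\<close>: then all pivots of \<open>U P\<close> are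
  identity matrices at \<open>X\<close>.\<close>

lemma rexp_for_realization:
  fixes X :: "'d::finite \<Rightarrow> 'a::field mat"
  assumes X: "X \<in> matrix_tuples m" and wp: "well_posed m L (\<lambda>k. ent (X k)) A"
  shows "\<exists>R. X \<in> rexp_dom m R \<and> realized R L A B C D"
proof -
  obtain T c where Tc: "\<forall>z. \<forall>a<m. \<forall>i<L. (\<Sum>t<T. c t * (fm_op m L (\<lambda>k. ent (X k)) A ^^ Suc t) z a i) = z a i"
    using fm_op_inverse[OF wp] by blast
  \<comment> \<open>With P the pencil, N is the product of \<open>\<Sum> c\<^sub>t P\<^sup>t\<close>
    and P, and b is the same polynomial in P applied to the input; \<open>U t\<close> is its summand
    \<open>P\<^sup>t\<close> applied to the input.\<close>
  define N where "N i j = rexp_sum (\<lambda>t. Mul (rexp_const (c t)) (rexp_pencil_pow L A (Suc t) i j)) {..<T}" for i j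
  define U where "U t i = rexp_sum (\<lambda>l. Mul (rexp_pencil_pow L A t i l) (rexp_input B l)) {..<L}" for t i
  define b where "b i = rexp_sum (\<lambda>t. Mul (rexp_const (c t)) (U t i)) {..<T}" for i
  have Nd: "Y \<in> rexp_dom n (N i j)" if "Y \<in> matrix_tuples n" for n Y i j
    using that by (simp add: N_def rexp_dom_sum rexp_dom_Mul del: rexp_pencil_pow.simps)
  have Ud: "Y \<in> rexp_dom n (U t i)" if "Y \<in> matrix_tuples n" for n Y t i
    using that by (simp add: U_def rexp_dom_sum rexp_dom_Mul)
  have bd: "Y \<in> rexp_dom n (b i)" if "Y \<in> matrix_tuples n" for n Y i
    using that by (simp add: b_def Ud rexp_dom_sum rexp_dom_Mul)
  have Na: "(\<Sum>j<L. rexp_app n Y (N i j) (\<lambda>b. z b j) a) =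
      (\<Sum>t<T. c t * (fm_op n L (\<lambda>k. ent (Y k)) A ^^ Suc t) z a i)"
    if Y: "Y \<in> matrix_tuples n" and a: "a < n" and i: "i < L" for n Y z a i
  proof -
    have "rexp_app n Y (N i j) (\<lambda>b. z b j) a = (\<Sum>t<T. c t * rexp_app n Y (rexp_pencil_pow L A (Suc t) i j) (\<lambda>b. z b j) a)" for j
      using rexp_app_sum_rexp[OF finite_lessThan Nd[OF Y, unfolded N_def] a] Y a
      unfolding N_def by (simp add: rexp_app_scaled del: rexp_pencil_pow.simps)
    then have "(\<Sum>j<L. rexp_app n Y (N i j) (\<lambda>b. z b j) a) =
      (\<Sum>t<T. c t * (\<Sum>j<L. rexp_app n Y (rexp_pencil_pow L A (Suc t) i j) (\<lambda>b. z b j) a))"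
      unfolding sum_distrib_left by (simp only: sum.swap[of _ "{..<T}"])
    then show ?thesis unfolding rexp_app_pencil_pow[OF Y a i] .
  qed
  have ba: "rexp_app n Y (b i) y a =
      (\<Sum>t<T. c t * (fm_op n L (\<lambda>k. ent (Y k)) A ^^ t) (fm_input n (\<lambda>k. ent (Y k)) B y) a i)"
    if Y: "Y \<in> matrix_tuples n" and a: "a < n" and i: "i < L" for n Y y a i
  proof -
    have "rexp_app n Y (U t i) y a = (\<Sum>l<L. rexp_app n Y (rexp_pencil_pow L A t i l) (\<lambda>b. fm_input n (\<lambda>k. ent (Y k)) B y b l) a)" for t
    proof -
      have d: "Y \<in> rexp_dom n (Mul (rexp_pencil_pow L A t i l) (rexp_input B l))" for l
        using Y by (simp add: rexp_dom_Mul)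
      show ?thesis
        unfolding U_def rexp_app_sum_rexp[OF finite_lessThan Ud[OF Y, unfolded U_def] a] rexp_app_Mul[OF d a]
        by (intro sum.cong refl rexp_app_cong rexp_app_input[OF Y])
    qed
    then have U: "rexp_app n Y (U t i) y a = (fm_op n L (\<lambda>k. ent (Y k)) A ^^ t) (fm_input n (\<lambda>k. ent (Y k)) B y) a i" for t
      unfolding rexp_app_pencil_pow[OF Y a i] .
    show ?thesis
      using rexp_app_sum_rexp[OF finite_lessThan bd[OF Y, unfolded b_def] a] Ud[OF Y] a
      unfolding b_def by (simp add: rexp_app_scaled U)
  qed
  have NX: "rexp_val m (N i j) X = (if i = j then 1\<^sub>m m else 0\<^sub>m m m)" if ij: "i < L" "j < L" for i j
  proof (rule rexp_val_eqI[OF Nd[OF X]])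
    fix a and y :: "nat \<Rightarrow> 'a" assume a: "a < m"
    define z where "z b l = (if l = j then y b else 0)" for b l
    have "rexp_app m X (N i l) (\<lambda>b. z b l) a = (if l = j then rexp_app m X (N i j) y a else 0)" for l
      by (simp add: z_def)
    then have "(\<Sum>l<L. rexp_app m X (N i l) (\<lambda>b. z b l) a) = rexp_app m X (N i j) y a"
      using ij by simp
    then have "rexp_app m X (N i j) y a = z a i"
      unfolding Na[OF X a ij(1)] using Tc a ij(1) by simp
    moreover have "(\<Sum>b<m. (if i = j then 1\<^sub>m m else 0\<^sub>m m m) $$ (a, b) * y b) =
      (\<Sum>b<m. (if a = b then 1 else 0) * (if i = j then y b else 0))"
      using a by (intro sum.cong) auto
    ultimately show "rexp_app m X (N i j) y a = (\<Sum>b<m. (if i = j then 1\<^sub>m m else 0\<^sub>m m m) $$ (a, b) * y b)"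
      using a by (simp add: z_def)
  qed simp
  have e1: "\<forall>i<L. X \<in> rexp_dom m (b i)" using bd[OF X] by blast
  have e2: "\<forall>i<L. \<forall>j<L. X \<in> rexp_dom m (N i j) \<and> rexp_val m (N i j) X = (if i = j then 1\<^sub>m m else 0\<^sub>m m m)"
    by (intro allI impI conjI Nd[OF X] NX)
  obtain \<xi> where \<xi>X: "\<forall>i<L. X \<in> rexp_dom m (\<xi> i)"
    and \<xi>0: "\<forall>n Y. (\<forall>i<L. Y \<in> rexp_dom n (\<xi> i)) \<longrightarrow>
       (\<forall>i<L. Y \<in> rexp_dom n (b i) \<and> (\<forall>j<L. Y \<in> rexp_dom n (N i j))) \<and>
       (\<forall>y z. (\<forall>i<L. \<forall>a<n. (\<Sum>j<L. rexp_app n Y (N i j) (z j) a) = rexp_app n Y (b i) y a) \<longrightarrow>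
          (\<forall>j<L. \<forall>a<n. z j a = rexp_app n Y (\<xi> j) y a))"
    using gaussian_elimination_rexp[of L X m b N, OF e1 e2] by (elim exE conjE) (rule that)
  have \<xi>: "z j a = rexp_app n Y (\<xi> j) y a"
    if h1: "\<forall>i<L. Y \<in> rexp_dom n (\<xi> i)"
      and h2: "\<forall>i<L. \<forall>a<n. (\<Sum>j<L. rexp_app n Y (N i j) (z j) a) = rexp_app n Y (b i) y a"
      and h3: "j < L" "a < n" for n Y y z j a
    using \<xi>0[THEN spec, THEN spec, THEN mp, OF h1, THEN conjunct2, THEN spec, THEN spec, THEN mp, OF h2] h3 by blast
  define R where "R = Add (rexp_const D) (rexp_sum (\<lambda>i. Mul (rexp_const (C i)) (\<xi> i)) {..<L})"
  have "realizes n L (\<lambda>k. ent (Y k)) A B C D (ent (rexp_val n R Y))" if YR: "Y \<in> rexp_dom n R" for n Y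
  proof -
    let ?Y = "\<lambda>k. ent (Y k)"
    have Y: "Y \<in> matrix_tuples n" by (rule rexp_domD(1)[OF YR])
    have sumd: "Y \<in> rexp_dom n (rexp_sum (\<lambda>i. Mul (rexp_const (C i)) (\<xi> i)) {..<L})"
      using YR by (simp add: R_def rexp_dom_Add)
    then have \<xi>d: "\<forall>i<L. Y \<in> rexp_dom n (\<xi> i)" by (simp add: rexp_dom_sum rexp_dom_Mul)
    \<comment> \<open>A state of the original system also solves the system multiplied by the
      polynomial in P, so elimination identifies it with \<xi> at every point of the domain.\<close>
    have sol: "x a j = rexp_app n Y (\<xi> j) y a" if s: "fm_sys n L ?Y A B x y" and j: "j < L" and a: "a < n" for x y a j
    proof (rule \<xi>[OF \<xi>d _ j a, where z = "\<lambda>j a. x a j"], intro allI impI)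
      fix i a assume i: "i < L" and a: "a < n"
      show "(\<Sum>j<L. rexp_app n Y (N i j) (\<lambda>a. x a j) a) = rexp_app n Y (b i) y a"
        unfolding Na[OF Y a i] ba[OF Y a i] funpow_Suc_right comp_def
        by (intro sum.cong refl arg_cong2[where f = "(*)"] fm_op_pow_cong[OF _ a i])
          (unfold fm_op_def, rule fm_sysD[OF s])
    qed
    \<comment> \<open>For zero input the expressions \<xi> give zero: definedness of all pivots at Y
      forces the pencil to be injective there.\<close>
    have wp: "well_posed n L ?Y A"
      unfolding well_posed_iff_sys[where B = B]
    proof (intro allI impI)
      fix x a i assume "fm_sys n L ?Y A B x (\<lambda>_. 0)" "a < n" "i < L"
      from sol[OF this(1,3,2)] show "x a i = 0" by simp
    qed
    show ?thesis unfolding realizes_def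
    proof (intro conjI wp allI impI)
      fix x y a assume s: "fm_sys n L ?Y A B x y" and a: "a < n"
      have "rexp_app n Y R y a = D * y a + (\<Sum>i<L. C i * rexp_app n Y (\<xi> i) y a)"
        unfolding R_def rexp_app_Add[OF YR[unfolded R_def] a] rexp_app_const[OF Y a]
          rexp_app_sum_rexp[OF finite_lessThan sumd a]
        using \<xi>d a by (simp add: rexp_app_scaled)
      also have "(\<Sum>i<L. C i * rexp_app n Y (\<xi> i) y a) = (\<Sum>i<L. C i * x a i)"
        by (intro sum.cong refl) (simp add: sol[OF s _ a])
      finally show "(\<Sum>b<n. ent (rexp_val n R Y) a b * y b) = D * y a + (\<Sum>i<L. C i * x a i)"
        unfolding rexp_app_def .
    qed
  qed
  moreover have "X \<in> rexp_dom m R"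
    using X \<xi>X by (simp add: R_def rexp_dom_Add rexp_dom_sum rexp_dom_Mul)
  ultimately show ?thesis unfolding realized_def by blast
qed

section \<open>Observability and controllability\<close>

text \<open>The family spans \<open>K^L\<close>, expressed by the vanishing of its annihilator.
  Observability says this of rows and controllability of columns, so both share their linear
  algebra.\<close>

definition separating :: "nat \<Rightarrow> ('w \<Rightarrow> nat \<Rightarrow> 'a::field) \<Rightarrow> bool" where
  "separating L f \<longleftrightarrow> (\<forall>v. (\<forall>w. (\<Sum>l<L. f w l * v l) = 0) \<longrightarrow> (\<forall>l<L. v l = 0))"

lemma separatingD:
  assumes "separating L f" "\<And>w. (\<Sum>l<L. f w l * v l) = (\<Sum>l<L. f w l * u l)" "l < L"
  shows "v l = u l"
proof -
  have "(\<Sum>l<L. f w l * (v l - u l)) = 0" for w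
    using assms(2)[of w] by (simp add: right_diff_distrib sum_subtractf)
  then show ?thesis using assms(1,3) unfolding separating_def by (metis eq_iff_diff_eq_0)
qed

lemma separating_dual_basis:
  assumes "separating L f"
  shows "\<exists>ws \<iota>. dual_basis L f L ws \<iota>"
proof -
  obtain r ws \<iota> where b: "dual_basis L f r ws \<iota>" using dual_basis_exists by blast
  have "\<not> r < L"
  proof
    assume "r < L"
    from dual_basis_annihilator[OF b this] show False using assms unfolding separating_def by blast
  qed
  then have "r = L" using dual_basis_le[OF b] by simp
  then show ?thesis using b by blast
qed

text \<open>For r = L the two matrices are square, so the inverse on one side is an inverse on the
  other.\<close>

lemma dual_basis_swap:
  assumes b: "dual_basis L f L ws \<iota>" and l: "l < L" "l' < L"
  shows "(\<Sum>i<L. \<iota> l i * f (ws i) l') = (if l = l' then 1 else 0)"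
proof -
  let ?S = "mat L L (\<lambda>(i, l). f (ws i) l)" and ?T = "mat L L (\<lambda>(l, j). \<iota> l j)"
  have c: "?S \<in> carrier_mat L L" "?T \<in> carrier_mat L L" by auto
  have "?S * ?T = 1\<^sub>m L"
  proof (rule eq_matI)
    fix i j assume "i < dim_row (1\<^sub>m L :: 'b mat)" "j < dim_col (1\<^sub>m L :: 'b mat)"
    then have ij: "i < L" "j < L" by auto
    show "(?S * ?T) $$ (i, j) = 1\<^sub>m L $$ (i, j)"
      unfolding index_mult_mat_sum[OF c ij] using dual_basisD(1)[OF b ij] ij by simp
  qed auto
  then have "?T * ?S = 1\<^sub>m L" by (rule mat_mult_left_right_inverse[OF c])
  moreover have "(?T * ?S) $$ (l, l') = (\<Sum>i<L. ?T $$ (l, i) * ?S $$ (i, l'))" by (rule index_mult_mat_sum[OF c(2,1) l])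
  ultimately show ?thesis using l by simp
qed

lemma separatingI:
  assumes "dual_basis L f L ws \<iota>"
  shows "separating L f"
  unfolding separating_def
proof (intro allI impI)
  fix v l assume v: "\<forall>w. (\<Sum>l<L. f w l * v l) = 0" and l: "l < L"
  have "v l = (\<Sum>l'<L. (if l = l' then 1 else 0) * v l')" using l by simp
  also have "\<dots> = (\<Sum>l'<L. (\<Sum>i<L. \<iota> l i * f (ws i) l') * v l')"
    by (intro sum.cong refl) (simp add: dual_basis_swap[OF assms l])
  also have "\<dots> = (\<Sum>i<L. \<iota> l i * (\<Sum>l'<L. f (ws i) l' * v l'))"
    unfolding sum_distrib_left sum_distrib_right by (subst sum.swap) (simp only: mult.assoc)
  also have "\<dots> = 0" using v by simp
  finally show "v l = 0" .
qed

lemma word_mat_mult_index: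
  assumes "\<And>k. A k \<in> carrier_mat L L" "M \<in> carrier_mat L c" "i < L" "j < c"
  shows "(word_mat L A w * M) $$ (i, j) = word_act L (\<lambda>k. ent (A k)) w (\<lambda>l. M $$ (l, j)) i"
  using assms(3)
proof (induction w arbitrary: i)
  case Nil
  then show ?case using assms(2,4) by simp
next
  case (Cons k w)
  have w: "word_mat L A w \<in> carrier_mat L L" by (rule word_mat_carrier) (rule assms(1))
  have "(word_mat L A (k # w) * M) $$ (i, j) = (A k * (word_mat L A w * M)) $$ (i, j)"
    by (simp add: assoc_mult_mat[OF assms(1) w assms(2)])
  also have "\<dots> = (\<Sum>l<L. A k $$ (i, l) * (word_mat L A w * M) $$ (l, j))"
    by (rule index_mult_mat_sum[OF assms(1) mult_carrier_mat[OF w assms(2)] Cons.prems assms(4)])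
  also have "\<dots> = word_act L (\<lambda>k. ent (A k)) (k # w) (\<lambda>l. M $$ (l, j)) i"
    by (simp add: Cons.IH)
  finally show ?case .
qed

lemma obs_row_index:
  assumes "\<And>k. A k \<in> carrier_mat L L" "C \<in> carrier_mat 1 L" "l < L"
  shows "(C * word_mat L A w) $$ (0, l) = obs_row L (\<lambda>k. ent (A k)) (\<lambda>i. C $$ (0, i)) w l"
proof -
  have w: "word_mat L A w \<in> carrier_mat L L" by (rule word_mat_carrier) (rule assms(1))
  have "word_mat L A w $$ (i, l) = word_act L (\<lambda>k. ent (A k)) w (unit_fun l) i" if i: "i < L" for i
  proof -
    have "word_mat L A w $$ (i, l) = (word_mat L A w * 1\<^sub>m L) $$ (i, l)" using w by simp
    also have "\<dots> = word_act L (\<lambda>k. ent (A k)) w (\<lambda>j. 1\<^sub>m L $$ (j, l)) i"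
      by (rule word_mat_mult_index) (use assms i in auto)
    also have "\<dots> = word_act L (\<lambda>k. ent (A k)) w (unit_fun l) i"
      by (rule word_act_cong[OF _ i]) (use assms(3) in \<open>simp add: unit_fun_def\<close>)
    finally show ?thesis .
  qed
  then show ?thesis
    unfolding obs_row_def by (subst index_mult_mat_sum[OF assms(2) w _ assms(3)]) simp_all
qed

lemma fm_observable_iff:
  fixes A :: "'d \<Rightarrow> 'a::field mat"
  assumes A: "\<And>k. A k \<in> carrier_mat L L" and C: "C \<in> carrier_mat 1 L"
  shows "fm_observable L A C \<longleftrightarrow> separating L (obs_row L (\<lambda>k. ent (A k)) (\<lambda>i. C $$ (0, i)))"
proof -
  let ?f = "obs_row L (\<lambda>k. ent (A k)) (\<lambda>i. C $$ (0, i))"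
  have w: "C * word_mat L A w \<in> carrier_mat 1 L" for w
    by (rule mult_carrier_mat[OF C]) (rule word_mat_carrier, rule A)
  have ker: "v \<in> (\<Inter>w. mat_kernel (C * word_mat L A w)) \<longleftrightarrow> v \<in> carrier_vec L \<and> (\<forall>w. (\<Sum>l<L. ?f w l * v $ l) = 0)" for v
  proof -
    have "v \<in> mat_kernel (C * word_mat L A w) \<longleftrightarrow> v \<in> carrier_vec L \<and> (\<Sum>l<L. ?f w l * v $ l) = 0" for w
    proof (cases "v \<in> carrier_vec L")
      case True
      have "(C * word_mat L A w *\<^sub>v v) $ 0 = (\<Sum>l<L. (C * word_mat L A w) $$ (0, l) * v $ l)"
        by (rule index_mult_vec_sum[OF w True]) simp
      also have "\<dots> = (\<Sum>l<L. ?f w l * v $ l)"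
        by (rule sum.cong[OF refl], subst obs_row_index[OF A C]) auto
      finally have 1: "(C * word_mat L A w *\<^sub>v v) $ 0 = (\<Sum>l<L. ?f w l * v $ l)" .
      have "z = 0\<^sub>v 1 \<longleftrightarrow> z $ 0 = 0" if "z \<in> carrier_vec 1" for z :: "'a vec"
        using that by (auto intro!: eq_vecI)
      note this[OF mult_mat_vec_carrier[OF w[of w] True]]
      then show ?thesis unfolding mat_kernel[OF w] mem_Collect_eq 1 using True by blast
    next
      case False
      then show ?thesis unfolding mat_kernel[OF w] by simp
    qed
    then show ?thesis by blast
  qed
  show ?thesis
  proof
    assume o: "fm_observable L A C"
    show "separating L ?f" unfolding separating_def
    proof (intro allI impI)
      fix v l assume v: "\<forall>w. (\<Sum>l<L. ?f w l * v l) = 0" and l: "l < L"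
      have "(\<Sum>l<L. ?f w l * vec L v $ l) = (\<Sum>l<L. ?f w l * v l)" for w by (intro sum.cong refl) simp
      then have "vec L v \<in> (\<Inter>w. mat_kernel (C * word_mat L A w))"
        unfolding ker using v by simp
      then have "vec L v = 0\<^sub>v L" using o unfolding fm_observable_def by blast
      then show "v l = 0" using l by (metis index_vec index_zero_vec(1))
    qed
  next
    assume s: "separating L ?f"
    have "v = 0\<^sub>v L" if "v \<in> (\<Inter>w. mat_kernel (C * word_mat L A w))" for v
    proof -
      have v: "v \<in> carrier_vec L" "\<forall>w. (\<Sum>l<L. ?f w l * v $ l) = 0" using that unfolding ker by blast+
      then have "\<forall>l<L. v $ l = 0" using s unfolding separating_def by blast
      then show ?thesis using v(1) by (intro eq_vecI) auto
    qed
    moreover have "0\<^sub>v L \<in> (\<Inter>w. mat_kernel (C * word_mat L A w))" unfolding ker by simp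
    ultimately show "fm_observable L A C" unfolding fm_observable_def by blast
  qed
qed

text \<open>The kernel of a functional that vanishes on the family contains its span; conversely, a
  dual basis of full size expands every vector in the family.\<close>

lemma span_eq_carrier_iff_separating:
  fixes u :: "'w \<Rightarrow> 'a::field vec"
  assumes u: "\<And>w. u w \<in> carrier_vec L"
  shows "LinearCombinations.module.span class_ring (module_vec TYPE('a) L) (range u) = carrier_vec L \<longleftrightarrow>
    separating L (\<lambda>w l. u w $ l)"
proof -
  interpret V: vec_space "TYPE('a)" L .
  have S: "range u \<subseteq> carrier_vec L" using u by blast
  have "submodule class_ring (V.span (range u)) (module_vec TYPE('a) L)" by (rule V.span_is_submodule) (use S in simp)
  note sub = submodule.m_closed[OF this, simplified] submodule.smult_closed[OF this, simplified]
    submodule.zero_closed[OF this, simplified] submodule.subset[OF this, simplified]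
  show ?thesis
  proof
    assume sp: "V.span (range u) = carrier_vec L"
    show "separating L (\<lambda>w l. u w $ l)" unfolding separating_def
    proof (intro allI impI)
      fix v l assume v: "\<forall>w. (\<Sum>l<L. u w $ l * v l) = 0" and l: "l < L"
      \<comment> \<open>The kernel of the functional v, a subspace that contains the family and
        hence all unit vectors.\<close>
      define W where "W = {x \<in> carrier_vec L. (\<Sum>l<L. x $ l * v l) = 0}"
      have "submodule class_ring W (module_vec TYPE('a) L)"
      proof (unfold_locales, simp_all add: W_def module_vec_simps class_ring_simps)
      qed (auto simp: distrib_right sum.distrib mult.assoc sum_distrib_left[symmetric])
      then have "V.span (range u) \<subseteq> W"
        by (rule V.span_is_subset[rotated]) (use u v in \<open>auto simp: W_def\<close>)
      then have "unit_vec L l \<in> W" unfolding sp by auto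
      then have "(\<Sum>j<L. unit_vec L l $ j * v j) = 0" by (simp add: W_def)
      moreover have "(\<Sum>j<L. unit_vec L l $ j * v j) = (\<Sum>j<L. (if j = l then 1 else 0) * v j)"
        using l by (intro sum.cong refl) (simp add: unit_vec_def)
      ultimately show "v l = 0" using l by simp
    qed
  next
    assume "separating L (\<lambda>w l. u w $ l)"
    then obtain ws \<iota> where b: "dual_basis L (\<lambda>w l. u w $ l) L ws \<iota>" using separating_dual_basis by blast
    have cl: "vec L (\<lambda>l. \<Sum>i<r. c i * u (ws i) $ l) \<in> V.span (range u)" for r and c :: "nat \<Rightarrow> 'a"
    proof (induction r)
      case 0
      have "vec L (\<lambda>l. \<Sum>i<0. c i * u (ws i) $ l) = 0\<^sub>v L" by (rule eq_vecI) auto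
      then show ?case using sub(3) by (simp add: module_vec_simps)
    next
      case (Suc r)
      have "u (ws r) \<in> V.span (range u)" using V.in_own_span[of "range u"] S by auto
      then have "c r \<cdot>\<^sub>v u (ws r) \<in> V.span (range u)" using sub(2) by (simp add: module_vec_simps)
      from sub(1)[OF Suc.IH this] have "vec L (\<lambda>l. \<Sum>i<r. c i * u (ws i) $ l) + c r \<cdot>\<^sub>v u (ws r) \<in> V.span (range u)"
        by (simp add: module_vec_simps)
      also have "vec L (\<lambda>l. \<Sum>i<r. c i * u (ws i) $ l) + c r \<cdot>\<^sub>v u (ws r) = vec L (\<lambda>l. \<Sum>i<Suc r. c i * u (ws i) $ l)"
        using u[of "ws r"] by (intro eq_vecI) auto
      finally show ?case .
    qed
    have "x \<in> V.span (range u)" if x: "x \<in> carrier_vec L" for x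
    proof -
      \<comment> \<open>Coordinates of x with respect to the dual basis.\<close>
      define c where "c i = (\<Sum>l<L. \<iota> l i * x $ l)" for i
      have "x $ l = (\<Sum>i<L. c i * u (ws i) $ l)" if l: "l < L" for l
      proof -
        have "(\<Sum>i<L. c i * u (ws i) $ l) = (\<Sum>l'<L. (\<Sum>i<L. \<iota> l' i * u (ws i) $ l) * x $ l')"
          unfolding c_def sum_distrib_right by (subst sum.swap) (simp only: mult_ac)
        also have "\<dots> = (\<Sum>l'<L. (if l' = l then 1 else 0) * x $ l')"
          by (intro sum.cong refl) (simp add: dual_basis_swap[OF b _ l])
        finally show ?thesis using l by simp
      qed
      then have "x = vec L (\<lambda>l. \<Sum>i<L. c i * u (ws i) $ l)" using x by (intro eq_vecI) auto
      then show ?thesis using cl[of c L] by (rule ssubst)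
    qed
    moreover have "V.span (range u) \<subseteq> carrier_vec L" using sub(4) .
    ultimately show "V.span (range u) = carrier_vec L" by blast
  qed
qed

lemma fm_controllable_iff:
  fixes A B :: "'d \<Rightarrow> 'a::field mat"
  assumes A: "\<And>k. A k \<in> carrier_mat L L" and B: "\<And>k. B k \<in> carrier_mat L 1"
  shows "fm_controllable L A B \<longleftrightarrow> separating L (ctr_col L (\<lambda>k. ent (A k)) (\<lambda>k i. B k $$ (i, 0)))"
proof -
  let ?f = "ctr_col L (\<lambda>k. ent (A k)) (\<lambda>k i. B k $$ (i, 0))"
  define u where "u wk = col (word_mat L A (fst wk) * B (snd wk)) 0" for wk
  have c: "word_mat L A w * B k \<in> carrier_mat L 1" for w k
    by (rule mult_carrier_mat[OF _ B]) (rule word_mat_carrier, rule A)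
  have u: "u wk \<in> carrier_vec L" for wk unfolding u_def carrier_vec_def using carrier_matD(1)[OF c] by simp
  have uf: "u wk $ l = ?f wk l" if l: "l < L" for wk l
  proof -
    have "u wk $ l = (word_mat L A (fst wk) * B (snd wk)) $$ (l, 0)"
      unfolding u_def by (rule index_col) (simp_all only: carrier_matD[OF c] l zero_less_one)
    also have "\<dots> = ?f wk l" unfolding ctr_col_def by (rule word_mat_mult_index[OF A B l]) simp
    finally show ?thesis .
  qed
  have "{col (word_mat L A w * B j) 0 | w j. True} = range u" unfolding u_def full_SetCompr_eq[symmetric] by force
  then have "fm_controllable L A B \<longleftrightarrow> separating L (\<lambda>w l. u w $ l)"
    unfolding fm_controllable_def using span_eq_carrier_iff_separating[OF u] by simp
  also have "\<dots> \<longleftrightarrow> separating L ?f"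
  proof -
    have "(\<Sum>l<L. u w $ l * v l) = (\<Sum>l<L. ?f w l * v l)" for w v by (intro sum.cong refl) (simp add: uf)
    then show ?thesis unfolding separating_def by simp
  qed
  finally show ?thesis .
qed

section \<open>Realizations with equal Markov parameters\<close>

text \<open>The entry of the Hankel matrix at a row word and a column word is the Markov parameter
  of their concatenation.\<close>

lemma hankel_eq:
  assumes "\<And>w k. (\<Sum>i<L. C i * word_act L A w (B k) i) = (\<Sum>i<L'. C' i * word_act L' A' w (B' k) i)"
  shows "(\<Sum>l<L. obs_row L A C w l * ctr_col L A B vk l) = (\<Sum>l<L'. obs_row L' A' C' w l * ctr_col L' A' B' vk l)"
  unfolding obs_row_act unfolding ctr_col_def word_act_append[symmetric] by (rule assms)

text \<open>The Hankel matrix factors through \<open>K^L'\<close>, while observability and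
  controllability of the first realization select rows and columns for which it is invertible of
  size L.\<close>

lemma hankel_dim_le:
  fixes A :: "'d::finite \<Rightarrow> nat \<Rightarrow> nat \<Rightarrow> 'a::field"
  assumes M: "\<And>w k. (\<Sum>i<L. C i * word_act L A w (B k) i) = (\<Sum>i<L'. C' i * word_act L' A' w (B' k) i)"
    and obs: "separating L (obs_row L A C)" and ctr: "separating L (ctr_col L A B)"
  shows "L \<le> L'"
proof -
  obtain ws \<iota> where bo: "dual_basis L (obs_row L A C) L ws \<iota>" using separating_dual_basis[OF obs] by blast
  obtain vs \<kappa> where bc: "dual_basis L (ctr_col L A B) L vs \<kappa>" using separating_dual_basis[OF ctr] by blast
  \<comment> \<open>Here \<iota> and \<kappa> invert the observability and controllability matrices
    of the first realization. The second controllability columns times both inverses form a right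
    inverse of the second observability rows.\<close>
  define G where "G l j = (\<Sum>p<L. ctr_col L' A' B' (vs p) l * (\<Sum>q<L. \<kappa> q p * \<iota> q j))" for l j
  show ?thesis
  proof (rule rect_inverse_le[where F = "\<lambda>i. obs_row L' A' C' (ws i)" and G = G])
    fix i j assume i: "i < L" and j: "j < L"
    let ?S = "\<lambda>l. obs_row L A C (ws i) l" and ?T = "\<lambda>p l. ctr_col L A B (vs p) l"
    have "(\<Sum>l<L'. obs_row L' A' C' (ws i) l * G l j) =
      (\<Sum>p<L. (\<Sum>l<L'. obs_row L' A' C' (ws i) l * ctr_col L' A' B' (vs p) l) * (\<Sum>q<L. \<kappa> q p * \<iota> q j))"
      unfolding G_def sum_distrib_left[of "obs_row L' A' C' (ws i) _"] sum_distrib_right[of _ "{..<L'}"]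
      by (subst sum.swap) (simp only: mult.assoc)
    also have "\<dots> = (\<Sum>p<L. (\<Sum>l<L. ?S l * ?T p l) * (\<Sum>q<L. \<kappa> q p * \<iota> q j))"
      unfolding hankel_eq[OF M] ..
    also have "\<dots> = (\<Sum>p<L. \<Sum>l<L. \<Sum>q<L. ?S l * \<iota> q j * (\<kappa> q p * ?T p l))"
      unfolding sum_distrib_left sum_distrib_right by (subst sum.swap) (simp only: mult_ac)
    also have "\<dots> = (\<Sum>l<L. \<Sum>p<L. \<Sum>q<L. ?S l * \<iota> q j * (\<kappa> q p * ?T p l))" by (rule sum.swap)
    also have "\<dots> = (\<Sum>l<L. \<Sum>q<L. \<Sum>p<L. ?S l * \<iota> q j * (\<kappa> q p * ?T p l))"
      by (rule sum.cong[OF refl], rule sum.swap)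
    also have "\<dots> = (\<Sum>l<L. \<Sum>q<L. ?S l * \<iota> q j * (if q = l then 1 else 0))"
      unfolding sum_distrib_left[symmetric] by (intro sum.cong refl arg_cong[where f = "(*) _"] dual_basis_swap[OF bc]) auto
    also have "\<dots> = (\<Sum>l<L. ?S l * \<iota> l j)" by simp
    also have "\<dots> = (if i = j then 1 else 0)" by (rule dual_basisD(1)[OF bo i j])
    finally show "(\<Sum>l<L'. obs_row L' A' C' (ws i) l * G l j) = (if i = j then 1 else 0)" .
  qed
qed

text \<open>T is the inverse of the second observability matrix times the first one. Both
  realizations have the same Hankel matrix, so T carries controllability columns to controllability
  columns.\<close>

lemma similarity_exists:
  fixes A :: "'d::finite \<Rightarrow> nat \<Rightarrow> nat \<Rightarrow> 'a::field"
  assumes M: "\<And>w k. (\<Sum>i<L. C i * word_act L A w (B k) i) = (\<Sum>i<L. C' i * word_act L A' w (B' k) i)"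
    and obs: "separating L (obs_row L A' C')"
  shows "\<exists>T. \<forall>vk. \<forall>l<L. (\<Sum>j<L. T l j * ctr_col L A B vk j) = ctr_col L A' B' vk l"
proof -
  obtain ws \<iota> where b: "dual_basis L (obs_row L A' C') L ws \<iota>" using separating_dual_basis[OF obs] by blast
  have "(\<Sum>j<L. (\<Sum>i<L. \<iota> l i * obs_row L A C (ws i) j) * ctr_col L A B vk j) = ctr_col L A' B' vk l"
    if l: "l < L" for vk l
  proof -
    have "(\<Sum>j<L. (\<Sum>i<L. \<iota> l i * obs_row L A C (ws i) j) * ctr_col L A B vk j) =
      (\<Sum>i<L. \<iota> l i * (\<Sum>j<L. obs_row L A C (ws i) j * ctr_col L A B vk j))"
      unfolding sum_distrib_left sum_distrib_right by (subst sum.swap) (simp only: mult.assoc)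
    also have "\<dots> = (\<Sum>i<L. \<iota> l i * (\<Sum>j<L. obs_row L A' C' (ws i) j * ctr_col L A' B' vk j))"
      unfolding hankel_eq[OF M] ..
    also have "\<dots> = (\<Sum>j<L. (\<Sum>i<L. \<iota> l i * obs_row L A' C' (ws i) j) * ctr_col L A' B' vk j)"
      unfolding sum_distrib_left sum_distrib_right by (subst sum.swap) (simp only: mult.assoc)
    also have "\<dots> = (\<Sum>j<L. (if l = j then 1 else 0) * ctr_col L A' B' vk j)"
      by (intro sum.cong refl) (simp add: dual_basis_swap[OF b l])
    finally show ?thesis using l by simp
  qed
  then show ?thesis by (intro exI[of _ "\<lambda>l j. \<Sum>i<L. \<iota> l i * obs_row L A C (ws i) j"] allI impI)
qed

lemma sum_mult_assoc:
  fixes f :: "'i \<Rightarrow> 'r::comm_ring_1"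
  shows "(\<Sum>j\<in>J. f j * (\<Sum>m\<in>I. g j m * h m)) = (\<Sum>m\<in>I. (\<Sum>j\<in>J. f j * g j m) * h m)"
  unfolding sum_distrib_left sum_distrib_right by (subst sum.swap) (simp only: mult.assoc)

lemma intertwine_ctr_col:
  assumes B: "\<And>k l. l < L \<Longrightarrow> (\<Sum>j<L. T l j * B k j) = B' k l"
    and A: "\<And>k i l. i < L \<Longrightarrow> l < L \<Longrightarrow> (\<Sum>j<L. T i j * A k j l) = (\<Sum>j<L. A' k i j * T j l)"
    and l: "l < L"
  shows "(\<Sum>j<L. T l j * ctr_col L A B wk j) = ctr_col L A' B' wk l"
proof -
  obtain w k where wk: "wk = (w, k)" by (cases wk)
  have "(\<Sum>j<L. T l j * word_act L A w (B k) j) = word_act L A' w (B' k) l"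
    using l
  proof (induction w arbitrary: l)
    case Nil
    then show ?case by (simp add: B)
  next
    case (Cons k' w)
    have "(\<Sum>j<L. T l j * word_act L A (k' # w) (B k) j) = (\<Sum>m<L. (\<Sum>j<L. T l j * A k' j m) * word_act L A w (B k) m)"
      unfolding word_act.simps by (rule sum_mult_assoc)
    also have "\<dots> = (\<Sum>m<L. (\<Sum>j<L. A' k' l j * T j m) * word_act L A w (B k) m)"
      by (intro sum.cong refl) (simp add: A Cons.prems)
    also have "\<dots> = (\<Sum>j<L. A' k' l j * (\<Sum>m<L. T j m * word_act L A w (B k) m))"
      by (rule sum_mult_assoc[symmetric])
    also have "\<dots> = word_act L A' (k' # w) (B' k) l"
      unfolding word_act.simps by (intro sum.cong refl) (simp add: Cons.IH)
    finally show ?case .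
  qed
  then show ?thesis by (simp add: wk ctr_col_def)
qed

text \<open>The intertwining relation for \<open>A\<^sub>k\<close> may be tested on controllability
  columns, since they separate functionals; there it is the hypothesis for the word prolonged by
  k.\<close>

lemma ctr_col_intertwine:
  fixes A :: "'d \<Rightarrow> nat \<Rightarrow> nat \<Rightarrow> 'a::field"
  assumes ctr: "separating L (ctr_col L A B)"
    and T: "\<And>vk l. l < L \<Longrightarrow> (\<Sum>j<L. T l j * ctr_col L A B vk j) = ctr_col L A' B' vk l"
  shows "l < L \<Longrightarrow> (\<Sum>j<L. T l j * B k j) = B' k l"
    and "i < L \<Longrightarrow> l < L \<Longrightarrow> (\<Sum>j<L. T i j * A k j l) = (\<Sum>j<L. A' k i j * T j l)"
proof -
  show "(\<Sum>j<L. T l j * B k j) = B' k l" if "l < L"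
    using T[OF that, of "([], k)"] by (simp add: ctr_col_def)
  assume i: "i < L" and l: "l < L"
  show "(\<Sum>j<L. T i j * A k j l) = (\<Sum>j<L. A' k i j * T j l)"
  proof (rule separatingD[OF ctr _ l, where v = "\<lambda>l. \<Sum>j<L. T i j * A k j l" and u = "\<lambda>l. \<Sum>j<L. A' k i j * T j l"])
    fix wk :: "'d list \<times> 'd"
    let ?c = "ctr_col L A B wk" and ?kw = "(k # fst wk, snd wk)"
    have "(\<Sum>l<L. (\<Sum>j<L. T i j * A k j l) * ?c l) = (\<Sum>j<L. T i j * ctr_col L A B ?kw j)"
      unfolding sum_mult_assoc[symmetric] by (simp add: ctr_col_def)
    also have "\<dots> = ctr_col L A' B' ?kw i" by (rule T[OF i])
    also have "\<dots> = (\<Sum>j<L. A' k i j * (\<Sum>l<L. T j l * ?c l))"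
      by (simp add: ctr_col_def T[unfolded ctr_col_def])
    also have "\<dots> = (\<Sum>l<L. (\<Sum>j<L. A' k i j * T j l) * ?c l)" by (rule sum_mult_assoc)
    finally show "(\<Sum>l<L. ?c l * (\<Sum>j<L. T i j * A k j l)) = (\<Sum>l<L. ?c l * (\<Sum>j<L. A' k i j * T j l))"
      by (simp only: mult.commute)
  qed
qed

text \<open>A similarity must carry the controllability columns of one realization to those of the
  other, and these span the state space: this gives uniqueness and all the identities.\<close>

lemma unique_similarity:
  fixes A B A' B' :: "'d::finite \<Rightarrow> 'a::field mat"
  assumes A: "\<And>k. A k \<in> carrier_mat L L" and B: "\<And>k. B k \<in> carrier_mat L 1" and C: "C \<in> carrier_mat 1 L"
    and A': "\<And>k. A' k \<in> carrier_mat L L" and B': "\<And>k. B' k \<in> carrier_mat L 1" and C': "C' \<in> carrier_mat 1 L"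
    and obs: "separating L (obs_row L (\<lambda>k. ent (A k)) (\<lambda>i. C $$ (0, i)))"
    and ctr: "separating L (ctr_col L (\<lambda>k. ent (A k)) (\<lambda>k i. B k $$ (i, 0)))"
    and obs': "separating L (obs_row L (\<lambda>k. ent (A' k)) (\<lambda>i. C' $$ (0, i)))"
    and M: "\<And>w k. (\<Sum>i<L. C $$ (0, i) * word_act L (\<lambda>k. ent (A k)) w (\<lambda>i. B k $$ (i, 0)) i) =
      (\<Sum>i<L. C' $$ (0, i) * word_act L (\<lambda>k. ent (A' k)) w (\<lambda>i. B' k $$ (i, 0)) i)"
  shows "\<exists>!T. T \<in> carrier_mat L L \<and> invertible_mat T \<and> C' = C * mat_inv T \<and>
    (\<forall>k. B' k = T * B k) \<and> (\<forall>k. A' k = T * A k * mat_inv T)"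
proof -
  let ?c = "ctr_col L (\<lambda>k. ent (A k)) (\<lambda>k i. B k $$ (i, 0))"
  let ?c' = "ctr_col L (\<lambda>k. ent (A' k)) (\<lambda>k i. B' k $$ (i, 0))"
  obtain T0 where T0: "\<And>vk l. l < L \<Longrightarrow> (\<Sum>j<L. T0 l j * ?c vk j) = ?c' vk l"
    using similarity_exists[where A = "\<lambda>k. ent (A k)" and B = "\<lambda>k i. B k $$ (i, 0)" and B' = "\<lambda>k i. B' k $$ (i, 0)", OF M obs'] by blast
  obtain T1 where T1: "\<And>vk l. l < L \<Longrightarrow> (\<Sum>j<L. T1 l j * ?c' vk j) = ?c vk l"
    using similarity_exists[where A = "\<lambda>k. ent (A' k)" and B = "\<lambda>k i. B' k $$ (i, 0)" and B' = "\<lambda>k i. B k $$ (i, 0)", OF M[symmetric] obs] by blast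
  have eqI: "f l = g l" if "\<And>vk. (\<Sum>l<L. f l * ?c vk l) = (\<Sum>l<L. g l * ?c vk l)" "l < L" for f g l
    by (rule separatingD[OF ctr _ that(2)]) (use that(1) in \<open>simp only: mult.commute\<close>)
  define T where "T = mat L L (\<lambda>(i, j). T0 i j)"
  define U where "U = mat L L (\<lambda>(i, j). T1 i j)"
  have Tc: "T \<in> carrier_mat L L" and Uc: "U \<in> carrier_mat L L" by (simp_all add: T_def U_def)
  \<comment> \<open>The maps obtained in the two directions compose to a map that fixes every
    controllability column.\<close>
  have "U * T = 1\<^sub>m L"
  proof (rule eq_matI)
    fix i j assume "i < dim_row (1\<^sub>m L :: 'a mat)" "j < dim_col (1\<^sub>m L :: 'a mat)"
    then have ij: "i < L" "j < L" by auto
    have "(\<Sum>m<L. T1 i m * T0 m j) = (if i = j then 1 else 0)"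
    proof (rule eqI[OF _ ij(2), where f = "\<lambda>j. \<Sum>m<L. T1 i m * T0 m j" and g = "\<lambda>j. if i = j then 1 else 0"])
      fix vk
      have "(\<Sum>l<L. (\<Sum>m<L. T1 i m * T0 m l) * ?c vk l) = (\<Sum>m<L. T1 i m * (\<Sum>l<L. T0 m l * ?c vk l))"
        by (rule sum_mult_assoc[symmetric])
      also have "\<dots> = (\<Sum>m<L. T1 i m * ?c' vk m)" by (intro sum.cong refl) (simp add: T0)
      also have "\<dots> = ?c vk i" by (rule T1[OF ij(1)])
      finally show "(\<Sum>l<L. (\<Sum>m<L. T1 i m * T0 m l) * ?c vk l) = (\<Sum>l<L. (if i = l then 1 else 0) * ?c vk l)"
        using ij by simp
    qed
    then show "(U * T) $$ (i, j) = 1\<^sub>m L $$ (i, j)"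
      unfolding index_mult_mat_sum[OF Uc Tc ij] using ij by (simp add: T_def U_def)
  qed (simp_all add: T_def U_def)
  then have "det U * det T = 1" using det_mult[OF Uc Tc] by simp
  then have "det T \<noteq> 0" by auto
  then have inv: "invertible_mat T" using invertible_mat_iff_det[OF Tc] by simp
  note Ti = mat_inv_props[OF Tc inv]
  have entT: "T $$ (i, j) = T0 i j" if "i < L" "j < L" for i j using that by (simp add: T_def)
  have TB: "T * B k = B' k" for k
  proof (rule eq_matI)
    fix i j assume "i < dim_row (B' k)" "j < dim_col (B' k)"
    then have ij: "i < L" "j = 0" using B'[of k] by auto
    have "(T * B k) $$ (i, 0) = (\<Sum>j<L. T0 i j * B k $$ (j, 0))"
      by (subst index_mult_mat_sum[OF Tc B ij(1)]) (auto simp: entT ij(1))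
    then show "(T * B k) $$ (i, j) = B' k $$ (i, j)"
      using ctr_col_intertwine(1)[OF ctr T0 ij(1), of k] ij(2) by simp
  qed (use Tc B[of k] B'[of k] in auto)
  have TA: "T * A k = A' k * T" for k
  proof (rule eq_matI)
    fix i j assume "i < dim_row (A' k * T)" "j < dim_col (A' k * T)"
    then have ij: "i < L" "j < L" using A'[of k] Tc by auto
    have "(T * A k) $$ (i, j) = (\<Sum>m<L. T0 i m * A k $$ (m, j))"
      by (subst index_mult_mat_sum[OF Tc A ij]) (auto simp: entT ij(1))
    moreover have "(A' k * T) $$ (i, j) = (\<Sum>m<L. A' k $$ (i, m) * T0 m j)"
      by (subst index_mult_mat_sum[OF A' Tc ij]) (auto simp: entT ij(2))
    ultimately show "(T * A k) $$ (i, j) = (A' k * T) $$ (i, j)"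
      using ctr_col_intertwine(2)[OF ctr T0 ij, of k] by simp
  qed (use Tc A[of k] A'[of k] in auto)
  have CT: "C' * T = C"
  proof (rule eq_matI)
    fix i j assume "i < dim_row C" "j < dim_col C"
    then have ij: "i = 0" "j < L" using C by auto
    have "(\<Sum>m<L. C' $$ (0, m) * T0 m j) = C $$ (0, j)"
    proof (rule eqI[OF _ ij(2), where f = "\<lambda>j. \<Sum>m<L. C' $$ (0, m) * T0 m j"])
      fix vk
      have "(\<Sum>l<L. (\<Sum>m<L. C' $$ (0, m) * T0 m l) * ?c vk l) = (\<Sum>m<L. C' $$ (0, m) * (\<Sum>l<L. T0 m l * ?c vk l))"
        by (rule sum_mult_assoc[symmetric])
      also have "\<dots> = (\<Sum>m<L. C' $$ (0, m) * ?c' vk m)" by (intro sum.cong refl) (simp add: T0)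
      also have "\<dots> = (\<Sum>l<L. C $$ (0, l) * ?c vk l)" using M by (simp add: ctr_col_def)
      finally show "(\<Sum>l<L. (\<Sum>m<L. C' $$ (0, m) * T0 m l) * ?c vk l) = (\<Sum>l<L. C $$ (0, l) * ?c vk l)" .
    qed
    moreover have "(C' * T) $$ (0, j) = (\<Sum>m<L. C' $$ (0, m) * T0 m j)"
      by (subst index_mult_mat_sum[OF C' Tc _ ij(2)]) (auto simp: entT ij(2))
    ultimately show "(C' * T) $$ (i, j) = C $$ (i, j)" using ij(1) by simp
  qed (use Tc C C' in auto)
  have "C' = C * mat_inv T"
    unfolding CT[symmetric] using C' Tc Ti by (simp add: assoc_mult_mat[OF C' Tc Ti(1)])
  moreover have "A' k = T * A k * mat_inv T" for k
    unfolding TA using A'[of k] Tc Ti by (simp add: assoc_mult_mat[OF A' Tc Ti(1)])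
  ultimately have ex: "T \<in> carrier_mat L L \<and> invertible_mat T \<and> C' = C * mat_inv T \<and>
    (\<forall>k. B' k = T * B k) \<and> (\<forall>k. A' k = T * A k * mat_inv T)"
    using Tc inv TB by simp
  show ?thesis
  proof (rule ex1I[of _ T])
    fix S assume S: "S \<in> carrier_mat L L \<and> invertible_mat S \<and> C' = C * mat_inv S \<and>
      (\<forall>k. B' k = S * B k) \<and> (\<forall>k. A' k = S * A k * mat_inv S)"
    then have Sc: "S \<in> carrier_mat L L" by blast
    have "invertible_mat S" using S by blast
    note Si = mat_inv_props[OF Sc this]
    have SB: "S * B k = B' k" and SA': "A' k = S * A k * mat_inv S" for k using S by auto
    have SA: "A' k * S = S * A k" for k
      unfolding SA' using assoc_mult_mat[OF mult_carrier_mat[OF Sc A[of k]] Si(1) Sc] Si(3)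
        right_mult_one_mat[OF mult_carrier_mat[OF Sc A[of k]]] by simp
    have Sctr: "(\<Sum>j<L. S $$ (l, j) * ?c vk j) = ?c' vk l" if l: "l < L" for vk l
    proof (rule intertwine_ctr_col[OF _ _ l, where T = "ent S"])
      show "(\<Sum>j<L. S $$ (l, j) * B k $$ (j, 0)) = B' k $$ (l, 0)" if "l < L" for k l
        unfolding SB[symmetric] by (rule index_mult_mat_sum[OF Sc B that, symmetric]) simp
      show "(\<Sum>j<L. S $$ (i, j) * A k $$ (j, l)) = (\<Sum>j<L. A' k $$ (i, j) * S $$ (j, l))" if "i < L" "l < L" for k i l
        using index_mult_mat_sum[OF Sc A[of k] that] index_mult_mat_sum[OF A'[of k] Sc that] SA[of k] by simp
    qed
    show "S = T"
    proof (rule eq_matI)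
      fix i j assume "i < dim_row T" "j < dim_col T"
      then have ij: "i < L" "j < L" using Tc by auto
      \<comment> \<open>Both matrices have the same effect on all controllability columns.\<close>
      have "S $$ (i, j) = T0 i j"
        by (rule eqI[OF _ ij(2), where f = "\<lambda>j. S $$ (i, j)"]) (simp only: Sctr[OF ij(1)] T0[OF ij(1)])
      then show "S $$ (i, j) = T $$ (i, j)" by (simp add: entT ij)
    qed (use Sc Tc in auto)
  qed (rule ex)
qed

section \<open>Rational functions regular at the origin\<close>

text \<open>The smaller coefficients depend neither on R nor on D, so a single reduction serves all
  members of a class.\<close>

lemma realized_reduce:
  fixes A :: "'d::finite \<Rightarrow> nat \<Rightarrow> nat \<Rightarrow> 'a::field"
  assumes "\<not> (separating L (obs_row L A C) \<and> separating L (ctr_col L A B))"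
  shows "\<exists>r<L. \<exists>A' B' C'. \<forall>R D. realized R L A B C D \<longrightarrow> realized R r A' B' C' D"
proof -
  have "\<exists>r<L. \<exists>A' B' C'. \<forall>n X V D. realizes n L X A B C D V \<longrightarrow> realizes n r X A' B' C' D V"
  proof (cases "separating L (obs_row L A C)")
    case False
    obtain r ws \<iota> where b: "dual_basis L (obs_row L A C) r ws \<iota>" using dual_basis_exists by blast
    moreover have "r \<noteq> L" using separatingI[of L "obs_row L A C" ws \<iota>] b False by blast
    ultimately show ?thesis using dual_basis_le[OF b] reduce_observable[OF b, of B] by (meson le_neq_implies_less)
  next
    case True
    then have False: "\<not> separating L (ctr_col L A B)" using assms by blast
    obtain r ws \<iota> where b: "dual_basis L (ctr_col L A B) r ws \<iota>" using dual_basis_exists by blast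
    moreover have "r \<noteq> L" using separatingI[of L "ctr_col L A B" ws \<iota>] b False by blast
    ultimately show ?thesis using dual_basis_le[OF b] reduce_controllable[OF b, of C] by (meson le_neq_implies_less)
  qed
  then show ?thesis unfolding realized_def by meson
qed

lemma realized_exists:
  fixes R :: "('a::field, 'd::finite) nc_rexp"
  assumes "(\<lambda>_. 0\<^sub>m 1 1) \<in> rexp_dom 1 R"
  shows "\<exists>L A B C D. realized R L A B C D"
proof -
  obtain L A B C where "\<forall>n. \<forall>X\<in>matrix_tuples n. \<forall>V. rexp_eval n X R = Some V \<longrightarrow>
    realizes n L (\<lambda>k. ent (X k)) A B C (rexp_val 1 R (\<lambda>_. 0\<^sub>m 1 1) $$ (0, 0)) (ent V)"
    using nc_sem_realization[OF nc_sem_rexp_eval rexp_domD(2)[OF assms]] by (elim exE)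
  then have "realized R L A B C (rexp_val 1 R (\<lambda>_. 0\<^sub>m 1 1) $$ (0, 0))"
    unfolding realized_def using rexp_domD(1,2) by blast
  then show ?thesis by blast
qed

text \<open>A realization of least dimension cannot be reduced. Here it realizes the single
  expression R; \<open>realized_extend\<close> passes to the class.\<close>

lemma realized_separating_exists:
  fixes R :: "('a::field, 'd::finite) nc_rexp"
  assumes "(\<lambda>_. 0\<^sub>m 1 1) \<in> rexp_dom 1 R"
  shows "\<exists>L A B C D. realized R L A B C D \<and> separating L (obs_row L A C) \<and> separating L (ctr_col L A B)"
proof -
  define P where "P L \<longleftrightarrow> (\<exists>A B C D. realized R L A B C D)" for L
  have "\<exists>L. P L" using realized_exists[OF assms] unfolding P_def .
  define L where "L = (LEAST L. P L)"
  have "P L" unfolding L_def by (rule LeastI_ex) fact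
  then obtain A B C D where r: "realized R L A B C D" unfolding P_def by blast
  have "separating L (obs_row L A C) \<and> separating L (ctr_col L A B)"
  proof (rule ccontr)
    assume "\<not> ?thesis"
    from realized_reduce[OF this] obtain r where "r < L" "P r" using r unfolding P_def by blast
    then show False using not_less_Least unfolding L_def by blast
  qed
  then show ?thesis using r by blast
qed

lemma realized_at_origin:
  fixes R :: "('a::field, 'd::finite) nc_rexp"
  assumes zero: "(\<lambda>_. 0\<^sub>m 1 1) \<in> rexp_dom 1 R" and r: "realized R L A B C D"
  shows "rexp_val 1 R (\<lambda>_. 0\<^sub>m 1 1) $$ (0, 0) = D"
proof -
  have "realizes 1 L (\<lambda>k::'d. ent (0\<^sub>m 1 1)) A B C D (ent (rexp_val 1 R (\<lambda>_. 0\<^sub>m 1 1)))"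
    using r[unfolded realized_def, rule_format, OF order_refl zero] .
  then show ?thesis by (rule realizes_at_origin) simp
qed

text \<open>Both realizations compute the value of R at the same shift, which lies in the domain
  because R is regular at the origin.\<close>

lemma realized_markov_eq:
  fixes R :: "('a::field, 'd::finite) nc_rexp"
  assumes zero: "(\<lambda>_. 0\<^sub>m 1 1) \<in> rexp_dom 1 R"
    and r: "realized R L A B C D" and r': "realized R L' A' B' C' D'"
  shows "(\<Sum>i<L. C i * word_act L A w (B k) i) = (\<Sum>i<L'. C' i * word_act L' A' w (B' k) i)"
proof -
  let ?N = "Suc (Suc (length w))"
  let ?X = "\<lambda>k'. shift_mat ?N (w @ [k]) k' :: 'a mat"
  have dom: "?X \<in> rexp_dom ?N R"
    by (rule upper_triangular_dom[OF zero]) (auto simp: shift_mat_def)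
  have "realizes ?N L (\<lambda>k'. ent (?X k')) A B C D (ent (rexp_val ?N R ?X))"
    "realizes ?N L' (\<lambda>k'. ent (?X k')) A' B' C' D' (ent (rexp_val ?N R ?X))"
    using r[unfolded realized_def, rule_format, OF _ dom] r'[unfolded realized_def, rule_format, OF _ dom] by simp_all
  from this[THEN markov_value] show ?thesis by simp
qed

lemma agree_sym: "agree R S \<Longrightarrow> agree S R"
  unfolding agree_def by (metis Int_iff)

lemma rexp_equiv_iff: "(R, S) \<in> rexp_equiv \<longleftrightarrow> nondegenerate R \<and> nondegenerate S \<and> agree R S"
  by (simp add: rexp_equiv_def agree_def)

text \<open>Any member can represent its class; this is where transitivity of agreement
  enters.\<close>

lemma nc_rational_functions_agree:
  fixes F :: "('a::field, 'd::finite) nc_rexp set"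
  assumes F: "F \<in> nc_rational_functions" and R: "R \<in> F"
  shows "S \<in> F \<longleftrightarrow> nondegenerate S \<and> agree S R"
proof -
  obtain Q where Q: "nondegenerate Q" "F = rexp_equiv `` {Q}"
    using F unfolding nc_rational_functions_def quotient_def by blast
  have QR: "nondegenerate R" "agree Q R" using R Q by (auto simp: rexp_equiv_iff)
  have S: "S \<in> F \<longleftrightarrow> nondegenerate S \<and> agree Q S" using Q by (auto simp: rexp_equiv_iff)
  show ?thesis
  proof
    assume "S \<in> F"
    then show "nondegenerate S \<and> agree S R" using S agree_trans[OF agree_sym QR(2) Q(1), of S] by blast
  next
    assume "nondegenerate S \<and> agree S R"
    then show "S \<in> F" using S agree_trans[OF QR(2) agree_sym QR(1), of S] by blast
  qed
qed

lemma rfun_val_eq: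
  fixes F :: "('a::field, 'd::finite) nc_rexp set"
  assumes F: "F \<in> nc_rational_functions" and R: "R \<in> F" and X: "X \<in> rexp_dom n R" and n: "n \<ge> 1"
  shows "rfun_val n F X = rexp_val n R X"
  unfolding rfun_val_def
proof (rule the_equality)
  fix V assume "\<exists>S\<in>F. X \<in> rexp_dom n S \<and> V = rexp_val n S X"
  then obtain S where S: "S \<in> F" "X \<in> rexp_dom n S" "V = rexp_val n S X" by blast
  have "agree S R" using nc_rational_functions_agree[OF F R] S(1) by blast
  then show "V = rexp_val n R X" using S X n unfolding agree_def by blast
qed (use R X in blast)

lemma fm_realization_iff:
  fixes F :: "('a::field, 'd::finite) nc_rexp set"
  assumes F: "F \<in> nc_rational_functions"
  shows "fm_realization F L A B C D \<longleftrightarrow>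
    (\<forall>k. A k \<in> carrier_mat L L) \<and> (\<forall>k. B k \<in> carrier_mat L 1) \<and> C \<in> carrier_mat 1 L \<and> D \<in> carrier_mat 1 1 \<and>
    (\<forall>R\<in>F. realized R L (\<lambda>k. ent (A k)) (\<lambda>k i. B k $$ (i, 0)) (\<lambda>i. C $$ (0, i)) (D $$ (0, 0)))"
proof (cases "(\<forall>k. A k \<in> carrier_mat L L) \<and> (\<forall>k. B k \<in> carrier_mat L 1) \<and> C \<in> carrier_mat 1 L \<and> D \<in> carrier_mat 1 1")
  case True
  then have c: "A k \<in> carrier_mat L L" "B k \<in> carrier_mat L 1" "C \<in> carrier_mat 1 L" "D \<in> carrier_mat 1 1" for k by blast+
  have eq: "invertible_mat (fm_pencil L A m X) \<and> rfun_val m F X = fm_val L A B C D m X \<longleftrightarrow>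
      realizes m L (\<lambda>k. ent (X k)) (\<lambda>k. ent (A k)) (\<lambda>k i. B k $$ (i, 0)) (\<lambda>i. C $$ (0, i)) (D $$ (0, 0)) (ent (rexp_val m R X))"
    if "R \<in> F" "X \<in> rexp_dom m R" "m \<ge> 1" for m X R
    unfolding rfun_val_eq[OF F that]
    by (rule realizes_iff_fm_val) (fact c matrix_tuplesD[OF rexp_domD(1)[OF that(2)]] rexp_domD(3)[OF that(2)])+
  have "(\<forall>m\<ge>1. \<forall>X \<in> rfun_dom m F. invertible_mat (fm_pencil L A m X) \<and> rfun_val m F X = fm_val L A B C D m X) \<longleftrightarrow>
    (\<forall>R\<in>F. realized R L (\<lambda>k. ent (A k)) (\<lambda>k i. B k $$ (i, 0)) (\<lambda>i. C $$ (0, i)) (D $$ (0, 0)))"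
    unfolding realized_def rfun_dom_def using eq by blast
  then show ?thesis unfolding fm_realization_def using True by blast
next
  case False
  then show ?thesis unfolding fm_realization_def by blast
qed

text \<open>Observability and controllability make the pencil invertible wherever some member of the
  class is defined, and then the realization of one member also yields the values of the
  others.\<close>

lemma realized_extend:
  fixes R R0 :: "('a::field, 'd::finite) nc_rexp"
  assumes ag: "agree R R0" and real: "realized R0 L A B C D" and zero: "(\<lambda>_. 0\<^sub>m 1 1) \<in> rexp_dom 1 R0"
    and obs: "separating L (obs_row L A C)" and ctr: "separating L (ctr_col L A B)"
  shows "realized R L A B C D"
  unfolding realized_def
proof (intro allI impI ballI)
  fix n X assume n: "n \<ge> 1" and X: "X \<in> rexp_dom n R"
  obtain ws \<iota> where bo: "dual_basis L (obs_row L A C) L ws \<iota>" using separating_dual_basis[OF obs] by blast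
  obtain vs \<kappa> where bc: "dual_basis L (ctr_col L A B) L vs \<kappa>" using separating_dual_basis[OF ctr] by blast
  have "well_posed n L (\<lambda>k. ent (X k)) A"
    by (rule well_posed_on_domain[OF ag real zero dual_basis_full(1)[OF bo, unfolded obs_row_def]
        dual_basis_full(2)[OF bc, unfolded ctr_col_def] X n])
  then show "realizes n L (\<lambda>k. ent (X k)) A B C D (ent (rexp_val n R X))"
    by (rule realizes_at_domain[OF ag real n zero X])
qed

lemma realized_agree:
  fixes R S :: "('a::field, 'd::finite) nc_rexp"
  assumes "realized R L A B C D" "realized S L A B C D"
  shows "agree R S"
  unfolding agree_def
proof (intro allI impI ballI)
  fix n X assume n: "n \<ge> 1" and X: "X \<in> rexp_dom n R \<inter> rexp_dom n S"
  then have r: "realizes n L (\<lambda>k. ent (X k)) A B C D (ent (rexp_val n R X))"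
    "realizes n L (\<lambda>k. ent (X k)) A B C D (ent (rexp_val n S X))"
    using assms unfolding realized_def by blast+
  have c: "rexp_val n R X \<in> carrier_mat n n" "rexp_val n S X \<in> carrier_mat n n" using X rexp_domD(3) by blast+
  show "rexp_val n R X = rexp_val n S X"
    by (rule eq_matI) (use c realizes_unique[OF r] in auto)
qed

text \<open>Serves the passage between coefficients given as functions and as matrices, which agree
  only inside the index range.\<close>

lemma realized_cong_coeffs:
  fixes A :: "'d::finite \<Rightarrow> nat \<Rightarrow> nat \<Rightarrow> 'a::field"
  assumes "realized R L A B C D"
    and A: "\<And>k i j. i < L \<Longrightarrow> j < L \<Longrightarrow> A k i j = A' k i j"
    and B: "\<And>k i. i < L \<Longrightarrow> B k i = B' k i" and C: "\<And>i. i < L \<Longrightarrow> C i = C' i"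
  shows "realized R L A' B' C' D"
proof -
  have s: "fm_step n L X A x a i = fm_step n L X A' x a i" if "i < L" for n X x a i
    unfolding fm_step_def by (intro sum.cong refl arg_cong2[where f = "(*)"]) (simp add: A that)
  have t: "fm_input n X B y a i = fm_input n X B' y a i" if "i < L" for n X y a i
    unfolding fm_input_def B[OF that] ..
  have u: "(\<Sum>i<L. C i * x i) = (\<Sum>i<L. C' i * x i)" for x
    by (intro sum.cong refl) (simp add: C)
  have wp: "well_posed n L X A \<longleftrightarrow> well_posed n L X A'" for n and X :: "'d \<Rightarrow> nat \<Rightarrow> nat \<Rightarrow> 'a"
  proof -
    have "(\<forall>a<n. \<forall>i<L. x a i = fm_step n L X A x a i) \<longleftrightarrow> (\<forall>a<n. \<forall>i<L. x a i = fm_step n L X A' x a i)" for x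
      by (metis s)
    then show ?thesis unfolding well_posed_def by blast
  qed
  have sys: "fm_sys n L X A B x y \<longleftrightarrow> fm_sys n L X A' B' x y" for n x y and X :: "'d \<Rightarrow> nat \<Rightarrow> nat \<Rightarrow> 'a"
    unfolding fm_sys_def by (metis s t)
  show ?thesis using assms(1) unfolding realized_def realizes_def wp sys u .
qed

text \<open>One inclusion is part of being a realization. For the other, an expression built from
  the same data and defined at X agrees with R0 and therefore belongs to the class.\<close>

lemma rfun_dom_eq:
  fixes F :: "('a::field, 'd::finite) nc_rexp set"
  assumes F: "F \<in> nc_rational_functions" and R0: "R0 \<in> F"
    and real: "fm_realization F L A B C D" and m: "m \<ge> 1"
  shows "rfun_dom m F = {X \<in> matrix_tuples m. det (fm_pencil L A m X) \<noteq> 0}"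
proof -
  have A: "A k \<in> carrier_mat L L" for k using real unfolding fm_realization_def by blast
  have R: "realized R L (\<lambda>k. ent (A k)) (\<lambda>k i. B k $$ (i, 0)) (\<lambda>i. C $$ (0, i)) (D $$ (0, 0))" if "R \<in> F" for R
    using real that unfolding fm_realization_iff[OF F] by blast
  have wp: "det (fm_pencil L A m X) \<noteq> 0 \<longleftrightarrow> well_posed m L (\<lambda>k. ent (X k)) (\<lambda>k. ent (A k))" if "X \<in> matrix_tuples m" for X
    unfolding well_posed_iff_det fm_pencil_eq_pencil[OF A matrix_tuplesD[OF that]] ..
  show ?thesis
  proof (intro equalityI subsetI)
    fix X assume "X \<in> rfun_dom m F"
    then obtain S where S: "S \<in> F" "X \<in> rexp_dom m S" unfolding rfun_dom_def by blast
    have X: "X \<in> matrix_tuples m" by (rule rexp_domD(1)[OF S(2)])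
    have "well_posed m L (\<lambda>k. ent (X k)) (\<lambda>k. ent (A k))"
      using R[OF S(1)] S(2) m unfolding realized_def realizes_def by blast
    then show "X \<in> {X \<in> matrix_tuples m. det (fm_pencil L A m X) \<noteq> 0}" using X wp[OF X] by blast
  next
    fix X assume "X \<in> {X \<in> matrix_tuples m. det (fm_pencil L A m X) \<noteq> 0}"
    then have X: "X \<in> matrix_tuples m" and "well_posed m L (\<lambda>k. ent (X k)) (\<lambda>k. ent (A k))" using wp by auto
    from rexp_for_realization[OF this] obtain S where S: "X \<in> rexp_dom m S"
      "realized S L (\<lambda>k. ent (A k)) (\<lambda>k i. B k $$ (i, 0)) (\<lambda>i. C $$ (0, i)) (D $$ (0, 0))" by blast
    have "nondegenerate S" unfolding nondegenerate_def using m S(1) by blast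
    moreover have "agree S R0" by (rule realized_agree[OF S(2) R[OF R0]])
    ultimately have "S \<in> F" using nc_rational_functions_agree[OF F R0] by blast
    then show "X \<in> rfun_dom m F" using S(1) unfolding rfun_dom_def by blast
  qed
qed

text \<open>A realization that fails one of the two conditions can be reduced for the whole class.
  Conversely, all realizations share their Markov parameters, so \<open>hankel_dim_le\<close> bounds
  every other dimension from below.\<close>

lemma fm_realization_minimal_iff:
  fixes F :: "('a::field, 'd::finite) nc_rexp set"
  assumes F: "F \<in> nc_rational_functions" and R0: "R0 \<in> F" and zero: "(\<lambda>_. 0\<^sub>m 1 1) \<in> rexp_dom 1 R0"
    and real: "fm_realization F L A B C D"
  shows "fm_minimal F L A B C D \<longleftrightarrow> fm_observable L A C \<and> fm_controllable L A B"
proof -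
  let ?A = "\<lambda>k. ent (A k)" and ?B = "\<lambda>k i. B k $$ (i, 0)" and ?C = "\<lambda>i. C $$ (0, i)"
  have c: "A k \<in> carrier_mat L L" "B k \<in> carrier_mat L 1" "C \<in> carrier_mat 1 L" "D \<in> carrier_mat 1 1" for k
    using real unfolding fm_realization_def by blast+
  have r: "realized R L ?A ?B ?C (D $$ (0, 0))" if "R \<in> F" for R
    using real that unfolding fm_realization_iff[OF F] by blast
  have oc: "fm_observable L A C \<longleftrightarrow> separating L (obs_row L ?A ?C)" "fm_controllable L A B \<longleftrightarrow> separating L (ctr_col L ?A ?B)"
    by (rule fm_observable_iff[OF c(1,3)], rule fm_controllable_iff[OF c(1,2)])
  show ?thesis
  proof
    assume min: "fm_minimal F L A B C D"
    show "fm_observable L A C \<and> fm_controllable L A B"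
    proof (rule ccontr)
      assume "\<not> ?thesis"
      then have "\<not> (separating L (obs_row L ?A ?C) \<and> separating L (ctr_col L ?A ?B))" unfolding oc .
      from realized_reduce[OF this] obtain s A' B' C' where s: "s < L"
        "\<And>R D. realized R L ?A ?B ?C D \<Longrightarrow> realized R s A' B' C' D" by blast
      define A1 where "A1 k = mat s s (\<lambda>(i, j). A' k i j)" for k
      define B1 where "B1 k = mat s 1 (\<lambda>(i, j). B' k i)" for k
      define C1 where "C1 = mat 1 s (\<lambda>(i, j). C' j)"
      have "realized R s (\<lambda>k. ent (A1 k)) (\<lambda>k i. B1 k $$ (i, 0)) (\<lambda>i. C1 $$ (0, i)) (D $$ (0, 0))" if "R \<in> F" for R
        by (rule realized_cong_coeffs[OF s(2)[OF r[OF that]]]) (simp_all add: A1_def B1_def C1_def)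
      then have "fm_realization F s A1 B1 C1 D"
        unfolding fm_realization_iff[OF F] using c(4) by (simp add: A1_def B1_def C1_def)
      then show False using min s(1) unfolding fm_minimal_def by (meson not_le)
    qed
  next
    assume "fm_observable L A C \<and> fm_controllable L A B"
    then have sep: "separating L (obs_row L ?A ?C)" "separating L (ctr_col L ?A ?B)" using oc by blast+
    have "L \<le> L'" if real': "fm_realization F L' A' B' C' D'" for L' A' B' C' D'
    proof -
      have r': "realized R0 L' (\<lambda>k. ent (A' k)) (\<lambda>k i. B' k $$ (i, 0)) (\<lambda>i. C' $$ (0, i)) (D' $$ (0, 0))"
        using real' R0 unfolding fm_realization_iff[OF F] by blast
      show ?thesis by (rule hankel_dim_le[OF realized_markov_eq[OF zero r[OF R0] r'] sep])
    qed
    then show "fm_minimal F L A B C D" unfolding fm_minimal_def using real by blast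
  qed
qed

lemma fm_realization_exists:
  fixes F :: "('a::field, 'd::finite) nc_rexp set"
  assumes F: "F \<in> nc_rational_functions" and R0: "R0 \<in> F" and zero: "(\<lambda>_. 0\<^sub>m 1 1) \<in> rexp_dom 1 R0"
  shows "\<exists>L A B C D. fm_realization F L A B C D \<and> fm_observable L A C \<and> fm_controllable L A B"
proof -
  obtain L A' B' C' d where r: "realized R0 L A' B' C' d"
    and sep: "separating L (obs_row L A' C')" "separating L (ctr_col L A' B')"
    using realized_separating_exists[OF zero] by blast
  define A where "A k = mat L L (\<lambda>(i, j). A' k i j)" for k
  define B where "B k = mat L 1 (\<lambda>(i, j). B' k i)" for k
  define C where "C = mat 1 L (\<lambda>(i, j). C' j)"
  define D where "D = mat 1 1 (\<lambda>(i, j). d)"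
  have c: "A k \<in> carrier_mat L L" "B k \<in> carrier_mat L 1" "C \<in> carrier_mat 1 L" "D \<in> carrier_mat 1 1" for k
    by (simp_all add: A_def B_def C_def D_def)
  have e: "i < L \<Longrightarrow> j < L \<Longrightarrow> A' k i j = A k $$ (i, j)" "i < L \<Longrightarrow> B' k i = B k $$ (i, 0)"
    "i < L \<Longrightarrow> C' i = C $$ (0, i)" "d = D $$ (0, 0)" for k i j
    by (simp_all add: A_def B_def C_def D_def)
  have "realized R L (\<lambda>k. ent (A k)) (\<lambda>k i. B k $$ (i, 0)) (\<lambda>i. C $$ (0, i)) (D $$ (0, 0))" if R: "R \<in> F" for R
  proof -
    have "agree R R0" using nc_rational_functions_agree[OF F R0] R by blast
    from realized_extend[OF this r zero sep] show ?thesis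
      unfolding e(4)[symmetric] by (rule realized_cong_coeffs) (rule e; assumption)+
  qed
  then have real: "fm_realization F L A B C D" unfolding fm_realization_iff[OF F] using c by blast
  have w: "word_act L A' w v i = word_act L (\<lambda>k. ent (A k)) w v i" if "i < L" for w v i
    using that by (induction w arbitrary: i) (simp_all add: e(1)[symmetric])
  have oc: "fm_observable L A C \<longleftrightarrow> separating L (obs_row L (\<lambda>k. ent (A k)) (\<lambda>i. C $$ (0, i)))"
    "fm_controllable L A B \<longleftrightarrow> separating L (ctr_col L (\<lambda>k. ent (A k)) (\<lambda>k i. B k $$ (i, 0)))"
    by (rule fm_observable_iff[OF c(1,3)], rule fm_controllable_iff[OF c(1,2)])
  have "obs_row L A' C' w l = obs_row L (\<lambda>k. ent (A k)) (\<lambda>i. C $$ (0, i)) w l" for w l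
    unfolding obs_row_def by (intro sum.cong refl) (simp add: w e(3))
  then have "obs_row L A' C' = obs_row L (\<lambda>k. ent (A k)) (\<lambda>i. C $$ (0, i))" by (simp add: fun_eq_iff)
  then have o: "fm_observable L A C" using sep(1) oc(1) by simp
  have "ctr_col L A' B' wk l = ctr_col L (\<lambda>k. ent (A k)) (\<lambda>k i. B k $$ (i, 0)) wk l" if "l < L" for wk l
    unfolding ctr_col_def w[OF that] by (rule word_act_cong[OF _ that]) (rule e(2))
  then have "(\<Sum>l<L. ctr_col L A' B' wk l * v l) = (\<Sum>l<L. ctr_col L (\<lambda>k. ent (A k)) (\<lambda>k i. B k $$ (i, 0)) wk l * v l)" for wk v
    by (intro sum.cong refl) simp
  note eq = this
  have ctrl: "fm_controllable L A B" using sep(2) unfolding oc(2) separating_def eq .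
  show ?thesis
    by (rule exI[of _ L], rule exI[of _ A], rule exI[of _ B], rule exI[of _ C], rule exI[of _ D])
      (rule conjI[OF real conjI[OF o ctrl]])
qed

lemma fm_realization_origin:
  fixes F :: "('a::field, 'd::finite) nc_rexp set"
  assumes F: "F \<in> nc_rational_functions" and R0: "R0 \<in> F" and zero: "(\<lambda>_. 0\<^sub>m 1 1) \<in> rexp_dom 1 R0"
    and real: "fm_realization F L A B C D"
  shows "D = rfun_val 1 F (\<lambda>_. 0\<^sub>m 1 1)"
proof -
  have c: "D \<in> carrier_mat 1 1" and "realized R0 L (\<lambda>k. ent (A k)) (\<lambda>k i. B k $$ (i, 0)) (\<lambda>i. C $$ (0, i)) (D $$ (0, 0))"
    using real R0 unfolding fm_realization_iff[OF F] by blast+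
  then have "rexp_val 1 R0 (\<lambda>_. 0\<^sub>m 1 1) $$ (0, 0) = D $$ (0, 0)" using realized_at_origin[OF zero] by blast
  then have "rexp_val 1 R0 (\<lambda>_. 0\<^sub>m 1 1) = D"
    by (intro eq_matI) (use c rexp_domD(3)[OF zero] in auto)
  then show ?thesis using rfun_val_eq[OF F R0 zero] by simp
qed

theorem corollary3p4:
  fixes F :: "('a::field, 'd::finite) nc_rexp set"
  assumes "F \<in> nc_rational_functions"
    and regular: "(\<lambda>_. 0\<^sub>m 1 1) \<in> rfun_dom 1 F"
  shows
    "(\<exists>L A B C D.
        fm_minimal F L A B C D \<and> fm_observable L A C \<and> fm_controllable L A B \<and>
        D = rfun_val 1 F (\<lambda>_. 0\<^sub>m 1 1) \<and>
        (\<forall>m\<ge>1. rfun_dom m F = {X \<in> matrix_tuples m. det (fm_pencil L A m X) \<noteq> 0}) \<and>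
        (\<forall>m\<ge>1. \<forall>X \<in> rfun_dom m F.
           rfun_val m F X =
             1\<^sub>m m \<otimes>\<^sub>K D
             + (1\<^sub>m m \<otimes>\<^sub>K C) * mat_inv (fm_pencil L A m X)
               * mat_sum (L * m) m (\<lambda>k. X k \<otimes>\<^sub>K B k) UNIV))
   \<and> (\<forall>L A B C D. fm_realization F L A B C D \<longrightarrow>
        (fm_minimal F L A B C D \<longleftrightarrow> fm_observable L A C \<and> fm_controllable L A B))
   \<and> (\<forall>L A B C D L' A' B' C' D'.
        fm_minimal F L A B C D \<longrightarrow> fm_minimal F L' A' B' C' D' \<longrightarrow>
        L = L' \<and> D = D' \<and>
        (\<exists>!T. T \<in> carrier_mat L L \<and> invertible_mat T \<and>
           C' = C * mat_inv T \<and>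
           (\<forall>k. B' k = T * B k) \<and>
           (\<forall>k. A' k = T * A k * mat_inv T)))"
proof -
  note F = assms(1)
  obtain R0 where R0: "R0 \<in> F" and zero: "(\<lambda>_. 0\<^sub>m 1 1) \<in> rexp_dom 1 R0"
    using regular unfolding rfun_dom_def by blast
  note minimal_iff = fm_realization_minimal_iff[OF F R0 zero]
  note origin = fm_realization_origin[OF F R0 zero]
  obtain L A B C D where real: "fm_realization F L A B C D" and oc: "fm_observable L A C" "fm_controllable L A B"
    using fm_realization_exists[OF F R0 zero] by blast
  have val: "\<forall>m\<ge>1. \<forall>X \<in> rfun_dom m F. rfun_val m F X =
      1\<^sub>m m \<otimes>\<^sub>K D + (1\<^sub>m m \<otimes>\<^sub>K C) * mat_inv (fm_pencil L A m X) * mat_sum (L * m) m (\<lambda>k. X k \<otimes>\<^sub>K B k) UNIV"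
    using real unfolding fm_realization_def fm_val_def by blast
  have dom: "\<forall>m\<ge>1. rfun_dom m F = {X \<in> matrix_tuples m. det (fm_pencil L A m X) \<noteq> 0}"
    using rfun_dom_eq[OF F R0 real] by blast
  have unique: "L = L' \<and> D = D' \<and>
      (\<exists>!T. T \<in> carrier_mat L L \<and> invertible_mat T \<and> C' = C * mat_inv T \<and>
         (\<forall>k. B' k = T * B k) \<and> (\<forall>k. A' k = T * A k * mat_inv T))"
    if min: "fm_minimal F L A B C D" and min': "fm_minimal F L' A' B' C' D'" for L A B C D L' A' B' C' D'
  proof -
    have real: "fm_realization F L A B C D" and real': "fm_realization F L' A' B' C' D'"
      using min min' unfolding fm_minimal_def by blast+
    have L: "L = L'" using min min' real real' unfolding fm_minimal_def by (meson le_antisym)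
    have D: "D = D'" using origin[OF real] origin[OF real'] by simp
    have c: "A k \<in> carrier_mat L L" "B k \<in> carrier_mat L 1" "C \<in> carrier_mat 1 L" for k
      using real unfolding fm_realization_def by blast+
    have c': "A' k \<in> carrier_mat L L" "B' k \<in> carrier_mat L 1" "C' \<in> carrier_mat 1 L" for k
      using real' unfolding fm_realization_def L by blast+
    have oc: "fm_observable L A C" "fm_controllable L A B" "fm_observable L A' C'"
      using minimal_iff[OF real] minimal_iff[OF real'] min min' L by blast+
    have r: "realized R0 L (\<lambda>k. ent (A k)) (\<lambda>k i. B k $$ (i, 0)) (\<lambda>i. C $$ (0, i)) (D $$ (0, 0))"
      using real R0 unfolding fm_realization_iff[OF F] by blast
    have r': "realized R0 L (\<lambda>k. ent (A' k)) (\<lambda>k i. B' k $$ (i, 0)) (\<lambda>i. C' $$ (0, i)) (D' $$ (0, 0))"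
      using real' R0 unfolding fm_realization_iff[OF F] L by blast
    have "\<exists>!T. T \<in> carrier_mat L L \<and> invertible_mat T \<and> C' = C * mat_inv T \<and>
        (\<forall>k. B' k = T * B k) \<and> (\<forall>k. A' k = T * A k * mat_inv T)"
      by (rule unique_similarity)
        (fact c c' oc(1)[unfolded fm_observable_iff[OF c(1,3)]] oc(2)[unfolded fm_controllable_iff[OF c(1,2)]]
          oc(3)[unfolded fm_observable_iff[OF c'(1,3)]] realized_markov_eq[OF zero r r'])+
    then show ?thesis using L D by blast
  qed
  have min: "fm_minimal F L A B C D" using minimal_iff[OF real] oc by blast
  note D = origin[OF real]
  show ?thesis
    by (intro conjI, rule exI[of _ L], rule exI[of _ A], rule exI[of _ B], rule exI[of _ C], rule exI[of _ D],
        intro conjI min oc D dom val)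
      (intro allI impI, erule minimal_iff, intro allI impI, erule (1) unique)
qed

end
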